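(* Let $\alpha,\beta\in(1,2)$. (a) Let $1<\gamma<1+\frac{\beta-1}2$. The process $$V_t=\int_{\mathbb R\times\Omega'}\Big(\int_0^\infty|y|^{-\gamma}\big(L_t(x+y,\omega')-L_t(x-y,\omega')\big)dy\Big)M_\alpha(dx,d\omega'),\quad t\ge0,$$ is $H$-sssi with $H=1+\frac1{\alpha\beta}-\frac\gamma\beta$. (b) Let $1<\gamma_1<\gamma_2$ with $\gamma_1<1+\frac{\beta-1}2$. The process $$\widetilde V_t=\int_{\mathbb R\times\Omega'}\Big(\int_0^\infty|y|^{-\gamma_1}\big(L_t(x+y,\omega')-L_t(x,\omega')\big)dy\Big)M_\alpha(dx,d\omega'),\quad t\ge0,$$ is $H$-sssi with $H=1+\frac1{\alpha\beta}-\frac{\min(\gamma_1,\gamma_2)}\beta$. Moreover, in this setting (as $\alpha,\beta$ and $\gamma$, respectively $\gamma_1,\gamma_2$, range over all admissible values) $H$ can take any value between $3/4$ and $1$, i.e. any value in $(3/4,1)$.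
   Context: $H$-sssi means self-similar with Hurst exponent $H$ (for every $c>0$, $(V_{ct})_{t\ge0}$ and $(c^HV_t)_{t\ge0}$ have the same finite-dimensional distributions) with stationary increments (for every $s\ge0$, $(V_{t+s}-V_s)_{t\ge0}$ and $(V_t)_{t\ge0}$ have the same finite-dimensional distributions). $(L_t(x,\omega'))_{t\ge0,x\in\mathbb R}$ is a jointly continuous version of the local time (with respect to Lebesgue measure) of a symmetric $\beta$-stable Lévy process started at $0$, defined on a probability space $(\Omega',\mathcal F',\mathbb P')$. $M_\alpha$ is a symmetric $\alpha$-stable random measure on $\mathbb R\times\Omega'$ with control measure $\lambda_1\otimes\mathbb P'$ ($\lambda_1$ is Lebesgue measure), defined on another probability space; thus, up to a fixed positive normalisation constant $c$, $\mathbb E\exp(i\theta\int h\,dM_\alpha)=\exp(-c|\theta|^\alpha\int_{\mathbb R}\mathbb E'|h(x,\cdot)|^\alpha dx)$ for $h\in L^\alpha(\lambda_1\otimes\mathbb P')$. *)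

theory Defs
  imports "HOL-Probability.Probability"
begin

section \<open>Self-similar processes with stationary increments\<close>

text \<open>
  All processes are indexed by \<open>real\<close>; only their values at times \<open>t \<ge> 0\<close> are ever constrained.
\<close>

definition same_fdd ::
    "'a measure \<Rightarrow> (real \<Rightarrow> 'a \<Rightarrow> real) \<Rightarrow> (real \<Rightarrow> 'a \<Rightarrow> real) \<Rightarrow> bool" where
  "same_fdd Q V W \<longleftrightarrow>
     (\<forall>J. finite J \<and> J \<subseteq> {0..} \<longrightarrow>
        distr Q (\<Pi>\<^sub>M t\<in>J. borel) (\<lambda>\<omega>. \<lambda>t\<in>J. V t \<omega>) =
        distr Q (\<Pi>\<^sub>M t\<in>J. borel) (\<lambda>\<omega>. \<lambda>t\<in>J. W t \<omega>))"

definition self_similar :: "'a measure \<Rightarrow> real \<Rightarrow> (real \<Rightarrow> 'a \<Rightarrow> real) \<Rightarrow> bool" where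
  "self_similar Q H V \<longleftrightarrow>
     (\<forall>c>0. same_fdd Q (\<lambda>t. V (c * t)) (\<lambda>t \<omega>. c powr H * V t \<omega>))"

definition stationary_increments :: "'a measure \<Rightarrow> (real \<Rightarrow> 'a \<Rightarrow> real) \<Rightarrow> bool" where
  "stationary_increments Q V \<longleftrightarrow>
     (\<forall>s\<ge>0. same_fdd Q (\<lambda>t \<omega>. V (t + s) \<omega> - V s \<omega>) V)"

text \<open>
  Measurability is part of the notion, as \<open>distr\<close> is only meaningful for measurable maps.
\<close>

definition H_sssi :: "'a measure \<Rightarrow> real \<Rightarrow> (real \<Rightarrow> 'a \<Rightarrow> real) \<Rightarrow> bool" where
  "H_sssi Q H V \<longleftrightarrow>
     (\<forall>t\<ge>0. V t \<in> borel_measurable Q) \<and> self_similar Q H V \<and> stationary_increments Q V"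

section \<open>Symmetric stable Levy processes and their local times\<close>

definition levy_process :: "'a measure \<Rightarrow> (real \<Rightarrow> 'a \<Rightarrow> real) \<Rightarrow> bool" where
  "levy_process P X \<longleftrightarrow>
     prob_space P \<and>
     (\<forall>t\<ge>0. X t \<in> borel_measurable P) \<and>
     (AE \<omega> in P. X 0 \<omega> = 0) \<and>
     (\<forall>(n::nat) \<tau>. mono \<tau> \<and> \<tau> 0 \<ge> 0 \<longrightarrow>
        prob_space.indep_vars P (\<lambda>_. borel) (\<lambda>i \<omega>. X (\<tau> (Suc i)) \<omega> - X (\<tau> i) \<omega>) {..<n}) \<and>
     (\<forall>s\<ge>0. \<forall>t\<ge>0. distr P borel (\<lambda>\<omega>. X (s + t) \<omega> - X s \<omega>) = distr P borel (X t)) \<and>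
     (AE \<omega> in P. (\<forall>t\<ge>0. continuous (at_right t) (\<lambda>s. X s \<omega>)) \<and>
                 (\<forall>t>0. \<exists>l. ((\<lambda>s. X s \<omega>) \<longlongrightarrow> l) (at_left t)))"

definition symmetric_stable_levy_process ::
    "'a measure \<Rightarrow> real \<Rightarrow> (real \<Rightarrow> 'a \<Rightarrow> real) \<Rightarrow> bool" where
  "symmetric_stable_levy_process P \<beta> X \<longleftrightarrow>
     levy_process P X \<and>
     (\<exists>\<sigma>>0. \<forall>t\<ge>0. \<forall>\<theta>.
        char (distr P borel (X t)) \<theta> = complex_of_real (exp (- \<sigma> * t * \<bar>\<theta>\<bar> powr \<beta>)))"

text \<open>
  The local time with respect to Lebesgue measure is the density of the occupation measure
  of \<open>X\<close> up to time \<open>t\<close>. The version is continuous in \<open>(t, x)\<close> for every \<open>\<omega>\<close>, whereas the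
  occupation density formula holds almost surely, simultaneously for all \<open>t\<close> and all Borel sets.
\<close>

definition jointly_continuous_local_time ::
    "'a measure \<Rightarrow> (real \<Rightarrow> 'a \<Rightarrow> real) \<Rightarrow> (real \<Rightarrow> real \<Rightarrow> 'a \<Rightarrow> real) \<Rightarrow> bool" where
  "jointly_continuous_local_time P X L \<longleftrightarrow>
     (\<forall>t\<ge>0. \<forall>x. L t x \<in> borel_measurable P) \<and>
     (\<forall>\<omega>\<in>space P. continuous_on ({0..} \<times> UNIV) (\<lambda>(t, x). L t x \<omega>)) \<and>
     (AE \<omega> in P. \<forall>t\<ge>0.
        (\<forall>x. 0 \<le> L t x \<omega>) \<and>
        (\<forall>A\<in>sets borel.
           emeasure lborel {s \<in> {0..t}. X s \<omega> \<in> A} = (\<integral>\<^sup>+x\<in>A. ennreal (L t x \<omega>) \<partial>lborel)))"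

section \<open>Symmetric stable random measures and the stable integral\<close>

text \<open>
  A symmetric \<open>\<alpha>\<close>-stable random measure with control measure \<open>m\<close> lives on the sets of finite
  \<open>m\<close>-measure: it is independently scattered, almost surely countably additive, and
  \<open>M A\<close> has characteristic function \<open>exp (- c m(A) |\<theta>|^\<alpha>)\<close>, where the normalisation
  constant \<open>c\<close> does not depend on \<open>A\<close>.
\<close>

definition stable_random_measure ::
    "'b measure \<Rightarrow> 'a measure \<Rightarrow> real \<Rightarrow> ('a set \<Rightarrow> 'b \<Rightarrow> real) \<Rightarrow> bool" where
  "stable_random_measure Q m \<alpha> M \<longleftrightarrow>
     prob_space Q \<and>
     (\<forall>A\<in>sets m. emeasure m A < \<infinity> \<longrightarrow> M A \<in> borel_measurable Q) \<and>
     (\<exists>c>0. \<forall>A\<in>sets m. emeasure m A < \<infinity> \<longrightarrow>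
        (\<forall>\<theta>. char (distr Q borel (M A)) \<theta> =
              complex_of_real (exp (- c * measure m A * \<bar>\<theta>\<bar> powr \<alpha>)))) \<and>
     (\<forall>(n::nat) A. disjoint_family_on A {..<n} \<and>
        (\<forall>i<n. A i \<in> sets m \<and> emeasure m (A i) < \<infinity>) \<longrightarrow>
        prob_space.indep_vars Q (\<lambda>_. borel) (\<lambda>i. M (A i)) {..<n}) \<and>
     (\<forall>A::nat \<Rightarrow> 'a set. disjoint_family A \<and> range A \<subseteq> sets m \<and> emeasure m (\<Union>i. A i) < \<infinity> \<longrightarrow>
        (AE \<omega> in Q. (\<lambda>i. M (A i) \<omega>) sums M (\<Union>i. A i) \<omega>))"

definition simple_stable_integral ::
    "'a measure \<Rightarrow> ('a set \<Rightarrow> 'b \<Rightarrow> real) \<Rightarrow> ('a \<Rightarrow> real) \<Rightarrow> 'b \<Rightarrow> real" where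
  "simple_stable_integral m M f \<omega> =
     (\<Sum>y\<in>f ` space m - {0}. y * M {x \<in> space m. f x = y} \<omega>)"

definition tendsto_in_probability ::
    "'b measure \<Rightarrow> (nat \<Rightarrow> 'b \<Rightarrow> real) \<Rightarrow> ('b \<Rightarrow> real) \<Rightarrow> bool" where
  "tendsto_in_probability Q Y Z \<longleftrightarrow>
     (\<forall>\<epsilon>>0. (\<lambda>n. measure Q {\<omega> \<in> space Q. \<bar>Y n \<omega> - Z \<omega>\<bar> > \<epsilon>}) \<longlonglongrightarrow> 0)"

definition in_L :: "'a measure \<Rightarrow> real \<Rightarrow> ('a \<Rightarrow> real) \<Rightarrow> bool" where
  "in_L m \<alpha> h \<longleftrightarrow> h \<in> borel_measurable m \<and> integrable m (\<lambda>z. \<bar>h z\<bar> powr \<alpha>)"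

text \<open>
  \<open>has_stable_integral Q m M \<alpha> h Y\<close>: the random variable \<open>Y\<close> is a version of the integral of
  \<open>h \<in> L\<^sup>\<alpha>(m)\<close> with respect to \<open>M\<close>, i.e. the limit in probability of the integrals of simple
  functions converging to \<open>h\<close> in \<open>L\<^sup>\<alpha>(m)\<close>.
\<close>

definition has_stable_integral ::
    "'b measure \<Rightarrow> 'a measure \<Rightarrow> ('a set \<Rightarrow> 'b \<Rightarrow> real) \<Rightarrow> real \<Rightarrow>
     ('a \<Rightarrow> real) \<Rightarrow> ('b \<Rightarrow> real) \<Rightarrow> bool" where
  "has_stable_integral Q m M \<alpha> h Y \<longleftrightarrow>
     in_L m \<alpha> h \<and> Y \<in> borel_measurable Q \<and>
     (\<exists>f::nat \<Rightarrow> 'a \<Rightarrow> real.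
        (\<forall>n. simple_function m (f n) \<and> emeasure m {z \<in> space m. f n z \<noteq> 0} < \<infinity>) \<and>
        (\<lambda>n. \<integral>\<^sup>+z. ennreal (\<bar>f n z - h z\<bar> powr \<alpha>) \<partial>m) \<longlonglongrightarrow> 0 \<and>
        tendsto_in_probability Q (\<lambda>n. simple_stable_integral m M (f n)) Y)"

text \<open>
  The process \<open>V\<^sub>t = \<integral> (\<integral>\<^sub>0\<^sup>\<infinity> k t z y dy) M(dz)\<close> is well defined and \<open>H\<close>-sssi: for every
  \<open>t \<ge> 0\<close> the inner Lebesgue integral converges absolutely for almost every \<open>z\<close>, it is
  a function of \<open>z\<close> that has an integral with respect to \<open>M\<close>, and every choice of versions of
  these integrals is an \<open>H\<close>-sssi process.
\<close>

definition stable_integral_process_H_sssi ::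
    "'b measure \<Rightarrow> 'a measure \<Rightarrow> ('a set \<Rightarrow> 'b \<Rightarrow> real) \<Rightarrow> real \<Rightarrow>
     (real \<Rightarrow> 'a \<Rightarrow> real \<Rightarrow> real) \<Rightarrow> real \<Rightarrow> bool" where
  "stable_integral_process_H_sssi Q m M \<alpha> k H \<longleftrightarrow>
     (\<forall>t\<ge>0. AE z in m. set_integrable lborel {0<..} (k t z)) \<and>
     (\<forall>t\<ge>0. \<exists>Y. has_stable_integral Q m M \<alpha> (\<lambda>z. LINT y:{0<..}|lborel. k t z y) Y) \<and>
     (\<forall>V. (\<forall>t\<ge>0. has_stable_integral Q m M \<alpha> (\<lambda>z. LINT y:{0<..}|lborel. k t z y) (V t)) \<longrightarrow>
          H_sssi Q H V)"

end

theory Submission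
  imports Defs
begin

text \<open>
  By independence and stationarity of the increments, the Fourier transform of a Gaussian
  mollifier gives the second moment of \<open>L\<^sub>t(x + a) - L\<^sub>t(x + b)\<close>, integrated over \<open>x\<close> with weight
  \<open>1 + \<bar>x\<bar>\<close>, a bound of order \<open>\<bar>a - b\<bar>\<close> to the power \<open>\<beta> - 1\<close>. By Hoelder's inequality with this weight
  the kernel lies in \<open>L\<^sup>\<alpha>\<close> because \<open>\<gamma> < 1 + (\<beta> - 1) / 2\<close>, so the stable integral exists.
  The finite-dimensional laws of the process only depend on the \<open>L\<^sup>\<alpha>\<close> norms of linear combinations of
  the kernels, which are in turn determined by the law of the Levy process. Self-similarity and
  stationarity of increments then come from the scaling and the Markov property
  of the local time, the random spatial shift \<open>X\<^sub>s\<close> being absorbed by translation invariance of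
  Lebesgue measure.
\<close>

section \<open>Laws determined by characteristic functions\<close>

text \<open>The range of \<gamma> is set by the size y^((\<beta> - 1)/2) of L_t(x + y) - L_t(x) in
  weighted L^2: multiplied by y^(-\<gamma>) it is integrable at y = 0 when \<gamma> < 1 + (\<beta> -
  1)/2. Lebesgue measure on the line is infinite, so an unweighted L^2 bound would say nothing about
  L^\<alpha> with \<alpha> < 2. The weight repairs this, as (1 + |x|)^(-\<alpha>/(2 - \<alpha>)) is
  integrable for \<alpha> > 1, and its price is E|X_s|, finite for \<beta> > 1. The obstacle to
  comparing laws is that the local time is not a function of finitely many values of X. An identity
  of characteristic functions is therefore carried through almost sure limits, from Riemann sums to
  occupation integrals, to mollified point values, to truncated Riesz kernels. Both kernels of the
  theorem belong to one family with two parameters, so a single argument serves (a) and (b). The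
  exponent H collects what t -> ct produces with a = c^(1/\<beta>): a factor c a^(-\<gamma>) on the
  kernel and a^(1/\<alpha>) from dx in the L^\<alpha> norm.\<close>

text \<open>A nonnegative weight of positive mass becomes a probability density after normalisation,
  so one-dimensional Levy uniqueness applies to the images under \<open>V\<close> and
  \<open>W\<close>; mass zero makes both sides vanish. The purpose is to exchange an exponential in
  one coordinate for any measurable function of it while the other coordinates sit in the
  weight.\<close>

lemma weighted_char_eqI:
  fixes g :: "'a \<Rightarrow> real" and g' :: "'b \<Rightarrow> real" and V W :: "_ \<Rightarrow> real" and u :: "real \<Rightarrow> complex"
  assumes [measurable]: "V \<in> borel_measurable P" "W \<in> borel_measurable P'" "u \<in> borel_measurable borel"
  assumes g: "integrable P g" "\<And>x. 0 \<le> g x" and g': "integrable P' g'" "\<And>x. 0 \<le> g' x"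
  assumes eq: "\<And>\<tau>. (CLINT x|P. iexp (\<tau> * V x) * g x) = (CLINT x|P'. iexp (\<tau> * W x) * g' x)"
  shows "(CLINT x|P. u (V x) * g x) = (CLINT x|P'. u (W x) * g' x)"
proof -
  have [measurable]: "g \<in> borel_measurable P" "g' \<in> borel_measurable P'" using g g' by auto
  define c where "c = (\<integral>x. g x \<partial>P)"
  \<comment> \<open>Frequency 0 shows that the two weights have the same total mass.\<close>
  have "complex_of_real c = complex_of_real (\<integral>x. g' x \<partial>P')"
    using eq[of 0] unfolding c_def by simp
  then have c': "c = (\<integral>x. g' x \<partial>P')" using of_real_eq_iff by blast
  have c0: "c \<ge> 0" unfolding c_def using g by (intro integral_nonneg_AE) auto
  show ?thesis
  proof (cases "c = 0")
    case True
    have "AE x in P. g x = 0" using integral_nonneg_eq_0_iff_AE[OF g(1)] g(2) True c_def by auto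
    moreover have "AE x in P'. g' x = 0"
      using integral_nonneg_eq_0_iff_AE[OF g'(1)] g'(2) True c' by auto
    ultimately have "(CLINT x|P. u (V x) * g x) = 0" "(CLINT x|P'. u (W x) * g' x) = 0"
      by (auto intro!: integral_eq_zero_AE)
    then show ?thesis by simp
  next
    case False
    then have cp: "c > 0" using c0 by simp
    define N where "N = distr (density P (\<lambda>x. g x / c)) borel V"
    define N' where "N' = distr (density P' (\<lambda>x. g' x / c)) borel W"
    have "emeasure (density P (\<lambda>x. ennreal (g x / c))) (space (density P (\<lambda>x. ennreal (g x / c)))) = 1"
    proof -
      have "(\<integral>\<^sup>+x. ennreal (g x / c) \<partial>P) = ennreal (\<integral>x. g x / c \<partial>P)"
        using g cp by (intro nn_integral_eq_integral) auto
      then show ?thesis using cp by (auto simp: emeasure_density c_def[symmetric] cong: nn_integral_cong)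
    qed
    then interpret p: prob_space "density P (\<lambda>x. ennreal (g x / c))" by (rule prob_spaceI)
    have "emeasure (density P' (\<lambda>x. ennreal (g' x / c))) (space (density P' (\<lambda>x. ennreal (g' x / c)))) = 1"
    proof -
      have "(\<integral>\<^sup>+x. ennreal (g' x / c) \<partial>P') = ennreal (\<integral>x. g' x / c \<partial>P')"
        using g' cp by (intro nn_integral_eq_integral) auto
      then show ?thesis using cp by (auto simp: emeasure_density c'[symmetric] cong: nn_integral_cong)
    qed
    then interpret p': prob_space "density P' (\<lambda>x. ennreal (g' x / c))" by (rule prob_spaceI)
    have N: "real_distribution N" unfolding N_def by (intro p.real_distribution_distr) simp
    have N': "real_distribution N'" unfolding N'_def by (intro p'.real_distribution_distr) simp
    have I: "(CLINT v|N. w v) = (CLINT x|P. w (V x) * g x) / c" if [measurable]: "w \<in> borel_measurable borel" for w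
    proof -
      have "(CLINT v|N. w v) = (CLINT x|P. (g x / c) *\<^sub>R w (V x))"
        unfolding N_def using cp g by (subst integral_distr) (auto intro!: integral_density)
      also have "\<dots> = (CLINT x|P. w (V x) * g x / c)"
        by (intro Bochner_Integration.integral_cong) (auto simp: scaleR_conv_of_real)
      finally show ?thesis by simp
    qed
    have I': "(CLINT v|N'. w v) = (CLINT x|P'. w (W x) * g' x) / c" if [measurable]: "w \<in> borel_measurable borel" for w
    proof -
      have "(CLINT v|N'. w v) = (CLINT x|P'. (g' x / c) *\<^sub>R w (W x))"
        unfolding N'_def using cp g' by (subst integral_distr) (auto intro!: integral_density)
      also have "\<dots> = (CLINT x|P'. w (W x) * g' x / c)"
        by (intro Bochner_Integration.integral_cong) (auto simp: scaleR_conv_of_real)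
      finally show ?thesis by simp
    qed
    have "char N = char N'"
      using eq by (intro ext) (simp add: char_def I I')
    then have "N = N'" using Levy_uniqueness N N' by blast
    then show ?thesis using I[of u] I'[of u] cp by simp
  qed
qed

lemma integral_lincomb3:
  fixes f g h :: "'a \<Rightarrow> complex"
  assumes "integrable M f" "integrable M g" "integrable M h"
  shows "integrable M (\<lambda>x. f x + c * g x + d * h x)"
    and "(CLINT x|M. f x + c * g x + d * h x) = (CLINT x|M. f x) + c * (CLINT x|M. g x) + d * (CLINT x|M. h x)"
  using assms by simp_all

text \<open>Coordinates are treated one at a time: the induction on \<open>S\<close> adds an
  indicator in coordinate \<open>k\<close> while the frequencies of all coordinates stay free. With
  every coordinate treated and all frequencies zero, the identity compares probabilities of
  rectangles, which determine the joint law.\<close>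

lemma distr_PiM_eqI_char:
  fixes V :: "'i \<Rightarrow> 'a \<Rightarrow> real" and W :: "'i \<Rightarrow> 'b \<Rightarrow> real"
  assumes P: "prob_space P" "prob_space P'" and J: "finite J"
    and V: "\<And>j. j \<in> J \<Longrightarrow> V j \<in> borel_measurable P"
    and W: "\<And>j. j \<in> J \<Longrightarrow> W j \<in> borel_measurable P'"
    and eq: "\<And>\<theta>. (CLINT \<omega>|P. iexp (\<Sum>j\<in>J. \<theta> j * V j \<omega>)) = (CLINT \<omega>|P'. iexp (\<Sum>j\<in>J. \<theta> j * W j \<omega>))"
  shows "distr P (\<Pi>\<^sub>M j\<in>J. borel) (\<lambda>\<omega>. \<lambda>j\<in>J. V j \<omega>) = distr P' (\<Pi>\<^sub>M j\<in>J. borel) (\<lambda>\<omega>. \<lambda>j\<in>J. W j \<omega>)"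
proof -
  interpret P: prob_space P by fact
  interpret P': prob_space P' by fact
  have rect: "(CLINT \<omega>|P. iexp (\<Sum>j\<in>J. \<theta> j * V j \<omega>) * (\<Prod>j\<in>S. indicator (A j) (V j \<omega>))) =
          (CLINT \<omega>|P'. iexp (\<Sum>j\<in>J. \<theta> j * W j \<omega>) * (\<Prod>j\<in>S. indicator (A j) (W j \<omega>)))"
    if "S \<subseteq> J" "\<And>j. j \<in> J \<Longrightarrow> A j \<in> sets borel" for S \<theta> A
    using finite_subset[OF that(1) J] that
  proof (induction S arbitrary: \<theta> rule: finite_induct)
    case empty
    then show ?case using eq by simp
  next
    case (insert k S)
    have k: "k \<in> J" and S: "S \<subseteq> J" using insert by auto
    define \<psi> where "\<psi> = (\<lambda>\<omega>. \<Sum>j\<in>J-{k}. \<theta> j * V j \<omega>)"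
    define \<psi>' where "\<psi>' = (\<lambda>\<omega>. \<Sum>j\<in>J-{k}. \<theta> j * W j \<omega>)"
    define I where "I = (\<lambda>\<omega>. (\<Prod>j\<in>S. indicator (A j) (V j \<omega>) :: real))"
    define I' where "I' = (\<lambda>\<omega>. (\<Prod>j\<in>S. indicator (A j) (W j \<omega>) :: real))"
    have [measurable]: "V k \<in> borel_measurable P" "W k \<in> borel_measurable P'" "A k \<in> sets borel"
      using V W k insert.prems(2) by auto
    have [measurable]: "\<psi> \<in> borel_measurable P" "\<psi>' \<in> borel_measurable P'"
      using V W by (auto simp: \<psi>_def \<psi>'_def)
    have [measurable]: "I \<in> borel_measurable P" "I' \<in> borel_measurable P'"
      unfolding I_def I'_def using S V W insert.prems(2)
      by (auto intro!: borel_measurable_prod borel_measurable_indicator' simp: subset_eq)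
    have I01: "0 \<le> I \<omega>" "I \<omega> \<le> 1" for \<omega> unfolding I_def by (auto intro!: prod_nonneg prod_le_1)
    have I01': "0 \<le> I' \<omega>" "I' \<omega> \<le> 1" for \<omega> unfolding I'_def by (auto intro!: prod_nonneg prod_le_1)
    have 3: "(\<Prod>j\<in>S. indicator (A j) (V j \<omega>)) = complex_of_real (I \<omega>)" for \<omega>
      unfolding I_def of_real_prod by (intro prod.cong) (auto simp: indicator_def)
    have 4: "(\<Prod>j\<in>S. indicator (A j) (W j \<omega>)) = complex_of_real (I' \<omega>)" for \<omega>
      unfolding I'_def of_real_prod by (intro prod.cong) (auto simp: indicator_def)
    \<comment> \<open>The frequency of coordinate \<open>k\<close> is a free \<tau>, while all
      others are multiplied by \<open>s\<close>; the values s = 0, 1, -1 are those that the real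
      part of an exponential calls for.\<close>
    have E: "(CLINT \<omega>|P. iexp (\<tau> * V k \<omega>) * (iexp (s * \<psi> \<omega>) * I \<omega>)) =
             (CLINT \<omega>|P'. iexp (\<tau> * W k \<omega>) * (iexp (s * \<psi>' \<omega>) * I' \<omega>))" for \<tau> s
    proof -
      define \<theta>' where "\<theta>' = (\<lambda>j. if j = k then \<tau> else s * \<theta> j)"
      have 1: "(\<Sum>j\<in>J. \<theta>' j * V j \<omega>) = \<tau> * V k \<omega> + s * \<psi> \<omega>" for \<omega>
        using k J by (simp add: sum.remove[of J k] \<psi>_def \<theta>'_def sum_distrib_left mult.assoc)
      have 2: "(\<Sum>j\<in>J. \<theta>' j * W j \<omega>) = \<tau> * W k \<omega> + s * \<psi>' \<omega>" for \<omega>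
        using k J by (simp add: sum.remove[of J k] \<psi>'_def \<theta>'_def sum_distrib_left mult.assoc)
      show ?thesis
        using insert.IH[OF S insert.prems(2), of \<theta>'] unfolding 1 2 3 4
        by (simp add: exp_add distrib_left mult.assoc)
    qed
    define u where "u = (\<lambda>v. iexp (\<theta> k * v) * indicator (A k) v :: complex)"
    have [measurable]: "u \<in> borel_measurable borel" unfolding u_def by measurable
    have ub: "norm (u v) \<le> 1" for v by (auto simp: u_def indicator_def norm_mult)
    have intP: "integrable P (\<lambda>\<omega>. w (V k \<omega>) * (iexp (s * \<psi> \<omega>) * I \<omega>))"
      if [measurable]: "w \<in> borel_measurable borel" and "\<And>v. norm (w v) \<le> 1" for w s
      using I01 that by (intro P.integrable_const_bound[where B=1]) (auto simp: norm_mult intro!: mult_le_one)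
    have intP': "integrable P' (\<lambda>\<omega>. w (W k \<omega>) * (iexp (s * \<psi>' \<omega>) * I' \<omega>))"
      if [measurable]: "w \<in> borel_measurable borel" and "\<And>v. norm (w v) \<le> 1" for w s
      using I01' that by (intro P'.integrable_const_bound[where B=1]) (auto simp: norm_mult intro!: mult_le_one)
    \<comment> \<open>Re(z e^(ir)) is half the sum of z e^(ir) and its conjugate, so the weight
      splits into three exponentials to which \<open>E\<close> applies.\<close>
    have sp: "w * complex_of_real ((1 + Re (z * iexp r)) * i) =
         w * (iexp (0 * r) * i) + (z/2) * (w * (iexp (1 * r) * i)) + (cnj z/2) * (w * (iexp (-1 * r) * i))" for w z r i
    proof -
      have "complex_of_real (Re (z * iexp r)) = (z * iexp r + cnj (z * iexp r)) / 2"
        unfolding complex_add_cnj by (simp del: times_complex.sel)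
      also have "cnj (z * iexp r) = cnj z * iexp (- r)" by (simp add: exp_cnj)
      finally show ?thesis by (simp add: algebra_simps add_divide_distrib)
    qed
    \<comment> \<open>The factor left over from the other coordinates is complex and no admissible
      weight. For |z| \<le> 1 the number 1 + Re(z e^(ir)) is nonnegative and can play that part in
      \<open>weighted_char_eqI\<close>.\<close>
    have step: "(CLINT \<omega>|P. u (V k \<omega>) * complex_of_real ((1 + Re (z * iexp (\<psi> \<omega>))) * I \<omega>)) =
             (CLINT \<omega>|P'. u (W k \<omega>) * complex_of_real ((1 + Re (z * iexp (\<psi>' \<omega>))) * I' \<omega>))"
      if z: "norm z \<le> 1" for z
    proof (rule weighted_char_eqI)
      have b: "\<bar>Re (z * iexp r)\<bar> \<le> 1" for r
        using abs_Re_le_cmod[of "z * iexp r"] z by (simp add: norm_mult)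
      show "0 \<le> (1 + Re (z * iexp (\<psi> x))) * I x" for x
        using b[of "\<psi> x"] I01[of x] by (intro mult_nonneg_nonneg) auto
      show "0 \<le> (1 + Re (z * iexp (\<psi>' x))) * I' x" for x
        using b[of "\<psi>' x"] I01'[of x] by (intro mult_nonneg_nonneg) auto
      have bb: "\<bar>1 + Re (z * iexp r)\<bar> * i \<le> 2 * 1" if "0 \<le> i" "i \<le> 1" for r i :: real
        using b[of r] that by (intro mult_mono) auto
      show "integrable P (\<lambda>\<omega>. (1 + Re (z * iexp (\<psi> \<omega>))) * I \<omega>)"
        using I01 bb by (intro P.integrable_const_bound[where B=2]) (auto simp: abs_mult)
      show "integrable P' (\<lambda>\<omega>. (1 + Re (z * iexp (\<psi>' \<omega>))) * I' \<omega>)"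
        using I01' bb by (intro P'.integrable_const_bound[where B=2]) (auto simp: abs_mult)
      show "(CLINT x|P. iexp (\<tau> * V k x) * complex_of_real ((1 + Re (z * iexp (\<psi> x))) * I x)) =
         (CLINT x|P'. iexp (\<tau> * W k x) * complex_of_real ((1 + Re (z * iexp (\<psi>' x))) * I' x))" for \<tau>
      proof -
        have w: "(\<lambda>v. iexp (\<tau> * v)) \<in> borel_measurable borel" by measurable
        note i = intP[OF w] intP'[OF w]
        show ?thesis unfolding sp
          by (subst integral_lincomb3(2), (rule i, simp)+)
            (subst integral_lincomb3(2), (rule i, simp)+, simp only: E)
      qed
    qed measurable
    have IP: "integrable P (\<lambda>\<omega>. u (V k \<omega>) * complex_of_real ((1 + Re (z * iexp (\<psi> \<omega>))) * I \<omega>))" for z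
      unfolding sp by (intro integral_lincomb3 intP) (use ub in auto)
    have IP': "integrable P' (\<lambda>\<omega>. u (W k \<omega>) * complex_of_real ((1 + Re (z * iexp (\<psi>' \<omega>))) * I' \<omega>))" for z
      unfolding sp by (intro integral_lincomb3 intP') (use ub in auto)
    \<comment> \<open>The complex exponential is recovered from nonnegative weights: e^(ir) = (1 +
      cos r) + i(1 + sin r) - (1 + i), the three terms being the cases z = 1, z = -i and z =
      0.\<close>
    have dec: "w * (iexp r * complex_of_real i) =
       w * complex_of_real ((1 + Re (1 * iexp r)) * i) + \<i> * (w * complex_of_real ((1 + Re ((-\<i>) * iexp r)) * i))
       + (- (1 + \<i>)) * (w * complex_of_real ((1 + Re (0 * iexp r)) * i))" for w r i
    proof -
      have "w * (z * complex_of_real i) =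
       w * complex_of_real ((1 + Re (1 * z)) * i) + \<i> * (w * complex_of_real ((1 + Re ((-\<i>) * z)) * i))
       + (- (1 + \<i>)) * (w * complex_of_real ((1 + Re (0 * z)) * i))" for z
        by (subst (1) complex_eq[of z]) (simp add: algebra_simps)
      then show ?thesis .
    qed
    have main: "(CLINT \<omega>|P. u (V k \<omega>) * (iexp (\<psi> \<omega>) * I \<omega>)) = (CLINT \<omega>|P'. u (W k \<omega>) * (iexp (\<psi>' \<omega>) * I' \<omega>))"
      unfolding dec
      by (subst integral_lincomb3(2), (rule IP)+) (subst integral_lincomb3(2), (rule IP')+, simp only: step norm_one norm_zero norm_minus_cancel norm_ii order_refl zero_le_one)
    have f1: "iexp (\<Sum>j\<in>J. \<theta> j * V j \<omega>) * (\<Prod>j\<in>insert k S. indicator (A j) (V j \<omega>)) = u (V k \<omega>) * (iexp (\<psi> \<omega>) * I \<omega>)" for \<omega>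
      using k J insert.hyps by (simp add: sum.remove[of J k] \<psi>_def u_def 3[symmetric] exp_add distrib_left mult_ac)
    have f2: "iexp (\<Sum>j\<in>J. \<theta> j * W j \<omega>) * (\<Prod>j\<in>insert k S. indicator (A j) (W j \<omega>)) = u (W k \<omega>) * (iexp (\<psi>' \<omega>) * I' \<omega>)" for \<omega>
      using k J insert.hyps by (simp add: sum.remove[of J k] \<psi>'_def u_def 4[symmetric] exp_add distrib_left mult_ac)
    show ?case unfolding f1 f2 by (rule main)
  qed
  have mV: "(\<lambda>\<omega>. \<lambda>j\<in>J. V j \<omega>) \<in> measurable P (\<Pi>\<^sub>M j\<in>J. borel)"
    using V by (intro measurable_restrict) auto
  have mW: "(\<lambda>\<omega>. \<lambda>j\<in>J. W j \<omega>) \<in> measurable P' (\<Pi>\<^sub>M j\<in>J. borel)"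
    using W by (intro measurable_restrict) auto
  show ?thesis
  proof (rule measure_eqI_PiM_finite[OF J, where A="\<lambda>_. space (\<Pi>\<^sub>M j\<in>J. borel)" and M="\<lambda>_. borel"])
    fix A :: "'i \<Rightarrow> real set" assume A: "\<And>i. i \<in> J \<Longrightarrow> A i \<in> sets borel"
    have PA: "Pi\<^sub>E J A \<in> sets (\<Pi>\<^sub>M j\<in>J. borel)" using A J by (intro sets_PiM_I_finite) auto
    have x1: "(CLINT \<omega>|P. iexp 0 * (\<Prod>j\<in>J. indicator (A j) (V j \<omega>))) =
        complex_of_real (measure P ((\<lambda>\<omega>. \<lambda>j\<in>J. V j \<omega>) -` Pi\<^sub>E J A \<inter> space P))"
    proof -
      have "(CLINT \<omega>|P. iexp 0 * (\<Prod>j\<in>J. indicator (A j) (V j \<omega>))) =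
            (CLINT \<omega>|P. complex_of_real (indicator ((\<lambda>\<omega>. \<lambda>j\<in>J. V j \<omega>) -` Pi\<^sub>E J A \<inter> space P) \<omega>))"
        using J by (intro Bochner_Integration.integral_cong) (auto simp: indicator_def PiE_iff prod_zero_iff)
      also have "\<dots> = complex_of_real (measure P ((\<lambda>\<omega>. \<lambda>j\<in>J. V j \<omega>) -` Pi\<^sub>E J A \<inter> space P))"
        by (subst integral_complex_of_real) (use measurable_sets[OF mV PA] in simp)
      finally show ?thesis .
    qed
    have x2: "(CLINT \<omega>|P'. iexp 0 * (\<Prod>j\<in>J. indicator (A j) (W j \<omega>))) =
        complex_of_real (measure P' ((\<lambda>\<omega>. \<lambda>j\<in>J. W j \<omega>) -` Pi\<^sub>E J A \<inter> space P'))"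
    proof -
      have "(CLINT \<omega>|P'. iexp 0 * (\<Prod>j\<in>J. indicator (A j) (W j \<omega>))) =
            (CLINT \<omega>|P'. complex_of_real (indicator ((\<lambda>\<omega>. \<lambda>j\<in>J. W j \<omega>) -` Pi\<^sub>E J A \<inter> space P') \<omega>))"
        using J by (intro Bochner_Integration.integral_cong) (auto simp: indicator_def PiE_iff prod_zero_iff)
      also have "\<dots> = complex_of_real (measure P' ((\<lambda>\<omega>. \<lambda>j\<in>J. W j \<omega>) -` Pi\<^sub>E J A \<inter> space P'))"
        by (subst integral_complex_of_real) (use measurable_sets[OF mW PA] in simp)
      finally show ?thesis .
    qed
    have "complex_of_real (measure P ((\<lambda>\<omega>. \<lambda>j\<in>J. V j \<omega>) -` Pi\<^sub>E J A \<inter> space P)) =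
          complex_of_real (measure P' ((\<lambda>\<omega>. \<lambda>j\<in>J. W j \<omega>) -` Pi\<^sub>E J A \<inter> space P'))"
      using rect[of J A "\<lambda>_. 0"] A unfolding x1[symmetric] x2[symmetric] by simp
    then have "measure P ((\<lambda>\<omega>. \<lambda>j\<in>J. V j \<omega>) -` Pi\<^sub>E J A \<inter> space P) =
          measure P' ((\<lambda>\<omega>. \<lambda>j\<in>J. W j \<omega>) -` Pi\<^sub>E J A \<inter> space P')" using of_real_eq_iff by blast
    then show "emeasure (distr P (Pi\<^sub>M J (\<lambda>j. borel)) (\<lambda>\<omega>. \<lambda>j\<in>J. V j \<omega>)) (Pi\<^sub>E J A) =
         emeasure (distr P' (Pi\<^sub>M J (\<lambda>j. borel)) (\<lambda>\<omega>. \<lambda>j\<in>J. W j \<omega>)) (Pi\<^sub>E J A)"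
      using mV mW PA by (simp add: emeasure_distr P.emeasure_eq_measure P'.emeasure_eq_measure)
  next
    show "emeasure (distr P (Pi\<^sub>M J (\<lambda>j. borel)) (\<lambda>\<omega>. \<lambda>j\<in>J. V j \<omega>)) (space (Pi\<^sub>M J (\<lambda>j. borel))) \<noteq> \<infinity>" for i :: nat
      using mV by (simp add: emeasure_distr P.emeasure_eq_measure)
  qed (auto simp: space_PiM prod_algebraI_finite J)
qed

section \<open>Absolute moments of stable variables\<close>

lemma nn_integral_powr_near_0:
  fixes a :: real
  assumes "a > -1"
  shows "(\<integral>\<^sup>+x. ennreal (x powr a) * indicator {0..1} x \<partial>lborel) = ennreal (1 / (a + 1))"
proof -
  have "((\<lambda>x. x powr a * indicator {0..1} x) has_integral (1 powr (a + 1) / (a + 1))) UNIV"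
    using has_integral_powr_from_0[OF assms, of 1]
    by (simp add: has_integral_restrict_UNIV[of "{0..1}", symmetric] indicator_def of_bool_def if_distrib[of "(*) _"] cong: if_cong)
  then have "(\<integral>\<^sup>+x. ennreal (x powr a * indicator {0..1} x) \<partial>lborel) = ennreal (1 powr (a + 1) / (a + 1))"
    by (intro nn_integral_has_integral_lborel) auto
  then show ?thesis by (simp add: ennreal_mult' ennreal_indicator)
qed

lemma nn_integral_powr_at_top:
  fixes a :: real
  assumes "a < -1"
  shows "(\<integral>\<^sup>+x. ennreal (x powr a) * indicator {1..} x \<partial>lborel) = ennreal (1 / (- a - 1))"
proof -
  have "((\<lambda>x. x powr a * indicator {1..} x) has_integral (- (1 powr (a + 1)) / (a + 1))) UNIV"
    using has_integral_powr_to_inf[OF assms, of 1]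
    by (simp add: has_integral_restrict_UNIV[of "{1..}", symmetric] indicator_def of_bool_def if_distrib[of "(*) _"] cong: if_cong)
  then have "(\<integral>\<^sup>+x. ennreal (x powr a * indicator {1..} x) \<partial>lborel) = ennreal (- (1 powr (a + 1)) / (a + 1))"
    by (intro nn_integral_has_integral_lborel) auto
  also have "- (1 powr (a + 1)) / (a + 1) = 1 / (- a - 1)" using assms by (simp add: field_simps)
  finally show ?thesis by (simp add: ennreal_mult' ennreal_indicator)
qed

lemma nn_integral_lborel_reflect:
  fixes f :: "real \<Rightarrow> ennreal"
  assumes [measurable]: "f \<in> borel_measurable borel"
  shows "(\<integral>\<^sup>+x. f (- x) \<partial>lborel) = (\<integral>\<^sup>+x. f x \<partial>lborel)"
  using nn_integral_real_affine[of f "-1" 0] by simp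

text \<open>The common integrability test: an exponent above -1 near the origin and one below -1 far
  out. Each half-line is compared with the same function \<open>g\<close>, the lower one by
  reflection.\<close>

lemma nn_integral_lborel_finite_powr:
  fixes f :: "real \<Rightarrow> real"
  assumes [measurable]: "f \<in> borel_measurable borel" and a: "a > -1" and b: "b < -1" and C: "0 \<le> C"
    and near: "\<And>x. x \<noteq> 0 \<Longrightarrow> \<bar>x\<bar> \<le> 1 \<Longrightarrow> f x \<le> C * \<bar>x\<bar> powr a"
    and far: "\<And>x. 1 \<le> \<bar>x\<bar> \<Longrightarrow> f x \<le> C * \<bar>x\<bar> powr b"
  shows "(\<integral>\<^sup>+x. ennreal (f x) \<partial>lborel) < \<infinity>"
proof -
  define g where "g = (\<lambda>x::real. ennreal (x powr a) * indicator {0..1} x + ennreal (x powr b) * indicator {1..} x)"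
  have [measurable]: "g \<in> borel_measurable borel" unfolding g_def by measurable
  have "(\<integral>\<^sup>+x. g x \<partial>lborel) = ennreal (1 / (a + 1)) + ennreal (1 / (- b - 1))"
    unfolding g_def by (subst nn_integral_add) (auto simp: nn_integral_powr_near_0[OF a] nn_integral_powr_at_top[OF b])
  then have gf: "(\<integral>\<^sup>+x. g x \<partial>lborel) < \<infinity>" by (simp add: less_top[symmetric])
  have "ennreal (f x) \<le> ennreal C * (g x + g (-x))" if "x \<noteq> 0" for x
  proof -
    have "ennreal (f x) \<le> ennreal (C * \<bar>x\<bar> powr a) * indicator {-1..1} x + ennreal (C * \<bar>x\<bar> powr b) * indicator {x. 1 \<le> \<bar>x\<bar>} x"
      using near[OF that] far[of x] by (auto simp: indicator_def ennreal_leI intro!: add_increasing)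
    also have "\<dots> \<le> ennreal C * (g x + g (-x))"
      using that C by (auto simp: g_def indicator_def ennreal_mult abs_if distrib_left)
    finally show ?thesis .
  qed
  then have "(\<integral>\<^sup>+x. ennreal (f x) \<partial>lborel) \<le> (\<integral>\<^sup>+x. ennreal C * (g x + g (-x)) \<partial>lborel)"
    by (intro nn_integral_mono_AE) (use AE_lborel_singleton[of 0] in auto)
  also have "\<dots> = ennreal C * ((\<integral>\<^sup>+x. g x \<partial>lborel) + (\<integral>\<^sup>+x. g x \<partial>lborel))"
    by (simp add: nn_integral_cmult nn_integral_add nn_integral_lborel_reflect)
  also have "\<dots> < \<infinity>" using gf by (auto simp: ennreal_mult_less_top)
  finally show ?thesis .
qed

text \<open>
  The first absolute moment is read off the characteristic function by integrating
  \<open>1 - cos (\<theta> x)\<close> against \<open>d\<theta> / \<theta>\<^sup>2\<close>, which gives a positive multiple of \<open>\<bar>x\<bar>\<close>.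
\<close>

lemma nn_integral_one_minus_cos:
  fixes y :: real
  shows "(\<integral>\<^sup>+\<theta>. ennreal ((1 - cos (\<theta> * y)) / \<theta>\<^sup>2) \<partial>lborel) =
         ennreal \<bar>y\<bar> * (\<integral>\<^sup>+u. ennreal ((1 - cos u) / u\<^sup>2) \<partial>lborel)"
proof (cases "y = 0")
  case False
  have e: "ennreal ((1 - cos (0 + y * x)) / (0 + y * x)\<^sup>2) = ennreal (1/y\<^sup>2) * ennreal ((1 - cos (x * y)) / x\<^sup>2)" for x
    by (subst ennreal_mult[symmetric]) (auto simp: field_simps power_mult_distrib)
  have "(\<integral>\<^sup>+u. ennreal ((1 - cos u) / u\<^sup>2) \<partial>lborel) =
    ennreal \<bar>y\<bar> * (\<integral>\<^sup>+x. ennreal ((1 - cos (0 + y * x)) / (0 + y * x)\<^sup>2) \<partial>lborel)"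
    using False by (intro nn_integral_real_affine) auto
  also have "\<dots> = ennreal \<bar>y\<bar> * (ennreal (1/y\<^sup>2) * (\<integral>\<^sup>+x. ennreal ((1 - cos (x * y)) / x\<^sup>2) \<partial>lborel))"
    unfolding e by (subst nn_integral_cmult) auto
  finally have "ennreal \<bar>y\<bar> * (\<integral>\<^sup>+u. ennreal ((1 - cos u) / u\<^sup>2) \<partial>lborel) =
     (ennreal \<bar>y\<bar> * ennreal \<bar>y\<bar> * ennreal (1/y\<^sup>2)) * (\<integral>\<^sup>+x. ennreal ((1 - cos (x * y)) / x\<^sup>2) \<partial>lborel)"
    by (simp add: mult.assoc)
  also have "ennreal \<bar>y\<bar> * ennreal \<bar>y\<bar> * ennreal (1/y\<^sup>2) = 1"
    using False by (simp add: ennreal_mult[symmetric] power2_eq_square)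
  finally show ?thesis by simp
qed simp

text \<open>Averaging the identity for 1 - cos over the law gives, by Fubini, the integral of (1 -
  exp(-A|\<theta>|^\<alpha>))/\<theta>^2, and rescaling \<theta> extracts A^(1/\<alpha>). The
  remaining integral is finite since the integrand is at most |\<theta>|^(\<alpha> - 2) at the
  origin, with \<alpha> > 1, and \<theta>^(-2) at infinity. \<open>K\<close> depends on \<alpha>
  only, and the case A = 0 says that the variable vanishes almost surely.\<close>

lemma stable_abs_moment:
  fixes \<alpha> :: real
  assumes \<alpha>: "1 < \<alpha>" "\<alpha> < 2"
  shows "\<exists>K\<ge>0. \<forall>A\<ge>0. \<forall>N::real measure. real_distribution N \<longrightarrow>
    (\<forall>\<theta>. char N \<theta> = complex_of_real (exp (- A * \<bar>\<theta>\<bar> powr \<alpha>))) \<longrightarrow>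
    (\<integral>\<^sup>+x. ennreal \<bar>x\<bar> \<partial>N) \<le> ennreal (K * A powr (1 / \<alpha>))"
proof -
  define \<kappa> where "\<kappa> = (\<integral>\<^sup>+u. ennreal ((1 - cos u) / u\<^sup>2) \<partial>lborel)"
  define f where "f = (\<lambda>x::real. (1 - exp (- (\<bar>x\<bar> powr \<alpha>))) / x\<^sup>2)"
  define K1 where "K1 = (\<integral>\<^sup>+x. ennreal (f x) \<partial>lborel)"
  have [measurable]: "f \<in> borel_measurable borel" unfolding f_def by measurable
  have K1: "K1 < \<infinity>" unfolding K1_def
  proof (rule nn_integral_lborel_finite_powr[where C=1 and a="\<alpha>-2" and b="-2"])
    fix x :: real assume x: "x \<noteq> 0" "\<bar>x\<bar> \<le> 1"
    have "1 - exp (- (\<bar>x\<bar> powr \<alpha>)) \<le> \<bar>x\<bar> powr \<alpha>" using exp_ge_add_one_self[of "- (\<bar>x\<bar> powr \<alpha>)"] by simp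
    then have "f x \<le> \<bar>x\<bar> powr \<alpha> / x\<^sup>2" unfolding f_def by (intro divide_right_mono) auto
    also have "x\<^sup>2 = \<bar>x\<bar> powr 2" using x by simp
    finally show "f x \<le> 1 * \<bar>x\<bar> powr (\<alpha> - 2)" by (simp add: powr_diff)
  next
    fix x :: real assume x: "1 \<le> \<bar>x\<bar>"
    have "f x \<le> 1 / x\<^sup>2" unfolding f_def by (intro divide_right_mono) auto
    also have "x\<^sup>2 = \<bar>x\<bar> powr 2" using x by simp
    finally show "f x \<le> 1 * \<bar>x\<bar> powr (-2)" by (simp add: powr_minus_divide)
  qed (use \<alpha> in auto)
  have "\<kappa> \<noteq> 0"
  proof
    assume "\<kappa> = 0"
    then have "AE u in lborel. ennreal ((1 - cos u) / u\<^sup>2) = 0"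
      unfolding \<kappa>_def by (subst (asm) nn_integral_0_iff_AE) auto
    then have "AE u in lborel. \<not> (u \<in> {1..2::real})"
    proof eventually_elim
      case (elim u)
      show ?case
      proof
      assume "u \<in> {1..2}"
      note elim
      then have "1 - cos u \<le> 0" using \<open>u \<in> {1..2}\<close> by (auto simp: ennreal_eq_0_iff divide_le_0_iff)
      moreover have "cos u < cos 0" using \<open>u \<in> {1..2}\<close> pi_gt3 by (intro cos_monotone_0_pi) auto
      ultimately show False by simp
      qed
    qed
    then have "emeasure lborel {1..2::real} = 0"
      by (subst (asm) AE_iff_measurable[where N="{1..2}"]) auto
    then show False by simp
  qed
  \<comment> \<open>A positive real number below \<kappa> is enough to bound the moment from above,
    whether or not \<kappa> is finite.\<close>
  then obtain k where k: "k > 0" "ennreal k \<le> \<kappa>"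
  proof (cases \<kappa>)
    case (real r)
    then show ?thesis using that[of r] \<open>\<kappa> \<noteq> 0\<close> by (auto simp: less_le)
  next
    case top
    then show ?thesis using that[of 1] by auto
  qed
  define K where "K = enn2real K1 / k"
  have K0: "K \<ge> 0" using k by (simp add: K_def)
  show ?thesis
  proof (intro exI[of _ K] conjI allI impI K0)
    fix A :: real and N :: "real measure"
    assume A: "0 \<le> A" and N: "real_distribution N" and ch: "\<forall>\<theta>. char N \<theta> = complex_of_real (exp (- A * \<bar>\<theta>\<bar> powr \<alpha>))"
    interpret real_distribution N by fact
    have e: "ennreal ((1 - exp (- A * \<bar>\<theta>\<bar> powr \<alpha>)) / \<theta>\<^sup>2) = (\<integral>\<^sup>+x. ennreal ((1 - cos (\<theta> * x)) / \<theta>\<^sup>2) \<partial>N)" for \<theta>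
    proof -
      have i: "integrable N (\<lambda>x. cos (\<theta> * x))" by (intro integrable_const_bound[where B=1]) auto
      have "Re (char N \<theta>) = (LINT x|N. cos (\<theta> * x))"
        unfolding char_def by (subst integral_Re[symmetric]) (auto intro!: integrable_iexp simp: Re_exp)
      then have "(LINT x|N. (1 - cos (\<theta> * x)) / \<theta>\<^sup>2) = (1 - exp (- A * \<bar>\<theta>\<bar> powr \<alpha>)) / \<theta>\<^sup>2"
        using ch i prob_space by simp
      then show ?thesis
        using i by (subst nn_integral_eq_integral) auto
    qed
    have "ennreal k * (\<integral>\<^sup>+x. ennreal \<bar>x\<bar> \<partial>N) = (\<integral>\<^sup>+x. ennreal \<bar>x\<bar> * ennreal k \<partial>N)"
      by (subst nn_integral_multc) (auto simp: mult.commute)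
    also have "\<dots> \<le> (\<integral>\<^sup>+x. (\<integral>\<^sup>+\<theta>. ennreal ((1 - cos (\<theta> * x)) / \<theta>\<^sup>2) \<partial>lborel) \<partial>N)"
      unfolding nn_integral_one_minus_cos \<kappa>_def[symmetric] using k by (intro nn_integral_mono mult_left_mono) auto
    also have "\<dots> = (\<integral>\<^sup>+\<theta>. (\<integral>\<^sup>+x. ennreal ((1 - cos (\<theta> * x)) / \<theta>\<^sup>2) \<partial>N) \<partial>lborel)"
    proof -
      interpret pair_sigma_finite N lborel ..
      show ?thesis by (rule Fubini'[symmetric]) measurable
    qed
    also have "\<dots> = (\<integral>\<^sup>+\<theta>. ennreal ((1 - exp (- A * \<bar>\<theta>\<bar> powr \<alpha>)) / \<theta>\<^sup>2) \<partial>lborel)"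
      unfolding e ..
    also have "\<dots> = ennreal (A powr (1/\<alpha>)) * K1"
    proof (cases "A = 0")
      case False
      \<comment> \<open>The scale with c^\<alpha> = A: the denominator contributes c^2 and the
        substitution 1/c, so that one factor c remains.\<close>
      define c where "c = A powr (1/\<alpha>)"
      have c: "c > 0" using False A by (simp add: c_def)
      have ca: "c powr \<alpha> = A" unfolding c_def powr_powr using \<alpha> A by simp
      have "ennreal (f (0 + c * \<theta>)) = ennreal (1/c\<^sup>2) * ennreal ((1 - exp (- A * \<bar>\<theta>\<bar> powr \<alpha>)) / \<theta>\<^sup>2)" for \<theta>
        using c ca A by (subst ennreal_mult[symmetric]) (auto simp: f_def abs_mult powr_mult power_mult_distrib)
      then have "K1 = ennreal \<bar>c\<bar> * (\<integral>\<^sup>+\<theta>. ennreal (1/c\<^sup>2) * ennreal ((1 - exp (- A * \<bar>\<theta>\<bar> powr \<alpha>)) / \<theta>\<^sup>2) \<partial>lborel)"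
        unfolding K1_def using c by (subst nn_integral_real_affine[of _ c 0]) auto
      then have "ennreal c * K1 = ennreal c * (ennreal c * (ennreal (1/c\<^sup>2) * (\<integral>\<^sup>+\<theta>. ennreal ((1 - exp (- A * \<bar>\<theta>\<bar> powr \<alpha>)) / \<theta>\<^sup>2) \<partial>lborel)))"
        using c by (simp add: nn_integral_cmult)
      also have "\<dots> = (ennreal c * ennreal c * ennreal (1/c\<^sup>2)) * (\<integral>\<^sup>+\<theta>. ennreal ((1 - exp (- A * \<bar>\<theta>\<bar> powr \<alpha>)) / \<theta>\<^sup>2) \<partial>lborel)"
        by (simp add: mult.assoc)
      also have "ennreal c * ennreal c * ennreal (1/c\<^sup>2) = 1"
        using c by (simp add: ennreal_mult[symmetric] power2_eq_square)
      finally show ?thesis by (simp add: c_def)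
    qed simp
    also have "\<dots> = ennreal k * ennreal (K * A powr (1/\<alpha>))"
      using K1 k by (cases K1) (auto simp: K_def ennreal_mult[symmetric] mult.commute)
    finally show "(\<integral>\<^sup>+x. ennreal \<bar>x\<bar> \<partial>N) \<le> ennreal (K * A powr (1 / \<alpha>))"
      using k by (subst (asm) ennreal_mult_le_mult_iff) auto
  qed
qed

section \<open>Integration against a stable random measure\<close>

text \<open>Finite measure of the support keeps every nonzero level set among the sets on which the
  random measure is controlled; the level set of 0 may be infinite.\<close>

definition finite_simple :: "'a measure \<Rightarrow> ('a \<Rightarrow> real) \<Rightarrow> bool" where
  "finite_simple m f \<longleftrightarrow> simple_function m f \<and> emeasure m {z \<in> space m. f z \<noteq> 0} < \<infinity>"

lemma finite_simple_level_set:
  assumes "finite_simple m f" "y \<noteq> 0"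
  shows "{z \<in> space m. f z = y} \<in> sets m" "emeasure m {z \<in> space m. f z = y} < \<infinity>"
proof -
  have f[measurable]: "f \<in> borel_measurable m"
    using assms(1) by (auto simp: finite_simple_def borel_measurable_simple_function)
  show "{z \<in> space m. f z = y} \<in> sets m" by measurable
  have "emeasure m {z \<in> space m. f z = y} \<le> emeasure m {z \<in> space m. f z \<noteq> 0}"
    using assms(2) by (intro emeasure_mono) auto
  then show "emeasure m {z \<in> space m. f z = y} < \<infinity>"
    using assms(1) by (auto simp: finite_simple_def)
qed

lemma finite_simple_lincomb:
  assumes f: "finite_simple m f" and g: "finite_simple m g"
  shows "finite_simple m (\<lambda>z. a * f z + b * g z)"
proof -
  have [measurable]: "f \<in> borel_measurable m" "g \<in> borel_measurable m"
    using f g by (auto simp: finite_simple_def borel_measurable_simple_function)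
  have "emeasure m {z \<in> space m. a * f z + b * g z \<noteq> 0} \<le> emeasure m ({z \<in> space m. f z \<noteq> 0} \<union> {z \<in> space m. g z \<noteq> 0})"
    by (intro emeasure_mono) auto
  also have "\<dots> \<le> emeasure m {z \<in> space m. f z \<noteq> 0} + emeasure m {z \<in> space m. g z \<noteq> 0}"
    by (intro emeasure_subadditive) auto
  also have "\<dots> < \<infinity>" using f g by (auto simp: finite_simple_def)
  finally show ?thesis using f g unfolding finite_simple_def by auto
qed

lemma powr_abs_add_le:
  fixes a b \<alpha> :: real
  assumes "0 \<le> \<alpha>"
  shows "\<bar>a + b\<bar> powr \<alpha> \<le> 2 powr \<alpha> * (\<bar>a\<bar> powr \<alpha> + \<bar>b\<bar> powr \<alpha>)"
proof -
  have "\<bar>a + b\<bar> powr \<alpha> \<le> (2 * max \<bar>a\<bar> \<bar>b\<bar>) powr \<alpha>" using assms by (intro powr_mono2) auto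
  also have "\<dots> = 2 powr \<alpha> * (max \<bar>a\<bar> \<bar>b\<bar>) powr \<alpha>" by (simp add: powr_mult)
  also have "\<dots> \<le> 2 powr \<alpha> * (\<bar>a\<bar> powr \<alpha> + \<bar>b\<bar> powr \<alpha>)" by (intro mult_left_mono) (auto simp: max_def)
  finally show ?thesis .
qed

text \<open>Convexity of the power at the points |a|/l and |b|/(1 - l) with weights l and 1 - l. As
  l tends to 1 the constant in front of |a|^\<alpha> tends to 1, which continuity of the L^\<alpha>
  norm requires and the factor 2^\<alpha> of \<open>powr_abs_add_le\<close> cannot give.\<close>

lemma powr_abs_add_convex:
  fixes a b \<alpha> l :: real
  assumes \<alpha>: "1 \<le> \<alpha>" and l: "0 < l" "l < 1"
  shows "\<bar>a + b\<bar> powr \<alpha> \<le> l powr (1 - \<alpha>) * \<bar>a\<bar> powr \<alpha> + (1 - l) powr (1 - \<alpha>) * \<bar>b\<bar> powr \<alpha>"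
proof -
  have p: "x powr (1 - \<alpha>) * y powr \<alpha> = x * (y / x) powr \<alpha>" if "x > 0" "y \<ge> 0" for x y :: real
    using that by (simp add: powr_diff powr_divide)
  have 1: "z powr \<alpha> \<le> x powr (1 - \<alpha>) * z powr \<alpha>" if "0 < x" "x < 1" for x z :: real
    using powr_mono'[of "1 - \<alpha>" 0 x] \<alpha> that mult_right_mono[of 1 "x powr (1 - \<alpha>)" "z powr \<alpha>"] by simp
  consider "a = 0" | "b = 0" | "a \<noteq> 0" "b \<noteq> 0" by blast
  then show ?thesis
  proof cases
    case 3
    have "\<bar>a + b\<bar> powr \<alpha> \<le> (\<bar>a\<bar> + \<bar>b\<bar>) powr \<alpha>" using \<alpha> by (intro powr_mono2) auto
    also have "\<bar>a\<bar> + \<bar>b\<bar> = l *\<^sub>R (\<bar>a\<bar> / l) + (1 - l) *\<^sub>R (\<bar>b\<bar> / (1 - l))" using l by simp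
    also have "\<dots> powr \<alpha> \<le> l * (\<bar>a\<bar> / l) powr \<alpha> + (1 - l) * (\<bar>b\<bar> / (1 - l)) powr \<alpha>"
      using 3 l convex_onD[OF powr_convex[OF \<alpha>], of "1 - l" "\<bar>a\<bar> / l" "\<bar>b\<bar> / (1 - l)"] by simp
    finally show ?thesis using p[of l "\<bar>a\<bar>"] p[of "1 - l" "\<bar>b\<bar>"] l by simp
  qed (use 1[of l "\<bar>a\<bar>"] 1[of "1 - l" "\<bar>b\<bar>"] l \<alpha> in auto)
qed

lemma in_L_lincomb:
  assumes f: "in_L m \<alpha> f" and g: "in_L m \<alpha> g" and \<alpha>: "0 \<le> \<alpha>"
  shows "in_L m \<alpha> (\<lambda>z. a * f z + b * g z)"
proof -
  have [measurable]: "f \<in> borel_measurable m" "g \<in> borel_measurable m" using f g by (auto simp: in_L_def)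
  have "integrable m (\<lambda>z. 2 powr \<alpha> * (\<bar>a\<bar> powr \<alpha> * \<bar>f z\<bar> powr \<alpha> + \<bar>b\<bar> powr \<alpha> * \<bar>g z\<bar> powr \<alpha>))"
    using f g by (auto simp: in_L_def)
  then have "integrable m (\<lambda>z. \<bar>a * f z + b * g z\<bar> powr \<alpha>)"
  proof (rule Bochner_Integration.integrable_bound)
    show "AE z in m. norm (\<bar>a * f z + b * g z\<bar> powr \<alpha>) \<le> norm (2 powr \<alpha> * (\<bar>a\<bar> powr \<alpha> * \<bar>f z\<bar> powr \<alpha> + \<bar>b\<bar> powr \<alpha> * \<bar>g z\<bar> powr \<alpha>))"
      using powr_abs_add_le[OF \<alpha>, of "a * f _" "b * g _"] by (auto simp: abs_mult powr_mult)
  qed measurable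
  then show ?thesis by (simp add: in_L_def)
qed

lemma finite_simple_in_L:
  assumes f: "finite_simple m f" shows "in_L m \<alpha> f"
proof -
  have [measurable]: "f \<in> borel_measurable m"
    using f by (auto simp: finite_simple_def borel_measurable_simple_function)
  have "Bochner_Integration.simple_bochner_integrable m (\<lambda>z. \<bar>f z\<bar> powr \<alpha>)"
  proof (rule Bochner_Integration.simple_bochner_integrable.intros)
    show "simple_function m (\<lambda>z. \<bar>f z\<bar> powr \<alpha>)"
      using f by (auto simp: finite_simple_def intro: simple_function_compose1[where g="\<lambda>y. \<bar>y\<bar> powr \<alpha>"])
    show "emeasure m {y \<in> space m. \<bar>f y\<bar> powr \<alpha> \<noteq> 0} \<noteq> \<infinity>"
      using f by (auto simp: finite_simple_def)
  qed
  then show ?thesis using has_bochner_integral_simple_bochner_integrable[of m "\<lambda>z. \<bar>f z\<bar> powr \<alpha>"]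
    by (auto simp: in_L_def integrable.simps)
qed

section \<open>The stable random measure on sets and on simple functions\<close>

text \<open>The normalisation \<open>c\<close> is named once and for all, so that the exponents of
  different integrals can be compared.\<close>

locale stable_measure =
  fixes Q :: "'b measure" and m :: "'a measure" and \<alpha> :: real and M :: "'a set \<Rightarrow> 'b \<Rightarrow> real" and c :: real
  assumes Q: "prob_space Q" and \<alpha>: "1 < \<alpha>" "\<alpha> < 2" and c: "c > 0"
    and meas: "\<And>A. A \<in> sets m \<Longrightarrow> emeasure m A < \<infinity> \<Longrightarrow> M A \<in> borel_measurable Q"
    and char: "\<And>A \<theta>. A \<in> sets m \<Longrightarrow> emeasure m A < \<infinity> \<Longrightarrow>
         char (distr Q borel (M A)) \<theta> = complex_of_real (exp (- c * measure m A * \<bar>\<theta>\<bar> powr \<alpha>))"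
    and indep: "\<And>(n::nat) A. disjoint_family_on A {..<n} \<Longrightarrow>
        (\<And>i. i < n \<Longrightarrow> A i \<in> sets m \<and> emeasure m (A i) < \<infinity>) \<Longrightarrow>
        prob_space.indep_vars Q (\<lambda>_. borel) (\<lambda>i. M (A i)) {..<n}"
    and sums: "\<And>A::nat \<Rightarrow> 'a set. disjoint_family A \<Longrightarrow> range A \<subseteq> sets m \<Longrightarrow> emeasure m (\<Union>i. A i) < \<infinity> \<Longrightarrow>
        (AE \<omega> in Q. (\<lambda>i. M (A i) \<omega>) sums M (\<Union>i. A i) \<omega>)"
begin

sublocale Q: prob_space Q by (rule Q)

text \<open>The characteristic function is exp(0) = 1, so the moment bound with A = 0 gives expected
  modulus 0.\<close>

lemma meas_empty: "AE \<omega> in Q. M {} \<omega> = 0"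
proof -
  have [measurable]: "M {} \<in> borel_measurable Q" by (intro meas) auto
  obtain K where K: "\<forall>A\<ge>0. \<forall>N::real measure. real_distribution N \<longrightarrow>
    (\<forall>\<theta>. char N \<theta> = complex_of_real (exp (- A * \<bar>\<theta>\<bar> powr \<alpha>))) \<longrightarrow>
    (\<integral>\<^sup>+x. ennreal \<bar>x\<bar> \<partial>N) \<le> ennreal (K * A powr (1 / \<alpha>))"
    using stable_abs_moment[OF \<alpha>] by blast
  have "(\<integral>\<^sup>+x. ennreal \<bar>x\<bar> \<partial>distr Q borel (M {})) \<le> ennreal (K * 0 powr (1 / \<alpha>))"
    by (rule K[rule_format]) (auto simp: char intro!: Q.real_distribution_distr)
  then have "(\<integral>\<^sup>+\<omega>. ennreal \<bar>M {} \<omega>\<bar> \<partial>Q) = 0"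
    by (simp add: nn_integral_distr)
  then show ?thesis by (subst (asm) nn_integral_0_iff_AE) (auto simp: ennreal_eq_0_iff)
qed

text \<open>Countable additivity for A, B and infinitely many empty sets, whose contributions vanish
  by \<open>meas_empty\<close>.\<close>

lemma meas_Un:
  assumes "A \<in> sets m" "emeasure m A < \<infinity>" "B \<in> sets m" "emeasure m B < \<infinity>" "A \<inter> B = {}"
  shows "AE \<omega> in Q. M (A \<union> B) \<omega> = M A \<omega> + M B \<omega>"
proof -
  define C where "C = (\<lambda>i::nat. if i = 0 then A else if i = 1 then B else {})"
  have U: "(\<Union>i. C i) = A \<union> B" 
  proof
    show "A \<union> B \<subseteq> (\<Union>i. C i)"
      using UN_upper[of 0 UNIV C] UN_upper[of 1 UNIV C] by (simp add: C_def)
  qed (auto simp: C_def split: if_splits)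
  have "emeasure m (A \<union> B) \<le> emeasure m A + emeasure m B" using assms by (intro emeasure_subadditive) auto
  then have "emeasure m (A \<union> B) < \<infinity>" using assms by (auto intro: le_less_trans)
  moreover have "disjoint_family C" using assms(5) by (auto simp: C_def disjoint_family_on_def split: if_splits)
  moreover have "range C \<subseteq> sets m" using assms by (auto simp: C_def)
  ultimately have "AE \<omega> in Q. (\<lambda>i. M (C i) \<omega>) sums M (A \<union> B) \<omega>"
    using sums[of C] unfolding U by simp
  then show ?thesis using meas_empty
  proof eventually_elim
    case (elim \<omega>)
    have "(\<lambda>i. M (C i) \<omega>) sums (\<Sum>i\<in>{0,1}. M (C i) \<omega>)"
      by (rule sums_finite) (auto simp: C_def elim)
    then show ?case using sums_unique2[OF elim(1)] by (simp add: C_def)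
  qed
qed

lemma meas_UN:
  assumes "finite I" "disjoint_family_on A I" "\<And>i. i \<in> I \<Longrightarrow> A i \<in> sets m \<and> emeasure m (A i) < \<infinity>"
  shows "AE \<omega> in Q. M (\<Union>i\<in>I. A i) \<omega> = (\<Sum>i\<in>I. M (A i) \<omega>)"
  using assms
proof (induction I rule: finite_induct)
  case empty
  then show ?case using meas_empty by simp
next
  case (insert i I)
  have IH: "AE \<omega> in Q. M (\<Union>i\<in>I. A i) \<omega> = (\<Sum>i\<in>I. M (A i) \<omega>)"
    using insert by (intro insert.IH) (auto simp: disjoint_family_on_def)
  have "emeasure m (\<Union>i\<in>I. A i) \<le> (\<Sum>i\<in>I. emeasure m (A i))"
    using insert by (intro emeasure_subadditive_finite) auto
  also have "\<dots> < \<infinity>" using insert.hyps(1) insert.prems(2) by simp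
  finally have f: "emeasure m (\<Union>i\<in>I. A i) < \<infinity>" .
  have "AE \<omega> in Q. M (A i \<union> (\<Union>i\<in>I. A i)) \<omega> = M (A i) \<omega> + M (\<Union>i\<in>I. A i) \<omega>"
    using insert f by (intro meas_Un) (auto simp: disjoint_family_on_def intro!: sets.finite_UN)
  then show ?case using IH by eventually_elim (use insert in simp)
qed

lemma simple_stable_integral_measurable:
  assumes "finite_simple m f"
  shows "simple_stable_integral m M f \<in> borel_measurable Q"
  unfolding simple_stable_integral_def
  using finite_simple_level_set[OF assms] by (auto intro!: borel_measurable_sum borel_measurable_times meas)

text \<open>The integral is defined through level sets; being computable on any finite partition
  into cells where \<open>f\<close> is constant, it becomes linear by passing to a common
  refinement.\<close>

lemma simple_stable_integral_partition:
  assumes f: "finite_simple m f" and I: "finite I" and d: "disjoint_family_on A I"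
    and A: "\<And>i. i \<in> I \<Longrightarrow> A i \<in> sets m \<and> emeasure m (A i) < \<infinity>"
    and fA: "\<And>i z. i \<in> I \<Longrightarrow> z \<in> A i \<Longrightarrow> f z = a i"
    and f0: "\<And>z. z \<in> space m \<Longrightarrow> f z \<noteq> 0 \<Longrightarrow> z \<in> (\<Union>i\<in>I. A i)"
  shows "AE \<omega> in Q. simple_stable_integral m M f \<omega> = (\<Sum>i\<in>I. a i * M (A i) \<omega>)"
proof -
  define Y where "Y = f ` space m - {0}"
  have Y: "finite Y" using f by (auto simp: Y_def finite_simple_def simple_function_def)
  \<comment> \<open>Empty cells are set aside: their coefficient need not be a value of
    \<open>f\<close>, and their contribution is 0 only almost surely.\<close>
  define J where "J = (\<lambda>y. {i\<in>I. A i \<noteq> {} \<and> a i = y})"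
  have Asp: "i \<in> I \<Longrightarrow> A i \<subseteq> space m" for i using A sets.sets_into_space by blast
  have lev: "{z \<in> space m. f z = y} = (\<Union>i\<in>J y. A i)" if "y \<in> Y" for y
  proof -
    have "y \<noteq> 0" using that by (auto simp: Y_def)
    then show ?thesis using f0 fA Asp unfolding J_def by fastforce
  qed
  have "AE \<omega> in Q. \<forall>y\<in>Y. M {z \<in> space m. f z = y} \<omega> = (\<Sum>i\<in>J y. M (A i) \<omega>)"
  proof (intro AE_finite_allI Y)
    fix y assume y: "y \<in> Y"
    show "AE \<omega> in Q. M {z \<in> space m. f z = y} \<omega> = (\<Sum>i\<in>J y. M (A i) \<omega>)"
      unfolding lev[OF y] using d A I by (intro meas_UN) (auto simp: J_def disjoint_family_on_def)
  qed
  then show ?thesis using meas_empty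
  proof eventually_elim
    case (elim \<omega>)
    have "simple_stable_integral m M f \<omega> = (\<Sum>y\<in>Y. \<Sum>i\<in>J y. a i * M (A i) \<omega>)"
      using elim(1) by (auto simp: simple_stable_integral_def Y_def[symmetric] sum_distrib_left J_def intro!: sum.cong)
    also have "\<dots> = (\<Sum>i\<in>(\<Union>y\<in>Y. J y). a i * M (A i) \<omega>)"
      using Y I by (intro sum.UNION_disjoint[symmetric]) (auto simp: J_def)
    also have "\<dots> = (\<Sum>i\<in>I. a i * M (A i) \<omega>)"
    proof (intro sum.mono_neutral_left I ballI)
      show "(\<Union>y\<in>Y. J y) \<subseteq> I" by (auto simp: J_def)
      fix i assume i: "i \<in> I - (\<Union>y\<in>Y. J y)"
      have "a i = 0" if "A i \<noteq> {}"
      proof (rule ccontr)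
        assume "a i \<noteq> 0"
        moreover obtain z where "z \<in> A i" using \<open>A i \<noteq> {}\<close> by blast
        ultimately have "a i \<in> Y" using fA[of i z] i Asp unfolding Y_def by force
        then show False using i that by (auto simp: J_def)
      qed
      then show "a i * M (A i) \<omega> = 0" using elim(2) by (cases "A i = {}") auto
    qed
    finally show ?case .
  qed
qed

text \<open>The joint level sets of (f, g) serve as one partition for all three functions. The pair
  (0, 0) is left out, since its level set may have infinite measure.\<close>

lemma simple_stable_integral_lincomb:
  assumes f: "finite_simple m f" and g: "finite_simple m g"
  shows "AE \<omega> in Q. simple_stable_integral m M (\<lambda>z. u * f z + v * g z) \<omega> =
           u * simple_stable_integral m M f \<omega> + v * simple_stable_integral m M g \<omega>"
proof -
  define I where "I = (\<lambda>z. (f z, g z)) ` space m - {(0, 0)}"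
  define A where "A = (\<lambda>p. {z \<in> space m. (f z, g z) = p})"
  have [measurable]: "f \<in> borel_measurable m" "g \<in> borel_measurable m"
    using f g by (auto simp: finite_simple_def borel_measurable_simple_function)
  have fin: "finite I"
  proof -
    have "I \<subseteq> f ` space m \<times> g ` space m" by (auto simp: I_def)
    then show ?thesis using f g by (auto simp: finite_simple_def simple_function_def intro: finite_subset)
  qed
  have d: "disjoint_family_on A I" by (auto simp: disjoint_family_on_def A_def)
  have A: "A p \<in> sets m \<and> emeasure m (A p) < \<infinity>" if "p \<in> I" for p
  proof -
    obtain a b where p: "p = (a, b)" by (cases p)
    then have ab: "a \<noteq> 0 \<or> b \<noteq> 0" using that by (auto simp: I_def)
    have s: "A p \<in> sets m" unfolding p A_def by simp
    show ?thesis
    proof (cases "a = 0")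
      case False
      have "emeasure m (A p) \<le> emeasure m {z \<in> space m. f z = a}" by (intro emeasure_mono) (auto simp: A_def p)
      then show ?thesis using s finite_simple_level_set[OF f False] by auto
    next
      case True
      then have "b \<noteq> 0" using ab by simp
      have "emeasure m (A p) \<le> emeasure m {z \<in> space m. g z = b}" by (intro emeasure_mono) (auto simp: A_def p)
      then show ?thesis using s finite_simple_level_set[OF g \<open>b \<noteq> 0\<close>] by auto
    qed
  qed
  have "AE \<omega> in Q. simple_stable_integral m M (\<lambda>z. u * f z + v * g z) \<omega> = (\<Sum>p\<in>I. (u * fst p + v * snd p) * M (A p) \<omega>)"
    using A fin d by (intro simple_stable_integral_partition finite_simple_lincomb f g) (auto simp: A_def I_def)
  moreover have "AE \<omega> in Q. simple_stable_integral m M f \<omega> = (\<Sum>p\<in>I. fst p * M (A p) \<omega>)"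
    using A fin d by (intro simple_stable_integral_partition f) (auto simp: A_def I_def)
  moreover have "AE \<omega> in Q. simple_stable_integral m M g \<omega> = (\<Sum>p\<in>I. snd p * M (A p) \<omega>)"
    using A fin d by (intro simple_stable_integral_partition g) (auto simp: A_def I_def)
  ultimately show ?thesis
    by eventually_elim (simp add: sum_distrib_left sum.distrib algebra_simps)
qed

text \<open>Disjoint level sets give independent summands, so the characteristic function is a
  product, and the exponents |y|^\<alpha> m(f = y) add up to the integral of |f|^\<alpha>.\<close>

lemma char_simple_stable_integral:
  assumes f: "finite_simple m f"
  shows "char (distr Q borel (simple_stable_integral m M f)) \<theta> =
    complex_of_real (exp (- c * (LINT z|m. \<bar>f z\<bar> powr \<alpha>) * \<bar>\<theta>\<bar> powr \<alpha>))"
proof -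
  define Y where "Y = f ` space m - {0}"
  have Y: "finite Y" using f by (auto simp: Y_def finite_simple_def simple_function_def)
  \<comment> \<open>Independence is available for sets numbered below some \<open>n\<close>, hence
    the enumeration of the nonzero values.\<close>
  obtain h where h: "bij_betw h {0..<card Y} Y" using ex_bij_betw_nat_finite[OF Y] by blast
  define n where "n = card Y"
  have h: "bij_betw h {..<n} Y" using h unfolding n_def by (simp add: lessThan_atLeast0)
  define A where "A = (\<lambda>i. {z \<in> space m. f z = h i})"
  have hY: "h i \<in> Y" if "i < n" for i using h that by (auto simp: bij_betw_def)
  have A: "A i \<in> sets m \<and> emeasure m (A i) < \<infinity>" if "i < n" for i
    using finite_simple_level_set[OF f, of "h i"] hY[OF that] by (auto simp: A_def Y_def)
  have [measurable]: "f \<in> borel_measurable m"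
    using f by (auto simp: finite_simple_def borel_measurable_simple_function)
  have "disjoint_family_on A {..<n}"
    using h by (auto simp: disjoint_family_on_def A_def bij_betw_def inj_on_def)
  from indep[OF this A] have "Q.indep_vars (\<lambda>_. borel) (\<lambda>i. M (A i)) {..<n}" by simp
  then have ind: "Q.indep_vars (\<lambda>_. borel) (\<lambda>i \<omega>. h i * M (A i) \<omega>) {..<n}"
    by (rule Q.indep_vars_compose2[where Y="\<lambda>i x. h i * x"]) auto
  have eq: "simple_stable_integral m M f = (\<lambda>\<omega>. \<Sum>i<n. h i * M (A i) \<omega>)"
    unfolding simple_stable_integral_def Y_def[symmetric] A_def
    using sum.reindex_bij_betw[OF h, of "\<lambda>y. y * M {z \<in> space m. f z = y} _"] by auto
  have ch: "char (distr Q borel (\<lambda>\<omega>. h i * M (A i) \<omega>)) \<theta> =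
      complex_of_real (exp (- c * (\<bar>h i\<bar> powr \<alpha> * measure m (A i)) * \<bar>\<theta>\<bar> powr \<alpha>))" if "i < n" for i
  proof -
    have [measurable]: "M (A i) \<in> borel_measurable Q" using meas A[OF that] by blast
    have "char (distr Q borel (\<lambda>\<omega>. h i * M (A i) \<omega>)) \<theta> = char (distr Q borel (M (A i))) (\<theta> * h i)"
      by (simp add: char_def integral_distr mult.assoc)
    also have "\<dots> = complex_of_real (exp (- c * (\<bar>h i\<bar> powr \<alpha> * measure m (A i)) * \<bar>\<theta>\<bar> powr \<alpha>))"
      using A[OF that] by (subst char) (auto simp: abs_mult powr_mult mult_ac)
    finally show ?thesis .
  qed
  have "(LINT z|m. \<bar>f z\<bar> powr \<alpha>) = (LINT z|m. (\<Sum>i<n. \<bar>h i\<bar> powr \<alpha> * indicator (A i) z))"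
  proof (intro Bochner_Integration.integral_cong refl)
    fix z assume z: "z \<in> space m"
    show "\<bar>f z\<bar> powr \<alpha> = (\<Sum>i<n. \<bar>h i\<bar> powr \<alpha> * indicator (A i) z)"
    proof (cases "f z = 0")
      case True
      then have "z \<notin> A i" if "i < n" for i using hY[OF that] by (auto simp: A_def Y_def)
      then show ?thesis using True by simp
    next
      case False
      then have "f z \<in> Y" using z by (auto simp: Y_def)
      then obtain k where k: "k < n" "h k = f z" using h by (auto simp: bij_betw_def)
      have "z \<in> A i \<longleftrightarrow> i = k" if "i < n" for i
        using that k z h by (auto simp: A_def bij_betw_def inj_on_def)
      then have "(\<Sum>i<n. \<bar>h i\<bar> powr \<alpha> * indicator (A i) z) = (\<Sum>i<n. if i = k then \<bar>h i\<bar> powr \<alpha> else 0)"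
        by (intro sum.cong) (auto simp: indicator_def)
      then show ?thesis using k by simp
    qed
  qed
  also have "\<dots> = (\<Sum>i<n. \<bar>h i\<bar> powr \<alpha> * measure m (A i))"
  proof -
    have "integrable m (\<lambda>z. indicator (A i) z :: real)" if "i < n" for i using A[OF that] by (intro integrable_real_indicator) auto
    moreover have "A i \<inter> space m = A i" for i by (auto simp: A_def)
    ultimately show ?thesis by (subst Bochner_Integration.integral_sum) auto
  qed
  finally have N: "(LINT z|m. \<bar>f z\<bar> powr \<alpha>) = (\<Sum>i<n. \<bar>h i\<bar> powr \<alpha> * measure m (A i))" .
  show ?thesis
    unfolding eq Q.char_distr_sum[OF ind] N
    by (simp add: ch of_real_prod[symmetric] exp_sum[symmetric] sum_distrib_left sum_distrib_right sum_negf[symmetric] del: of_real_prod)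
qed

end

section \<open>Continuity of the L^\<alpha> norm and convergence in probability\<close>

text \<open>The convexity estimate is used twice, with the roles of \<open>f n\<close> and
  \<open>h\<close> exchanged. For a fixed l the error term vanishes as n grows, and l close to 1
  makes the remaining constants as close to 1 as desired.\<close>

lemma in_L_integral_powr_tendsto:
  assumes f: "\<And>n. in_L m \<alpha> (f n)" and h: "in_L m \<alpha> h" and \<alpha>: "1 \<le> \<alpha>"
    and lim: "(\<lambda>n::nat. \<integral>\<^sup>+z. ennreal (\<bar>f n z - h z\<bar> powr \<alpha>) \<partial>m) \<longlonglongrightarrow> 0"
  shows "(\<lambda>n. LINT z|m. \<bar>f n z\<bar> powr \<alpha>) \<longlonglongrightarrow> (LINT z|m. \<bar>h z\<bar> powr \<alpha>)"
proof -
  define d where "d = (\<lambda>n. LINT z|m. \<bar>f n z - h z\<bar> powr \<alpha>)"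
  define x where "x = (\<lambda>n. LINT z|m. \<bar>f n z\<bar> powr \<alpha>)"
  define N where "N = (LINT z|m. \<bar>h z\<bar> powr \<alpha>)"
  have D: "integrable m (\<lambda>z. \<bar>f n z - h z\<bar> powr \<alpha>)" for n
    using in_L_lincomb[OF f[of n] h, of 1 "-1"] \<alpha> by (auto simp: in_L_def)
  have "ennreal (d n) = (\<integral>\<^sup>+z. ennreal (\<bar>f n z - h z\<bar> powr \<alpha>) \<partial>m)" for n
    unfolding d_def by (rule nn_integral_eq_integral[symmetric, OF D]) auto
  moreover have "0 \<le> d n" for n unfolding d_def by (intro integral_nonneg_AE) auto
  ultimately have d: "d \<longlonglongrightarrow> 0" using lim by (simp add: ennreal_tendsto_0_iff[symmetric])
  have F: "integrable m (\<lambda>z. \<bar>f n z\<bar> powr \<alpha>)" and H: "integrable m (\<lambda>z. \<bar>h z\<bar> powr \<alpha>)" for n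
    using f h by (auto simp: in_L_def)
  have 1: "x n \<le> l powr (1 - \<alpha>) * N + (1 - l) powr (1 - \<alpha>) * d n" if "0 < l" "l < 1" for l n
  proof -
    have "x n \<le> (LINT z|m. l powr (1 - \<alpha>) * \<bar>h z\<bar> powr \<alpha> + (1 - l) powr (1 - \<alpha>) * \<bar>f n z - h z\<bar> powr \<alpha>)"
      unfolding x_def
    proof (rule integral_mono)
      show "\<bar>f n z\<bar> powr \<alpha> \<le> l powr (1 - \<alpha>) * \<bar>h z\<bar> powr \<alpha> + (1 - l) powr (1 - \<alpha>) * \<bar>f n z - h z\<bar> powr \<alpha>" for z
        using powr_abs_add_convex[OF \<alpha> that, of "h z" "f n z - h z"] by simp
    qed (use F H D in auto)
    also have "\<dots> = l powr (1 - \<alpha>) * N + (1 - l) powr (1 - \<alpha>) * d n"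
      unfolding N_def d_def using H D by simp
    finally show ?thesis .
  qed
  have 2: "N \<le> l powr (1 - \<alpha>) * x n + (1 - l) powr (1 - \<alpha>) * d n" if "0 < l" "l < 1" for l n
  proof -
    have "N \<le> (LINT z|m. l powr (1 - \<alpha>) * \<bar>f n z\<bar> powr \<alpha> + (1 - l) powr (1 - \<alpha>) * \<bar>f n z - h z\<bar> powr \<alpha>)"
      unfolding N_def
    proof (rule integral_mono)
      show "\<bar>h z\<bar> powr \<alpha> \<le> l powr (1 - \<alpha>) * \<bar>f n z\<bar> powr \<alpha> + (1 - l) powr (1 - \<alpha>) * \<bar>f n z - h z\<bar> powr \<alpha>" for z
        using powr_abs_add_convex[OF \<alpha> that, of "f n z" "h z - f n z"] by (simp add: abs_minus_commute)
    qed (use F H D in auto)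
    also have "\<dots> = l powr (1 - \<alpha>) * x n + (1 - l) powr (1 - \<alpha>) * d n"
      unfolding x_def d_def using F D by simp
    finally show ?thesis .
  qed
  \<comment> \<open>Applied with the exponents 1 - \<alpha> and \<alpha> - 1: for l near 1 the loss
    in either estimate is smaller than the gap between \<open>a\<close> and
    \<open>N\<close>.\<close>
  have l1: "((\<lambda>l. l powr e * N) \<longlongrightarrow> 1 powr e * N) (at_left 1)" for e :: real
    by (intro tendsto_intros) auto
  have l01: "\<forall>\<^sub>F l in at_left (1::real). 0 < l \<and> l < 1"
    using eventually_at_left[of 0 "1::real" "\<lambda>l. 0 < l \<and> l < 1"] by force
  show ?thesis unfolding x_def[symmetric] N_def[symmetric]
  proof (rule order_tendstoI)
    fix a assume a: "N < a"
    have "\<forall>\<^sub>F l in at_left 1. l powr (1 - \<alpha>) * N < a"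
      using order_tendstoD(2)[OF l1[of "1 - \<alpha>"], of a] a by simp
    then obtain l where l: "0 < l" "l < 1" "l powr (1 - \<alpha>) * N < a"
      using eventually_happens'[OF _ eventually_conj[OF l01]] by (auto simp: trivial_limit_at_left_real)
    have "(\<lambda>n. l powr (1 - \<alpha>) * N + (1 - l) powr (1 - \<alpha>) * d n) \<longlonglongrightarrow> l powr (1 - \<alpha>) * N + (1 - l) powr (1 - \<alpha>) * 0"
      by (intro tendsto_intros d)
    from order_tendstoD(2)[OF this, of a] l have "\<forall>\<^sub>F n in sequentially. l powr (1 - \<alpha>) * N + (1 - l) powr (1 - \<alpha>) * d n < a"
      by simp
    then show "\<forall>\<^sub>F n in sequentially. x n < a"
      by eventually_elim (use 1[OF l(1,2)] in \<open>auto intro: le_less_trans\<close>)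
  next
    fix a assume a: "a < N"
    have "\<forall>\<^sub>F l in at_left 1. a < l powr (\<alpha> - 1) * N"
      using order_tendstoD(1)[OF l1[of "\<alpha> - 1"], of a] a by simp
    then obtain l where l: "0 < l" "l < 1" "a < l powr (\<alpha> - 1) * N"
      using eventually_happens'[OF _ eventually_conj[OF l01]] by (auto simp: trivial_limit_at_left_real)
    have "(\<lambda>n. l powr (\<alpha> - 1) * (N - (1 - l) powr (1 - \<alpha>) * d n)) \<longlonglongrightarrow> l powr (\<alpha> - 1) * (N - (1 - l) powr (1 - \<alpha>) * 0)"
      by (intro tendsto_intros d)
    from order_tendstoD(1)[OF this, of a] l
    have "\<forall>\<^sub>F n in sequentially. a < l powr (\<alpha> - 1) * (N - (1 - l) powr (1 - \<alpha>) * d n)"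
      by simp
    then show "\<forall>\<^sub>F n in sequentially. a < x n"
    proof eventually_elim
      case (elim n)
      have "l powr (\<alpha> - 1) * (N - (1 - l) powr (1 - \<alpha>) * d n) \<le> l powr (\<alpha> - 1) * (l powr (1 - \<alpha>) * x n)"
        using 2[OF l(1,2), of n] by (intro mult_left_mono) auto
      also have "\<dots> = x n" using l by (simp add: mult.assoc[symmetric] powr_add[symmetric])
      finally show ?case using elim by simp
    qed
  qed
qed

lemma norm_iexp_diff_le: "cmod (iexp x - iexp y) \<le> \<bar>x - y\<bar>"
proof -
  have "iexp x - iexp y = iexp y * (iexp (x - y) - 1)" by (simp add: exp_add[symmetric] algebra_simps)
  then have "cmod (iexp x - iexp y) = cmod (iexp (x - y) - 1)" by (simp add: norm_mult)
  also have "\<dots> \<le> \<bar>x - y\<bar>" using iexp_approx1[of "x - y" 0] by simp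
  finally show ?thesis .
qed

text \<open>Off the event |Y_n - Z| > \<epsilon> the two exponentials differ by at most
  |\<theta>|\<epsilon>, and on it by at most 2.\<close>

lemma char_tendsto_in_probability:
  assumes "prob_space Q" and [measurable]: "\<And>n. Y n \<in> borel_measurable Q" "Z \<in> borel_measurable Q"
    and lim: "tendsto_in_probability Q Y Z"
  shows "(\<lambda>n. char (distr Q borel (Y n)) \<theta>) \<longlonglongrightarrow> char (distr Q borel Z) \<theta>"
proof (rule tendstoI)
  interpret prob_space Q by fact
  fix r :: real assume r: "0 < r"
  \<comment> \<open>Leaves half of \<open>r\<close> for the exceptional event; the added 1 covers
    \<theta> = 0.\<close>
  define \<epsilon> where "\<epsilon> = r / (2 * (\<bar>\<theta>\<bar> + 1))"
  have \<epsilon>: "\<epsilon> > 0" "\<bar>\<theta>\<bar> * \<epsilon> < r / 2" using r by (auto simp: \<epsilon>_def field_simps)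
  have "(\<lambda>n. 2 * measure Q {\<omega> \<in> space Q. \<bar>Y n \<omega> - Z \<omega>\<bar> > \<epsilon>}) \<longlonglongrightarrow> 2 * 0"
    using lim \<epsilon> unfolding tendsto_in_probability_def by (intro tendsto_intros) auto
  then have "\<forall>\<^sub>F n in sequentially. 2 * measure Q {\<omega> \<in> space Q. \<bar>Y n \<omega> - Z \<omega>\<bar> > \<epsilon>} < r / 2"
    by (rule order_tendstoD(2)) (use r in simp)
  then show "\<forall>\<^sub>F n in sequentially. dist (char (distr Q borel (Y n)) \<theta>) (char (distr Q borel Z) \<theta>) < r"
  proof eventually_elim
    case (elim n)
    let ?A = "{\<omega> \<in> space Q. \<bar>Y n \<omega> - Z \<omega>\<bar> > \<epsilon>}"
    have i: "integrable Q (\<lambda>\<omega>. iexp (\<theta> * Y n \<omega>))" "integrable Q (\<lambda>\<omega>. iexp (\<theta> * Z \<omega>))"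
      by (auto intro!: integrable_iexp)
    have "dist (char (distr Q borel (Y n)) \<theta>) (char (distr Q borel Z) \<theta>) = cmod (CLINT \<omega>|Q. iexp (\<theta> * Y n \<omega>) - iexp (\<theta> * Z \<omega>))"
      using i by (simp add: char_def integral_distr dist_norm)
    also have "\<dots> \<le> (LINT \<omega>|Q. cmod (iexp (\<theta> * Y n \<omega>) - iexp (\<theta> * Z \<omega>)))" by (rule integral_norm_bound)
    also have "\<dots> \<le> (LINT \<omega>|Q. \<bar>\<theta>\<bar> * \<epsilon> + 2 * indicator ?A \<omega>)"
    proof (rule integral_mono)
      show "integrable Q (\<lambda>\<omega>. cmod (iexp (\<theta> * Y n \<omega>) - iexp (\<theta> * Z \<omega>)))"
        using i by auto
      show "integrable Q (\<lambda>\<omega>. \<bar>\<theta>\<bar> * \<epsilon> + 2 * indicator ?A \<omega>)"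
        by (intro integrable_const_bound[where B="\<bar>\<theta>\<bar> * \<epsilon> + 2"]) (use \<epsilon> in \<open>auto simp: indicator_def\<close>)
      fix \<omega> assume \<omega>: "\<omega> \<in> space Q"
      show "cmod (iexp (\<theta> * Y n \<omega>) - iexp (\<theta> * Z \<omega>)) \<le> \<bar>\<theta>\<bar> * \<epsilon> + 2 * indicator ?A \<omega>"
      proof (cases "\<omega> \<in> ?A")
        case True
        have "cmod (iexp (\<theta> * Y n \<omega>) - iexp (\<theta> * Z \<omega>)) \<le> cmod (iexp (\<theta> * Y n \<omega>)) + cmod (iexp (\<theta> * Z \<omega>))"
          by (rule norm_triangle_ineq4)
        also have "\<dots> = 2" by (simp only: norm_exp_i_times)
        finally show ?thesis using True \<epsilon> by (simp add: add_increasing)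
      next
        case False
        have "cmod (iexp (\<theta> * Y n \<omega>) - iexp (\<theta> * Z \<omega>)) \<le> \<bar>\<theta> * Y n \<omega> - \<theta> * Z \<omega>\<bar>" by (rule norm_iexp_diff_le)
        also have "\<dots> = \<bar>\<theta>\<bar> * \<bar>Y n \<omega> - Z \<omega>\<bar>" by (simp add: abs_mult[symmetric] algebra_simps)
        also have "\<dots> \<le> \<bar>\<theta>\<bar> * \<epsilon>" using False \<omega> by (intro mult_left_mono) auto
        finally show ?thesis using False by simp
      qed
    qed
    also have "\<dots> = \<bar>\<theta>\<bar> * \<epsilon> + 2 * measure Q ?A"
      by (subst Bochner_Integration.integral_add) (auto simp: prob_space emeasure_eq_measure)
    also have "\<dots> < r" using elim \<epsilon> by simp
    finally show ?case .
  qed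
qed

text \<open>Up to a null set, a large error of the combination forces a large error of one of the
  two sequences.\<close>

lemma tendsto_in_probability_lincomb:
  assumes "prob_space Q" and m[measurable]: "\<And>n. Y n \<in> borel_measurable Q" "\<And>n. Z n \<in> borel_measurable Q" "Y' \<in> borel_measurable Q" "Z' \<in> borel_measurable Q"
      "\<And>n. X n \<in> borel_measurable Q"
    and Y: "tendsto_in_probability Q Y Y'" and Z: "tendsto_in_probability Q Z Z'"
    and X: "\<And>n. AE \<omega> in Q. X n \<omega> = a * Y n \<omega> + b * Z n \<omega>"
  shows "tendsto_in_probability Q X (\<lambda>\<omega>. a * Y' \<omega> + b * Z' \<omega>)"
  unfolding tendsto_in_probability_def
proof (intro allI impI)
  interpret prob_space Q by fact
  fix \<epsilon> :: real assume \<epsilon>: "0 < \<epsilon>"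
  \<comment> \<open>Two errors of size \<open>d\<close> produce at most (|a| + |b|) d, which is
    below \<epsilon>; the added 1 covers a = b = 0.\<close>
  define d where "d = \<epsilon> / (\<bar>a\<bar> + \<bar>b\<bar> + 1)"
  have d: "d > 0" "(\<bar>a\<bar> + \<bar>b\<bar>) * d < \<epsilon>"
    using \<epsilon> by (auto simp: d_def field_simps intro!: divide_pos_pos add_nonneg_pos)
  let ?P = "\<lambda>n. measure Q {\<omega> \<in> space Q. \<bar>Y n \<omega> - Y' \<omega>\<bar> > d} + measure Q {\<omega> \<in> space Q. \<bar>Z n \<omega> - Z' \<omega>\<bar> > d}"
  have P0: "?P \<longlonglongrightarrow> 0 + 0"
    using Y Z d unfolding tendsto_in_probability_def by (intro tendsto_add) auto
  show "(\<lambda>n. prob {\<omega> \<in> space Q. \<epsilon> < \<bar>X n \<omega> - (a * Y' \<omega> + b * Z' \<omega>)\<bar>}) \<longlonglongrightarrow> 0"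
  proof (rule tendsto_sandwich[of "\<lambda>_. 0" _ sequentially ?P 0]; (intro always_eventually allI)?)
    show "?P \<longlonglongrightarrow> 0" using P0 by simp
    fix n
    have "prob {\<omega> \<in> space Q. \<epsilon> < \<bar>X n \<omega> - (a * Y' \<omega> + b * Z' \<omega>)\<bar>} \<le>
       prob ({\<omega> \<in> space Q. \<bar>Y n \<omega> - Y' \<omega>\<bar> > d} \<union> {\<omega> \<in> space Q. \<bar>Z n \<omega> - Z' \<omega>\<bar> > d})"
    proof (rule finite_measure_mono_AE)
      show "AE \<omega> in Q. \<omega> \<in> {\<omega> \<in> space Q. \<epsilon> < \<bar>X n \<omega> - (a * Y' \<omega> + b * Z' \<omega>)\<bar>} \<longrightarrow>
         \<omega> \<in> {\<omega> \<in> space Q. \<bar>Y n \<omega> - Y' \<omega>\<bar> > d} \<union> {\<omega> \<in> space Q. \<bar>Z n \<omega> - Z' \<omega>\<bar> > d}"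
      proof (rule AE_mp[OF X[of n]], rule AE_I2, intro impI, rule ccontr)
        fix \<omega> assume e: "X n \<omega> = a * Y n \<omega> + b * Z n \<omega>" and A: "\<omega> \<in> {\<omega> \<in> space Q. \<epsilon> < \<bar>X n \<omega> - (a * Y' \<omega> + b * Z' \<omega>)\<bar>}"
          and n: "\<omega> \<notin> {\<omega> \<in> space Q. \<bar>Y n \<omega> - Y' \<omega>\<bar> > d} \<union> {\<omega> \<in> space Q. \<bar>Z n \<omega> - Z' \<omega>\<bar> > d}"
        have "X n \<omega> - (a * Y' \<omega> + b * Z' \<omega>) = a * (Y n \<omega> - Y' \<omega>) + b * (Z n \<omega> - Z' \<omega>)"
          unfolding e by (simp add: algebra_simps)
        also have "\<bar>\<dots>\<bar> \<le> \<bar>a\<bar> * \<bar>Y n \<omega> - Y' \<omega>\<bar> + \<bar>b\<bar> * \<bar>Z n \<omega> - Z' \<omega>\<bar>"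
          by (simp add: abs_mult[symmetric] abs_triangle_ineq)
        also have "\<dots> \<le> \<bar>a\<bar> * d + \<bar>b\<bar> * d" using n A by (intro add_mono mult_left_mono) auto
        also have "\<dots> < \<epsilon>" using d by (simp add: algebra_simps)
        finally show False using A by simp
      qed
    qed measurable
    also have "\<dots> \<le> ?P n" by (intro measure_Un_le) measurable
    finally show "prob {\<omega> \<in> space Q. \<epsilon> < \<bar>X n \<omega> - (a * Y' \<omega> + b * Z' \<omega>)\<bar>} \<le> ?P n" .
  qed auto
qed

lemma AE_tendsto_in_probability:
  assumes "prob_space Q" and [measurable]: "\<And>n. Y n \<in> borel_measurable Q" "Z \<in> borel_measurable Q"
    and lim: "AE \<omega> in Q. (\<lambda>n. Y n \<omega>) \<longlonglongrightarrow> Z \<omega>"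
  shows "tendsto_in_probability Q Y Z"
  unfolding tendsto_in_probability_def
proof (intro allI impI)
  interpret prob_space Q by fact
  fix \<epsilon> :: real assume \<epsilon>: "0 < \<epsilon>"
  let ?A = "\<lambda>n. {\<omega> \<in> space Q. \<bar>Y n \<omega> - Z \<omega>\<bar> > \<epsilon>}"
  have "(\<lambda>n. LINT \<omega>|Q. indicator (?A n) \<omega>) \<longlonglongrightarrow> (LINT \<omega>|Q. (0::real))"
  proof (rule integral_dominated_convergence[where w="\<lambda>_. 1"])
    show "AE \<omega> in Q. (\<lambda>n. indicator (?A n) \<omega> :: real) \<longlonglongrightarrow> 0"
      using lim
    proof eventually_elim
      case (elim \<omega>)
      have "\<forall>\<^sub>F n in sequentially. \<bar>Y n \<omega> - Z \<omega>\<bar> < \<epsilon>" using tendstoD[OF elim \<epsilon>] by (simp add: dist_real_def)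
      then have "\<forall>\<^sub>F n in sequentially. indicator (?A n) \<omega> = (0::real)" by eventually_elim (auto simp: indicator_def)
      then show ?case by (rule tendsto_eventually)
    qed
  qed (auto simp: indicator_def)
  then show "(\<lambda>n. prob (?A n)) \<longlonglongrightarrow> 0" by simp
qed

text \<open>The approximants satisfy |f_n| \<le> 2|h|, so (3|h|)^\<alpha> dominates |f_n -
  h|^\<alpha>. The support of f_n has finite measure because f_n has a smallest nonzero modulus
  \<open>d\<close>, and |h| is at least d/2 wherever f_n does not vanish.\<close>

lemma in_L_approx_finite_simple:
  assumes h: "in_L m \<alpha> h" and \<alpha>: "0 < \<alpha>"
  obtains f where "\<And>n::nat. finite_simple m (f n)"
    "(\<lambda>n. \<integral>\<^sup>+z. ennreal (\<bar>f n z - h z\<bar> powr \<alpha>) \<partial>m) \<longlonglongrightarrow> 0"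
proof -
  have [measurable]: "h \<in> borel_measurable m" and hi: "integrable m (\<lambda>z. \<bar>h z\<bar> powr \<alpha>)"
    using h by (auto simp: in_L_def)
  obtain f where f: "\<And>n. simple_function m (f n)" "\<And>z. z \<in> space m \<Longrightarrow> (\<lambda>n. f n z) \<longlonglongrightarrow> h z"
    "\<And>n z. z \<in> space m \<Longrightarrow> norm (f n z) \<le> 2 * norm (h z)"
    using borel_measurable_implies_sequence_metric[of h m 0] by (auto simp: dist_real_def) metis
  have [measurable]: "f n \<in> borel_measurable m" for n using f(1) by (rule borel_measurable_simple_function)
  have hf: "(\<integral>\<^sup>+z. ennreal (\<bar>h z\<bar> powr \<alpha>) \<partial>m) < \<infinity>"
    using hi by (simp add: nn_integral_eq_integral)
  have fs: "finite_simple m (f n)" for n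
    unfolding finite_simple_def
  proof (intro conjI f(1))
    have fin: "finite (f n ` space m - {0})" using f(1)[of n] by (auto simp: simple_function_def)
    \<comment> \<open>The inserted 1 keeps the minimum meaningful when \<open>f n\<close> vanishes
      everywhere.\<close>
    define d where "d = Min (insert 1 (abs ` (f n ` space m - {0})))"
    have d: "d > 0" unfolding d_def using fin by (subst Min_gr_iff) auto
    have d2: "d \<le> \<bar>f n z\<bar>" if "z \<in> space m" "f n z \<noteq> 0" for z
      unfolding d_def using fin that by (intro Min_le) auto
    have "ennreal ((d/2) powr \<alpha>) * emeasure m {z \<in> space m. f n z \<noteq> 0} = (\<integral>\<^sup>+z. ennreal ((d/2) powr \<alpha>) * indicator {z \<in> space m. f n z \<noteq> 0} z \<partial>m)"
      by (subst nn_integral_cmult_indicator) auto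
    also have "\<dots> \<le> (\<integral>\<^sup>+z. ennreal (\<bar>h z\<bar> powr \<alpha>) \<partial>m)"
    proof (rule nn_integral_mono)
      fix z assume z: "z \<in> space m"
      show "ennreal ((d/2) powr \<alpha>) * indicator {z \<in> space m. f n z \<noteq> 0} z \<le> ennreal (\<bar>h z\<bar> powr \<alpha>)"
        using d2[OF z] f(3)[OF z, of n] d \<alpha> by (auto simp: indicator_def intro!: ennreal_leI powr_mono2)
    qed
    finally have "ennreal ((d/2) powr \<alpha>) * emeasure m {z \<in> space m. f n z \<noteq> 0} < \<infinity>" using hf by (rule le_less_trans)
    then show "emeasure m {z \<in> space m. f n z \<noteq> 0} < \<infinity>" using d by (auto simp: ennreal_mult_less_top)
  qed
  have "(\<lambda>n. \<integral>\<^sup>+z. ennreal (\<bar>f n z - h z\<bar> powr \<alpha>) \<partial>m) \<longlonglongrightarrow> (\<integral>\<^sup>+z. 0 \<partial>m)"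
  proof (rule nn_integral_dominated_convergence[where w="\<lambda>z. ennreal (3 powr \<alpha>) * ennreal (\<bar>h z\<bar> powr \<alpha>)"])
    show "AE z in m. ennreal (\<bar>f n z - h z\<bar> powr \<alpha>) \<le> ennreal (3 powr \<alpha>) * ennreal (\<bar>h z\<bar> powr \<alpha>)" for n
    proof (rule AE_I2)
      fix z assume z: "z \<in> space m"
      have "\<bar>f n z - h z\<bar> powr \<alpha> \<le> (3 * \<bar>h z\<bar>) powr \<alpha>" using f(3)[OF z, of n] \<alpha> by (intro powr_mono2) auto
      then show "ennreal (\<bar>f n z - h z\<bar> powr \<alpha>) \<le> ennreal (3 powr \<alpha>) * ennreal (\<bar>h z\<bar> powr \<alpha>)"
        by (subst ennreal_mult[symmetric]) (auto simp: powr_mult intro!: ennreal_leI)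
    qed
    show "(\<integral>\<^sup>+z. ennreal (3 powr \<alpha>) * ennreal (\<bar>h z\<bar> powr \<alpha>) \<partial>m) < \<infinity>"
      using hf by (subst nn_integral_cmult) (auto simp: ennreal_mult_less_top)
    show "AE z in m. (\<lambda>n. ennreal (\<bar>f n z - h z\<bar> powr \<alpha>)) \<longlonglongrightarrow> 0"
    proof (rule AE_I2)
      fix z assume "z \<in> space m"
      then have "(\<lambda>n. \<bar>f n z - h z\<bar>) \<longlonglongrightarrow> 0" using f(2) by (intro tendsto_rabs_zero LIM_zero)
      then have "(\<lambda>n. \<bar>f n z - h z\<bar> powr \<alpha>) \<longlonglongrightarrow> 0 powr \<alpha>"
        using \<alpha> by (intro tendsto_powr'[OF _ tendsto_const]) auto
      then show "(\<lambda>n. ennreal (\<bar>f n z - h z\<bar> powr \<alpha>)) \<longlonglongrightarrow> 0" by (simp add: ennreal_tendsto_0_iff)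
    qed
  qed auto
  then show ?thesis by (intro that[of f] fs) simp
qed

section \<open>The integral of general functions in L^\<alpha>\<close>

context stable_measure
begin

lemma has_stable_integral_finite_simple:
  "has_stable_integral Q m M \<alpha> h Y \<longleftrightarrow> in_L m \<alpha> h \<and> Y \<in> borel_measurable Q \<and>
     (\<exists>f. (\<forall>n. finite_simple m (f n)) \<and> (\<lambda>n. \<integral>\<^sup>+z. ennreal (\<bar>f n z - h z\<bar> powr \<alpha>) \<partial>m) \<longlonglongrightarrow> 0 \<and>
        tendsto_in_probability Q (\<lambda>n. simple_stable_integral m M (f n)) Y)"
  by (simp add: has_stable_integral_def finite_simple_def)

text \<open>The formula for simple functions passes to the limit on both sides, by convergence in
  probability on the left and by continuity of the L^\<alpha> norm on the right. In particular the
  law depends on \<open>h\<close> through this norm alone.\<close>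

lemma char_stable_integral:
  assumes "has_stable_integral Q m M \<alpha> h Y"
  shows "char (distr Q borel Y) \<theta> = complex_of_real (exp (- c * (LINT z|m. \<bar>h z\<bar> powr \<alpha>) * \<bar>\<theta>\<bar> powr \<alpha>))"
proof -
  obtain f where h: "in_L m \<alpha> h" and Y: "Y \<in> borel_measurable Q" and f: "\<And>n. finite_simple m (f n)"
    and lim: "(\<lambda>n. \<integral>\<^sup>+z. ennreal (\<bar>f n z - h z\<bar> powr \<alpha>) \<partial>m) \<longlonglongrightarrow> 0"
    and P: "tendsto_in_probability Q (\<lambda>n. simple_stable_integral m M (f n)) Y"
    using assms unfolding has_stable_integral_finite_simple by blast
  have 1: "(\<lambda>n. char (distr Q borel (simple_stable_integral m M (f n))) \<theta>) \<longlonglongrightarrow> char (distr Q borel Y) \<theta>"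
    by (intro char_tendsto_in_probability Q simple_stable_integral_measurable f Y P)
  have "(\<lambda>n. LINT z|m. \<bar>f n z\<bar> powr \<alpha>) \<longlonglongrightarrow> (LINT z|m. \<bar>h z\<bar> powr \<alpha>)"
    using \<alpha> by (intro in_L_integral_powr_tendsto finite_simple_in_L f h lim) auto
  then have 2: "(\<lambda>n. char (distr Q borel (simple_stable_integral m M (f n))) \<theta>) \<longlonglongrightarrow>
      complex_of_real (exp (- c * (LINT z|m. \<bar>h z\<bar> powr \<alpha>) * \<bar>\<theta>\<bar> powr \<alpha>))"
    unfolding char_simple_stable_integral[OF f] by (intro tendsto_intros)
  show ?thesis by (rule LIMSEQ_unique[OF 1 2])
qed

text \<open>The same combination of the approximating sequences works. Together with
  \<open>char_stable_integral\<close> this yields joint characteristic functions of several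
  integrals.\<close>

lemma has_stable_integral_lincomb:
  assumes "has_stable_integral Q m M \<alpha> h Y" "has_stable_integral Q m M \<alpha> g Z"
  shows "has_stable_integral Q m M \<alpha> (\<lambda>z. a * h z + b * g z) (\<lambda>\<omega>. a * Y \<omega> + b * Z \<omega>)"
proof -
  obtain f where h: "in_L m \<alpha> h" and Y[measurable]: "Y \<in> borel_measurable Q" and f: "\<And>n. finite_simple m (f n)"
    and lim: "(\<lambda>n. \<integral>\<^sup>+z. ennreal (\<bar>f n z - h z\<bar> powr \<alpha>) \<partial>m) \<longlonglongrightarrow> 0"
    and P: "tendsto_in_probability Q (\<lambda>n. simple_stable_integral m M (f n)) Y"
    using assms(1) unfolding has_stable_integral_finite_simple by blast
  obtain f' where g: "in_L m \<alpha> g" and Z[measurable]: "Z \<in> borel_measurable Q" and f': "\<And>n. finite_simple m (f' n)"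
    and lim': "(\<lambda>n. \<integral>\<^sup>+z. ennreal (\<bar>f' n z - g z\<bar> powr \<alpha>) \<partial>m) \<longlonglongrightarrow> 0"
    and P': "tendsto_in_probability Q (\<lambda>n. simple_stable_integral m M (f' n)) Z"
    using assms(2) unfolding has_stable_integral_finite_simple by blast
  have [measurable]: "h \<in> borel_measurable m" "g \<in> borel_measurable m" using g h by (auto simp: in_L_def)
  have [measurable]: "f n \<in> borel_measurable m" "f' n \<in> borel_measurable m" for n
    using f[of n] f'[of n] by (auto simp: finite_simple_def borel_measurable_simple_function)
  let ?F = "\<lambda>n z. a * f n z + b * f' n z"
  let ?C = "\<lambda>x. ennreal (2 powr \<alpha> * \<bar>x\<bar> powr \<alpha>)"
  have "(\<integral>\<^sup>+z. ennreal (\<bar>?F n z - (a * h z + b * g z)\<bar> powr \<alpha>) \<partial>m)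
     \<le> ?C a * (\<integral>\<^sup>+z. ennreal (\<bar>f n z - h z\<bar> powr \<alpha>) \<partial>m) + ?C b * (\<integral>\<^sup>+z. ennreal (\<bar>f' n z - g z\<bar> powr \<alpha>) \<partial>m)" for n
  proof -
    have "(\<integral>\<^sup>+z. ennreal (\<bar>?F n z - (a * h z + b * g z)\<bar> powr \<alpha>) \<partial>m) \<le>
      (\<integral>\<^sup>+z. ?C a * ennreal (\<bar>f n z - h z\<bar> powr \<alpha>) + ?C b * ennreal (\<bar>f' n z - g z\<bar> powr \<alpha>) \<partial>m)"
    proof (rule nn_integral_mono)
      fix z
      have "\<bar>?F n z - (a * h z + b * g z)\<bar> powr \<alpha> = \<bar>a * (f n z - h z) + b * (f' n z - g z)\<bar> powr \<alpha>"
        by (simp add: algebra_simps)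
      also have "\<dots> \<le> 2 powr \<alpha> * (\<bar>a * (f n z - h z)\<bar> powr \<alpha> + \<bar>b * (f' n z - g z)\<bar> powr \<alpha>)"
        using \<alpha> by (intro powr_abs_add_le) auto
      also have "\<dots> = 2 powr \<alpha> * \<bar>a\<bar> powr \<alpha> * \<bar>f n z - h z\<bar> powr \<alpha> + 2 powr \<alpha> * \<bar>b\<bar> powr \<alpha> * \<bar>f' n z - g z\<bar> powr \<alpha>"
        by (simp add: abs_mult powr_mult distrib_left mult.assoc)
      finally show "ennreal (\<bar>?F n z - (a * h z + b * g z)\<bar> powr \<alpha>) \<le> ?C a * ennreal (\<bar>f n z - h z\<bar> powr \<alpha>) + ?C b * ennreal (\<bar>f' n z - g z\<bar> powr \<alpha>)"
        by (simp add: ennreal_leI flip: ennreal_mult ennreal_plus)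
    qed
    also have "\<dots> = ?C a * (\<integral>\<^sup>+z. ennreal (\<bar>f n z - h z\<bar> powr \<alpha>) \<partial>m) + ?C b * (\<integral>\<^sup>+z. ennreal (\<bar>f' n z - g z\<bar> powr \<alpha>) \<partial>m)"
      by (subst nn_integral_add) (auto simp: nn_integral_cmult)
    finally show ?thesis .
  qed
  note le = this
  have "(\<lambda>n. ?C a * (\<integral>\<^sup>+z. ennreal (\<bar>f n z - h z\<bar> powr \<alpha>) \<partial>m) + ?C b * (\<integral>\<^sup>+z. ennreal (\<bar>f' n z - g z\<bar> powr \<alpha>) \<partial>m)) \<longlonglongrightarrow> ?C a * 0 + ?C b * 0"
    by (intro tendsto_add ennreal_tendsto_cmult lim lim') auto
  then have L0: "(\<lambda>n. ?C a * (\<integral>\<^sup>+z. ennreal (\<bar>f n z - h z\<bar> powr \<alpha>) \<partial>m) + ?C b * (\<integral>\<^sup>+z. ennreal (\<bar>f' n z - g z\<bar> powr \<alpha>) \<partial>m)) \<longlonglongrightarrow> 0"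
    by simp
  have L: "(\<lambda>n. \<integral>\<^sup>+z. ennreal (\<bar>?F n z - (a * h z + b * g z)\<bar> powr \<alpha>) \<partial>m) \<longlonglongrightarrow> 0"
    by (rule tendsto_sandwich[of "\<lambda>_. 0", OF always_eventually always_eventually tendsto_const L0]) (use le in auto)
  show ?thesis unfolding has_stable_integral_finite_simple
  proof (intro conjI exI[of _ ?F] allI L finite_simple_lincomb f f')
    show "in_L m \<alpha> (\<lambda>z. a * h z + b * g z)" using \<alpha> by (intro in_L_lincomb g h) auto
    show "tendsto_in_probability Q (\<lambda>n. simple_stable_integral m M (?F n)) (\<lambda>\<omega>. a * Y \<omega> + b * Z \<omega>)"
      by (intro tendsto_in_probability_lincomb[where Y="\<lambda>n. simple_stable_integral m M (f n)" and
            Z="\<lambda>n. simple_stable_integral m M (f' n)"] Q Y Z simple_stable_integral_lincomb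
        simple_stable_integral_measurable finite_simple_lincomb P P' f f')
  qed measurable
qed

lemma has_stable_integral_zero: "has_stable_integral Q m M \<alpha> (\<lambda>z. 0) (\<lambda>\<omega>. 0)"
  unfolding has_stable_integral_finite_simple
  by (intro conjI exI[of _ "\<lambda>n z. 0"])
    (auto simp: in_L_def finite_simple_def tendsto_in_probability_def simple_stable_integral_def image_constant_conv)

lemma has_stable_integral_sum:
  assumes "finite J" "\<And>j. j \<in> J \<Longrightarrow> has_stable_integral Q m M \<alpha> (h j) (Y j)"
  shows "has_stable_integral Q m M \<alpha> (\<lambda>z. \<Sum>j\<in>J. \<theta> j * h j z) (\<lambda>\<omega>. \<Sum>j\<in>J. \<theta> j * Y j \<omega>)"
  using assms
proof (induction J rule: finite_induct)
  case empty
  then show ?case using has_stable_integral_zero by simp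
next
  case (insert j J)
  have "has_stable_integral Q m M \<alpha> (\<lambda>z. \<theta> j * h j z + 1 * (\<Sum>j\<in>J. \<theta> j * h j z)) (\<lambda>\<omega>. \<theta> j * Y j \<omega> + 1 * (\<Sum>j\<in>J. \<theta> j * Y j \<omega>))"
    using insert by (intro has_stable_integral_lincomb) auto
  then show ?case using insert by simp
qed

text \<open>In the role of an isometry: the integral is bounded from L^\<alpha>(m) to L^1(Q). First
  moments exist because \<alpha> > 1.\<close>

lemma simple_stable_integral_moment:
  "\<exists>K\<ge>0. \<forall>f. finite_simple m f \<longrightarrow>
     (\<integral>\<^sup>+\<omega>. ennreal \<bar>simple_stable_integral m M f \<omega>\<bar> \<partial>Q) \<le> ennreal (K * (LINT z|m. \<bar>f z\<bar> powr \<alpha>) powr (1 / \<alpha>))"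
proof -
  obtain K where K0: "K \<ge> 0" and K: "\<forall>A\<ge>0. \<forall>N::real measure. real_distribution N \<longrightarrow>
    (\<forall>\<theta>. char N \<theta> = complex_of_real (exp (- A * \<bar>\<theta>\<bar> powr \<alpha>))) \<longrightarrow>
    (\<integral>\<^sup>+x. ennreal \<bar>x\<bar> \<partial>N) \<le> ennreal (K * A powr (1 / \<alpha>))"
    using stable_abs_moment[OF \<alpha>] by blast
  show ?thesis
  proof (intro exI[of _ "K * c powr (1 / \<alpha>)"] conjI allI impI)
    fix f assume f: "finite_simple m f"
    have [measurable]: "simple_stable_integral m M f \<in> borel_measurable Q"
      by (rule simple_stable_integral_measurable[OF f])
    have N: "0 \<le> (LINT z|m. \<bar>f z\<bar> powr \<alpha>)" by (intro integral_nonneg_AE) auto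
    have "(\<integral>\<^sup>+\<omega>. ennreal \<bar>simple_stable_integral m M f \<omega>\<bar> \<partial>Q) = (\<integral>\<^sup>+x. ennreal \<bar>x\<bar> \<partial>distr Q borel (simple_stable_integral m M f))"
      by (subst nn_integral_distr) auto
    also have "\<dots> \<le> ennreal (K * (c * (LINT z|m. \<bar>f z\<bar> powr \<alpha>)) powr (1 / \<alpha>))"
      using c N char_simple_stable_integral[OF f] by (intro K[rule_format] Q.real_distribution_distr) auto
    also have "\<dots> = ennreal (K * c powr (1 / \<alpha>) * (LINT z|m. \<bar>f z\<bar> powr \<alpha>) powr (1 / \<alpha>))"
      using c N by (simp add: powr_mult mult.assoc)
    finally show "(\<integral>\<^sup>+\<omega>. ennreal \<bar>simple_stable_integral m M f \<omega>\<bar> \<partial>Q) \<le> ennreal (K * c powr (1 / \<alpha>) * (LINT z|m. \<bar>f z\<bar> powr \<alpha>) powr (1 / \<alpha>))" .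
  qed (use K0 in auto)
qed

text \<open>The integrals of simple approximants are Cauchy in L^1(Q) by the moment bound, so a
  subsequence converges almost surely; along it the approximants still tend to
  \<open>h\<close>.\<close>

lemma has_stable_integral_exists:
  assumes h: "in_L m \<alpha> h"
  shows "\<exists>Y. has_stable_integral Q m M \<alpha> h Y"
proof -
  obtain f where f: "\<And>n. finite_simple m (f n)" and lim: "(\<lambda>n. \<integral>\<^sup>+z. ennreal (\<bar>f n z - h z\<bar> powr \<alpha>) \<partial>m) \<longlonglongrightarrow> 0"
    by (rule in_L_approx_finite_simple[OF h]) (use \<alpha> in auto)
  obtain K where K0: "K \<ge> 0" and K: "\<And>f. finite_simple m f \<Longrightarrow>
     (\<integral>\<^sup>+\<omega>. ennreal \<bar>simple_stable_integral m M f \<omega>\<bar> \<partial>Q) \<le> ennreal (K * (LINT z|m. \<bar>f z\<bar> powr \<alpha>) powr (1 / \<alpha>))"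
    using simple_stable_integral_moment by blast
  define S where "S = (\<lambda>n. simple_stable_integral m M (f n))"
  have S[measurable]: "S n \<in> borel_measurable Q" for n unfolding S_def by (rule simple_stable_integral_measurable[OF f])
  have Si: "integrable Q (S n)" for n
  proof (rule integrableI_bounded)
    show "(\<integral>\<^sup>+\<omega>. ennreal (norm (S n \<omega>)) \<partial>Q) < \<infinity>" using K[OF f[of n]] unfolding S_def
      by (auto simp: less_top[symmetric] top_unique)
  qed simp
  define d where "d = (\<lambda>n. LINT z|m. \<bar>f n z - h z\<bar> powr \<alpha>)"
  have D: "integrable m (\<lambda>z. \<bar>f n z - h z\<bar> powr \<alpha>)" for n
    using in_L_lincomb[OF finite_simple_in_L[OF f[of n], of \<alpha>] h, of 1 "-1"] \<alpha> by (auto simp: in_L_def)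
  have d0: "0 \<le> d n" for n unfolding d_def by (intro integral_nonneg_AE) auto
  have "ennreal (d n) = (\<integral>\<^sup>+z. ennreal (\<bar>f n z - h z\<bar> powr \<alpha>) \<partial>m)" for n
    unfolding d_def by (rule nn_integral_eq_integral[symmetric, OF D]) auto
  then have d: "d \<longlonglongrightarrow> 0" using lim d0 by (simp add: ennreal_tendsto_0_iff[symmetric])
  have diff: "(LINT \<omega>|Q. norm (S i \<omega> - S j \<omega>)) \<le> K * (2 powr \<alpha> * (d i + d j)) powr (1 / \<alpha>)" for i j
  proof -
    have fs: "finite_simple m (\<lambda>z. 1 * f i z + (-1) * f j z)" by (intro finite_simple_lincomb f)
    have eq: "AE \<omega> in Q. simple_stable_integral m M (\<lambda>z. 1 * f i z + (-1) * f j z) \<omega> = S i \<omega> - S j \<omega>"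
      using simple_stable_integral_lincomb[OF f[of i] f[of j], of 1 "-1"] by (simp add: S_def)
    have nle: "(LINT z|m. \<bar>1 * f i z + (-1) * f j z\<bar> powr \<alpha>) \<le> 2 powr \<alpha> * (d i + d j)"
    proof -
      have "(LINT z|m. \<bar>1 * f i z + (-1) * f j z\<bar> powr \<alpha>) \<le> (LINT z|m. 2 powr \<alpha> * (\<bar>f i z - h z\<bar> powr \<alpha> + \<bar>f j z - h z\<bar> powr \<alpha>))"
      proof (rule integral_mono)
        show "\<bar>1 * f i z + (-1) * f j z\<bar> powr \<alpha> \<le> 2 powr \<alpha> * (\<bar>f i z - h z\<bar> powr \<alpha> + \<bar>f j z - h z\<bar> powr \<alpha>)" for z
          using powr_abs_add_le[of \<alpha> "f i z - h z" "h z - f j z"] \<alpha> by (simp add: abs_minus_commute)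
      qed (use D finite_simple_in_L[OF fs, of \<alpha>] in \<open>auto simp: in_L_def\<close>)
      also have "\<dots> = 2 powr \<alpha> * (d i + d j)" unfolding d_def using D by simp
      finally show ?thesis .
    qed
    have "ennreal (LINT \<omega>|Q. norm (S i \<omega> - S j \<omega>)) = (\<integral>\<^sup>+\<omega>. ennreal \<bar>S i \<omega> - S j \<omega>\<bar> \<partial>Q)"
      using Si by (subst nn_integral_eq_integral) auto
    also have "\<dots> = (\<integral>\<^sup>+\<omega>. ennreal \<bar>simple_stable_integral m M (\<lambda>z. 1 * f i z + (-1) * f j z) \<omega>\<bar> \<partial>Q)"
      using eq by (intro nn_integral_cong_AE) auto
    also have "\<dots> \<le> ennreal (K * (LINT z|m. \<bar>1 * f i z + (-1) * f j z\<bar> powr \<alpha>) powr (1 / \<alpha>))" by (rule K[OF fs])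
    also have "\<dots> \<le> ennreal (K * (2 powr \<alpha> * (d i + d j)) powr (1 / \<alpha>))"
      using nle K0 \<alpha> by (intro ennreal_leI mult_left_mono powr_mono2) (auto intro!: integral_nonneg_AE)
    finally show ?thesis using K0 by (subst (asm) ennreal_le_iff) auto
  qed
  have Cau: "\<exists>N. \<forall>i\<ge>N. \<forall>j\<ge>N. (LINT x|Q. norm (S i x - S j x)) < e" if e: "e > 0" for e
  proof -
    \<comment> \<open>Chosen so that K (2^\<alpha> (r + r))^(1/\<alpha>) equals K e/(K + 1), which
      is below e.\<close>
    define r where "r = (e / (K + 1)) powr \<alpha> / (2 powr \<alpha> * 2)"
    have r: "r > 0" using e K0 by (simp add: r_def)
    obtain N where N: "\<And>n. n \<ge> N \<Longrightarrow> d n < r"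
      using order_tendstoD(2)[OF d r] unfolding eventually_sequentially by blast
    show ?thesis
    proof (intro exI[of _ N] allI impI)
      fix i j assume ij: "N \<le> i" "N \<le> j"
      have "2 powr \<alpha> * (d i + d j) \<le> 2 powr \<alpha> * (r + r)"
        using N[OF ij(1)] N[OF ij(2)] by (intro mult_left_mono add_mono) auto
      also have "\<dots> = (e / (K + 1)) powr \<alpha>" by (simp add: r_def)
      finally have "(2 powr \<alpha> * (d i + d j)) powr (1 / \<alpha>) \<le> ((e / (K + 1)) powr \<alpha>) powr (1 / \<alpha>)"
        using \<alpha> d0[of i] d0[of j] by (intro powr_mono2) auto
      also have "\<dots> = e / (K + 1)" using \<alpha> e K0 by (simp add: powr_powr)
      finally have "K * (2 powr \<alpha> * (d i + d j)) powr (1 / \<alpha>) \<le> K * (e / (K + 1))"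
        using K0 by (intro mult_left_mono) auto
      also have "\<dots> < e" using e K0 by (simp add: field_simps)
      finally show "(LINT x|Q. norm (S i x - S j x)) < e" using diff[of i j] by simp
    qed
  qed
  obtain r where r: "strict_mono r" and C: "AE x in Q. Cauchy (\<lambda>i. S (r i) x)"
    by (rule cauchy_L1_AE_cauchy_subseq[OF Si Cau])
  define Y where "Y = (\<lambda>\<omega>. lim (\<lambda>i. S (r i) \<omega>))"
  have [measurable]: "Y \<in> borel_measurable Q" unfolding Y_def by measurable
  have "AE \<omega> in Q. (\<lambda>i. S (r i) \<omega>) \<longlonglongrightarrow> Y \<omega>"
    using C by eventually_elim (auto simp: Y_def Cauchy_convergent_iff convergent_LIMSEQ_iff)
  then have P: "tendsto_in_probability Q (\<lambda>i. S (r i)) Y"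
    by (intro AE_tendsto_in_probability Q) auto
  show ?thesis unfolding has_stable_integral_finite_simple
    using h P f LIMSEQ_subseq_LIMSEQ[OF lim r]
    by (intro exI[of _ Y] conjI exI[of _ "\<lambda>i. f (r i)"]) (auto simp: S_def o_def)
qed

end

section \<open>Stable Levy processes and Riemann sums along their paths\<close>

lemma (in prob_space) integral_eq_of_distr_PiM_eq:
  fixes G :: "('i \<Rightarrow> real) \<Rightarrow> complex"
  assumes [measurable]: "G \<in> borel_measurable (\<Pi>\<^sub>M i\<in>T. borel)"
    and V: "(\<lambda>\<omega>. \<lambda>i\<in>T. V i \<omega>) \<in> measurable M (\<Pi>\<^sub>M i\<in>T. borel)"
    and W: "(\<lambda>\<omega>. \<lambda>i\<in>T. W i \<omega>) \<in> measurable N (\<Pi>\<^sub>M i\<in>T. borel)"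
    and eq: "distr M (\<Pi>\<^sub>M i\<in>T. borel) (\<lambda>\<omega>. \<lambda>i\<in>T. V i \<omega>) = distr N (\<Pi>\<^sub>M i\<in>T. borel) (\<lambda>\<omega>. \<lambda>i\<in>T. W i \<omega>)"
  shows "(CLINT \<omega>|M. G (\<lambda>i\<in>T. V i \<omega>)) = (CLINT \<omega>|N. G (\<lambda>i\<in>T. W i \<omega>))"
proof -
  have "(CLINT \<omega>|M. G (\<lambda>i\<in>T. V i \<omega>)) = (CLINT x|distr M (\<Pi>\<^sub>M i\<in>T. borel) (\<lambda>\<omega>. \<lambda>i\<in>T. V i \<omega>). G x)"
    by (subst integral_distr[OF V]) auto
  also have "\<dots> = (CLINT \<omega>|N. G (\<lambda>i\<in>T. W i \<omega>))"
    unfolding eq by (subst integral_distr[OF W]) auto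
  finally show ?thesis .
qed

section \<open>Uniqueness of the finite-dimensional distributions\<close>

text \<open>The distributional half of the notion, with the scale \<sigma> exposed, because
  processes on different spaces are compared and must share it. Regularity of paths is kept apart,
  being a statement about single paths.\<close>

definition stable_levy :: "'a measure \<Rightarrow> real \<Rightarrow> real \<Rightarrow> (real \<Rightarrow> 'a \<Rightarrow> real) \<Rightarrow> bool" where
  "stable_levy P \<sigma> \<beta> X \<longleftrightarrow>
     prob_space P \<and> (\<forall>t\<ge>0. X t \<in> borel_measurable P) \<and> (AE \<omega> in P. X 0 \<omega> = 0) \<and>
     (\<forall>(n::nat) \<tau>. mono \<tau> \<and> \<tau> 0 \<ge> 0 \<longrightarrow>
        prob_space.indep_vars P (\<lambda>_. borel) (\<lambda>i \<omega>. X (\<tau> (Suc i)) \<omega> - X (\<tau> i) \<omega>) {..<n}) \<and>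
     (\<forall>s\<ge>0. \<forall>t\<ge>0. distr P borel (\<lambda>\<omega>. X (s + t) \<omega> - X s \<omega>) = distr P borel (X t)) \<and>
     (\<forall>t\<ge>0. \<forall>\<theta>. char (distr P borel (X t)) \<theta> = complex_of_real (exp (- \<sigma> * t * \<bar>\<theta>\<bar> powr \<beta>)))"

lemma stable_levyD:
  assumes "stable_levy P \<sigma> \<beta> X"
  shows "prob_space P" "\<And>t. 0 \<le> t \<Longrightarrow> X t \<in> borel_measurable P" "AE \<omega> in P. X 0 \<omega> = 0"
    "\<And>n \<tau>. mono \<tau> \<Longrightarrow> 0 \<le> \<tau> 0 \<Longrightarrow>
        prob_space.indep_vars P (\<lambda>_. borel) (\<lambda>i \<omega>. X (\<tau> (Suc i)) \<omega> - X (\<tau> i) \<omega>) {..<n::nat}"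
    "\<And>s t. 0 \<le> s \<Longrightarrow> 0 \<le> t \<Longrightarrow> distr P borel (\<lambda>\<omega>. X (s + t) \<omega> - X s \<omega>) = distr P borel (X t)"
    "\<And>t \<theta>. 0 \<le> t \<Longrightarrow> char (distr P borel (X t)) \<theta> = complex_of_real (exp (- \<sigma> * t * \<bar>\<theta>\<bar> powr \<beta>))"
  using assms unfolding stable_levy_def by auto

text \<open>Independence makes the joint law a product, and stationarity reduces each factor to a
  law with known characteristic function.\<close>

lemma stable_levy_increments_distr_eq:
  fixes \<tau> :: "nat \<Rightarrow> real"
  assumes X: "stable_levy P \<sigma> \<beta> X" and X': "stable_levy P' \<sigma> \<beta> X'"
    and \<tau>: "mono \<tau>" "0 \<le> \<tau> 0" and n: "0 < n"
  shows "distr P (\<Pi>\<^sub>M i\<in>{..<n}. borel) (\<lambda>\<omega>. \<lambda>i\<in>{..<n}. X (\<tau> (Suc i)) \<omega> - X (\<tau> i) \<omega>) =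
         distr P' (\<Pi>\<^sub>M i\<in>{..<n}. borel) (\<lambda>\<omega>. \<lambda>i\<in>{..<n}. X' (\<tau> (Suc i)) \<omega> - X' (\<tau> i) \<omega>)"
proof -
  have \<tau>0: "0 \<le> \<tau> i" "\<tau> i \<le> \<tau> (Suc i)" for i
    using \<tau> monoD[OF \<tau>(1), of 0 i] monoD[OF \<tau>(1), of i "Suc i"] by auto
  have "distr P borel (\<lambda>\<omega>. X (\<tau> (Suc i)) \<omega> - X (\<tau> i) \<omega>) = distr P' borel (\<lambda>\<omega>. X' (\<tau> (Suc i)) \<omega> - X' (\<tau> i) \<omega>)" for i
  proof -
    define t where "t = \<tau> (Suc i) - \<tau> i"
    have t: "t \<ge> 0" "\<tau> (Suc i) = \<tau> i + t" using \<tau>0 by (auto simp: t_def)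
    interpret P: prob_space P by (rule stable_levyD[OF X])
    interpret P': prob_space P' by (rule stable_levyD[OF X'])
    have "distr P borel (X t) = distr P' borel (X' t)"
      using t by (intro Levy_uniqueness P.real_distribution_distr P'.real_distribution_distr ext)
        (auto simp: stable_levyD[OF X] stable_levyD[OF X'])
    then show ?thesis
      unfolding t(2) using stable_levyD(5)[OF X \<tau>0(1)[of i] t(1)] stable_levyD(5)[OF X' \<tau>0(1)[of i] t(1)] by simp
  qed
  note d = this
  have "distr P (\<Pi>\<^sub>M i\<in>{..<n}. borel) (\<lambda>\<omega>. \<lambda>i\<in>{..<n}. X (\<tau> (Suc i)) \<omega> - X (\<tau> i) \<omega>) =
      (\<Pi>\<^sub>M i\<in>{..<n}. distr P borel (\<lambda>\<omega>. X (\<tau> (Suc i)) \<omega> - X (\<tau> i) \<omega>))"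
    using n \<tau> \<tau>0 prob_space.indep_vars_iff_distr_eq_PiM'[OF stable_levyD(1)[OF X], where I="{..<n}" and M'="\<lambda>_. borel" and X="\<lambda>i \<omega>. X (\<tau> (Suc i)) \<omega> - X (\<tau> i) \<omega>"]
      stable_levyD(4)[OF X \<tau>, of n] stable_levyD(2)[OF X]
    by (auto simp: borel_measurable_diff)
  moreover have "distr P' (\<Pi>\<^sub>M i\<in>{..<n}. borel) (\<lambda>\<omega>. \<lambda>i\<in>{..<n}. X' (\<tau> (Suc i)) \<omega> - X' (\<tau> i) \<omega>) =
      (\<Pi>\<^sub>M i\<in>{..<n}. distr P' borel (\<lambda>\<omega>. X' (\<tau> (Suc i)) \<omega> - X' (\<tau> i) \<omega>))"
    using n \<tau> \<tau>0 prob_space.indep_vars_iff_distr_eq_PiM'[OF stable_levyD(1)[OF X'], where I="{..<n}" and M'="\<lambda>_. borel" and X="\<lambda>i \<omega>. X' (\<tau> (Suc i)) \<omega> - X' (\<tau> i) \<omega>"]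
      stable_levyD(4)[OF X' \<tau>, of n] stable_levyD(2)[OF X']
    by (auto simp: borel_measurable_diff)
  ultimately show ?thesis by (simp add: d)
qed

text \<open>Brings a finite set of times into the form of a monotone grid, on which independence of
  increments is formulated. The grid starts at 0, so that values become sums of increments.\<close>

lemma finite_nonneg_subset_mono_range:
  fixes T :: "real set"
  assumes "finite T" "T \<subseteq> {0..}"
  obtains \<tau> :: "nat \<Rightarrow> real" and n where "mono \<tau>" "\<tau> 0 = 0" "0 < n" "T \<subseteq> \<tau> ` {..n}"
proof -
  define l where "l = sorted_list_of_set T"
  have l: "sorted l" "set l = T" using assms by (auto simp: l_def)
  \<comment> \<open>Index 0 carries the time 0, index i the i-th smallest element, and capping the
    index repeats the last one for ever.\<close>
  define \<tau> where "\<tau> = (\<lambda>i::nat. if i = 0 \<or> l = [] then 0 else l ! min (i - 1) (length l - 1))"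
  have pos: "0 \<le> \<tau> i" for i
  proof (cases "i = 0 \<or> l = []")
    case False
    then have "min (i - 1) (length l - 1) < length l" by (cases l) auto
    then have "l ! min (i - 1) (length l - 1) \<in> set l" by (rule nth_mem)
    then show ?thesis using l assms(2) False by (auto simp: \<tau>_def)
  qed (auto simp: \<tau>_def)
  have "mono \<tau>"
  proof (rule monoI)
    fix i j :: nat assume ij: "i \<le> j"
    show "\<tau> i \<le> \<tau> j"
    proof (cases "i = 0 \<or> l = []")
      case True then show ?thesis using pos[of j] by (auto simp: \<tau>_def)
    next
      case False
      then have "min (j - 1) (length l - 1) < length l" by (cases l) auto
      then have "l ! min (i - 1) (length l - 1) \<le> l ! min (j - 1) (length l - 1)"
        using ij l(1) by (intro sorted_nth_mono) auto
      then show ?thesis using False ij by (auto simp: \<tau>_def)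
    qed
  qed
  moreover have "T \<subseteq> \<tau> ` {..length l + 1}"
  proof
    fix x assume "x \<in> T"
    then obtain i where i: "i < length l" "x = l ! i" using l by (metis in_set_conv_nth)
    then have "\<tau> (Suc i) = x" by (auto simp: \<tau>_def min_def)
    then show "x \<in> \<tau> ` {..length l + 1}" using i by (intro image_eqI[of _ _ "Suc i"]) auto
  qed
  ultimately show ?thesis using that[of \<tau> "length l + 1"] by (auto simp: \<tau>_def)
qed

text \<open>As X_0 = 0 almost surely, every value is a partial sum of increments; one map \<phi>
  expresses this for both processes, and the increments have equal laws.\<close>

lemma stable_levy_fdd_eq:
  assumes X: "stable_levy P \<sigma> \<beta> X" and X': "stable_levy P' \<sigma> \<beta> X'"
    and T: "finite T" "T \<subseteq> {0..}"
  shows "distr P (\<Pi>\<^sub>M t\<in>T. borel) (\<lambda>\<omega>. \<lambda>t\<in>T. X t \<omega>) = distr P' (\<Pi>\<^sub>M t\<in>T. borel) (\<lambda>\<omega>. \<lambda>t\<in>T. X' t \<omega>)"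
proof -
  obtain \<tau> :: "nat \<Rightarrow> real" and n where \<tau>: "mono \<tau>" "\<tau> 0 = 0" and n: "0 < n" and sub: "T \<subseteq> \<tau> ` {..n}"
    using finite_nonneg_subset_mono_range[OF T] .
  have \<tau>0: "0 \<le> \<tau> i" for i using \<tau> monoD[OF \<tau>(1), of 0 i] by auto
  have "\<forall>t\<in>T. \<exists>k. k \<le> n \<and> \<tau> k = t" using sub by auto
  from bchoice[OF this] obtain k where k: "\<And>t. t \<in> T \<Longrightarrow> k t \<le> n \<and> \<tau> (k t) = t" by blast
  define \<phi> where "\<phi> = (\<lambda>x. \<lambda>t\<in>T. \<Sum>i<k t. x i :: real)"
  have \<phi>: "\<phi> \<in> measurable (\<Pi>\<^sub>M i\<in>{..<n}. borel) (\<Pi>\<^sub>M t\<in>T. borel)"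
    unfolding \<phi>_def by (intro measurable_restrict borel_measurable_sum measurable_component_singleton) (use k in force)
  have *: "distr P (\<Pi>\<^sub>M t\<in>T. borel) (\<lambda>\<omega>. \<lambda>t\<in>T. X t \<omega>) =
      distr (distr P (\<Pi>\<^sub>M i\<in>{..<n}. borel) (\<lambda>\<omega>. \<lambda>i\<in>{..<n}. X (\<tau> (Suc i)) \<omega> - X (\<tau> i) \<omega>)) (\<Pi>\<^sub>M t\<in>T. borel) \<phi>"
    if X: "stable_levy P \<sigma> \<beta> X" for P :: "'x measure" and X
  proof -
    have inc: "(\<lambda>\<omega>. \<lambda>i\<in>{..<n}. X (\<tau> (Suc i)) \<omega> - X (\<tau> i) \<omega>) \<in> measurable P (\<Pi>\<^sub>M i\<in>{..<n}. borel)"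
      using \<tau>0 stable_levyD(2)[OF X] by (intro measurable_restrict borel_measurable_diff) auto
    have "distr P (\<Pi>\<^sub>M t\<in>T. borel) (\<lambda>\<omega>. \<lambda>t\<in>T. X t \<omega>) =
      distr P (\<Pi>\<^sub>M t\<in>T. borel) (\<phi> \<circ> (\<lambda>\<omega>. \<lambda>i\<in>{..<n}. X (\<tau> (Suc i)) \<omega> - X (\<tau> i) \<omega>))"
    proof (rule distr_cong_AE[OF refl refl])
      show "(\<lambda>\<omega>. \<lambda>t\<in>T. X t \<omega>) \<in> measurable P (\<Pi>\<^sub>M t\<in>T. borel)"
        using T stable_levyD(2)[OF X] by (intro measurable_restrict) auto
      show "\<phi> \<circ> (\<lambda>\<omega>. \<lambda>i\<in>{..<n}. X (\<tau> (Suc i)) \<omega> - X (\<tau> i) \<omega>) \<in> measurable P (\<Pi>\<^sub>M t\<in>T. borel)"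
        by (rule measurable_comp[OF inc \<phi>])
      show "AE \<omega> in P. (\<lambda>t\<in>T. X t \<omega>) = (\<phi> \<circ> (\<lambda>\<omega>. \<lambda>i\<in>{..<n}. X (\<tau> (Suc i)) \<omega> - X (\<tau> i) \<omega>)) \<omega>"
        using stable_levyD(3)[OF X]
      proof eventually_elim
        case (elim \<omega>)
        have "X t \<omega> = (\<Sum>i<k t. if i < n then X (\<tau> (Suc i)) \<omega> - X (\<tau> i) \<omega> else undefined)" if t: "t \<in> T" for t
        proof -
          have "(\<Sum>i<k t. if i < n then X (\<tau> (Suc i)) \<omega> - X (\<tau> i) \<omega> else undefined) = (\<Sum>i<k t. X (\<tau> (Suc i)) \<omega> - X (\<tau> i) \<omega>)"
            using k[OF t] by (intro sum.cong) auto
          also have "\<dots> = X (\<tau> (k t)) \<omega> - X (\<tau> 0) \<omega>" by (rule sum_lessThan_telescope)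
          finally show ?thesis using k[OF t] elim \<tau>(2) by simp
        qed
        then show ?case by (auto simp: \<phi>_def restrict_def fun_eq_iff)
      qed
    qed
    also have "\<dots> = distr (distr P (\<Pi>\<^sub>M i\<in>{..<n}. borel) (\<lambda>\<omega>. \<lambda>i\<in>{..<n}. X (\<tau> (Suc i)) \<omega> - X (\<tau> i) \<omega>)) (\<Pi>\<^sub>M t\<in>T. borel) \<phi>"
      by (rule distr_distr[OF \<phi> inc, symmetric])
    finally show ?thesis .
  qed
  show ?thesis
    unfolding *[OF X] *[OF X'] using stable_levy_increments_distr_eq[OF X X' \<tau>(1) _ n] \<tau>(2) by simp
qed

section \<open>Right-continuous paths and their Riemann sums\<close>

definition right_continuous_path :: "(real \<Rightarrow> real) \<Rightarrow> bool" where
  "right_continuous_path x \<longleftrightarrow> (\<forall>t\<ge>0. (x \<longlongrightarrow> x t) (at_right t))"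

lemma symmetric_stable_levy_processE:
  assumes "symmetric_stable_levy_process P \<beta> X"
  obtains \<sigma> where "0 < \<sigma>" "stable_levy P \<sigma> \<beta> X" "AE \<omega> in P. right_continuous_path (\<lambda>s. X s \<omega>)"
proof -
  have "AE \<omega> in P. right_continuous_path (\<lambda>s. X s \<omega>)"
    using assms unfolding symmetric_stable_levy_process_def levy_process_def right_continuous_path_def continuous_within
    by auto
  then show ?thesis
    using assms that unfolding symmetric_stable_levy_process_def levy_process_def stable_levy_def by blast
qed

text \<open>Each cell carries the value at its right endpoint, a time strictly after
  \<open>s\<close>, so that right-continuity alone yields pointwise convergence.\<close>

definition step_path :: "nat \<Rightarrow> real \<Rightarrow> (real \<Rightarrow> real) \<Rightarrow> real \<Rightarrow> real" where
  "step_path N t x s = (\<Sum>k<N. indicator {t * real k / real N..<t * real (Suc k) / real N} s * x (t * real (Suc k) / real N))"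

lemma step_path_measurable [measurable]: "step_path N t x \<in> borel_measurable borel"
  unfolding step_path_def by measurable

lemma step_path_eq:
  assumes t: "0 < t" and N: "0 < N" and s: "0 \<le> s" "s < t"
  shows "\<exists>u>s. u \<le> s + t / real N \<and> step_path N t x s = x u"
proof -
  define K where "K = nat \<lfloor>s * N / t\<rfloor>"
  have K: "real K \<le> s * N / t" "s * N / t < real K + 1"
    using t s N by (auto simp: K_def)
  have "s * N / t < N" using t s N by (simp add: field_simps)
  then have KN: "K < N" using K(1) by linarith
  have b: "t * real K / real N \<le> s" "s < t * real (Suc K) / real N"
    using K t N by (auto simp: field_simps)
  have uniq: "k = K" if "k < N" "s \<in> {t * real k / real N..<t * real (Suc k) / real N}" for k
  proof -
    have "real k \<le> s * N / t" "s * N / t < real k + 1" using that t N by (auto simp: field_simps)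
    then show ?thesis using K by linarith
  qed
  have "step_path N t x s = (\<Sum>k<N. if k = K then x (t * real (Suc K) / real N) else 0)"
    unfolding step_path_def
  proof (intro sum.cong refl)
    fix k assume k: "k \<in> {..<N}"
    show "indicator {t * real k / real N..<t * real (Suc k) / real N} s * x (t * real (Suc k) / real N) =
        (if k = K then x (t * real (Suc K) / real N) else 0)"
    proof (cases "k = K")
      case True
      then have "s \<in> {t * real k / real N..<t * real (Suc k) / real N}" using b by simp
      then show ?thesis using True by simp
    next
      case False
      then have "s \<notin> {t * real k / real N..<t * real (Suc k) / real N}" using uniq[of k] k by blast
      then show ?thesis using False by simp
    qed
  qed
  then have "step_path N t x s = x (t * real (Suc K) / real N)" using KN by simp
  moreover have "t * real (Suc K) / real N \<le> s + t / real N" using b(1) by (simp add: field_simps add_divide_distrib)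
  ultimately show ?thesis using b(2) by blast
qed

lemma step_path_eq_0: "\<not> (0 \<le> s \<and> s < t) \<Longrightarrow> 0 \<le> t \<Longrightarrow> step_path N t x s = 0"
proof -
  assume s: "\<not> (0 \<le> s \<and> s < t)" and t: "0 \<le> t"
  have "s \<notin> {t * real k / real N..<t * real (Suc k) / real N}" if "k < N" for k
  proof
    assume "s \<in> {t * real k / real N..<t * real (Suc k) / real N}"
    then have a: "t * real k / real N \<le> s" "s < t * real (Suc k) / real N" by auto
    have "0 \<le> t * real k / real N" using t by simp
    moreover have "t * real (Suc k) / real N \<le> t * 1"
      using t that by (simp only: times_divide_eq_right[symmetric]) (intro mult_left_mono, auto simp: field_simps)
    ultimately show False using a s by auto
  qed
  then show ?thesis unfolding step_path_def by (auto intro!: sum.neutral)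
qed

lemma step_path_tendsto:
  assumes x: "right_continuous_path x" and t: "0 < t"
  shows "(\<lambda>N. step_path (Suc N) t x s) \<longlonglongrightarrow> indicator {0..<t} s * x s"
proof (cases "0 \<le> s \<and> s < t")
  case True
  have "\<forall>N. \<exists>u>s. u \<le> s + t / real (Suc N) \<and> step_path (Suc N) t x s = x u"
    by (intro allI step_path_eq[OF t zero_less_Suc conjunct1[OF True] conjunct2[OF True]])
  from choice[OF this] obtain u where "\<forall>N. u N > s \<and> u N \<le> s + t / real (Suc N) \<and> step_path (Suc N) t x s = x (u N)" ..
  note u = this[rule_format]
  have "u \<longlonglongrightarrow> s"
  proof (rule tendsto_sandwich[of "\<lambda>_. s" _ _ "\<lambda>N. s + t / real (Suc N)"])
    show "(\<lambda>N. s + t / real (Suc N)) \<longlonglongrightarrow> s"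
      using tendsto_add[OF tendsto_const LIMSEQ_Suc[OF lim_const_over_n[of t]], of s] by simp
  qed (use u in \<open>auto intro!: always_eventually less_imp_le\<close>)
  then have "filterlim u (at_right s) sequentially"
    unfolding filterlim_at using u by (auto intro!: always_eventually)
  moreover have "(x \<longlongrightarrow> x s) (at_right s)" using x True by (auto simp: right_continuous_path_def)
  ultimately have "(\<lambda>N. x (u N)) \<longlonglongrightarrow> x s" by (rule filterlim_compose[rotated])
  then show ?thesis using u True by simp
next
  case False
  then show ?thesis using t step_path_eq_0[of s t] by (auto simp: indicator_def)
qed

text \<open>A pointwise limit of Borel step functions is Borel. The half-open window reaches up to t
  + 1 in order to contain the closed interval up to \<open>t\<close>.\<close>

lemma right_continuous_path_measurable:
  assumes x: "right_continuous_path x"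
  shows "(\<lambda>s. indicator {0..t} s * x s) \<in> borel_measurable borel"
proof -
  have "(\<lambda>s. indicator {0..<t + 1} s * x s) \<in> borel_measurable borel" if "0 \<le> t"
    by (rule borel_measurable_LIMSEQ_real[OF step_path_tendsto[OF x]]) (use that in auto)
  then have "(\<lambda>s. indicator {0..t} s * (indicator {0..<t + 1} s * x s)) \<in> borel_measurable borel" if "0 \<le> t"
    using that by measurable
  moreover have "(\<lambda>s. indicator {0..t} s * (indicator {0..<t + 1} s * x s)) = (\<lambda>s. indicator {0..t} s * x s)"
    by (auto simp: indicator_def)
  ultimately show ?thesis by (cases "0 \<le> t") auto
qed

lemma right_continuous_path_compose:
  assumes x: "right_continuous_path x" and f: "continuous_on UNIV f"
  shows "right_continuous_path (\<lambda>s. f (x s))"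
  unfolding right_continuous_path_def
proof (intro allI impI)
  fix t :: real assume "0 \<le> t"
  then show "((\<lambda>s. f (x s)) \<longlongrightarrow> f (x t)) (at_right t)"
    using x f by (intro isCont_tendsto_compose[of "x t" f]) (auto simp: right_continuous_path_def continuous_on_eq_continuous_at)
qed

text \<open>The Riemann sum is the integral of the step path, and the bound \<open>B\<close> on [0,
  t) dominates. For t = 0 both sides vanish.\<close>

lemma riemann_sum_tendsto:
  assumes x: "right_continuous_path x" and B: "\<And>s. \<bar>x s\<bar> \<le> B" and t: "0 \<le> t"
  shows "(\<lambda>N. t / real (Suc N) * (\<Sum>k\<le>N. x (t * real (Suc k) / real (Suc N)))) \<longlonglongrightarrow> (LINT s:{0..t}|lborel. x s)"
proof (cases "t = 0")
  case True
  have "(LINT s|lborel. indicator {0} s * x s) = 0"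
    by (rule integral_eq_zero_AE) (use AE_lborel_singleton[of 0] in auto)
  then show ?thesis using True by (simp add: set_lebesgue_integral_def)
next
  case False
  then have t: "0 < t" using t by simp
  have "(\<lambda>N. LINT s|lborel. step_path (Suc N) t x s) \<longlonglongrightarrow> (LINT s|lborel. indicator {0..<t} s * x s)"
  proof (rule integral_dominated_convergence[where w="\<lambda>s. indicator {0..<t} s * B"])
    show "(\<lambda>s. indicator {0..<t} s * x s) \<in> borel_measurable lborel"
      by (rule borel_measurable_LIMSEQ_real[OF step_path_tendsto[OF x t]]) simp
    show "AE s in lborel. norm (step_path (Suc N) t x s) \<le> indicator {0..<t} s * B" for N
    proof (rule AE_I2)
      fix s
      show "norm (step_path (Suc N) t x s) \<le> indicator {0..<t} s * B"
      proof (cases "0 \<le> s \<and> s < t")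
        case True
        then obtain u where "step_path (Suc N) t x s = x u" using step_path_eq[OF t, of "Suc N" s x] by auto
        then show ?thesis using True B by simp
      qed (use t step_path_eq_0[of s t] in auto)
    qed
    show "AE s in lborel. (\<lambda>N. step_path (Suc N) t x s) \<longlonglongrightarrow> indicator {0..<t} s * x s"
      using step_path_tendsto[OF x t] by auto
    show "integrable lborel (\<lambda>s. indicator {0..<t} s * B)"
      using t by (intro integrable_mult_left integrable_real_indicator) auto
  qed simp
  moreover have "(LINT s|lborel. step_path (Suc N) t x s) = t / real (Suc N) * (\<Sum>k\<le>N. x (t * real (Suc k) / real (Suc N)))" for N
  proof -
    define I where "I = (\<lambda>k. {t * real k / real (Suc N)..<t * real (Suc k) / real (Suc N)})"
    have "t * real (Suc k) / real (Suc N) - t * real k / real (Suc N) = t / real (Suc N)" for k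
      by (simp only: diff_divide_distrib[symmetric] right_diff_distrib[symmetric]) simp
    moreover have "t * real k / real (Suc N) \<le> t * real (Suc k) / real (Suc N)" for k using t by (intro divide_right_mono mult_left_mono) auto
    ultimately have m: "emeasure lborel (I k) = ennreal (t / real (Suc N))" for k
      by (simp add: I_def del: of_nat_Suc)
    have "(LINT s|lborel. step_path (Suc N) t x s) = (\<Sum>k<Suc N. LINT s|lborel. indicator (I k) s * x (t * real (Suc k) / real (Suc N)))"
    proof -
      have "integrable lborel (\<lambda>s. indicator (I k) s * x (t * real (Suc k) / real (Suc N)))" for k
        by (intro integrable_mult_left integrable_real_indicator) (simp_all only: m ennreal_less_top infinity_ennreal_def, simp add: I_def)
      then show ?thesis unfolding step_path_def I_def by (intro Bochner_Integration.integral_sum)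
    qed
    also have "\<dots> = (\<Sum>k<Suc N. measure lborel (I k) * x (t * real (Suc k) / real (Suc N)))"
      by (intro sum.cong refl) (simp add: Bochner_Integration.integral_indicator)
    also have "\<dots> = (\<Sum>k<Suc N. t / real (Suc N) * x (t * real (Suc k) / real (Suc N)))"
      using t by (simp only: measure_def m) simp
    finally show ?thesis by (simp only: sum_distrib_left lessThan_Suc_atMost)
  qed
  moreover have "(LINT s:{0..t}|lborel. x s) = (LINT s|lborel. indicator {0..<t} s * x s)"
    unfolding set_lebesgue_integral_def
    by (rule integral_discrete_difference[of "{t}"]) (auto simp: indicator_def)
  ultimately show ?thesis by simp
qed

section \<open>Occupation densities\<close>

text \<open>A weak form of the local time, for each fixed \<open>t\<close> and tested on bounded
  continuous functions. Riemann sums along the path reach exactly such test functions, and the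
  shifted and rescaled processes inherit the property with explicit densities.\<close>

definition occupation_density :: "'a measure \<Rightarrow> (real \<Rightarrow> 'a \<Rightarrow> real) \<Rightarrow> (real \<Rightarrow> real \<Rightarrow> 'a \<Rightarrow> real) \<Rightarrow> bool" where
  "occupation_density P X L \<longleftrightarrow>
     (\<forall>t\<ge>0. \<forall>x. L t x \<in> borel_measurable P) \<and>
     (\<forall>\<omega>\<in>space P. \<forall>t\<ge>0. continuous_on UNIV (\<lambda>x. L t x \<omega>)) \<and>
     (\<forall>t\<ge>0. AE \<omega> in P. (\<forall>x. 0 \<le> L t x \<omega>) \<and> integrable lborel (\<lambda>x. L t x \<omega>) \<and>
        (\<forall>f B. continuous_on UNIV f \<longrightarrow> (\<forall>v. \<bar>f v\<bar> \<le> B) \<longrightarrow>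
           (LINT u:{0..t}|lborel. f (X u \<omega>)) = (LINT v|lborel. f v * L t v \<omega>)))"

lemma occupation_densityD:
  assumes "occupation_density P X L" "0 \<le> t"
  shows "L t x \<in> borel_measurable P"
    "\<omega> \<in> space P \<Longrightarrow> continuous_on UNIV (\<lambda>x. L t x \<omega>)"
    "\<omega> \<in> space P \<Longrightarrow> (\<lambda>x. L t x \<omega>) \<in> borel_measurable borel"
    "AE \<omega> in P. (\<forall>x. 0 \<le> L t x \<omega>) \<and> integrable lborel (\<lambda>x. L t x \<omega>) \<and>
        (\<forall>f B. continuous_on UNIV f \<longrightarrow> (\<forall>v. \<bar>f v\<bar> \<le> B) \<longrightarrow>
           (LINT u:{0..t}|lborel. f (X u \<omega>)) = (LINT v|lborel. f v * L t v \<omega>))"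
  using assms unfolding occupation_density_def by (auto intro: borel_measurable_continuous_onI)

text \<open>The constant test function 1 measures the whole time interval.\<close>

lemma occupation_density_integral:
  assumes "occupation_density P X L" "0 \<le> t"
  shows "AE \<omega> in P. (\<integral>\<^sup>+x. ennreal (L t x \<omega>) \<partial>lborel) = ennreal t"
  using occupation_densityD(4)[OF assms]
proof eventually_elim
  case (elim \<omega>)
  have eq: "(LINT u:{0..t}|lborel. (\<lambda>_. 1::real) (X u \<omega>)) = (LINT v|lborel. (\<lambda>_. 1) v * L t v \<omega>)"
    by (rule elim[THEN conjunct2, THEN conjunct2, rule_format, of "\<lambda>_. 1" 1]) auto
  have "(\<integral>\<^sup>+x. ennreal (L t x \<omega>) \<partial>lborel) = ennreal (LINT v|lborel. L t v \<omega>)"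
    using elim by (intro nn_integral_eq_integral) auto
  also have "(LINT v|lborel. L t v \<omega>) = t" using eq assms(2) by (simp add: set_lebesgue_integral_def)
  finally show ?case .
qed

text \<open>Measurable in \<omega> and continuous in \<open>x\<close> implies jointly measurable:
  \<open>x\<close> is rounded down to the grid of mesh 1/(n + 1), where only countably many sections
  occur, and the mesh goes to 0.\<close>

lemma occupation_density_joint_measurable:
  assumes L: "occupation_density P X L" "0 \<le> t"
  shows "(\<lambda>z. L t (fst z) (snd z)) \<in> borel_measurable (borel \<Otimes>\<^sub>M P)"
proof (rule borel_measurable_LIMSEQ_real)
  let ?g = "\<lambda>n z. L t (real_of_int \<lfloor>real (Suc n) * fst z\<rfloor> / real (Suc n)) (snd z)"
  show "?g n \<in> borel_measurable (borel \<Otimes>\<^sub>M P)" for n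
  proof (rule measurable_compose_countable[where f="\<lambda>i z. L t (real_of_int i / real (Suc n)) (snd z)" and g="\<lambda>z. \<lfloor>real (Suc n) * fst z\<rfloor>"])
    show "(\<lambda>z. L t (real_of_int i / real (Suc n)) (snd z)) \<in> borel_measurable (borel \<Otimes>\<^sub>M P)" for i
      by (rule measurable_compose[OF measurable_snd occupation_densityD(1)[OF L]])
  qed measurable
  fix z :: "real \<times> 'a" assume "z \<in> space (borel \<Otimes>\<^sub>M P)"
  then have z: "snd z \<in> space P" by (auto simp: space_pair_measure)
  have "(\<lambda>n. real_of_int \<lfloor>real (Suc n) * fst z\<rfloor> / real (Suc n)) \<longlonglongrightarrow> fst z"
  proof (rule tendsto_sandwich[of "\<lambda>n. fst z - 1 / real (Suc n)" _ _ "\<lambda>n. fst z"])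
    show "(\<lambda>n. fst z - 1 / real (Suc n)) \<longlonglongrightarrow> fst z"
      using tendsto_diff[OF tendsto_const LIMSEQ_Suc[OF lim_const_over_n[of 1]], of "fst z"] by simp
    show "\<forall>\<^sub>F n in sequentially. fst z - 1 / real (Suc n) \<le> real_of_int \<lfloor>real (Suc n) * fst z\<rfloor> / real (Suc n)"
    proof (intro always_eventually allI)
      fix n
      have "(real (Suc n) * fst z - 1) / real (Suc n) \<le> real_of_int \<lfloor>real (Suc n) * fst z\<rfloor> / real (Suc n)"
        by (intro divide_right_mono) (linarith, simp)
      then show "fst z - 1 / real (Suc n) \<le> real_of_int \<lfloor>real (Suc n) * fst z\<rfloor> / real (Suc n)"
        by (simp add: diff_divide_distrib del: of_nat_Suc)
    qed
    show "\<forall>\<^sub>F n in sequentially. real_of_int \<lfloor>real (Suc n) * fst z\<rfloor> / real (Suc n) \<le> fst z"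
    proof (intro always_eventually allI)
      fix n
      have "real_of_int \<lfloor>real (Suc n) * fst z\<rfloor> / real (Suc n) \<le> (real (Suc n) * fst z) / real (Suc n)"
        by (intro divide_right_mono) (linarith, simp)
      then show "real_of_int \<lfloor>real (Suc n) * fst z\<rfloor> / real (Suc n) \<le> fst z" by (simp del: of_nat_Suc)
    qed
  qed simp
  then show "(\<lambda>n. ?g n z) \<longlonglongrightarrow> L t (fst z) (snd z)"
    using occupation_densityD(2)[OF L z]
    by (intro isCont_tendsto_compose[of "fst z" "\<lambda>x. L t x (snd z)"]) (auto simp: continuous_on_eq_continuous_at)
qed

text \<open>The formula for Borel sets says that the path carries Lebesgue measure on [0, t] to the
  measure with density L_t. Integrating a continuous function against both measures is the weak
  form.\<close>

lemma occupation_density_of_local_time: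
  assumes rc: "AE \<omega> in P. right_continuous_path (\<lambda>s. X s \<omega>)" and L: "jointly_continuous_local_time P X L"
  shows "occupation_density P X L"
  unfolding occupation_density_def
proof (intro conjI ballI allI impI)
  show "L t x \<in> borel_measurable P" if "0 \<le> t" for t x
    using L that by (auto simp: jointly_continuous_local_time_def)
  show cont: "continuous_on UNIV (\<lambda>x. L t x \<omega>)" if "\<omega> \<in> space P" "0 \<le> t" for \<omega> t
  proof -
    have "continuous_on ({0..} \<times> UNIV) (\<lambda>(t, x). L t x \<omega>)" using L that by (auto simp: jointly_continuous_local_time_def)
    then have "continuous_on UNIV ((\<lambda>(t, x). L t x \<omega>) \<circ> (\<lambda>x. (t, x)))"
      using that by (intro continuous_on_compose continuous_intros) (auto elim: continuous_on_subset)
    then show ?thesis by (simp add: o_def)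
  qed
  fix t :: real assume t: "0 \<le> t"
  have "AE \<omega> in P. \<forall>t\<ge>0. (\<forall>x. 0 \<le> L t x \<omega>) \<and>
        (\<forall>A\<in>sets borel. emeasure lborel {s \<in> {0..t}. X s \<omega> \<in> A} = (\<integral>\<^sup>+x\<in>A. ennreal (L t x \<omega>) \<partial>lborel))"
    using L by (auto simp: jointly_continuous_local_time_def)
  then show "AE \<omega> in P. (\<forall>x. 0 \<le> L t x \<omega>) \<and> integrable lborel (\<lambda>x. L t x \<omega>) \<and>
        (\<forall>f B. continuous_on UNIV f \<longrightarrow> (\<forall>v. \<bar>f v\<bar> \<le> B) \<longrightarrow>
           (LINT u:{0..t}|lborel. f (X u \<omega>)) = (LINT v|lborel. f v * L t v \<omega>))"
    using rc AE_space
  proof eventually_elim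
    case (elim \<omega>)
    let ?l = "\<lambda>x. L t x \<omega>"
    have l0: "\<And>x. 0 \<le> ?l x" and occ: "\<And>A. A \<in> sets borel \<Longrightarrow> emeasure lborel {s \<in> {0..t}. X s \<omega> \<in> A} = (\<integral>\<^sup>+x\<in>A. ennreal (?l x) \<partial>lborel)"
      using elim t by auto
    have [measurable]: "?l \<in> borel_measurable borel" using cont[OF elim(3) t] by (rule borel_measurable_continuous_onI)
    \<comment> \<open>The path cut off outside [0, t]: a Borel function by right-continuity, and
      equal to the path where it matters.\<close>
    define y where "y = (\<lambda>s. indicator {0..t} s * X s \<omega>)"
    have [measurable]: "y \<in> borel_measurable borel" unfolding y_def by (rule right_continuous_path_measurable[OF elim(2)])
    have yr: "y \<in> measurable (restrict_space lborel {0..t}) borel" by (rule measurable_restrict_space1) simp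
    have eq: "distr (restrict_space lborel {0..t}) borel y = density lborel (\<lambda>x. ennreal (?l x))"
    proof (rule measure_eqI)
      fix A assume "A \<in> sets (distr (restrict_space lborel {0..t}) borel y)"
      then have A[measurable]: "A \<in> sets borel" by simp
      have s: "y -` A \<inter> {0..t} = {s \<in> {0..t}. X s \<omega> \<in> A}" by (auto simp: y_def)
      have "emeasure (distr (restrict_space lborel {0..t}) borel y) A = emeasure lborel (y -` A \<inter> {0..t})"
        using yr A by (subst emeasure_distr) (auto simp: emeasure_restrict_space space_restrict_space)
      also have "\<dots> = emeasure (density lborel (\<lambda>x. ennreal (?l x))) A"
        unfolding s occ[OF A] by (simp add: emeasure_density)
      finally show "emeasure (distr (restrict_space lborel {0..t}) borel y) A = emeasure (density lborel (\<lambda>x. ennreal (?l x))) A" .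
    qed simp
    have "integrable lborel ?l"
    proof (rule integrableI_bounded)
      have "(\<integral>\<^sup>+x. ennreal (norm (?l x)) \<partial>lborel) = (\<integral>\<^sup>+x\<in>UNIV. ennreal (?l x) \<partial>lborel)" using l0 by simp
      also have "\<dots> = emeasure lborel {s \<in> {0..t}. X s \<omega> \<in> UNIV}" by (rule occ[symmetric]) simp
      also have "{s \<in> {0..t}. X s \<omega> \<in> UNIV} = {0..t}" by auto
      finally show "(\<integral>\<^sup>+x. ennreal (norm (?l x)) \<partial>lborel) < \<infinity>" using t by simp
    qed simp
    moreover have "(LINT u:{0..t}|lborel. f (X u \<omega>)) = (LINT v|lborel. f v * ?l v)" if f: "continuous_on UNIV f" for f :: "real \<Rightarrow> real"
    proof -
      have [measurable]: "f \<in> borel_measurable borel" using f by (rule borel_measurable_continuous_onI)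
      have "(LINT u:{0..t}|lborel. f (X u \<omega>)) = (LINT u:{0..t}|lborel. f (y u))"
        unfolding set_lebesgue_integral_def by (intro Bochner_Integration.integral_cong) (auto simp: indicator_def y_def)
      also have "\<dots> = (LINT u|restrict_space lborel {0..t}. f (y u))"
        by (subst integral_restrict_space) (auto simp: set_lebesgue_integral_def)
      also have "\<dots> = (LINT v|distr (restrict_space lborel {0..t}) borel y. f v)"
        by (subst integral_distr[OF yr]) auto
      also have "\<dots> = (LINT v|lborel. f v * ?l v)"
        unfolding eq using l0 by (subst integral_density) (auto simp: mult.commute)
      finally show ?thesis .
    qed
    ultimately show ?case using l0 by auto
  qed
qed

section \<open>The Gaussian mollifier\<close>

text \<open>The centred normal density with standard deviation 1/(n + 1). A Gaussian is chosen
  because its Fourier transform is explicit and positive.\<close>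

definition gauss_kernel :: "nat \<Rightarrow> real \<Rightarrow> real" where
  "gauss_kernel n u = real (Suc n) * std_normal_density (real (Suc n) * u)"

lemma gauss_kernel_nonneg: "0 \<le> gauss_kernel n u"
  by (simp add: gauss_kernel_def)

lemma gauss_kernel_measurable [measurable]: "gauss_kernel n \<in> borel_measurable borel"
  unfolding gauss_kernel_def by measurable

lemma gauss_kernel_continuous: "continuous_on UNIV (gauss_kernel n)"
  unfolding gauss_kernel_def std_normal_density_def by (intro continuous_intros) auto

text \<open>All three bounds rest on exp(y^2/2) \<ge> 1 + y^2/2, which dominates 1, |y| and
  y^2/2.\<close>

lemma std_normal_density_le: "std_normal_density y \<le> 1" "std_normal_density y * \<bar>y\<bar> \<le> 1" "std_normal_density y * y\<^sup>2 \<le> 2"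
proof -
  have c: "1 / sqrt (2 * pi) \<le> 1" using pi_gt3 by (auto simp: field_simps)
  have e: "1 + y\<^sup>2 / 2 \<le> exp (y\<^sup>2 / 2)" by (rule exp_ge_add_one_self)
  have *: "std_normal_density y * r \<le> b" if "0 \<le> r" "r \<le> b * (1 + y\<^sup>2 / 2)" "0 \<le> b" for r b
  proof -
    have "std_normal_density y * r \<le> exp (- y\<^sup>2 / 2) * r"
      unfolding std_normal_density_def using c that
      by (intro mult_right_mono mult_left_le_one_le) (auto simp: mult_le_cancel_right2)
    also have "\<dots> \<le> exp (- y\<^sup>2 / 2) * (b * exp (y\<^sup>2 / 2))"
      using that e by (intro mult_left_mono order_trans[OF that(2)] mult_left_mono) auto
    also have "\<dots> = b" by (simp add: exp_minus field_simps)
    finally show ?thesis .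
  qed
  show "std_normal_density y \<le> 1" using *[of 1 1] by simp
  have "0 \<le> (\<bar>y\<bar> - 1)\<^sup>2" by simp
  then have "\<bar>y\<bar> \<le> 1 * (1 + y\<^sup>2 / 2)" by (simp add: power2_diff)
  then show "std_normal_density y * \<bar>y\<bar> \<le> 1" using *[of "\<bar>y\<bar>" 1] by simp
  show "std_normal_density y * y\<^sup>2 \<le> 2" using *[of "y\<^sup>2" 2] by simp
qed

lemma integrable_bounded_mult:
  fixes f h :: "'a \<Rightarrow> real"
  assumes h: "integrable M h" and [measurable]: "f \<in> borel_measurable M" and f: "\<And>x. \<bar>f x\<bar> \<le> B"
  shows "integrable M (\<lambda>x. f x * h x)"
proof (rule Bochner_Integration.integrable_bound[OF integrable_mult_right[OF h, of B]])
  show "(\<lambda>x. f x * h x) \<in> borel_measurable M" using h by measurable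
  show "AE x in M. norm (f x * h x) \<le> norm (B * h x)"
    unfolding real_norm_def abs_mult by (intro AE_I2 mult_right_mono order_trans[OF f abs_ge_self]) auto
qed

lemma gauss_kernel_le: "gauss_kernel n u \<le> real (Suc n)"
  unfolding gauss_kernel_def using mult_left_mono[OF std_normal_density_le(1), of "real (Suc n)"] by simp

lemma gauss_kernel_tail: "u \<noteq> 0 \<Longrightarrow> gauss_kernel n u \<le> 1 / \<bar>u\<bar>" "u \<noteq> 0 \<Longrightarrow> gauss_kernel n u \<le> 2 / u\<^sup>2 / real (Suc n)"
proof -
  assume u: "u \<noteq> 0"
  have "gauss_kernel n u * \<bar>u\<bar> \<le> 1"
    using std_normal_density_le(2)[of "real (Suc n) * u"] by (simp add: gauss_kernel_def abs_mult mult_ac del: of_nat_Suc)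
  then show "gauss_kernel n u \<le> 1 / \<bar>u\<bar>" using u by (simp add: field_simps)
  have "gauss_kernel n u * (u\<^sup>2 * real (Suc n)) \<le> 2"
    using std_normal_density_le(3)[of "real (Suc n) * u"] by (simp add: gauss_kernel_def power2_eq_square mult_ac del: of_nat_Suc)
  then show "gauss_kernel n u \<le> 2 / u\<^sup>2 / real (Suc n)" using u by (simp add: pos_le_divide_eq del: of_nat_Suc)
qed

text \<open>\<open>l\<close> may be unbounded, so the integral is cut at distance 1 from
  \<open>x\<close>. Near \<open>x\<close> compactness bounds \<open>l\<close>, and v = x + u/(n + 1)
  leaves a fixed Gaussian weight. Far away the kernel is at most 1 and tends to 0, with |l| as
  dominating function.\<close>

lemma gauss_kernel_tendsto:
  assumes l: "continuous_on UNIV l" and li: "integrable lborel l"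
  shows "(\<lambda>n. LINT v|lborel. gauss_kernel n (v - x) * l v) \<longlonglongrightarrow> l x"
proof -
  have [measurable]: "l \<in> borel_measurable borel" using l by (rule borel_measurable_continuous_onI)
  let ?N = "\<lambda>v. indicator {v. \<bar>v - x\<bar> < 1} v :: real"
  let ?F = "\<lambda>v. indicator {v. \<not> \<bar>v - x\<bar> < 1} v :: real"
  have "compact (l ` {x-1..x+1})" by (intro compact_continuous_image continuous_on_subset[OF l]) auto
  then have "bounded (l ` {x-1..x+1})" by (rule compact_imp_bounded)
  then obtain B where B: "\<And>v. v \<in> {x-1..x+1} \<Longrightarrow> norm (l v) \<le> B" unfolding bounded_iff by blast
  have near: "(\<lambda>n. LINT u|lborel. std_normal_density u * (?N (x + u / real (Suc n)) * l (x + u / real (Suc n)))) \<longlonglongrightarrow> (LINT u|lborel. std_normal_density u * l x)"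
  proof (rule integral_dominated_convergence[where w="\<lambda>u. std_normal_density u * B"])
    show "AE u in lborel. norm (std_normal_density u * (?N (x + u / real (Suc n)) * l (x + u / real (Suc n)))) \<le> std_normal_density u * B" for n
    proof (rule AE_I2)
      fix u
      have "norm (?N (x + u / real (Suc n)) * l (x + u / real (Suc n))) \<le> B"
      proof (cases "\<bar>x + u / real (Suc n) - x\<bar> < 1")
        case True
        then have "x + u / real (Suc n) \<in> {x-1..x+1}" unfolding abs_less_iff by auto
        then show ?thesis using B True by (simp del: of_nat_Suc)
      next
        case False
        then have "?N (x + u / real (Suc n)) = 0" by (simp add: indicator_def)
        then show ?thesis using order_trans[OF norm_ge_zero B[of x]] by simp
      qed
      then show "norm (std_normal_density u * (?N (x + u / real (Suc n)) * l (x + u / real (Suc n)))) \<le> std_normal_density u * B"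
        unfolding norm_mult[of "std_normal_density u"] by (auto intro!: mult_left_mono)
    qed
    show "AE u in lborel. (\<lambda>n. std_normal_density u * (?N (x + u / real (Suc n)) * l (x + u / real (Suc n)))) \<longlonglongrightarrow> std_normal_density u * l x"
    proof (rule AE_I2)
      fix u
      have t: "(\<lambda>n. x + u / real (Suc n)) \<longlonglongrightarrow> x"
        using tendsto_add[OF tendsto_const LIMSEQ_Suc[OF lim_const_over_n[of u]], of x] by simp
      then have "\<forall>\<^sub>F n in sequentially. dist (x + u / real (Suc n)) x < 1" by (rule tendstoD) simp
      then have "\<forall>\<^sub>F n in sequentially. ?N (x + u / real (Suc n)) = 1"
        by eventually_elim (simp add: dist_real_def del: of_nat_Suc)
      then have "(\<lambda>n. ?N (x + u / real (Suc n))) \<longlonglongrightarrow> 1" by (rule tendsto_eventually)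
      moreover have "(\<lambda>n. l (x + u / real (Suc n))) \<longlonglongrightarrow> l x"
        using t l by (intro isCont_tendsto_compose[of x l]) (auto simp: continuous_on_eq_continuous_at)
      ultimately have "(\<lambda>n. std_normal_density u * (?N (x + u / real (Suc n)) * l (x + u / real (Suc n)))) \<longlonglongrightarrow> std_normal_density u * (1 * l x)"
        by (intro tendsto_mult tendsto_const)
      then show "(\<lambda>n. std_normal_density u * (?N (x + u / real (Suc n)) * l (x + u / real (Suc n)))) \<longlonglongrightarrow> std_normal_density u * l x" by simp
    qed
    show "integrable lborel (\<lambda>u. std_normal_density u * B)" by (intro integrable_mult_left) simp
  qed measurable
  have near_eq: "(LINT u|lborel. std_normal_density u * (?N (x + u / real (Suc n)) * l (x + u / real (Suc n)))) =
     (LINT v|lborel. gauss_kernel n (v - x) * (?N v * l v))" for n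
    using lborel_integral_real_affine[of "1 / real (Suc n)" "\<lambda>v. gauss_kernel n (v - x) * (?N v * l v)" x]
    by (simp add: gauss_kernel_def mult.assoc del: of_nat_Suc)
  have far: "(\<lambda>n. LINT v|lborel. gauss_kernel n (v - x) * (?F v * l v)) \<longlonglongrightarrow> (LINT v|lborel. (\<lambda>_::real. 0::real) v)"
  proof (rule integral_dominated_convergence[where w="\<lambda>v. \<bar>l v\<bar>"])
    have le: "norm (gauss_kernel n (v - x) * (?F v * l v)) \<le> 2 * \<bar>l v\<bar> / real (Suc n)" "norm (gauss_kernel n (v - x) * (?F v * l v)) \<le> \<bar>l v\<bar>" for n v
    proof -
      have 1: "gauss_kernel n (v - x) \<le> 2 / real (Suc n)" "gauss_kernel n (v - x) \<le> 1" if v: "1 \<le> \<bar>v - x\<bar>"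
      proof -
        have "1 \<le> (v - x)\<^sup>2" using v power_mono[of 1 "\<bar>v - x\<bar>" 2] by simp
        then have "2 / (v - x)\<^sup>2 / real (Suc n) \<le> 2 / real (Suc n)"
          by (intro divide_right_mono) (auto simp: divide_le_eq)
        then show "gauss_kernel n (v - x) \<le> 2 / real (Suc n)" using gauss_kernel_tail(2)[of "v - x" n] v by (intro order_trans[OF gauss_kernel_tail(2)]) auto
        have "1 / \<bar>v - x\<bar> \<le> 1" using v by simp
        then show "gauss_kernel n (v - x) \<le> 1" using gauss_kernel_tail(1)[of "v - x" n] v by (intro order_trans[OF gauss_kernel_tail(1)]) auto
      qed
      show "norm (gauss_kernel n (v - x) * (?F v * l v)) \<le> 2 * \<bar>l v\<bar> / real (Suc n)"
        using mult_right_mono[OF 1(1), of "\<bar>l v\<bar>"] by (auto simp: indicator_def abs_mult gauss_kernel_nonneg simp del: of_nat_Suc)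
      show "norm (gauss_kernel n (v - x) * (?F v * l v)) \<le> \<bar>l v\<bar>"
        using mult_right_mono[OF 1(2), of "\<bar>l v\<bar>"] by (auto simp: indicator_def abs_mult gauss_kernel_nonneg simp del: of_nat_Suc)
    qed
    show "AE v in lborel. norm (gauss_kernel n (v - x) * (?F v * l v)) \<le> \<bar>l v\<bar>" for n using le by auto
    show "AE v in lborel. (\<lambda>n. gauss_kernel n (v - x) * (?F v * l v)) \<longlonglongrightarrow> 0"
    proof (rule AE_I2)
      fix v
      show "(\<lambda>n. gauss_kernel n (v - x) * (?F v * l v)) \<longlonglongrightarrow> 0"
        by (rule Lim_null_comparison[OF always_eventually LIMSEQ_Suc[OF lim_const_over_n]]) (use le(1) in blast)
    qed
    show "integrable lborel (\<lambda>v. \<bar>l v\<bar>)" using li by simp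
  qed measurable
  have split: "(LINT v|lborel. gauss_kernel n (v - x) * l v) =
     (LINT v|lborel. gauss_kernel n (v - x) * (?N v * l v)) + (LINT v|lborel. gauss_kernel n (v - x) * (?F v * l v))" for n
  proof -
    have i: "integrable lborel (\<lambda>v. gauss_kernel n (v - x) * (indicator A v * l v))" if [measurable]: "A \<in> sets borel" for A
    proof (rule Bochner_Integration.integrable_bound[where f="\<lambda>v. real (Suc n) * l v"])
      show "AE v in lborel. norm (gauss_kernel n (v - x) * (indicator A v * l v)) \<le> norm (real (Suc n) * l v)"
        using gauss_kernel_le[of n] gauss_kernel_nonneg[of n] by (auto simp: indicator_def abs_mult intro!: mult_right_mono simp del: of_nat_Suc)
    qed (use li in auto)
    have "gauss_kernel n (v - x) * l v = gauss_kernel n (v - x) * (?N v * l v) + gauss_kernel n (v - x) * (?F v * l v)" for v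
      by (auto simp: indicator_def)
    then show ?thesis using i by (subst Bochner_Integration.integral_add[symmetric]) auto
  qed
  have "(\<lambda>n. LINT v|lborel. gauss_kernel n (v - x) * l v) \<longlonglongrightarrow> (LINT u|lborel. std_normal_density u * l x) + (LINT v|lborel. (\<lambda>_::real. 0::real) v)"
    unfolding split using near unfolding near_eq by (intro tendsto_add far)
  then show ?thesis by simp
qed

section \<open>Comparison of laws along almost sure limits\<close>

text \<open>Dominated convergence, the exponentials having modulus 1. This is the device by which
  equality of laws on two probability spaces is passed from approximants to limits.\<close>

lemma integral_iexp_eq_LIMSEQ:
  assumes P: "prob_space P" "prob_space P'"
    and [measurable]: "\<And>n. Z n \<in> borel_measurable P" "W \<in> borel_measurable P" "\<And>n. Z' n \<in> borel_measurable P'" "W' \<in> borel_measurable P'"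
    and lim: "AE \<omega> in P. (\<lambda>n. Z n \<omega>) \<longlonglongrightarrow> W \<omega>" "AE \<omega> in P'. (\<lambda>n. Z' n \<omega>) \<longlonglongrightarrow> W' \<omega>"
    and eq: "\<And>n::nat. (CLINT \<omega>|P. iexp (Z n \<omega>)) = (CLINT \<omega>|P'. iexp (Z' n \<omega>))"
  shows "(CLINT \<omega>|P. iexp (W \<omega>)) = (CLINT \<omega>|P'. iexp (W' \<omega>))"
proof -
  have *: "(\<lambda>n. CLINT \<omega>|P. iexp (Z n \<omega>)) \<longlonglongrightarrow> (CLINT \<omega>|P. iexp (W \<omega>))"
    if "prob_space P" and [measurable]: "\<And>n. Z n \<in> borel_measurable P" "W \<in> borel_measurable P" and "AE \<omega> in P. (\<lambda>n. Z n \<omega>) \<longlonglongrightarrow> W \<omega>"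
    for P :: "'x measure" and Z :: "nat \<Rightarrow> 'x \<Rightarrow> real" and W
  proof -
    interpret prob_space P by fact
    show ?thesis
    proof (rule integral_dominated_convergence[where w="\<lambda>_. 1"])
      show "AE \<omega> in P. (\<lambda>n. iexp (Z n \<omega>)) \<longlonglongrightarrow> iexp (W \<omega>)"
        using that(4) by eventually_elim (intro tendsto_intros)
    qed auto
  qed
  show ?thesis
    using LIMSEQ_unique[OF *[of P Z W] *[of P' Z' W', unfolded eq[symmetric]]] assms by auto
qed

lemma occupation_density_integral_measurable:
  assumes L: "occupation_density P X L" "0 \<le> t" and [measurable]: "f \<in> borel_measurable borel"
  shows "(\<lambda>\<omega>. LINT v|lborel. f v * L t v \<omega>) \<in> borel_measurable P"
proof -
  have [measurable]: "(\<lambda>z. L t (fst z) (snd z)) \<in> borel_measurable (borel \<Otimes>\<^sub>M P)"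
    by (rule occupation_density_joint_measurable[OF L])
  have [measurable]: "(\<lambda>(\<omega>, v). L t v \<omega>) \<in> borel_measurable (P \<Otimes>\<^sub>M borel)"
    using measurable_compose[OF measurable_pair_swap' occupation_density_joint_measurable[OF L]] by (simp add: split_beta')
  have "(\<lambda>(\<omega>, v). f v * L t v \<omega>) \<in> borel_measurable (P \<Otimes>\<^sub>M lborel)" by measurable
  then show ?thesis by (rule lborel.borel_measurable_lebesgue_integral)
qed

text \<open>An integral against the density is an integral along the path, hence a limit of Riemann
  sums; these depend on finitely many values of the process, whose joint law is determined by
  \<sigma> and \<beta>.\<close>

lemma occupation_density_integral_law:
  assumes X: "stable_levy P \<sigma> \<beta> X" "AE \<omega> in P. right_continuous_path (\<lambda>s. X s \<omega>)" "occupation_density P X L"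
    and X': "stable_levy P' \<sigma> \<beta> X'" "AE \<omega> in P'. right_continuous_path (\<lambda>s. X' s \<omega>)" "occupation_density P' X' L'"
    and J: "finite J" and t: "\<And>j. j \<in> J \<Longrightarrow> 0 \<le> t j"
    and f: "\<And>j. j \<in> J \<Longrightarrow> continuous_on UNIV (f j)" "\<And>j v. j \<in> J \<Longrightarrow> \<bar>f j v\<bar> \<le> B j"
  shows "(CLINT \<omega>|P. iexp (\<Sum>j\<in>J. LINT v|lborel. f j v * L (t j) v \<omega>)) =
         (CLINT \<omega>|P'. iexp (\<Sum>j\<in>J. LINT v|lborel. f j v * L' (t j) v \<omega>))"
proof -
  define u where "u = (\<lambda>N j k. t j * real (Suc k) / real (Suc N))"
  define R where "R = (\<lambda>N x. \<Sum>j\<in>J. t j / real (Suc N) * (\<Sum>k\<le>N. f j (x (u N j k))))"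
  \<comment> \<open>The sampling times of all indices together, so that one finite-dimensional law
    covers the whole sum.\<close>
  define T where "T = (\<lambda>N::nat. \<Union>j\<in>J. (\<lambda>k. u N j k) ` {..N})"
  have T: "finite (T N)" "T N \<subseteq> {0..}" for N
    using J t by (auto simp: T_def u_def)
  have [measurable]: "f j \<in> borel_measurable borel" if "j \<in> J" for j using f(1)[OF that] by (rule borel_measurable_continuous_onI)
  have R: "R N \<in> borel_measurable (\<Pi>\<^sub>M s\<in>T N. borel)" for N
  proof -
    have "(\<lambda>x. f j (x (u N j k))) \<in> borel_measurable (\<Pi>\<^sub>M s\<in>T N. borel)" if "j \<in> J" "k \<le> N" for j k
      using that by (intro measurable_compose[OF measurable_component_singleton]) (auto simp: T_def)
    then show ?thesis unfolding R_def by (intro borel_measurable_sum borel_measurable_times borel_measurable_const) auto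
  qed
  have *: "(\<lambda>\<omega>. R N (\<lambda>s\<in>T N. X s \<omega>)) \<in> borel_measurable P"
     "AE \<omega> in P. (\<lambda>N. R N (\<lambda>s\<in>T N. X s \<omega>)) \<longlonglongrightarrow> (\<Sum>j\<in>J. LINT v|lborel. f j v * L (t j) v \<omega>)"
     "(\<lambda>\<omega>. \<lambda>s\<in>T N. X s \<omega>) \<in> measurable P (\<Pi>\<^sub>M s\<in>T N. borel)"
    if X: "stable_levy P \<sigma> \<beta> X" "AE \<omega> in P. right_continuous_path (\<lambda>s. X s \<omega>)" "occupation_density P X L"
    for P :: "'x measure" and X L and N
  proof -
    show m: "(\<lambda>\<omega>. \<lambda>s\<in>T N. X s \<omega>) \<in> measurable P (\<Pi>\<^sub>M s\<in>T N. borel)" for N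
      using T stable_levyD(2)[OF X(1)] by (intro measurable_restrict) auto
    show "(\<lambda>\<omega>. R N (\<lambda>s\<in>T N. X s \<omega>)) \<in> borel_measurable P" by (rule measurable_compose[OF m R])
    have "AE \<omega> in P. \<forall>j\<in>J. (\<forall>f B. continuous_on UNIV f \<longrightarrow> (\<forall>v. \<bar>f v\<bar> \<le> B) \<longrightarrow>
           (LINT u:{0..t j}|lborel. f (X u \<omega>)) = (LINT v|lborel. f v * L (t j) v \<omega>))"
      using occupation_densityD(4)[OF X(3) t] by (intro AE_finite_allI J) auto
    then show "AE \<omega> in P. (\<lambda>N. R N (\<lambda>s\<in>T N. X s \<omega>)) \<longlonglongrightarrow> (\<Sum>j\<in>J. LINT v|lborel. f j v * L (t j) v \<omega>)"
      using X(2)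
    proof eventually_elim
      case (elim \<omega>)
      have r: "R N (\<lambda>s\<in>T N. X s \<omega>) = (\<Sum>j\<in>J. t j / real (Suc N) * (\<Sum>k\<le>N. f j (X (t j * real (Suc k) / real (Suc N)) \<omega>)))" for N
      proof -
        have "(\<lambda>s\<in>T N. X s \<omega>) (u N j k) = X (t j * real (Suc k) / real (Suc N)) \<omega>" if "j \<in> J" "k \<le> N" for j k
        proof -
          have "u N j k \<in> T N" using that by (auto simp: T_def)
          then show ?thesis unfolding u_def by (simp only: restrict_apply if_True)
        qed
        then show ?thesis unfolding R_def by (intro sum.cong refl arg_cong2[where f="(*)"]) (auto simp del: of_nat_Suc)
      qed
      show ?case unfolding r
      proof (intro tendsto_sum)
        fix j assume j: "j \<in> J"
        have "(LINT v|lborel. f j v * L (t j) v \<omega>) = (LINT u:{0..t j}|lborel. f j (X u \<omega>))"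
          using elim(1) j f[OF j] by metis
        then show "(\<lambda>N. t j / real (Suc N) * (\<Sum>k\<le>N. f j (X (t j * real (Suc k) / real (Suc N)) \<omega>))) \<longlonglongrightarrow> (LINT v|lborel. f j v * L (t j) v \<omega>)"
          using riemann_sum_tendsto[OF right_continuous_path_compose[OF elim(2) f(1)[OF j]] f(2)[OF j] t[OF j]] by simp
      qed
    qed
  qed
  have m: "(\<lambda>\<omega>. \<Sum>j\<in>J. LINT v|lborel. f j v * L (t j) v \<omega>) \<in> borel_measurable P"
    "(\<lambda>\<omega>. \<Sum>j\<in>J. LINT v|lborel. f j v * L' (t j) v \<omega>) \<in> borel_measurable P'"
    using X(3) X'(3) t by (auto intro!: borel_measurable_sum occupation_density_integral_measurable)
  show ?thesis
  proof (rule integral_iexp_eq_LIMSEQ[OF stable_levyD(1)[OF X(1)] stable_levyD(1)[OF X'(1)] *(1)[OF X] m(1) *(1)[OF X'] m(2) *(2)[OF X] *(2)[OF X']])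
    fix N
    show "(CLINT \<omega>|P. iexp (R N (\<lambda>s\<in>T N. X s \<omega>))) = (CLINT \<omega>|P'. iexp (R N (\<lambda>s\<in>T N. X' s \<omega>)))"
      using prob_space.integral_eq_of_distr_PiM_eq[OF stable_levyD(1)[OF X(1)] _ *(3)[OF X] *(3)[OF X'] stable_levy_fdd_eq[OF X(1) X'(1) T], of "\<lambda>x. iexp (R N x)"] R[of N]
      by simp
  qed
qed

section \<open>Second moments of local time increments\<close>

text \<open>The Gaussian exponential is the characteristic function of the standard normal law;
  rescaling the frequency turns the scale of the mollifier into a cut-off at frequencies of order n
  + 1.\<close>

lemma gauss_kernel_fourier:
  "complex_of_real (gauss_kernel n u) =
     1 / sqrt (2 * pi) * (CLINT \<eta>|lborel. std_normal_density (\<eta> / real (Suc n)) * iexp (u * \<eta>))"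
proof -
  let ?N = "real (Suc n)"
  have "complex_of_real (exp (- (?N * u)\<^sup>2 / 2)) = char std_normal_distribution (?N * u)"
    by (simp add: char_std_normal_distribution)
  also have "\<dots> = (CLINT \<xi>|lborel. std_normal_density \<xi> *\<^sub>R iexp (?N * u * \<xi>))"
    unfolding char_def by (subst integral_density) auto
  also have "\<dots> = \<bar>1 / ?N\<bar> *\<^sub>R (CLINT \<eta>|lborel. std_normal_density (0 + 1 / ?N * \<eta>) *\<^sub>R iexp (?N * u * (0 + 1 / ?N * \<eta>)))"
    by (rule lborel_integral_real_affine) simp
  also have "\<dots> = complex_of_real (1 / ?N) * (CLINT \<eta>|lborel. std_normal_density (\<eta> / ?N) * iexp (u * \<eta>))"
    by (simp add: scaleR_conv_of_real mult.assoc del: of_nat_Suc)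
  finally have e: "complex_of_real (exp (- (?N * u)\<^sup>2 / 2)) = complex_of_real (1 / ?N) * (CLINT \<eta>|lborel. std_normal_density (\<eta> / ?N) * iexp (u * \<eta>))" .
  have "complex_of_real (gauss_kernel n u) = complex_of_real (?N * (1 / sqrt (2 * pi))) * complex_of_real (exp (- (?N * u)\<^sup>2 / 2))"
    by (simp add: gauss_kernel_def std_normal_density_def del: of_nat_Suc)
  also have "\<dots> = complex_of_real (?N * (1 / sqrt (2 * pi)) * (1 / ?N)) * (CLINT \<eta>|lborel. std_normal_density (\<eta> / ?N) * iexp (u * \<eta>))"
    unfolding e by (simp only: of_real_mult mult.assoc)
  also have "?N * (1 / sqrt (2 * pi)) * (1 / ?N) = 1 / sqrt (2 * pi)" by (simp del: of_nat_Suc)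
  finally show ?thesis by simp
qed

lemma integrable_std_normal_scaled: "integrable lborel (\<lambda>\<eta>. std_normal_density (\<eta> / real (Suc n)))"
  using lborel_integrable_real_affine[of std_normal_density "1 / real (Suc n)" 0] by (simp del: of_nat_Suc)

text \<open>The integrable cut-off justifies Fubini, and the expectation is expressed by the
  characteristic function, the explicit datum of a stable law.\<close>

lemma expectation_gauss_kernel:
  assumes N: "real_distribution N"
  shows "complex_of_real (LINT y|N. gauss_kernel n (y + u)) =
     1 / sqrt (2 * pi) * (CLINT \<eta>|lborel. std_normal_density (\<eta> / real (Suc n)) * iexp (u * \<eta>) * char N \<eta>)"
proof -
  interpret real_distribution N by fact
  interpret pair_sigma_finite lborel N ..
  let ?f = "\<lambda>\<eta> y. complex_of_real (std_normal_density (\<eta> / real (Suc n))) * iexp ((y + u) * \<eta>)"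
  have int: "integrable (lborel \<Otimes>\<^sub>M N) (\<lambda>(\<eta>, y). ?f \<eta> y)"
  proof (rule Fubini_integrable)
    show "integrable lborel (\<lambda>\<eta>. LINT y|N. norm (case (\<eta>, y) of (\<eta>, y) \<Rightarrow> ?f \<eta> y))"
      using integrable_std_normal_scaled[of n] by (simp add: norm_mult prob_space[simplified] del: of_nat_Suc)
    show "AE \<eta> in lborel. integrable N (\<lambda>y. case (\<eta>, y) of (\<eta>, y) \<Rightarrow> ?f \<eta> y)"
      by (intro AE_I2 integrable_const_bound[where B="std_normal_density _"]) (auto simp: norm_mult)
  qed measurable
  have "complex_of_real (LINT y|N. gauss_kernel n (y + u)) = (CLINT y|N. complex_of_real (gauss_kernel n (y + u)))"
    by (rule integral_complex_of_real[symmetric])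
  also have "\<dots> = 1 / sqrt (2 * pi) * (CLINT y|N. CLINT \<eta>|lborel. ?f \<eta> y)"
    unfolding gauss_kernel_fourier by (rule integral_mult_right_zero)
  also have "(CLINT y|N. CLINT \<eta>|lborel. ?f \<eta> y) = (CLINT \<eta>|lborel. CLINT y|N. ?f \<eta> y)"
    by (rule Fubini_integral[OF int])
  also have "\<dots> = (CLINT \<eta>|lborel. std_normal_density (\<eta> / real (Suc n)) * iexp (u * \<eta>) * char N \<eta>)"
  proof (intro Bochner_Integration.integral_cong refl)
    fix \<eta>
    have "(CLINT y|N. ?f \<eta> y) = (CLINT y|N. (std_normal_density (\<eta> / real (Suc n)) * iexp (u * \<eta>)) * iexp (\<eta> * y))"
      by (intro Bochner_Integration.integral_cong refl) (simp add: exp_add[symmetric] algebra_simps)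
    then show "(CLINT y|N. ?f \<eta> y) = std_normal_density (\<eta> / real (Suc n)) * iexp (u * \<eta>) * char N \<eta>"
      by (simp add: char_def)
  qed
  finally show ?thesis .
qed

text \<open>A Riemann sum at right endpoints of the decreasing function exp(-rs) lies below its
  integral 1/r. In algebraic form this is q(1 + \<delta>r) \<le> 1 for q = exp(-\<delta>r), and the
  bound is uniform in \<delta> and \<open>K\<close>.\<close>

lemma geometric_exp_sum_le:
  assumes "0 < r" "0 < \<delta>"
  shows "(\<Sum>m<K. \<delta> * exp (- (real (Suc m) * \<delta> * r))) \<le> 1 / r"
proof -
  define q where "q = exp (- (\<delta> * r))"
  have q: "0 < q" "q * (1 + \<delta> * r) \<le> 1"
  proof -
    have "q * (1 + \<delta> * r) \<le> q * exp (\<delta> * r)" unfolding q_def by (intro mult_left_mono exp_ge_add_one_self) auto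
    then show "q * (1 + \<delta> * r) \<le> 1" by (simp add: q_def exp_minus)
  qed (simp add: q_def)
  have e: "exp (- (real (Suc m) * \<delta> * r)) = q ^ Suc m" for m
    unfolding q_def exp_of_nat_mult[symmetric] by (simp add: mult_ac)
  have "(\<delta> * r) * (\<Sum>m<K. q ^ Suc m) \<le> 1 - q ^ K"
  proof (induction K)
    case (Suc K)
    have "(\<delta> * r) * (\<Sum>m<Suc K. q ^ Suc m) \<le> 1 - q ^ K + (\<delta> * r) * q ^ Suc K" using Suc by (simp add: algebra_simps)
    also have "\<dots> = 1 - q ^ Suc K - q ^ K * (1 - q * (1 + \<delta> * r))" by (simp add: algebra_simps)
    also have "\<dots> \<le> 1 - q ^ Suc K" using q by simp
    finally show ?case .
  qed simp
  also have "\<dots> \<le> 1" using q by simp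
  finally have "r * (\<Sum>m<K. \<delta> * q ^ Suc m) \<le> 1" by (simp add: sum_distrib_left mult_ac)
  then show ?thesis using assms unfolding e by (simp add: field_simps)
qed

text \<open>The integral that bounds increments of the potential kernel, taken at distance
  1.\<close>

definition riesz_const :: "real \<Rightarrow> real" where
  "riesz_const \<beta> = enn2real (\<integral>\<^sup>+\<eta>. ennreal (min 2 \<bar>\<eta>\<bar> * \<bar>\<eta>\<bar> powr (- \<beta>)) \<partial>lborel)"

text \<open>Rescaling \<eta> by \<open>d\<close> produces d^(\<beta> - 1). The integral converges at
  the origin because min(2, |\<eta>|) supplies a factor |\<eta>| and \<beta> < 2, and at infinity
  because \<beta> > 1.\<close>

lemma nn_integral_riesz:
  assumes \<beta>: "1 < \<beta>" "\<beta> < 2" and d: "0 \<le> d"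
  shows "(\<integral>\<^sup>+\<eta>. ennreal (min 2 (d * \<bar>\<eta>\<bar>) * \<bar>\<eta>\<bar> powr (- \<beta>)) \<partial>lborel) = ennreal (riesz_const \<beta> * d powr (\<beta> - 1))"
proof -
  let ?f = "\<lambda>\<eta>::real. min 2 \<bar>\<eta>\<bar> * \<bar>\<eta>\<bar> powr (- \<beta>)"
  have "(\<integral>\<^sup>+\<eta>. ennreal (?f \<eta>) \<partial>lborel) < \<infinity>"
  proof (rule nn_integral_lborel_finite_powr[where C=2 and a="1-\<beta>" and b="-\<beta>"])
    fix x :: real assume x: "x \<noteq> 0" "\<bar>x\<bar> \<le> 1"
    have "?f x = \<bar>x\<bar> * \<bar>x\<bar> powr (- \<beta>)" using x by simp
    also have "\<dots> = \<bar>x\<bar> powr (1 - \<beta>)" using x by (simp add: powr_diff powr_minus_divide)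
    also have "\<dots> \<le> 2 * \<bar>x\<bar> powr (1 - \<beta>)" by simp
    finally show "?f x \<le> 2 * \<bar>x\<bar> powr (1 - \<beta>)" .
  next
    fix x :: real
    show "?f x \<le> 2 * \<bar>x\<bar> powr (- \<beta>)" by (intro mult_right_mono) auto
  qed (use \<beta> in auto)
  then have K: "(\<integral>\<^sup>+\<eta>. ennreal (?f \<eta>) \<partial>lborel) = ennreal (riesz_const \<beta>)"
    unfolding riesz_const_def by (simp add: less_top[symmetric])
  show ?thesis
  proof (cases "d = 0")
    case False
    then have d: "d > 0" using d by simp
    have "ennreal (?f (0 + d * \<eta>)) = ennreal (d powr (- \<beta>)) * ennreal (min 2 (d * \<bar>\<eta>\<bar>) * \<bar>\<eta>\<bar> powr (- \<beta>))" for \<eta>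
      using d by (subst ennreal_mult[symmetric]) (auto simp: abs_mult powr_mult mult_ac)
    then have "ennreal (riesz_const \<beta>) = ennreal d * (ennreal (d powr (- \<beta>)) * (\<integral>\<^sup>+\<eta>. ennreal (min 2 (d * \<bar>\<eta>\<bar>) * \<bar>\<eta>\<bar> powr (- \<beta>)) \<partial>lborel))"
      unfolding K[symmetric] using d by (subst nn_integral_real_affine[of _ d 0]) (auto simp: nn_integral_cmult)
    then have "ennreal (riesz_const \<beta>) = ennreal (d powr (1 - \<beta>)) * (\<integral>\<^sup>+\<eta>. ennreal (min 2 (d * \<bar>\<eta>\<bar>) * \<bar>\<eta>\<bar> powr (- \<beta>)) \<partial>lborel)"
      using d by (simp add: mult.assoc[symmetric] ennreal_mult[symmetric] powr_diff powr_minus_divide)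
    then have "ennreal (d powr (\<beta> - 1)) * ennreal (riesz_const \<beta>) =
       (ennreal (d powr (\<beta> - 1)) * ennreal (d powr (1 - \<beta>))) * (\<integral>\<^sup>+\<eta>. ennreal (min 2 (d * \<bar>\<eta>\<bar>) * \<bar>\<eta>\<bar> powr (- \<beta>)) \<partial>lborel)"
      by (simp add: mult.assoc)
    also have "ennreal (d powr (\<beta> - 1)) * ennreal (d powr (1 - \<beta>)) = 1"
      using d by (simp add: ennreal_mult[symmetric] powr_add[symmetric])
    finally show ?thesis by (simp add: ennreal_mult[symmetric] riesz_const_def mult.commute)
  qed simp
qed

lemma riesz_const_nonneg: "0 \<le> riesz_const \<beta>" by (simp add: riesz_const_def)

text \<open>On the Fourier side the sum over times is at most 1/(\<sigma>|\<eta>|^\<beta>), which is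
  not integrable at 0. The difference of two mollifiers repairs this, since |e^(ia\<eta>) -
  e^(ib\<eta>)| \<le> min(2, |a - b||\<eta>|). The resulting bound is free of \<open>n\<close>,
  \<open>\<delta>\<close> and \<open>K\<close>, so it survives the limits in the mesh and in the
  mollifier.\<close>

lemma stable_levy_potential_bound:
  assumes X: "stable_levy P \<sigma> \<beta> X" and \<sigma>: "0 < \<sigma>" and \<beta>: "1 < \<beta>" "\<beta> < 2" and \<delta>: "0 < \<delta>"
  shows "\<bar>\<Sum>m<K. \<delta> * (LINT \<omega>|P. gauss_kernel n (X (real (Suc m) * \<delta>) \<omega> + a) - gauss_kernel n (X (real (Suc m) * \<delta>) \<omega> + b))\<bar>
     \<le> riesz_const \<beta> / \<sigma> * \<bar>a - b\<bar> powr (\<beta> - 1)"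
proof -
  interpret P: prob_space P by (rule stable_levyD[OF X])
  let ?t = "\<lambda>m. real (Suc m) * \<delta>"
  let ?e = "\<lambda>m \<eta>. exp (- (?t m * (\<sigma> * \<bar>\<eta>\<bar> powr \<beta>)))"
  let ?\<phi> = "\<lambda>\<eta>. std_normal_density (\<eta> / real (Suc n))"
  let ?g = "\<lambda>m \<eta>. complex_of_real (?\<phi> \<eta>) * (iexp (a * \<eta>) - iexp (b * \<eta>)) * complex_of_real (\<delta> * ?e m \<eta>)"
  have t: "0 \<le> ?t m" for m using \<delta> by simp
  have [measurable]: "X (?t m) \<in> borel_measurable P" for m by (rule stable_levyD(2)[OF X t])
  have i0: "integrable lborel (\<lambda>\<eta>. complex_of_real (?\<phi> \<eta>) * iexp (u * \<eta>) * complex_of_real (\<delta> * ?e m \<eta>))" for u m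
  proof (rule Bochner_Integration.integrable_bound[where f="\<lambda>\<eta>. \<delta> * ?\<phi> \<eta>"])
    show "AE \<eta> in lborel. norm (complex_of_real (?\<phi> \<eta>) * iexp (u * \<eta>) * complex_of_real (\<delta> * ?e m \<eta>)) \<le> norm (\<delta> * ?\<phi> \<eta>)"
    proof (rule AE_I2)
      fix \<eta>
      have "?\<phi> \<eta> * (\<delta> * ?e m \<eta>) \<le> ?\<phi> \<eta> * (\<delta> * 1)" using \<delta> \<sigma> t[of m] by (intro mult_left_mono) auto
      then show "norm (complex_of_real (?\<phi> \<eta>) * iexp (u * \<eta>) * complex_of_real (\<delta> * ?e m \<eta>)) \<le> norm (\<delta> * ?\<phi> \<eta>)"
        using \<delta> by (simp add: norm_mult mult_ac del: of_nat_Suc)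
    qed
    show "integrable lborel (\<lambda>\<eta>. \<delta> * ?\<phi> \<eta>)" by (intro integrable_mult_right integrable_std_normal_scaled)
  qed measurable
  have i: "integrable lborel (?g m)" for m
    using Bochner_Integration.integrable_diff[OF i0[of a m] i0[of b m]] by (simp only: right_diff_distrib left_diff_distrib)
  have E: "complex_of_real (\<delta> * (LINT \<omega>|P. gauss_kernel n (X (?t m) \<omega> + a) - gauss_kernel n (X (?t m) \<omega> + b))) =
      1 / sqrt (2 * pi) * (CLINT \<eta>|lborel. ?g m \<eta>)" for m
  proof -
    let ?N = "distr P borel (X (?t m))"
    have N: "real_distribution ?N" by (rule P.real_distribution_distr[OF stable_levyD(2)[OF X t]])
    have ik: "integrable P (\<lambda>\<omega>. gauss_kernel n (X (?t m) \<omega> + u))" for u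
      by (rule P.integrable_const_bound[where B="real (Suc n)"]) (auto simp: gauss_kernel_nonneg gauss_kernel_le simp del: of_nat_Suc)
    have k: "complex_of_real (LINT \<omega>|P. gauss_kernel n (X (?t m) \<omega> + u)) =
       1 / sqrt (2 * pi) * (CLINT \<eta>|lborel. complex_of_real (?\<phi> \<eta>) * iexp (u * \<eta>) * complex_of_real (?e m \<eta>))" for u
    proof -
      have "(LINT \<omega>|P. gauss_kernel n (X (?t m) \<omega> + u)) = (LINT y|?N. gauss_kernel n (y + u))"
        by (subst integral_distr) (auto simp del: of_nat_Suc)
      moreover have "char ?N \<eta> = complex_of_real (?e m \<eta>)" for \<eta>
        by (subst stable_levyD(6)[OF X t]) (simp add: mult_ac)
      ultimately show ?thesis using expectation_gauss_kernel[OF N, of n u] by simp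
    qed
    have "complex_of_real (\<delta> * (LINT \<omega>|P. gauss_kernel n (X (?t m) \<omega> + a) - gauss_kernel n (X (?t m) \<omega> + b))) =
      complex_of_real \<delta> * (complex_of_real (LINT \<omega>|P. gauss_kernel n (X (?t m) \<omega> + a)) - complex_of_real (LINT \<omega>|P. gauss_kernel n (X (?t m) \<omega> + b)))"
      using ik by simp
    also have "\<dots> = 1 / sqrt (2 * pi) * ((CLINT \<eta>|lborel. complex_of_real \<delta> * (complex_of_real (?\<phi> \<eta>) * iexp (a * \<eta>) * complex_of_real (?e m \<eta>))) -
        (CLINT \<eta>|lborel. complex_of_real \<delta> * (complex_of_real (?\<phi> \<eta>) * iexp (b * \<eta>) * complex_of_real (?e m \<eta>))))"
      unfolding k by (simp add: algebra_simps)
    also have "\<dots> = 1 / sqrt (2 * pi) * (CLINT \<eta>|lborel. ?g m \<eta>)"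
      using i0[of a m] i0[of b m]
      by (subst Bochner_Integration.integral_diff[symmetric]) (auto simp: algebra_simps)
    finally show ?thesis .
  qed
  have bound: "norm (\<Sum>m<K. ?g m \<eta>) \<le> min 2 (\<bar>a - b\<bar> * \<bar>\<eta>\<bar>) * \<bar>\<eta>\<bar> powr (- \<beta>) / \<sigma>" if \<eta>: "\<eta> \<noteq> 0" for \<eta>
  proof -
    define r where "r = \<sigma> * \<bar>\<eta>\<bar> powr \<beta>"
    have r: "r > 0" using \<sigma> \<eta> by (simp add: r_def)
    have "(\<Sum>m<K. ?g m \<eta>) = complex_of_real (?\<phi> \<eta>) * (iexp (a * \<eta>) - iexp (b * \<eta>)) * complex_of_real (\<Sum>m<K. \<delta> * ?e m \<eta>)"
      by (simp only: sum_distrib_left of_real_sum)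
    then have "norm (\<Sum>m<K. ?g m \<eta>) = ?\<phi> \<eta> * norm (iexp (a * \<eta>) - iexp (b * \<eta>)) * (\<Sum>m<K. \<delta> * ?e m \<eta>)"
      using \<delta> by (simp only: norm_mult norm_of_real) (simp add: sum_nonneg del: of_nat_Suc)
    also have "\<dots> \<le> 1 * min 2 (\<bar>a - b\<bar> * \<bar>\<eta>\<bar>) * (1 / r)"
    proof (intro mult_mono)
      show "?\<phi> \<eta> \<le> 1" by (rule std_normal_density_le)
      have "norm (iexp (a * \<eta>) - iexp (b * \<eta>)) \<le> \<bar>a * \<eta> - b * \<eta>\<bar>" by (rule norm_iexp_diff_le)
      moreover have "norm (iexp (a * \<eta>) - iexp (b * \<eta>)) \<le> 2"
        using norm_triangle_ineq4[of "iexp (a * \<eta>)" "iexp (b * \<eta>)"] by simp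
      ultimately show "norm (iexp (a * \<eta>) - iexp (b * \<eta>)) \<le> min 2 (\<bar>a - b\<bar> * \<bar>\<eta>\<bar>)"
        by (simp add: abs_mult[symmetric] algebra_simps)
      show "(\<Sum>m<K. \<delta> * ?e m \<eta>) \<le> 1 / r"
        using geometric_exp_sum_le[OF r \<delta>, of K] by (simp add: r_def mult.assoc del: of_nat_Suc)
    qed (use \<delta> r in \<open>auto intro!: sum_nonneg mult_nonneg_nonneg simp: min_def simp del: of_nat_Suc\<close>)
    also have "\<dots> = min 2 (\<bar>a - b\<bar> * \<bar>\<eta>\<bar>) * \<bar>\<eta>\<bar> powr (- \<beta>) / \<sigma>"
      by (simp add: r_def powr_minus_divide)
    finally show ?thesis .
  qed
  let ?S = "\<Sum>m<K. \<delta> * (LINT \<omega>|P. gauss_kernel n (X (?t m) \<omega> + a) - gauss_kernel n (X (?t m) \<omega> + b))"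
  have "complex_of_real ?S = (\<Sum>m<K. complex_of_real (\<delta> * (LINT \<omega>|P. gauss_kernel n (X (?t m) \<omega> + a) - gauss_kernel n (X (?t m) \<omega> + b))))"
    by (rule of_real_sum)
  also have "\<dots> = (\<Sum>m<K. complex_of_real (1 / sqrt (2 * pi)) * (CLINT \<eta>|lborel. ?g m \<eta>))"
    by (simp only: E)
  also have "\<dots> = complex_of_real (1 / sqrt (2 * pi)) * (\<Sum>m<K. CLINT \<eta>|lborel. ?g m \<eta>)"
    by (rule sum_distrib_left[symmetric])
  also have "(\<Sum>m<K. CLINT \<eta>|lborel. ?g m \<eta>) = (CLINT \<eta>|lborel. (\<Sum>m<K. ?g m \<eta>))"
    by (rule Bochner_Integration.integral_sum[symmetric], rule i)
  finally have "\<bar>?S\<bar> = norm (complex_of_real (1 / sqrt (2 * pi)) * (CLINT \<eta>|lborel. (\<Sum>m<K. ?g m \<eta>)))"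
    by (subst norm_of_real[where 'a=complex, symmetric]) (simp only:)
  \<comment> \<open>The factor 1/sqrt(2 pi) is at most 1 and is dropped.\<close>
  also have "\<dots> \<le> 1 * norm (CLINT \<eta>|lborel. (\<Sum>m<K. ?g m \<eta>))"
    unfolding norm_mult norm_of_real using pi_gt3 by (intro mult_right_mono) (auto simp: field_simps)
  finally have 1: "\<bar>?S\<bar> \<le> norm (CLINT \<eta>|lborel. (\<Sum>m<K. ?g m \<eta>))" by simp
  have "ennreal \<bar>?S\<bar> \<le> ennreal (norm (CLINT \<eta>|lborel. (\<Sum>m<K. ?g m \<eta>)))" using 1 by (rule ennreal_leI)
  also have "\<dots> \<le> (\<integral>\<^sup>+\<eta>. ennreal (norm (\<Sum>m<K. ?g m \<eta>)) \<partial>lborel)"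
    by (rule integral_norm_bound_ennreal) (use i in auto)
  also have "\<dots> \<le> (\<integral>\<^sup>+\<eta>. ennreal (1 / \<sigma>) * ennreal (min 2 (\<bar>a - b\<bar> * \<bar>\<eta>\<bar>) * \<bar>\<eta>\<bar> powr (- \<beta>)) \<partial>lborel)"
  proof (rule nn_integral_mono_AE)
    show "AE \<eta> in lborel. ennreal (norm (\<Sum>m<K. ?g m \<eta>)) \<le> ennreal (1 / \<sigma>) * ennreal (min 2 (\<bar>a - b\<bar> * \<bar>\<eta>\<bar>) * \<bar>\<eta>\<bar> powr (- \<beta>))"
      using AE_lborel_singleton[of 0]
    proof eventually_elim
      case (elim \<eta>)
      then show ?case using bound[OF elim] \<sigma> by (subst ennreal_mult'[symmetric]) (auto intro!: ennreal_leI)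
    qed
  qed
  also have "\<dots> = ennreal (1 / \<sigma>) * ennreal (riesz_const \<beta> * \<bar>a - b\<bar> powr (\<beta> - 1))"
    by (subst nn_integral_cmult) (auto simp: nn_integral_riesz[OF \<beta>])
  also have "\<dots> = ennreal (riesz_const \<beta> / \<sigma> * \<bar>a - b\<bar> powr (\<beta> - 1))"
    using \<sigma> by (subst ennreal_mult'[symmetric]) (auto simp: riesz_const_nonneg)
  finally show ?thesis using \<sigma> by (simp add: ennreal_le_iff riesz_const_nonneg)
qed

section \<open>Markov property and second moments of sums along the path\<close>

text \<open>The Markov property at time \<open>s\<close>: X_s is independent of the increment over
  the next \<open>u\<close> units, which has the law of X_u. The joint law is a product, and Fubini
  integrates the increment out.\<close>

lemma stable_levy_two_point:
  fixes g h :: "real \<Rightarrow> real"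
  assumes X: "stable_levy P \<sigma> \<beta> X" and s: "0 \<le> s" and u: "0 \<le> u"
    and [measurable]: "g \<in> borel_measurable borel" "h \<in> borel_measurable borel" and C: "\<And>v. \<bar>g v\<bar> \<le> C" "\<And>v. \<bar>h v\<bar> \<le> C"
  shows "(LINT \<omega>|P. g (X s \<omega>) * h (X (s + u) \<omega>)) = (LINT \<omega>|P. g (X s \<omega>) * (LINT \<omega>'|P. h (X s \<omega> + X u \<omega>')))"
proof -
  interpret P: prob_space P by (rule stable_levyD[OF X])
  \<comment> \<open>A grid through 0, s and s + u, constant afterwards; its first two increments are
    the variables in question.\<close>
  define \<tau> where "\<tau> = (\<lambda>i::nat. if i = 0 then 0 else if i = 1 then s else s + u)"
  have "mono \<tau>" using s u by (auto simp: \<tau>_def mono_def)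
  then have iv: "P.indep_vars (\<lambda>_. borel) (\<lambda>i \<omega>. X (\<tau> (Suc i)) \<omega> - X (\<tau> i) \<omega>) {..<2}"
    by (intro stable_levyD(4)[OF X]) (auto simp: \<tau>_def)
  have "{..<2::nat} = insert 0 {1}" by auto
  then have ind: "P.indep_var borel (\<lambda>\<omega>. X s \<omega> - X 0 \<omega>) borel (\<lambda>\<omega>. X (s + u) \<omega> - X s \<omega>)"
    using P.indep_vars_sum[of "{1}" 0 "\<lambda>i \<omega>. X (\<tau> (Suc i)) \<omega> - X (\<tau> i) \<omega>"] iv by (simp add: \<tau>_def)
  have [measurable]: "X s \<in> borel_measurable P" "X u \<in> borel_measurable P" "X (s + u) \<in> borel_measurable P" "X 0 \<in> borel_measurable P"
    using s u by (auto intro!: stable_levyD(2)[OF X])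
  let ?A = "\<lambda>\<omega>. X s \<omega> - X 0 \<omega>" and ?B = "\<lambda>\<omega>. X (s + u) \<omega> - X s \<omega>"
  have dB: "distr P borel ?B = distr P borel (X u)" by (rule stable_levyD(5)[OF X s u])
  have A: "AE \<omega> in P. ?A \<omega> = X s \<omega>" using stable_levyD(3)[OF X] by eventually_elim simp
  interpret A: prob_space "distr P borel ?A" by (rule P.prob_space_distr) measurable
  interpret B: prob_space "distr P borel ?B" by (rule P.prob_space_distr) measurable
  interpret AB: pair_prob_space "distr P borel ?A" "distr P borel ?B" ..
  have C0: "0 \<le> C" using C(1)[of 0] by auto
  have gh: "\<bar>g v * h w\<bar> \<le> C * C" for v w unfolding abs_mult using C C0 by (intro mult_mono) auto
  have "(LINT \<omega>|P. g (X s \<omega>) * h (X (s + u) \<omega>)) = (LINT \<omega>|P. g (?A \<omega>) * h (?A \<omega> + ?B \<omega>))"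
    using A by (intro integral_cong_AE) auto
  also have "\<dots> = (LINT p|distr P (borel \<Otimes>\<^sub>M borel) (\<lambda>\<omega>. (?A \<omega>, ?B \<omega>)). g (fst p) * h (fst p + snd p))"
    by (subst integral_distr) auto
  also have "distr P (borel \<Otimes>\<^sub>M borel) (\<lambda>\<omega>. (?A \<omega>, ?B \<omega>)) = distr P borel ?A \<Otimes>\<^sub>M distr P borel ?B"
    using ind unfolding P.indep_var_distribution_eq by simp
  also have "(LINT p|(distr P borel ?A \<Otimes>\<^sub>M distr P borel ?B). g (fst p) * h (fst p + snd p)) =
      (LINT v|distr P borel ?A. LINT w|distr P borel ?B. g (fst (v, w)) * h (fst (v, w) + snd (v, w)))"
  proof (rule AB.integral_fst'[symmetric])
    show "integrable (distr P borel ?A \<Otimes>\<^sub>M distr P borel ?B) (\<lambda>p. g (fst p) * h (fst p + snd p))"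
      by (rule AB.integrable_const_bound[where B="C * C"]) (use gh in auto)
  qed
  also have "\<dots> = (LINT v|distr P borel ?A. g v * (LINT \<omega>'|P. h (v + X u \<omega>')))"
    unfolding dB by (simp add: integral_distr)
  also have "\<dots> = (LINT \<omega>|P. g (?A \<omega>) * (LINT \<omega>'|P. h (?A \<omega> + X u \<omega>')))"
    by (subst integral_distr) auto
  also have "\<dots> = (LINT \<omega>|P. g (X s \<omega>) * (LINT \<omega>'|P. h (X s \<omega> + X u \<omega>')))"
    using A by (intro integral_cong_AE) auto
  finally show ?thesis .
qed

text \<open>Off-diagonal pairs are indexed by the earlier position \<open>k\<close> and the lag m +
  1, the form in which one conditions on the earlier value.\<close>

lemma square_sum_eq:
  fixes a :: "nat \<Rightarrow> real"
  shows "(\<Sum>k<N. a k)\<^sup>2 = (\<Sum>k<N. (a k)\<^sup>2 + 2 * (\<Sum>m<N - Suc k. a k * a (Suc (k + m))))"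
proof (induction N)
  case (Suc N)
  have "(\<Sum>m<Suc N - Suc k. a k * a (Suc (k + m))) = (\<Sum>m<N - Suc k. a k * a (Suc (k + m))) + a k * a N" if "k < N" for k
  proof -
    have "Suc N - Suc k = Suc (N - Suc k)" "Suc (k + (N - Suc k)) = N" using that by auto
    then show ?thesis by simp
  qed
  then have "(\<Sum>k<N. (a k)\<^sup>2 + 2 * (\<Sum>m<Suc N - Suc k. a k * a (Suc (k + m)))) =
     (\<Sum>k<N. ((a k)\<^sup>2 + 2 * (\<Sum>m<N - Suc k. a k * a (Suc (k + m)))) + 2 * a N * a k)"
    by (intro sum.cong) (auto simp: algebra_simps)
  also have "\<dots> = (\<Sum>k<N. a k)\<^sup>2 + 2 * a N * (\<Sum>k<N. a k)"
    unfolding sum.distrib[of _ "\<lambda>k. 2 * a N * a k"] Suc.IH sum_distrib_left by simp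
  finally show ?case by (simp add: power2_eq_square algebra_simps)
qed simp

text \<open>The diagonal contributes the factor \<delta>C. Off the diagonal, conditioning on the
  value at the earlier time replaces the later sum by its expectation from that starting point,
  bounded by \<open>B\<close> uniformly, so that a first absolute moment remains.\<close>

lemma stable_levy_second_moment:
  fixes g :: "real \<Rightarrow> real"
  assumes X: "stable_levy P \<sigma> \<beta> X" and \<delta>: "0 < \<delta>"
    and [measurable]: "g \<in> borel_measurable borel" and C: "\<And>v. \<bar>g v\<bar> \<le> C"
    and B: "\<And>K z. \<bar>\<Sum>m<K. \<delta> * (LINT \<omega>|P. g (z + X (real (Suc m) * \<delta>) \<omega>))\<bar> \<le> B"
  shows "(LINT \<omega>|P. (\<delta> * (\<Sum>k<N. g (X (real (Suc k) * \<delta>) \<omega>)))\<^sup>2) \<le>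
     (\<delta> * C + 2 * B) * (\<Sum>k<N. \<delta> * (LINT \<omega>|P. \<bar>g (X (real (Suc k) * \<delta>) \<omega>)\<bar>))"
proof -
  interpret P: prob_space P by (rule stable_levyD[OF X])
  let ?T = "\<lambda>k. real (Suc k) * \<delta>"
  let ?a = "\<lambda>k \<omega>. g (X (?T k) \<omega>)"
  have T: "0 \<le> ?T k" for k using \<delta> by simp
  have mX[measurable]: "X (?T k) \<in> borel_measurable P" for k by (rule stable_levyD(2)[OF X T])
  have C0: "0 \<le> C" using C[of 0] by auto
  have i1: "integrable P (\<lambda>\<omega>. \<bar>?a k \<omega>\<bar>)" for k
    by (rule P.integrable_const_bound[where B=C]) (auto simp: C simp del: of_nat_Suc)
  have gg: "\<bar>g v * g w\<bar> \<le> C * C" for v w unfolding abs_mult using C C0 by (intro mult_mono) auto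
  have i2: "integrable P (\<lambda>\<omega>. ?a k \<omega> * ?a l \<omega>)" for k l
    by (rule P.integrable_const_bound[where B="C * C"]) (auto simp: gg simp del: of_nat_Suc)
  have i2': "integrable P (\<lambda>\<omega>. (?a k \<omega>)\<^sup>2)" for k using i2[of k k] by (simp add: power2_eq_square)
  define G where "G = (\<lambda>m v. LINT \<omega>'|P. g (v + X (?T m) \<omega>'))"
  have Gb: "\<bar>G m v\<bar> \<le> C" for m v
  proof -
    have "\<bar>G m v\<bar> \<le> (LINT \<omega>'|P. C)"
      unfolding real_norm_def[symmetric] G_def
      by (rule order_trans[OF integral_norm_bound integral_mono])
        (auto intro!: P.integrable_const_bound[where B=C] simp: C simp del: of_nat_Suc)
    then show ?thesis by (simp add: P.prob_space)
  qed
  have mG[measurable]: "G m \<in> borel_measurable borel" for m unfolding G_def by measurable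
  have iG: "integrable P (\<lambda>\<omega>. ?a k \<omega> * G m (X (?T k) \<omega>))" for k m
  proof (rule P.integrable_const_bound[where B="C * C"])
    have "\<bar>g v * G m v\<bar> \<le> C * C" for v unfolding abs_mult using C C0 Gb by (intro mult_mono) auto
    then show "AE \<omega> in P. norm (?a k \<omega> * G m (X (?T k) \<omega>)) \<le> C * C" by (auto simp del: of_nat_Suc)
  qed (intro borel_measurable_times measurable_compose[OF mX mG]; measurable)
  have cross: "\<delta> * (\<Sum>m<K. LINT \<omega>|P. ?a k \<omega> * ?a (Suc (k + m)) \<omega>) \<le> B * (LINT \<omega>|P. \<bar>?a k \<omega>\<bar>)" for k K
  proof -
    have "(LINT \<omega>|P. ?a k \<omega> * ?a (Suc (k + m)) \<omega>) = (LINT \<omega>|P. ?a k \<omega> * G m (X (?T k) \<omega>))" for m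
    proof -
      have "?T (Suc (k + m)) = ?T k + ?T m" by (simp add: algebra_simps)
      then show ?thesis unfolding G_def by (simp only:) (rule stable_levy_two_point[OF X T T _ _ C C]; measurable)
    qed
    then have "\<delta> * (\<Sum>m<K. LINT \<omega>|P. ?a k \<omega> * ?a (Suc (k + m)) \<omega>) = (\<Sum>m<K. \<delta> * (LINT \<omega>|P. ?a k \<omega> * G m (X (?T k) \<omega>)))"
      by (simp only: sum_distrib_left)
    also have "\<dots> = (LINT \<omega>|P. (\<Sum>m<K. \<delta> * (?a k \<omega> * G m (X (?T k) \<omega>))))"
      by (simp only: integral_mult_right_zero[symmetric]) (rule Bochner_Integration.integral_sum[symmetric], intro integrable_mult_right iG)
    also have "\<dots> = (LINT \<omega>|P. ?a k \<omega> * (\<Sum>m<K. \<delta> * G m (X (?T k) \<omega>)))"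
      by (simp only: sum_distrib_left mult.left_commute)
    also have "\<dots> \<le> (LINT \<omega>|P. B * \<bar>?a k \<omega>\<bar>)"
    proof (rule integral_mono)
      show "integrable P (\<lambda>\<omega>. ?a k \<omega> * (\<Sum>m<K. \<delta> * G m (X (?T k) \<omega>)))"
        by (simp only: sum_distrib_left mult.left_commute[of _ \<delta>]) (intro Bochner_Integration.integrable_sum integrable_mult_right iG)
      show "integrable P (\<lambda>\<omega>. B * \<bar>?a k \<omega>\<bar>)" by (intro integrable_mult_right i1)
      fix \<omega>
      \<comment> \<open>The absolute value is placed outside the sum over \<open>m\<close>:
        \<open>B\<close> bounds the signed sum, where terms may cancel.\<close>
      have "?a k \<omega> * (\<Sum>m<K. \<delta> * G m (X (?T k) \<omega>)) \<le> \<bar>?a k \<omega>\<bar> * \<bar>\<Sum>m<K. \<delta> * G m (X (?T k) \<omega>)\<bar>"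
        unfolding abs_mult[symmetric] by (rule abs_ge_self)
      also have "\<dots> \<le> \<bar>?a k \<omega>\<bar> * B" unfolding G_def by (intro mult_left_mono B) auto
      finally show "?a k \<omega> * (\<Sum>m<K. \<delta> * G m (X (?T k) \<omega>)) \<le> B * \<bar>?a k \<omega>\<bar>" by (simp only: mult.commute)
    qed
    also have "\<dots> = B * (LINT \<omega>|P. \<bar>?a k \<omega>\<bar>)" by (rule integral_mult_right_zero)
    finally show ?thesis .
  qed
  have sq: "(LINT \<omega>|P. (?a k \<omega>)\<^sup>2) \<le> C * (LINT \<omega>|P. \<bar>?a k \<omega>\<bar>)" for k
  proof -
    have "(LINT \<omega>|P. (?a k \<omega>)\<^sup>2) \<le> (LINT \<omega>|P. C * \<bar>?a k \<omega>\<bar>)"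
    proof (rule integral_mono[OF i2' integrable_mult_right[OF i1]])
      fix \<omega>
      have "(?a k \<omega>)\<^sup>2 = \<bar>?a k \<omega>\<bar> * \<bar>?a k \<omega>\<bar>" by (simp only: power2_eq_square abs_mult_self_eq)
      also have "\<dots> \<le> C * \<bar>?a k \<omega>\<bar>" by (intro mult_right_mono C) auto
      finally show "(?a k \<omega>)\<^sup>2 \<le> C * \<bar>?a k \<omega>\<bar>" .
    qed
    then show ?thesis by (simp only: integral_mult_right_zero)
  qed
  have "(LINT \<omega>|P. (\<delta> * (\<Sum>k<N. ?a k \<omega>))\<^sup>2) = \<delta>\<^sup>2 * (LINT \<omega>|P. (\<Sum>k<N. (?a k \<omega>)\<^sup>2 + 2 * (\<Sum>m<N - Suc k. ?a k \<omega> * ?a (Suc (k + m)) \<omega>)))"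
    by (simp only: power_mult_distrib integral_mult_right_zero square_sum_eq)
  also have "(LINT \<omega>|P. (\<Sum>k<N. (?a k \<omega>)\<^sup>2 + 2 * (\<Sum>m<N - Suc k. ?a k \<omega> * ?a (Suc (k + m)) \<omega>))) =
     (\<Sum>k<N. (LINT \<omega>|P. (?a k \<omega>)\<^sup>2) + 2 * (\<Sum>m<N - Suc k. LINT \<omega>|P. ?a k \<omega> * ?a (Suc (k + m)) \<omega>))"
  proof (subst Bochner_Integration.integral_sum)
    have j: "integrable P (\<lambda>\<omega>. 2 * (\<Sum>m<N - Suc k. ?a k \<omega> * ?a (Suc (k + m)) \<omega>))" for k
      by (intro integrable_mult_right Bochner_Integration.integrable_sum i2)
    show "integrable P (\<lambda>\<omega>. (?a k \<omega>)\<^sup>2 + 2 * (\<Sum>m<N - Suc k. ?a k \<omega> * ?a (Suc (k + m)) \<omega>))" for k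
      by (intro Bochner_Integration.integrable_add i2' j)
    show "(\<Sum>k<N. LINT \<omega>|P. (?a k \<omega>)\<^sup>2 + 2 * (\<Sum>m<N - Suc k. ?a k \<omega> * ?a (Suc (k + m)) \<omega>)) =
      (\<Sum>k<N. (LINT \<omega>|P. (?a k \<omega>)\<^sup>2) + 2 * (\<Sum>m<N - Suc k. LINT \<omega>|P. ?a k \<omega> * ?a (Suc (k + m)) \<omega>))"
      by (intro sum.cong refl) (simp only: Bochner_Integration.integral_add[OF i2' j] integral_mult_right_zero Bochner_Integration.integral_sum[OF i2])
  qed
  also have "\<delta>\<^sup>2 * \<dots> = (\<Sum>k<N. \<delta> * (\<delta> * (LINT \<omega>|P. (?a k \<omega>)\<^sup>2) + 2 * (\<delta> * (\<Sum>m<N - Suc k. LINT \<omega>|P. ?a k \<omega> * ?a (Suc (k + m)) \<omega>))))"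
    unfolding sum_distrib_left[of "\<delta>\<^sup>2"] by (intro sum.cong refl) (simp add: power2_eq_square algebra_simps)
  also have "\<dots> \<le> (\<Sum>k<N. \<delta> * (\<delta> * (C * (LINT \<omega>|P. \<bar>?a k \<omega>\<bar>)) + 2 * (B * (LINT \<omega>|P. \<bar>?a k \<omega>\<bar>))))"
    using \<delta> by (intro sum_mono mult_left_mono add_mono cross sq) auto
  also have "\<dots> = (\<delta> * C + 2 * B) * (\<Sum>k<N. \<delta> * (LINT \<omega>|P. \<bar>?a k \<omega>\<bar>))"
    unfolding sum_distrib_left by (intro sum.cong refl) (simp add: algebra_simps)
  finally show ?thesis .
qed

section \<open>Weighted energy of the local time\<close>

text \<open>The bound for E|X_s| grows like (\<sigma>s)^(1/\<beta>), so its value at the end of the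
  interval serves for all s. These moments pay for the weight 1 + |x|.\<close>

lemma stable_levy_abs_moment:
  assumes \<beta>: "1 < \<beta>" "\<beta> < 2" and \<sigma>: "0 < \<sigma>" and X: "stable_levy P \<sigma> \<beta> X"
  shows "\<exists>m\<ge>0. \<forall>s. 0 \<le> s \<and> s \<le> t \<longrightarrow> (\<integral>\<^sup>+\<omega>. ennreal \<bar>X s \<omega>\<bar> \<partial>P) \<le> ennreal m"
proof -
  interpret P: prob_space P by (rule stable_levyD[OF X])
  obtain K where K0: "K \<ge> 0" and K: "\<forall>A\<ge>0. \<forall>N::real measure. real_distribution N \<longrightarrow>
    (\<forall>\<theta>. char N \<theta> = complex_of_real (exp (- A * \<bar>\<theta>\<bar> powr \<beta>))) \<longrightarrow>
    (\<integral>\<^sup>+x. ennreal \<bar>x\<bar> \<partial>N) \<le> ennreal (K * A powr (1 / \<beta>))"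
    using stable_abs_moment[OF \<beta>] by blast
  show ?thesis
  proof (intro exI[of _ "K * (\<sigma> * \<bar>t\<bar>) powr (1 / \<beta>)"] conjI allI impI)
    fix s assume s: "0 \<le> s \<and> s \<le> t"
    have [measurable]: "X s \<in> borel_measurable P" using s by (intro stable_levyD(2)[OF X]) auto
    have "(\<integral>\<^sup>+\<omega>. ennreal \<bar>X s \<omega>\<bar> \<partial>P) = (\<integral>\<^sup>+x. ennreal \<bar>x\<bar> \<partial>distr P borel (X s))"
      by (subst nn_integral_distr) auto
    also have "\<dots> \<le> ennreal (K * (\<sigma> * s) powr (1 / \<beta>))"
      using s \<sigma> stable_levyD(6)[OF X, of s] by (intro K[rule_format] P.real_distribution_distr) auto
    also have "\<dots> \<le> ennreal (K * (\<sigma> * \<bar>t\<bar>) powr (1 / \<beta>))"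
      using s \<sigma> \<beta> K0 by (intro ennreal_leI mult_left_mono powr_mono2) auto
    finally show "(\<integral>\<^sup>+\<omega>. ennreal \<bar>X s \<omega>\<bar> \<partial>P) \<le> ennreal (K * (\<sigma> * \<bar>t\<bar>) powr (1 / \<beta>))" .
  qed (use K0 in auto)
qed

text \<open>With x = v - a - u/(n + 1) the weight is at most 2 + |v| + |u|, the kernel becomes the
  standard normal density, and the mean of |u| is sqrt(2/pi) \<le> 1; hence the constant 3.\<close>

lemma nn_integral_weight_gauss_kernel:
  assumes a: "\<bar>a\<bar> \<le> 1"
  shows "(\<integral>\<^sup>+x. ennreal ((1 + \<bar>x\<bar>) * gauss_kernel n (v - x - a)) \<partial>lborel) \<le> ennreal (3 + \<bar>v\<bar>)"
proof -
  let ?N = "real (Suc n)"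
  have "(\<integral>\<^sup>+x. ennreal ((1 + \<bar>x\<bar>) * gauss_kernel n (v - x - a)) \<partial>lborel) =
     ennreal \<bar>- (1 / ?N)\<bar> * (\<integral>\<^sup>+u. ennreal ((1 + \<bar>(v - a) + (- (1 / ?N)) * u\<bar>) * gauss_kernel n (v - ((v - a) + (- (1 / ?N)) * u) - a)) \<partial>lborel)"
    by (rule nn_integral_real_affine) (simp, simp del: of_nat_Suc)
  also have "\<dots> = (\<integral>\<^sup>+u. ennreal (1 / ?N) * ennreal ((1 + \<bar>(v - a) + (- (1 / ?N)) * u\<bar>) * gauss_kernel n (v - ((v - a) + (- (1 / ?N)) * u) - a)) \<partial>lborel)"
    by (subst nn_integral_cmult) (auto simp del: of_nat_Suc)
  also have "\<dots> \<le> (\<integral>\<^sup>+u. ennreal ((2 + \<bar>v\<bar>) * std_normal_density u + std_normal_density u * \<bar>u\<bar>) \<partial>lborel)"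
  proof (rule nn_integral_mono)
    fix u
    have k: "gauss_kernel n (v - ((v - a) + (- (1 / ?N)) * u) - a) = ?N * std_normal_density u"
      by (simp add: gauss_kernel_def del: of_nat_Suc)
    have "\<bar>(v - a) + (- (1 / ?N)) * u\<bar> \<le> \<bar>v\<bar> + \<bar>a\<bar> + \<bar>(1 / ?N) * u\<bar>" by linarith
    also have "\<bar>(1 / ?N) * u\<bar> \<le> 1 * \<bar>u\<bar>" unfolding abs_mult by (intro mult_right_mono) auto
    finally have "1 + \<bar>(v - a) + (- (1 / ?N)) * u\<bar> \<le> 2 + \<bar>v\<bar> + \<bar>u\<bar>" using a by simp
    then have "(1 + \<bar>(v - a) + (- (1 / ?N)) * u\<bar>) * std_normal_density u \<le> (2 + \<bar>v\<bar> + \<bar>u\<bar>) * std_normal_density u"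
      by (intro mult_right_mono) auto
    then have "(1 + \<bar>(v - a) + (- (1 / ?N)) * u\<bar>) * std_normal_density u \<le> (2 + \<bar>v\<bar>) * std_normal_density u + std_normal_density u * \<bar>u\<bar>"
      by (simp only: distrib_right mult.commute[of _ "\<bar>u\<bar>"])
    moreover have "ennreal (1 / ?N) * ennreal (w * (?N * std_normal_density u)) = ennreal (w * std_normal_density u)" if "0 \<le> w" for w
      using that by (subst ennreal_mult[symmetric]) (auto simp del: of_nat_Suc)
    ultimately show "ennreal (1 / ?N) * ennreal ((1 + \<bar>(v - a) + (- (1 / ?N)) * u\<bar>) * gauss_kernel n (v - ((v - a) + (- (1 / ?N)) * u) - a))
       \<le> ennreal ((2 + \<bar>v\<bar>) * std_normal_density u + std_normal_density u * \<bar>u\<bar>)"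
      unfolding k using ennreal_leI abs_ge_zero add_nonneg_nonneg zero_le_one by metis
  qed
  also have "\<dots> = ennreal (LINT u|lborel. (2 + \<bar>v\<bar>) * std_normal_density u + std_normal_density u * \<bar>u\<bar>)"
    using integrable_std_normal_moment_abs[of 1] by (intro nn_integral_eq_integral) (auto intro!: AE_I2 add_nonneg_nonneg)
  also have "(LINT u|lborel. (2 + \<bar>v\<bar>) * std_normal_density u + std_normal_density u * \<bar>u\<bar>) = (2 + \<bar>v\<bar>) + sqrt (2 / pi)"
    using integrable_std_normal_moment_abs[of 1] integral_std_normal_moment_abs_odd[of 0] by simp
  also have "\<dots> \<le> ennreal (3 + \<bar>v\<bar>)"
  proof (rule ennreal_leI)
    have "2 / pi \<le> 1" using pi_gt3 by simp
    then have "sqrt (2 / pi) \<le> 1" using real_sqrt_le_1_iff by blast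
    then show "(2 + \<bar>v\<bar>) + sqrt (2 / pi) \<le> 3 + \<bar>v\<bar>" by simp
  qed
  finally show ?thesis .
qed

text \<open>Fatou in \<open>x\<close> for almost every \<omega> and once more in \<omega>: an
  iterated bound survives a pointwise limit without a dominating function.\<close>

lemma nn_integral_fatou_iterated:
  fixes u :: "nat \<Rightarrow> 'a \<Rightarrow> real \<Rightarrow> real" and c :: "nat \<Rightarrow> real"
  assumes u: "\<And>n. (\<lambda>(\<omega>, x). u n \<omega> x) \<in> borel_measurable (P \<Otimes>\<^sub>M lborel)"
    and lim: "AE \<omega> in P. \<forall>x. (\<lambda>n. u n \<omega> x) \<longlonglongrightarrow> v \<omega> x"
    and le: "\<And>n. (\<integral>\<^sup>+\<omega>. \<integral>\<^sup>+x. ennreal (u n \<omega> x) \<partial>lborel \<partial>P) \<le> ennreal (c n)" and c: "c \<longlonglongrightarrow> d"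
  shows "(\<integral>\<^sup>+\<omega>. \<integral>\<^sup>+x. ennreal (v \<omega> x) \<partial>lborel \<partial>P) \<le> ennreal d"
proof -
  have [measurable]: "(\<lambda>\<omega>. \<integral>\<^sup>+x. ennreal (u n \<omega> x) \<partial>lborel) \<in> borel_measurable P" for n
    using measurable_compose[OF u measurable_ennreal, of n]
    by (intro lborel.borel_measurable_nn_integral) (simp add: split_beta')
  have "(\<integral>\<^sup>+\<omega>. \<integral>\<^sup>+x. ennreal (v \<omega> x) \<partial>lborel \<partial>P) \<le> (\<integral>\<^sup>+\<omega>. liminf (\<lambda>n. \<integral>\<^sup>+x. ennreal (u n \<omega> x) \<partial>lborel) \<partial>P)"
  proof (rule nn_integral_mono_AE)
    show "AE \<omega> in P. (\<integral>\<^sup>+x. ennreal (v \<omega> x) \<partial>lborel) \<le> liminf (\<lambda>n. \<integral>\<^sup>+x. ennreal (u n \<omega> x) \<partial>lborel)"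
      using lim AE_space
    proof eventually_elim
      case (elim \<omega>)
      have "(\<lambda>x. u n \<omega> x) \<in> borel_measurable lborel" for n
        using measurable_Pair2[OF u elim(2), of n] by simp
      then have m: "(\<lambda>x. ennreal (u n \<omega> x)) \<in> borel_measurable lborel" for n by measurable
      have "(\<integral>\<^sup>+x. ennreal (v \<omega> x) \<partial>lborel) = (\<integral>\<^sup>+x. liminf (\<lambda>n. ennreal (u n \<omega> x)) \<partial>lborel)"
        using elim(1) by (intro nn_integral_cong lim_imp_Liminf[symmetric] tendsto_ennrealI) auto
      also have "\<dots> \<le> liminf (\<lambda>n. \<integral>\<^sup>+x. ennreal (u n \<omega> x) \<partial>lborel)" by (rule nn_integral_liminf[OF m])
      finally show ?case .
    qed
  qed
  also have "\<dots> \<le> liminf (\<lambda>n. \<integral>\<^sup>+\<omega>. \<integral>\<^sup>+x. ennreal (u n \<omega> x) \<partial>lborel \<partial>P)" by (rule nn_integral_liminf) measurable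
  also have "\<dots> \<le> liminf (\<lambda>n. ennreal (c n))" using le by (intro Liminf_mono always_eventually allI)
  also have "\<dots> = ennreal d" using c by (intro lim_imp_Liminf tendsto_ennrealI) auto
  finally show ?thesis .
qed

text \<open>For each \<open>x\<close> the second-moment bound is applied to the difference of the
  mollifiers at x + a and x + b, with a constant free of \<open>x\<close>; integrating with the
  weight leaves first absolute moments of \<open>X\<close>, at most \<open>m\<close>. The summand
  with n + 1 stems from the diagonal and carries the mesh t/(N + 1).\<close>

lemma stable_levy_discrete_energy:
  assumes X: "stable_levy P \<sigma> \<beta> X" and \<sigma>: "0 < \<sigma>" and \<beta>: "1 < \<beta>" "\<beta> < 2"
    and t: "0 \<le> t" and m: "0 \<le> m" "\<And>s. 0 \<le> s \<Longrightarrow> s \<le> t \<Longrightarrow> (\<integral>\<^sup>+\<omega>. ennreal \<bar>X s \<omega>\<bar> \<partial>P) \<le> ennreal m"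
    and ab: "\<bar>a\<bar> \<le> 1" "\<bar>b\<bar> \<le> 1"
  defines "B \<equiv> riesz_const \<beta> / \<sigma> * \<bar>a - b\<bar> powr (\<beta> - 1)"
  shows "(\<integral>\<^sup>+\<omega>. \<integral>\<^sup>+x. ennreal ((1 + \<bar>x\<bar>) * (t / real (Suc N) * (\<Sum>k\<le>N. gauss_kernel n (X (t * real (Suc k) / real (Suc N)) \<omega> - x - a) - gauss_kernel n (X (t * real (Suc k) / real (Suc N)) \<omega> - x - b)))\<^sup>2) \<partial>lborel \<partial>P)
    \<le> ennreal ((t / real (Suc N) * real (Suc n) + 2 * B) * (t * (2 * (3 + m))))"
proof (cases "t = 0")
  case False
  define \<delta> where "\<delta> = t / real (Suc N)"
  have \<delta>: "0 < \<delta>" using False t by (simp add: \<delta>_def)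
  interpret P: prob_space P by (rule stable_levyD[OF X])
  interpret pair_sigma_finite P lborel ..
  let ?T = "\<lambda>k. real (Suc k) * \<delta>"
  have T0: "0 \<le> ?T k" for k using \<delta> by simp
  have T: "t * real (Suc k) / real (Suc N) = ?T k" for k by (simp add: \<delta>_def)
  have Tt: "?T k \<le> t" if "k \<le> N" for k
  proof -
    have "?T k \<le> real (Suc N) * \<delta>" using that \<delta> by (intro mult_right_mono) auto
    then show ?thesis by (simp add: \<delta>_def)
  qed
  have mX[measurable]: "X (?T k) \<in> borel_measurable P" for k by (rule stable_levyD(2)[OF X T0])
  have B0: "0 \<le> B" unfolding B_def using \<sigma> by (intro mult_nonneg_nonneg divide_nonneg_pos riesz_const_nonneg) auto
  define A where "A = \<delta> * real (Suc n) + 2 * B"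
  have A0: "0 \<le> A" using \<delta> B0 by (auto simp: A_def)
  define g where "g = (\<lambda>x v. gauss_kernel n (v - x - a) - gauss_kernel n (v - x - b))"
  have [measurable]: "g x \<in> borel_measurable borel" for x unfolding g_def by measurable
  have gC: "\<bar>g x v\<bar> \<le> real (Suc n)" for x v
    using gauss_kernel_nonneg[of n "v - x - a"] gauss_kernel_nonneg[of n "v - x - b"]
      gauss_kernel_le[of n "v - x - a"] gauss_kernel_le[of n "v - x - b"] unfolding g_def by linarith
  \<comment> \<open>The starting point \<open>z\<close> merely moves both centres and keeps their
    distance, so the potential bound is uniform in \<open>z\<close> and \<open>x\<close>.\<close>
  have gB: "\<bar>\<Sum>m<K. \<delta> * (LINT \<omega>|P. g x (z + X (?T m) \<omega>))\<bar> \<le> B" for K z x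
  proof -
    have "g x (z + X (?T m) \<omega>) = gauss_kernel n (X (?T m) \<omega> + (z - x - a)) - gauss_kernel n (X (?T m) \<omega> + (z - x - b))" for m \<omega>
      unfolding g_def by (simp only: add.commute[of z] add_diff_eq)
    then show ?thesis
      using stable_levy_potential_bound[OF X \<sigma> \<beta> \<delta>, where K=K and n=n and a="z - x - a" and b="z - x - b"] by (simp add: B_def abs_minus_commute del: of_nat_Suc)
  qed
  let ?Z = "\<lambda>\<omega> x. \<delta> * (\<Sum>k<Suc N. g x (X (?T k) \<omega>))"
  have mu: "(\<lambda>(\<omega>, x). ennreal (1 + \<bar>x\<bar>) * ennreal ((?Z \<omega> x)\<^sup>2)) \<in> borel_measurable (P \<Otimes>\<^sub>M lborel)"
    unfolding g_def by measurable
  have mg: "(\<lambda>(\<omega>, x). ennreal (1 + \<bar>x\<bar>) * ennreal \<bar>g x (X (?T k) \<omega>)\<bar>) \<in> borel_measurable (P \<Otimes>\<^sub>M lborel)" for k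
    unfolding g_def by measurable
  have sec: "(\<integral>\<^sup>+\<omega>. ennreal ((?Z \<omega> x)\<^sup>2) \<partial>P) \<le> ennreal A * (\<Sum>k<Suc N. ennreal \<delta> * (\<integral>\<^sup>+\<omega>. ennreal \<bar>g x (X (?T k) \<omega>)\<bar> \<partial>P))" for x
  proof -
    have i: "integrable P (\<lambda>\<omega>. (?Z \<omega> x)\<^sup>2)"
    proof (rule P.integrable_const_bound[where B="(\<delta> * (\<Sum>k<Suc N. real (Suc n)))\<^sup>2"])
      have "\<bar>?Z \<omega> x\<bar> \<le> \<delta> * (\<Sum>k<Suc N. real (Suc n))" for \<omega>
        unfolding abs_mult using \<delta> gC by (intro mult_mono order_trans[OF sum_abs] sum_mono) auto
      then have "(?Z \<omega> x)\<^sup>2 \<le> (\<delta> * (\<Sum>k<Suc N. real (Suc n)))\<^sup>2" for \<omega>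
        by (intro abs_le_square_iff[THEN iffD1] order_trans[OF _ abs_ge_self])
      then show "AE \<omega> in P. norm ((?Z \<omega> x)\<^sup>2) \<le> (\<delta> * (\<Sum>k<Suc N. real (Suc n)))\<^sup>2"
        unfolding real_norm_def abs_power2 by (intro AE_I2)
    qed measurable
    have j: "integrable P (\<lambda>\<omega>. \<bar>g x (X (?T k) \<omega>)\<bar>)" for k
      by (rule P.integrable_const_bound[where B="real (Suc n)"]) (use gC in \<open>auto simp del: of_nat_Suc\<close>)
    have "(\<integral>\<^sup>+\<omega>. ennreal ((?Z \<omega> x)\<^sup>2) \<partial>P) = ennreal (LINT \<omega>|P. (?Z \<omega> x)\<^sup>2)"
      by (rule nn_integral_eq_integral[OF i]) auto
    also have "\<dots> \<le> ennreal (A * (\<Sum>k<Suc N. \<delta> * (LINT \<omega>|P. \<bar>g x (X (?T k) \<omega>)\<bar>)))"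
      unfolding A_def by (intro ennreal_leI stable_levy_second_moment[OF X \<delta> _ gC gB]) measurable
    also have "\<dots> = ennreal A * (\<Sum>k<Suc N. ennreal \<delta> * ennreal (LINT \<omega>|P. \<bar>g x (X (?T k) \<omega>)\<bar>))"
      using A0 \<delta> by (subst ennreal_mult) (auto intro!: sum_nonneg mult_nonneg_nonneg integral_nonneg_AE simp: sum_ennreal[symmetric] ennreal_mult simp del: of_nat_Suc sum.lessThan_Suc)
    also have "\<dots> = ennreal A * (\<Sum>k<Suc N. ennreal \<delta> * (\<integral>\<^sup>+\<omega>. ennreal \<bar>g x (X (?T k) \<omega>)\<bar> \<partial>P))"
      by (intro arg_cong2[where f="(*)"] refl sum.cong nn_integral_eq_integral[OF j, symmetric]) auto
    finally show ?thesis .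
  qed
  have gw: "(\<integral>\<^sup>+x. ennreal (1 + \<bar>x\<bar>) * ennreal \<bar>g x v\<bar> \<partial>lborel) \<le> ennreal (3 + \<bar>v\<bar>) + ennreal (3 + \<bar>v\<bar>)" for v
  proof -
    have "(\<integral>\<^sup>+x. ennreal (1 + \<bar>x\<bar>) * ennreal \<bar>g x v\<bar> \<partial>lborel) \<le>
       (\<integral>\<^sup>+x. ennreal ((1 + \<bar>x\<bar>) * gauss_kernel n (v - x - a)) + ennreal ((1 + \<bar>x\<bar>) * gauss_kernel n (v - x - b)) \<partial>lborel)"
    proof (rule nn_integral_mono)
      fix x
      have "\<bar>g x v\<bar> \<le> gauss_kernel n (v - x - a) + gauss_kernel n (v - x - b)"
        unfolding g_def using gauss_kernel_nonneg[of n "v - x - a"] gauss_kernel_nonneg[of n "v - x - b"] by linarith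
      then have "(1 + \<bar>x\<bar>) * \<bar>g x v\<bar> \<le> (1 + \<bar>x\<bar>) * gauss_kernel n (v - x - a) + (1 + \<bar>x\<bar>) * gauss_kernel n (v - x - b)"
        unfolding distrib_left[symmetric] by (intro mult_left_mono) auto
      then show "ennreal (1 + \<bar>x\<bar>) * ennreal \<bar>g x v\<bar> \<le> ennreal ((1 + \<bar>x\<bar>) * gauss_kernel n (v - x - a)) + ennreal ((1 + \<bar>x\<bar>) * gauss_kernel n (v - x - b))"
        by (simp add: ennreal_mult[symmetric] ennreal_plus[symmetric] gauss_kernel_nonneg ennreal_leI del: ennreal_plus)
    qed
    also have "\<dots> = (\<integral>\<^sup>+x. ennreal ((1 + \<bar>x\<bar>) * gauss_kernel n (v - x - a)) \<partial>lborel) + (\<integral>\<^sup>+x. ennreal ((1 + \<bar>x\<bar>) * gauss_kernel n (v - x - b)) \<partial>lborel)"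
      by (rule nn_integral_add) measurable
    also have "\<dots> \<le> ennreal (3 + \<bar>v\<bar>) + ennreal (3 + \<bar>v\<bar>)" by (intro add_mono nn_integral_weight_gauss_kernel ab)
    finally show ?thesis .
  qed
  have gX: "(\<integral>\<^sup>+\<omega>. \<integral>\<^sup>+x. ennreal (1 + \<bar>x\<bar>) * ennreal \<bar>g x (X (?T k) \<omega>)\<bar> \<partial>lborel \<partial>P) \<le> ennreal (2 * (3 + m))" if "k \<le> N" for k
  proof -
    have "(\<integral>\<^sup>+\<omega>. \<integral>\<^sup>+x. ennreal (1 + \<bar>x\<bar>) * ennreal \<bar>g x (X (?T k) \<omega>)\<bar> \<partial>lborel \<partial>P) \<le> (\<integral>\<^sup>+\<omega>. 2 * (3 + ennreal \<bar>X (?T k) \<omega>\<bar>) \<partial>P)"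
      by (intro nn_integral_mono order_trans[OF gw]) (simp add: mult_2)
    also have "\<dots> = 2 * (3 + (\<integral>\<^sup>+\<omega>. ennreal \<bar>X (?T k) \<omega>\<bar> \<partial>P))"
      by (simp add: nn_integral_cmult nn_integral_add P.emeasure_space_1 del: of_nat_Suc)
    also have "\<dots> \<le> 2 * (3 + ennreal m)" using m(2)[OF T0 Tt[OF that]] by (intro mult_left_mono add_left_mono) auto
    also have "\<dots> = ennreal 2 * (ennreal 3 + ennreal m)" by simp
    also have "\<dots> = ennreal (2 * (3 + m))" using m(1) by (subst ennreal_plus[symmetric], simp, simp, subst ennreal_mult[symmetric]) auto
    finally show ?thesis .
  qed
  have "(\<integral>\<^sup>+\<omega>. \<integral>\<^sup>+x. ennreal ((1 + \<bar>x\<bar>) * (?Z \<omega> x)\<^sup>2) \<partial>lborel \<partial>P) = (\<integral>\<^sup>+\<omega>. \<integral>\<^sup>+x. ennreal (1 + \<bar>x\<bar>) * ennreal ((?Z \<omega> x)\<^sup>2) \<partial>lborel \<partial>P)"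
    by (simp add: ennreal_mult del: of_nat_Suc)
  also have "\<dots> = (\<integral>\<^sup>+x. \<integral>\<^sup>+\<omega>. ennreal (1 + \<bar>x\<bar>) * ennreal ((?Z \<omega> x)\<^sup>2) \<partial>P \<partial>lborel)"
    by (rule Fubini'[OF mu, symmetric])
  also have "\<dots> = (\<integral>\<^sup>+x. ennreal (1 + \<bar>x\<bar>) * (\<integral>\<^sup>+\<omega>. ennreal ((?Z \<omega> x)\<^sup>2) \<partial>P) \<partial>lborel)"
    by (intro nn_integral_cong nn_integral_cmult) measurable
  also have "\<dots> \<le> (\<integral>\<^sup>+x. ennreal (1 + \<bar>x\<bar>) * (ennreal A * (\<Sum>k<Suc N. ennreal \<delta> * (\<integral>\<^sup>+\<omega>. ennreal \<bar>g x (X (?T k) \<omega>)\<bar> \<partial>P))) \<partial>lborel)"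
    by (intro nn_integral_mono mult_left_mono sec) auto
  also have "\<dots> = (\<integral>\<^sup>+x. ennreal A * (\<Sum>k<Suc N. ennreal \<delta> * (\<integral>\<^sup>+\<omega>. ennreal (1 + \<bar>x\<bar>) * ennreal \<bar>g x (X (?T k) \<omega>)\<bar> \<partial>P)) \<partial>lborel)"
  proof (intro nn_integral_cong)
    fix x
    have c: "(\<integral>\<^sup>+\<omega>. ennreal (1 + \<bar>x\<bar>) * ennreal \<bar>g x (X (?T k) \<omega>)\<bar> \<partial>P) = ennreal (1 + \<bar>x\<bar>) * (\<integral>\<^sup>+\<omega>. ennreal \<bar>g x (X (?T k) \<omega>)\<bar> \<partial>P)" for k
      by (rule nn_integral_cmult) measurable
    show "ennreal (1 + \<bar>x\<bar>) * (ennreal A * (\<Sum>k<Suc N. ennreal \<delta> * (\<integral>\<^sup>+\<omega>. ennreal \<bar>g x (X (?T k) \<omega>)\<bar> \<partial>P))) =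
      ennreal A * (\<Sum>k<Suc N. ennreal \<delta> * (\<integral>\<^sup>+\<omega>. ennreal (1 + \<bar>x\<bar>) * ennreal \<bar>g x (X (?T k) \<omega>)\<bar> \<partial>P))"
      unfolding c sum_distrib_left by (intro sum.cong refl) (simp only: mult_ac)
  qed
  also have "\<dots> = ennreal A * (\<Sum>k<Suc N. ennreal \<delta> * (\<integral>\<^sup>+x. \<integral>\<^sup>+\<omega>. ennreal (1 + \<bar>x\<bar>) * ennreal \<bar>g x (X (?T k) \<omega>)\<bar> \<partial>P \<partial>lborel))"
  proof -
    have [measurable]: "(\<lambda>x. \<integral>\<^sup>+\<omega>. ennreal (1 + \<bar>x\<bar>) * ennreal \<bar>g x (X (?T k) \<omega>)\<bar> \<partial>P) \<in> borel_measurable lborel" for k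
      unfolding g_def by measurable
    show ?thesis
      by (subst nn_integral_cmult, measurable, subst nn_integral_sum, measurable, subst nn_integral_cmult, measurable)
  qed
  also have "\<dots> = ennreal A * (\<Sum>k<Suc N. ennreal \<delta> * (\<integral>\<^sup>+\<omega>. \<integral>\<^sup>+x. ennreal (1 + \<bar>x\<bar>) * ennreal \<bar>g x (X (?T k) \<omega>)\<bar> \<partial>lborel \<partial>P))"
    by (simp only: Fubini'[OF mg])
  also have "\<dots> \<le> ennreal A * (\<Sum>k<Suc N. ennreal \<delta> * ennreal (2 * (3 + m)))"
    by (intro mult_left_mono sum_mono gX) auto
  also have "\<dots> = ennreal (A * (t * (2 * (3 + m))))"
  proof -
    have "(\<Sum>k<Suc N. ennreal \<delta> * ennreal (2 * (3 + m))) = ennreal (\<Sum>k<Suc N. \<delta> * (2 * (3 + m)))"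
      using \<delta> m(1) by (subst sum_ennreal[symmetric]) (auto simp: ennreal_mult simp del: sum.lessThan_Suc)
    also have "(\<Sum>k<Suc N. \<delta> * (2 * (3 + m))) = t * (2 * (3 + m))" by (simp add: \<delta>_def del: of_nat_Suc sum.lessThan_Suc)
    finally show ?thesis using A0 by (simp add: ennreal_mult')
  qed
  finally show ?thesis unfolding T g_def A_def \<delta>_def[symmetric] lessThan_Suc_atMost .
qed simp

text \<open>The order of limits is essential: refining the mesh for a fixed mollifier removes the
  diagonal term, which would grow with n otherwise. Removing the mollifier afterwards leaves the
  increment of the local time. Each limit costs one application of Fatou.\<close>

lemma local_time_energy:
  assumes X: "stable_levy P \<sigma> \<beta> X" and \<sigma>: "0 < \<sigma>" and \<beta>: "1 < \<beta>" "\<beta> < 2"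
    and rc: "AE \<omega> in P. right_continuous_path (\<lambda>s. X s \<omega>)" and L: "occupation_density P X L" and t: "0 \<le> t"
  shows "\<exists>C\<ge>0. \<forall>a b. \<bar>a\<bar> \<le> 1 \<longrightarrow> \<bar>b\<bar> \<le> 1 \<longrightarrow>
     (\<integral>\<^sup>+\<omega>. \<integral>\<^sup>+x. ennreal ((1 + \<bar>x\<bar>) * (L t (x + a) \<omega> - L t (x + b) \<omega>)\<^sup>2) \<partial>lborel \<partial>P) \<le> ennreal (C * \<bar>a - b\<bar> powr (\<beta> - 1))"
proof -
  interpret P: prob_space P by (rule stable_levyD[OF X])
  obtain m where m: "0 \<le> m" "\<And>s. 0 \<le> s \<Longrightarrow> s \<le> t \<Longrightarrow> (\<integral>\<^sup>+\<omega>. ennreal \<bar>X s \<omega>\<bar> \<partial>P) \<le> ennreal m"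
    using stable_levy_abs_moment[OF \<beta> \<sigma> X, of t] by auto
  define C where "C = 2 * (riesz_const \<beta> / \<sigma>) * (t * (2 * (3 + m)))"
  have "(\<integral>\<^sup>+\<omega>. \<integral>\<^sup>+x. ennreal ((1 + \<bar>x\<bar>) * (L t (x + a) \<omega> - L t (x + b) \<omega>)\<^sup>2) \<partial>lborel \<partial>P) \<le> ennreal (C * \<bar>a - b\<bar> powr (\<beta> - 1))"
    if ab: "\<bar>a\<bar> \<le> 1" "\<bar>b\<bar> \<le> 1" for a b
  proof -
    define B where "B = riesz_const \<beta> / \<sigma> * \<bar>a - b\<bar> powr (\<beta> - 1)"
    let ?g = "\<lambda>n x v. gauss_kernel n (v - x - a) - gauss_kernel n (v - x - b)"
    have gcont: "continuous_on UNIV (?g n x)" for n x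
    proof -
      have "continuous_on UNIV (\<lambda>v. gauss_kernel n (v - x - c))" for c
        by (rule continuous_on_compose2[OF gauss_kernel_continuous]) (auto intro!: continuous_intros)
      then show ?thesis by (intro continuous_on_diff)
    qed
    have gC: "\<bar>?g n x v\<bar> \<le> real (Suc n)" for n x v
      using gauss_kernel_nonneg[of n "v - x - a"] gauss_kernel_nonneg[of n "v - x - b"]
        gauss_kernel_le[of n "v - x - a"] gauss_kernel_le[of n "v - x - b"] by linarith
    have mL[measurable]: "(\<lambda>z. L t (fst z) (snd z)) \<in> borel_measurable (borel \<Otimes>\<^sub>M P)"
      by (rule occupation_density_joint_measurable[OF L t])
    \<comment> \<open>The limit in the mesh at fixed \<open>n\<close>; the summand with factor 0 is
      what remains of the diagonal.\<close>
    have step1: "(\<integral>\<^sup>+\<omega>. \<integral>\<^sup>+x. ennreal ((1 + \<bar>x\<bar>) * (LINT v|lborel. ?g n x v * L t v \<omega>)\<^sup>2) \<partial>lborel \<partial>P) \<le> ennreal ((0 * real (Suc n) + 2 * B) * (t * (2 * (3 + m))))" for n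
    proof (rule nn_integral_fatou_iterated[where u="\<lambda>N \<omega> x. (1 + \<bar>x\<bar>) * (t / real (Suc N) * (\<Sum>k\<le>N. ?g n x (X (t * real (Suc k) / real (Suc N)) \<omega>)))\<^sup>2"])
      fix N
      have [measurable]: "X (t * real (Suc k) / real (Suc N)) \<in> borel_measurable P" for k
        using t by (intro stable_levyD(2)[OF X]) auto
      show "(\<lambda>(\<omega>, x). (1 + \<bar>x\<bar>) * (t / real (Suc N) * (\<Sum>k\<le>N. ?g n x (X (t * real (Suc k) / real (Suc N)) \<omega>)))\<^sup>2) \<in> borel_measurable (P \<Otimes>\<^sub>M lborel)"
        by measurable
      show "(\<integral>\<^sup>+\<omega>. \<integral>\<^sup>+x. ennreal ((1 + \<bar>x\<bar>) * (t / real (Suc N) * (\<Sum>k\<le>N. ?g n x (X (t * real (Suc k) / real (Suc N)) \<omega>)))\<^sup>2) \<partial>lborel \<partial>P)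
         \<le> ennreal ((t / real (Suc N) * real (Suc n) + 2 * B) * (t * (2 * (3 + m))))"
        unfolding B_def by (rule stable_levy_discrete_energy[OF X \<sigma> \<beta> t m ab])
    next
      show "AE \<omega> in P. \<forall>x. (\<lambda>N. (1 + \<bar>x\<bar>) * (t / real (Suc N) * (\<Sum>k\<le>N. ?g n x (X (t * real (Suc k) / real (Suc N)) \<omega>)))\<^sup>2) \<longlonglongrightarrow> (1 + \<bar>x\<bar>) * (LINT v|lborel. ?g n x v * L t v \<omega>)\<^sup>2"
        using rc occupation_densityD(4)[OF L t]
      proof eventually_elim
        case (elim \<omega>)
        show ?case
        proof
          fix x
          have "(LINT v|lborel. ?g n x v * L t v \<omega>) = (LINT u:{0..t}|lborel. ?g n x (X u \<omega>))"
            by (rule elim(2)[THEN conjunct2, THEN conjunct2, rule_format, symmetric, of "?g n x" "real (Suc n)"]) (rule gcont gC)+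
          moreover have "(\<lambda>N. t / real (Suc N) * (\<Sum>k\<le>N. ?g n x (X (t * real (Suc k) / real (Suc N)) \<omega>))) \<longlonglongrightarrow> (LINT u:{0..t}|lborel. ?g n x (X u \<omega>))"
            by (rule riemann_sum_tendsto[where B="real (Suc n)"]) (rule right_continuous_path_compose[OF elim(1) gcont] gC t)+
          ultimately show "(\<lambda>N. (1 + \<bar>x\<bar>) * (t / real (Suc N) * (\<Sum>k\<le>N. ?g n x (X (t * real (Suc k) / real (Suc N)) \<omega>)))\<^sup>2) \<longlonglongrightarrow> (1 + \<bar>x\<bar>) * (LINT v|lborel. ?g n x v * L t v \<omega>)\<^sup>2"
            by (simp only:) (intro tendsto_intros)
        qed
      qed
    next
      show "(\<lambda>N. (t / real (Suc N) * real (Suc n) + 2 * B) * (t * (2 * (3 + m)))) \<longlonglongrightarrow> (0 * real (Suc n) + 2 * B) * (t * (2 * (3 + m)))"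
        by (intro tendsto_intros LIMSEQ_Suc[OF lim_const_over_n])
    qed
    have "(\<integral>\<^sup>+\<omega>. \<integral>\<^sup>+x. ennreal ((1 + \<bar>x\<bar>) * (L t (x + a) \<omega> - L t (x + b) \<omega>)\<^sup>2) \<partial>lborel \<partial>P) \<le> ennreal (2 * B * (t * (2 * (3 + m))))"
    \<comment> \<open>The limit in \<open>n\<close>: the mollified differences tend to the
      difference of the local time at x + a and x + b, by continuity in space.\<close>
    proof (rule nn_integral_fatou_iterated[where u="\<lambda>n \<omega> x. (1 + \<bar>x\<bar>) * (LINT v|lborel. ?g n x v * L t v \<omega>)\<^sup>2"])
      fix n
      have [measurable]: "(\<lambda>q. L t (snd q) (fst (fst q))) \<in> borel_measurable ((P \<Otimes>\<^sub>M lborel) \<Otimes>\<^sub>M lborel)"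
      proof -
        have "(\<lambda>q. (snd q, fst (fst q))) \<in> measurable ((P \<Otimes>\<^sub>M lborel) \<Otimes>\<^sub>M lborel) (borel \<Otimes>\<^sub>M P)" by measurable
        from measurable_compose[OF this mL] show ?thesis by simp
      qed
      have "(\<lambda>(p, v). ?g n (snd p) v * L t v (fst p)) \<in> borel_measurable ((P \<Otimes>\<^sub>M lborel) \<Otimes>\<^sub>M lborel)" by measurable
      then have "(\<lambda>p. LINT v|lborel. ?g n (snd p) v * L t v (fst p)) \<in> borel_measurable (P \<Otimes>\<^sub>M lborel)"
        by (rule lborel.borel_measurable_lebesgue_integral)
      then show "(\<lambda>(\<omega>, x). (1 + \<bar>x\<bar>) * (LINT v|lborel. ?g n x v * L t v \<omega>)\<^sup>2) \<in> borel_measurable (P \<Otimes>\<^sub>M lborel)"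
        unfolding split_beta' by measurable
      show "(\<integral>\<^sup>+\<omega>. \<integral>\<^sup>+x. ennreal ((1 + \<bar>x\<bar>) * (LINT v|lborel. ?g n x v * L t v \<omega>)\<^sup>2) \<partial>lborel \<partial>P) \<le> ennreal (2 * B * (t * (2 * (3 + m))))"
        using step1[of n] by simp
    next
      show "AE \<omega> in P. \<forall>x. (\<lambda>n. (1 + \<bar>x\<bar>) * (LINT v|lborel. ?g n x v * L t v \<omega>)\<^sup>2) \<longlonglongrightarrow> (1 + \<bar>x\<bar>) * (L t (x + a) \<omega> - L t (x + b) \<omega>)\<^sup>2"
        using occupation_densityD(4)[OF L t] AE_space
      proof eventually_elim
        case (elim \<omega>)
        have c: "continuous_on UNIV (\<lambda>v. L t v \<omega>)" by (rule occupation_densityD(2)[OF L t elim(2)])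
        have [measurable]: "(\<lambda>v. L t v \<omega>) \<in> borel_measurable borel" by (rule occupation_densityD(3)[OF L t elim(2)])
        have i: "integrable lborel (\<lambda>v. L t v \<omega>)" using elim by auto
        show ?case
        proof
          fix x
          have gi: "integrable lborel (\<lambda>v. gauss_kernel n (v - y) * L t v \<omega>)" for n y
            by (rule integrable_bounded_mult[OF i, where B="real (Suc n)"])
              (use gauss_kernel_le gauss_kernel_nonneg in \<open>auto simp del: of_nat_Suc\<close>)
          have "(LINT v|lborel. ?g n x v * L t v \<omega>) = (LINT v|lborel. gauss_kernel n (v - (x + a)) * L t v \<omega>) - (LINT v|lborel. gauss_kernel n (v - (x + b)) * L t v \<omega>)" for n
            using gi by (subst Bochner_Integration.integral_diff[symmetric]) (auto simp: algebra_simps)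
          then show "(\<lambda>n. (1 + \<bar>x\<bar>) * (LINT v|lborel. ?g n x v * L t v \<omega>)\<^sup>2) \<longlonglongrightarrow> (1 + \<bar>x\<bar>) * (L t (x + a) \<omega> - L t (x + b) \<omega>)\<^sup>2"
            using gauss_kernel_tendsto[OF c i] by (simp only:) (intro tendsto_intros)
        qed
      qed
    qed simp
    moreover have "2 * B * (t * (2 * (3 + m))) = C * \<bar>a - b\<bar> powr (\<beta> - 1)"
      unfolding C_def B_def by (simp only: mult_ac)
    ultimately show ?thesis by (simp only:)
  qed
  moreover have "0 \<le> C" unfolding C_def using \<sigma> t m(1) riesz_const_nonneg[of \<beta>] by auto
  ultimately show ?thesis by blast
qed

section \<open>The Riesz transform of the local time\<close>

text \<open>Meant for inner integrals of absolute values, which might be infinite: a majorant in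
  L^\<alpha> yields convergence for almost every \<open>z\<close> and the L^\<alpha> bound at
  once.\<close>

definition L_dominated :: "'a measure \<Rightarrow> real \<Rightarrow> ('a \<Rightarrow> ennreal) \<Rightarrow> bool" where
  "L_dominated m \<alpha> F \<longleftrightarrow> (\<exists>R. (\<forall>z. 0 \<le> R z) \<and> in_L m \<alpha> R \<and> (AE z in m. F z \<le> ennreal (R z)))"

lemma L_dominated_add:
  assumes "L_dominated m \<alpha> F" "L_dominated m \<alpha> G" "0 \<le> \<alpha>"
  shows "L_dominated m \<alpha> (\<lambda>z. F z + G z)"
proof -
  obtain R S where R: "\<And>z. 0 \<le> R z" "in_L m \<alpha> R" "AE z in m. F z \<le> ennreal (R z)"
    and S: "\<And>z. 0 \<le> S z" "in_L m \<alpha> S" "AE z in m. G z \<le> ennreal (S z)"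
    using assms by (auto simp: L_dominated_def)
  show ?thesis unfolding L_dominated_def
  proof (intro exI[of _ "\<lambda>z. 1 * R z + 1 * S z"] conjI allI)
    show "in_L m \<alpha> (\<lambda>z. 1 * R z + 1 * S z)" by (intro in_L_lincomb R S assms)
    show "AE z in m. F z + G z \<le> ennreal (1 * R z + 1 * S z)"
      using R(3) S(3) by eventually_elim (use R(1) S(1) in \<open>auto intro: add_mono\<close>)
  qed (use R(1) S(1) in auto)
qed

lemma L_dominated_cmult:
  assumes "L_dominated m \<alpha> F" "0 \<le> \<alpha>" "0 \<le> c"
  shows "L_dominated m \<alpha> (\<lambda>z. ennreal c * F z)"
proof -
  obtain R where R: "\<And>z. 0 \<le> R z" "in_L m \<alpha> R" "AE z in m. F z \<le> ennreal (R z)"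
    using assms by (auto simp: L_dominated_def)
  show ?thesis unfolding L_dominated_def
  proof (intro exI[of _ "\<lambda>z. c * R z + 0 * R z"] conjI allI)
    show "in_L m \<alpha> (\<lambda>z. c * R z + 0 * R z)" by (intro in_L_lincomb R assms)
    show "AE z in m. ennreal c * F z \<le> ennreal (c * R z + 0 * R z)"
      using R(3) by eventually_elim (use R(1) assms in \<open>auto simp: ennreal_mult intro: mult_left_mono\<close>)
  qed (use R(1) assms in auto)
qed

lemma L_dominated_mono:
  assumes "L_dominated m \<alpha> F" "AE z in m. G z \<le> F z"
  shows "L_dominated m \<alpha> G"
proof -
  obtain R where R: "\<And>z. 0 \<le> R z" "in_L m \<alpha> R" "AE z in m. F z \<le> ennreal (R z)"
    using assms by (auto simp: L_dominated_def)
  have "AE z in m. G z \<le> ennreal (R z)" using R(3) assms(2) by eventually_elim (rule order_trans)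
  then show ?thesis using R unfolding L_dominated_def by blast
qed

text \<open>Interpolation between L^1 and L^infinity, by F^\<alpha> \<le> C^(\<alpha> - 1)
  F.\<close>

lemma L_dominated_bounded:
  assumes [measurable]: "F \<in> borel_measurable m" and C: "AE z in m. F z \<le> ennreal C" "0 \<le> C"
    and int: "(\<integral>\<^sup>+z. F z \<partial>m) < \<infinity>" and \<alpha>: "1 \<le> \<alpha>"
  shows "L_dominated m \<alpha> F"
  unfolding L_dominated_def
proof (intro exI[of _ "\<lambda>z. enn2real (F z)"] conjI allI)
  show "AE z in m. F z \<le> ennreal (enn2real (F z))"
    using C(1) by eventually_elim (metis ennreal_enn2real_if ennreal_less_top le_less_trans less_irrefl order_refl)
  have "integrable m (\<lambda>z. enn2real (F z) powr \<alpha>)"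
  proof (rule integrableI_bounded)
    have "(\<integral>\<^sup>+z. ennreal (norm (enn2real (F z) powr \<alpha>)) \<partial>m) \<le> (\<integral>\<^sup>+z. ennreal (C powr (\<alpha> - 1)) * F z \<partial>m)"
    proof (rule nn_integral_mono_AE)
      show "AE z in m. ennreal (norm (enn2real (F z) powr \<alpha>)) \<le> ennreal (C powr (\<alpha> - 1)) * F z"
        using C(1)
      proof eventually_elim
        case (elim z)
        then obtain r where r: "F z = ennreal r" "0 \<le> r" by (cases "F z") (auto simp: top_unique)
        then have rC: "r \<le> C" using elim C(2) by simp
        have "r powr \<alpha> = r powr (\<alpha> - 1) * r"
        proof (cases "r = 0")
          case False
          then have "r powr (\<alpha> - 1) * r powr 1 = r powr \<alpha>" unfolding powr_add[symmetric] by simp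
          then show ?thesis using False r by simp
        qed simp
        also have "\<dots> \<le> C powr (\<alpha> - 1) * r" using r rC \<alpha> by (intro mult_right_mono powr_mono2) auto
        finally show ?case using r by (simp add: ennreal_mult[symmetric] ennreal_leI)
      qed
    qed
    also have "\<dots> < \<infinity>" using int by (simp add: nn_integral_cmult ennreal_mult_less_top)
    finally show "(\<integral>\<^sup>+z. ennreal (norm (enn2real (F z) powr \<alpha>)) \<partial>m) < \<infinity>" .
  qed measurable
  then show "in_L m \<alpha> (\<lambda>z. enn2real (F z))" by (simp add: in_L_def)
qed simp

text \<open>
  Pointwise form of Hoelder's inequality between \<open>L\<^sup>2(w)\<close> and \<open>L\<^sup>\<alpha>\<close>: either
  \<open>r\<^sup>\<alpha> \<le> w r\<^sup>2\<close>, or \<open>r\<^sup>2\<^sup>-\<^sup>\<alpha> < 1/w\<close>.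
\<close>

lemma powr_le_weighted_square:
  fixes r w \<alpha> :: real
  assumes r: "0 \<le> r" and w: "0 < w" and \<alpha>: "0 < \<alpha>" "\<alpha> < 2"
  shows "r powr \<alpha> \<le> w * r\<^sup>2 + w powr (- \<alpha> / (2 - \<alpha>))"
proof (cases "r powr \<alpha> \<le> w * r\<^sup>2")
  case True
  then show ?thesis by (simp add: add_increasing2)
next
  case False
  then have r: "0 < r" using r by (cases "r = 0") auto
  have "w * r powr 2 < r powr \<alpha>" using False r by simp
  then have "w * r powr 2 * r powr (- \<alpha>) < r powr \<alpha> * r powr (- \<alpha>)" using r by (intro mult_strict_right_mono) auto
  moreover have "r powr 2 * r powr (- \<alpha>) = r powr (2 - \<alpha>)" "r powr \<alpha> * r powr (- \<alpha>) = 1"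
    unfolding powr_add[symmetric] using r by simp_all
  ultimately have *: "w * r powr (2 - \<alpha>) < 1" by (simp only: mult.assoc)
  have "r powr (2 - \<alpha>) \<le> w powr (-1)" using * w by (simp add: powr_minus_divide field_simps)
  then have "(r powr (2 - \<alpha>)) powr (\<alpha> / (2 - \<alpha>)) \<le> (w powr (-1)) powr (\<alpha> / (2 - \<alpha>))"
    using \<alpha> by (intro powr_mono2) auto
  then have "r powr \<alpha> \<le> w powr (- \<alpha> / (2 - \<alpha>))" using \<alpha> unfolding powr_powr by simp
  then show ?thesis using w by (simp add: add_increasing)
qed

lemma AE_pair_snd:
  assumes P: "prob_space P" and Q: "AE \<omega> in P. Q \<omega>"
  shows "AE z in (lborel :: real measure) \<Otimes>\<^sub>M P. Q (snd z)"
proof -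
  interpret P: prob_space P by fact
  interpret pair_sigma_finite "lborel :: real measure" P ..
  obtain N where N: "{\<omega>\<in>space P. \<not> Q \<omega>} \<subseteq> N" "emeasure P N = 0" "N \<in> sets P"
    using Q by (rule AE_E)
  have [measurable]: "N \<in> sets P" by fact
  have "AE \<omega> in P. \<omega> \<notin> N" using N by (intro AE_not_in) (auto simp: null_sets_def)
  then have "AE z in (lborel :: real measure) \<Otimes>\<^sub>M P. snd z \<notin> N"
  proof (intro AE_pair_measure)
    have "{z \<in> space ((lborel :: real measure) \<Otimes>\<^sub>M P). snd z \<notin> N} = UNIV \<times> (space P - N)"
      by (auto simp: space_pair_measure)
    moreover have "UNIV \<times> (space P - N) \<in> sets ((lborel :: real measure) \<Otimes>\<^sub>M P)"
      by (intro pair_measureI) auto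
    ultimately show "{z \<in> space ((lborel :: real measure) \<Otimes>\<^sub>M P). snd z \<notin> N} \<in> sets ((lborel :: real measure) \<Otimes>\<^sub>M P)"
      by (simp only:)
  qed simp
  then show ?thesis using AE_space
    by eventually_elim (use N(1) in \<open>auto simp: space_pair_measure\<close>)
qed

text \<open>The inequality \<open>powr_le_weighted_square\<close> with w = 1 + |x| leaves the term
  (1 + |x|)^(-\<alpha>/(2 - \<alpha>)). It is integrable over pairs because \<alpha>/(2 - \<alpha>)
  > 1 for \<alpha> > 1 and \<open>P\<close> has mass 1.\<close>

lemma L_dominated_weighted_square:
  assumes P: "prob_space P" and [measurable]: "F \<in> borel_measurable (lborel \<Otimes>\<^sub>M P)"
    and int: "(\<integral>\<^sup>+z. ennreal (1 + \<bar>fst z\<bar>) * (F z)\<^sup>2 \<partial>(lborel \<Otimes>\<^sub>M P)) < \<infinity>" and \<alpha>: "1 < \<alpha>" "\<alpha> < 2"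
  shows "L_dominated (lborel \<Otimes>\<^sub>M P) \<alpha> F"
  unfolding L_dominated_def
proof (intro exI[of _ "\<lambda>z. enn2real (F z)"] conjI allI)
  interpret P: prob_space P by fact
  interpret pair_sigma_finite lborel P ..
  let ?m = "lborel \<Otimes>\<^sub>M P"
  \<comment> \<open>The weight is at least 1, so an infinite value of \<open>F\<close> would make
    the weighted square infinite as well.\<close>
  have "AE z in ?m. ennreal (1 + \<bar>fst z\<bar>) * (F z)\<^sup>2 < \<infinity>"
    using int by (intro finite_nn_integral_imp_ae_finite) auto
  then have fin: "AE z in ?m. F z < \<infinity>"
  proof eventually_elim
    case (elim z)
    show ?case
    proof (rule ccontr)
      assume "\<not> F z < \<infinity>"
      then have "F z = \<top>" by (simp add: less_top[symmetric])
      then show False using elim by (simp add: ennreal_mult_eq_top_iff power2_eq_square)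
    qed
  qed
  then show "AE z in ?m. F z \<le> ennreal (enn2real (F z))" by eventually_elim simp
  let ?e = "- \<alpha> / (2 - \<alpha>)"
  have e: "?e < -1" using \<alpha> by (simp add: field_simps)
  have wfin: "(\<integral>\<^sup>+x. ennreal ((1 + \<bar>x::real\<bar>) powr ?e) \<partial>lborel) < \<infinity>"
  proof (rule nn_integral_lborel_finite_powr[where C=1 and a=0 and b="?e"])
    fix x :: real assume "x \<noteq> 0"
    have "(1 + \<bar>x\<bar>) powr ?e \<le> 1 powr ?e" using e by (intro powr_mono2') auto
    then show "(1 + \<bar>x\<bar>) powr ?e \<le> 1 * \<bar>x\<bar> powr 0" using \<open>x \<noteq> 0\<close> by simp
  next
    fix x :: real assume "1 \<le> \<bar>x\<bar>"
    then show "(1 + \<bar>x\<bar>) powr ?e \<le> 1 * \<bar>x\<bar> powr ?e" using e by (simp, intro powr_mono2') auto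
  qed (use e in auto)
  have "integrable ?m (\<lambda>z. enn2real (F z) powr \<alpha>)"
  proof (rule integrableI_bounded)
    have "(\<integral>\<^sup>+z. ennreal (norm (enn2real (F z) powr \<alpha>)) \<partial>?m) \<le> (\<integral>\<^sup>+z. ennreal (1 + \<bar>fst z\<bar>) * (F z)\<^sup>2 + ennreal ((1 + \<bar>fst z\<bar>) powr ?e) \<partial>?m)"
    proof (rule nn_integral_mono_AE)
      show "AE z in ?m. ennreal (norm (enn2real (F z) powr \<alpha>)) \<le> ennreal (1 + \<bar>fst z\<bar>) * (F z)\<^sup>2 + ennreal ((1 + \<bar>fst z\<bar>) powr ?e)"
        using fin
      proof eventually_elim
        case (elim z)
        then obtain r where r: "F z = ennreal r" "0 \<le> r" by (cases "F z") auto
        have "r powr \<alpha> \<le> (1 + \<bar>fst z\<bar>) * r\<^sup>2 + (1 + \<bar>fst z\<bar>) powr ?e"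
          using \<alpha> r by (intro powr_le_weighted_square) auto
        moreover have "ennreal (1 + \<bar>fst z\<bar>) * (ennreal r)\<^sup>2 + ennreal ((1 + \<bar>fst z\<bar>) powr ?e) = ennreal ((1 + \<bar>fst z\<bar>) * r\<^sup>2 + (1 + \<bar>fst z\<bar>) powr ?e)"
          using r by (subst ennreal_power, simp, subst ennreal_mult[symmetric]) (auto simp: ennreal_plus[symmetric] simp del: ennreal_plus)
        ultimately show ?case using r by (simp only:) (simp add: ennreal_leI del: ennreal_plus)
      qed
    qed
    also have "\<dots> = (\<integral>\<^sup>+z. ennreal (1 + \<bar>fst z\<bar>) * (F z)\<^sup>2 \<partial>?m) + (\<integral>\<^sup>+z. ennreal ((1 + \<bar>fst z\<bar>) powr ?e) \<partial>?m)"
      by (rule nn_integral_add) measurable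
    also have "(\<integral>\<^sup>+z. ennreal ((1 + \<bar>fst z\<bar>) powr ?e) \<partial>?m) = (\<integral>\<^sup>+x. \<integral>\<^sup>+\<omega>. ennreal ((1 + \<bar>x\<bar>) powr ?e) \<partial>P \<partial>lborel)"
      using sigma_finite_measure.nn_integral_fst[OF prob_space_imp_sigma_finite[OF P], of "\<lambda>z. ennreal ((1 + \<bar>fst z\<bar>) powr ?e)" lborel] by simp
    also have "\<dots> = (\<integral>\<^sup>+x. ennreal ((1 + \<bar>x\<bar>) powr ?e) \<partial>lborel)" by (simp add: P.emeasure_space_1)
    finally show "(\<integral>\<^sup>+z. ennreal (norm (enn2real (F z) powr \<alpha>)) \<partial>?m) < \<infinity>"
      using int wfin by (auto intro: le_less_trans)
  qed measurable
  then show "in_L ?m \<alpha> (\<lambda>z. enn2real (F z))" by (simp add: in_L_def)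
qed simp

section \<open>Riesz-type kernels of the local time\<close>

text \<open>One family for both parts of the theorem: p = 1, q = -1 gives the symmetric difference,
  the last term cancelling, and p = 1, q = 0 the one-sided difference. The subtraction of p + q
  copies of L_t(x) makes the bracket vanish at y = 0 in every case.\<close>

definition riesz_kernel :: "(real \<Rightarrow> real \<Rightarrow> 'a \<Rightarrow> real) \<Rightarrow> real \<Rightarrow> real \<Rightarrow> real \<Rightarrow> real \<Rightarrow> real \<times> 'a \<Rightarrow> real \<Rightarrow> real" where
  "riesz_kernel L \<gamma> p q t z y =
     \<bar>y\<bar> powr (- \<gamma>) * (p * L t (fst z + y) (snd z) + q * L t (fst z - y) (snd z) - (p + q) * L t (fst z) (snd z))"

definition riesz_transform :: "(real \<Rightarrow> real \<Rightarrow> 'a \<Rightarrow> real) \<Rightarrow> real \<Rightarrow> real \<Rightarrow> real \<Rightarrow> real \<Rightarrow> real \<times> 'a \<Rightarrow> real" where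
  "riesz_transform L \<gamma> p q t z = (LINT y:{0<..}|lborel. riesz_kernel L \<gamma> p q t z y)"

text \<open>The values s = 1, -1 and 0 cover the three levels x + y, x - y and x of the
  kernel.\<close>

lemma occupation_density_shift_measurable:
  assumes L: "occupation_density P X L" "0 \<le> t"
  shows "(\<lambda>w. L t (fst (fst w) + s * snd w) (snd (fst w))) \<in> borel_measurable ((lborel \<Otimes>\<^sub>M P) \<Otimes>\<^sub>M lborel)"
proof -
  have "(\<lambda>w. (fst (fst w) + s * snd w, snd (fst w))) \<in> measurable ((lborel \<Otimes>\<^sub>M P) \<Otimes>\<^sub>M lborel) (borel \<Otimes>\<^sub>M P)"
    by measurable
  from measurable_compose[OF this occupation_density_joint_measurable[OF L]] show ?thesis by simp
qed

lemma riesz_kernel_measurable: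
  assumes L: "occupation_density P X L" "0 \<le> t"
  shows "(\<lambda>w. riesz_kernel L \<gamma> p q t (fst w) (snd w)) \<in> borel_measurable ((lborel \<Otimes>\<^sub>M P) \<Otimes>\<^sub>M lborel)"
proof -
  note m = occupation_density_shift_measurable[OF L, of 1] occupation_density_shift_measurable[OF L, of "-1"]
    occupation_density_shift_measurable[OF L, of 0]
  show ?thesis unfolding riesz_kernel_def using m by (simp)
qed

lemma riesz_transform_measurable:
  assumes L: "occupation_density P X L" "0 \<le> t"
  shows "riesz_transform L \<gamma> p q t \<in> borel_measurable (lborel \<Otimes>\<^sub>M P)"
proof -
  have [measurable]: "(\<lambda>w. riesz_kernel L \<gamma> p q t (fst w) (snd w)) \<in> borel_measurable ((lborel \<Otimes>\<^sub>M P) \<Otimes>\<^sub>M lborel)"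
    by (rule riesz_kernel_measurable[OF L])
  have "(\<lambda>(z, y). indicator {0<..} y *\<^sub>R riesz_kernel L \<gamma> p q t z y) \<in> borel_measurable ((lborel \<Otimes>\<^sub>M P) \<Otimes>\<^sub>M lborel)"
    unfolding split_beta' by measurable
  then show ?thesis unfolding riesz_transform_def[abs_def] set_lebesgue_integral_def
    by (rule lborel.borel_measurable_lebesgue_integral)
qed

context
  fixes P :: "'a measure" and X L and \<sigma> \<beta> t :: real
  assumes X: "stable_levy P \<sigma> \<beta> X" and \<sigma>: "0 < \<sigma>" and \<beta>: "1 < \<beta>" "\<beta> < 2"
    and rc: "AE \<omega> in P. right_continuous_path (\<lambda>s. X s \<omega>)" and L: "occupation_density P X L" and t: "0 \<le> t"
begin

text \<open>Since K \<le> 1, the average is at most the total occupation time \<open>t\<close>; its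
  integral over all pairs is \<open>t\<close> times the integral of \<open>K\<close>. A bounded
  integrable function lies in L^\<alpha>.\<close>

lemma averaged_local_time_dominated:
  fixes K :: "real \<Rightarrow> ennreal"
  assumes [measurable]: "K \<in> borel_measurable borel" and K1: "\<And>y. K y \<le> 1" and Kint: "(\<integral>\<^sup>+y. K y \<partial>lborel) < \<infinity>"
    and s: "s = 1 \<or> s = (-1::real)" and \<alpha>: "1 \<le> \<alpha>"
  shows "L_dominated (lborel \<Otimes>\<^sub>M P) \<alpha> (\<lambda>z. \<integral>\<^sup>+y. K y * ennreal (L t (fst z + s * y) (snd z)) \<partial>lborel)"
proof -
  interpret P: prob_space P by (rule stable_levyD[OF X])
  interpret pair_sigma_finite "lborel :: real measure" P ..
  have [measurable]: "(\<lambda>w. L t (fst (fst w) + s * snd w) (snd (fst w))) \<in> borel_measurable ((lborel \<Otimes>\<^sub>M P) \<Otimes>\<^sub>M lborel)"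
    by (rule occupation_density_shift_measurable[OF L t])
  have int_y: "(\<integral>\<^sup>+y. ennreal (L t (x + s * y) \<omega>) \<partial>lborel) = (\<integral>\<^sup>+x. ennreal (L t x \<omega>) \<partial>lborel)"
    and int_x: "(\<integral>\<^sup>+x. ennreal (L t (x + y) \<omega>) \<partial>lborel) = (\<integral>\<^sup>+x. ennreal (L t x \<omega>) \<partial>lborel)" if \<omega>: "\<omega> \<in> space P" for x y \<omega>
  proof -
    have [measurable]: "(\<lambda>x. L t x \<omega>) \<in> borel_measurable borel" by (rule occupation_densityD(3)[OF L t \<omega>])
    show "(\<integral>\<^sup>+y. ennreal (L t (x + s * y) \<omega>) \<partial>lborel) = (\<integral>\<^sup>+x. ennreal (L t x \<omega>) \<partial>lborel)"
      using s by (subst (2) nn_integral_real_affine[where c=s and t=x]) auto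
    show "(\<integral>\<^sup>+x. ennreal (L t (x + y) \<omega>) \<partial>lborel) = (\<integral>\<^sup>+x. ennreal (L t x \<omega>) \<partial>lborel)"
      by (subst (2) nn_integral_real_affine[where c=1 and t=y]) (auto simp: add.commute)
  qed
  show ?thesis
  proof (rule L_dominated_bounded[where C=t, OF _ _ t _ \<alpha>])
    show m: "(\<lambda>z. \<integral>\<^sup>+y. K y * ennreal (L t (fst z + s * y) (snd z)) \<partial>lborel) \<in> borel_measurable (lborel \<Otimes>\<^sub>M P)"
      by (rule lborel.borel_measurable_nn_integral) (simp add: split_beta')
    show "AE z in lborel \<Otimes>\<^sub>M P. (\<integral>\<^sup>+y. K y * ennreal (L t (fst z + s * y) (snd z)) \<partial>lborel) \<le> ennreal t"
      using AE_pair_snd[OF stable_levyD(1)[OF X] occupation_density_integral[OF L t]] AE_space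
    proof eventually_elim
      case (elim z)
      have "(\<integral>\<^sup>+y. K y * ennreal (L t (fst z + s * y) (snd z)) \<partial>lborel) \<le> (\<integral>\<^sup>+y. ennreal (L t (fst z + s * y) (snd z)) \<partial>lborel)"
        using K1 by (intro nn_integral_mono) (metis mult_1 mult_right_mono zero_le)
      also have "\<dots> = ennreal t" using elim int_y[of "snd z" "fst z"] by (auto simp: space_pair_measure)
      finally show ?case .
    qed
    have "(\<integral>\<^sup>+z. \<integral>\<^sup>+y. K y * ennreal (L t (fst z + s * y) (snd z)) \<partial>lborel \<partial>(lborel \<Otimes>\<^sub>M P)) =
      (\<integral>\<^sup>+\<omega>. \<integral>\<^sup>+x. \<integral>\<^sup>+y. K y * ennreal (L t (x + s * y) \<omega>) \<partial>lborel \<partial>lborel \<partial>P)"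
      using nn_integral_snd[OF m] by simp
    also have "\<dots> = (\<integral>\<^sup>+\<omega>. ennreal t * (\<integral>\<^sup>+y. K y \<partial>lborel) \<partial>P)"
    proof (rule nn_integral_cong_AE)
      show "AE \<omega> in P. (\<integral>\<^sup>+x. \<integral>\<^sup>+y. K y * ennreal (L t (x + s * y) \<omega>) \<partial>lborel \<partial>lborel) = ennreal t * (\<integral>\<^sup>+y. K y \<partial>lborel)"
        using occupation_density_integral[OF L t] AE_space
      proof eventually_elim
        case (elim \<omega>)
        have [measurable]: "(\<lambda>x. L t x \<omega>) \<in> borel_measurable borel" by (rule occupation_densityD(3)[OF L t elim(2)])
        have "(\<integral>\<^sup>+x. \<integral>\<^sup>+y. K y * ennreal (L t (x + s * y) \<omega>) \<partial>lborel \<partial>lborel) = (\<integral>\<^sup>+y. \<integral>\<^sup>+x. K y * ennreal (L t (x + s * y) \<omega>) \<partial>lborel \<partial>lborel)"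
          by (rule lborel_pair.Fubini'[symmetric]) measurable
        also have "\<dots> = (\<integral>\<^sup>+y. K y * (\<integral>\<^sup>+x. ennreal (L t (x + s * y) \<omega>) \<partial>lborel) \<partial>lborel)"
          by (intro nn_integral_cong nn_integral_cmult) measurable
        also have "\<dots> = (\<integral>\<^sup>+y. ennreal t * K y \<partial>lborel)" by (simp only: int_x[OF elim(2)] elim(1) mult.commute)
        also have "\<dots> = ennreal t * (\<integral>\<^sup>+y. K y \<partial>lborel)" by (rule nn_integral_cmult) measurable
        finally show ?case .
      qed
    qed
    also have "\<dots> < \<infinity>" using Kint by (simp add: P.emeasure_space_1 ennreal_mult_less_top)
    finally show "(\<integral>\<^sup>+z. \<integral>\<^sup>+y. K y * ennreal (L t (fst z + s * y) (snd z)) \<partial>lborel \<partial>(lborel \<Otimes>\<^sub>M P)) < \<infinity>" .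
  qed
qed

text \<open>Cauchy-Schwarz with y^(-\<gamma>) split into y^(-a/2) and y^(a/2 - \<gamma>). The first
  factor requires a < 1; by the energy bound the second leads to the integral of y^(a - 2\<gamma> +
  \<beta> - 1), which requires a > 2\<gamma> - \<beta>. The upper bound on \<gamma> says precisely
  that such an \<open>a\<close> exists.\<close>

lemma near_local_time_dominated:
  assumes \<gamma>: "1 < \<gamma>" "\<gamma> < 1 + (\<beta> - 1) / 2" and s: "s = 1 \<or> s = (-1::real)" and \<alpha>: "1 < \<alpha>" "\<alpha> < 2"
  shows "L_dominated (lborel \<Otimes>\<^sub>M P) \<alpha>
     (\<lambda>z. \<integral>\<^sup>+y. indicator {0<..<1} y * ennreal (y powr (- \<gamma>) * \<bar>L t (fst z + s * y) (snd z) - L t (fst z) (snd z)\<bar>) \<partial>lborel)"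
    (is "L_dominated ?m \<alpha> ?F")
proof -
  interpret P: prob_space P by (rule stable_levyD[OF X])
  interpret pair_sigma_finite "lborel :: real measure" P ..
  have [measurable]: "(\<lambda>w. L t (fst (fst w) + s * snd w) (snd (fst w))) \<in> borel_measurable ((lborel \<Otimes>\<^sub>M P) \<Otimes>\<^sub>M lborel)"
    by (rule occupation_density_shift_measurable[OF L t])
  have mL: "(\<lambda>z. L t (fst z) (snd z)) \<in> borel_measurable (borel \<Otimes>\<^sub>M P)" by (rule occupation_density_joint_measurable[OF L t])
  have mD: "(\<lambda>z. L t (fst z + s * y) (snd z)) \<in> borel_measurable (lborel \<Otimes>\<^sub>M P)" for y
  proof -
    have "(\<lambda>z. (fst z + s * y, snd z)) \<in> measurable (lborel \<Otimes>\<^sub>M P) (borel \<Otimes>\<^sub>M P)" by measurable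
    from measurable_compose[OF this mL] show ?thesis by simp
  qed
  have [measurable]: "(\<lambda>z. L t (fst z) (snd z)) \<in> borel_measurable (lborel \<Otimes>\<^sub>M P)"
    using mD[of 0] by simp
  have [measurable]: "(\<lambda>w. L t (fst (fst w)) (snd (fst w))) \<in> borel_measurable ((lborel \<Otimes>\<^sub>M P) \<Otimes>\<^sub>M lborel)"
    using occupation_density_shift_measurable[OF L t, of 0] by simp
  \<comment> \<open>The midpoint of the interval from 2\<gamma> - \<beta> to 1.\<close>
  define a where "a = (1 + 2 * \<gamma> - \<beta>) / 2"
  have a: "a < 1" "2 * \<gamma> - \<beta> < a" using \<gamma> by (auto simp: a_def field_simps)
  obtain C where C: "0 \<le> C" "\<And>a b. \<bar>a\<bar> \<le> 1 \<Longrightarrow> \<bar>b\<bar> \<le> 1 \<Longrightarrow>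
     (\<integral>\<^sup>+\<omega>. \<integral>\<^sup>+x. ennreal ((1 + \<bar>x\<bar>) * (L t (x + a) \<omega> - L t (x + b) \<omega>)\<^sup>2) \<partial>lborel \<partial>P) \<le> ennreal (C * \<bar>a - b\<bar> powr (\<beta> - 1))"
    using local_time_energy[OF X \<sigma> \<beta> rc L t] by auto
  let ?D = "\<lambda>z y. L t (fst z + s * y) (snd z) - L t (fst z) (snd z)"
  let ?A = "(\<integral>\<^sup>+y. indicator {0<..<1} y * ennreal (y powr (- a)) \<partial>lborel)"
  have powr_fin: "(\<integral>\<^sup>+y. indicator {0<..<1} y * ennreal (y powr e) \<partial>lborel) < \<infinity>" if "-1 < e" for e :: real
  proof -
    have "(\<integral>\<^sup>+y. indicator {0<..<1} y * ennreal (y powr e) \<partial>lborel) \<le> (\<integral>\<^sup>+x. ennreal (x powr e) * indicator {0..1} x \<partial>lborel)"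
      by (intro nn_integral_mono) (auto simp: indicator_def)
    also have "\<dots> < \<infinity>" by (simp add: nn_integral_powr_near_0[OF that])
    finally show ?thesis .
  qed
  have sq: "(?F z)\<^sup>2 \<le> ?A * (\<integral>\<^sup>+y. indicator {0<..<1} y * ennreal (y powr (a - 2 * \<gamma>) * (?D z y)\<^sup>2) \<partial>lborel)" if z: "z \<in> space ?m" for z
  proof -
    have [measurable]: "(\<lambda>x. L t x (snd z)) \<in> borel_measurable borel"
      using z by (intro occupation_densityD(3)[OF L t]) (auto simp: space_pair_measure)
    have e1: "?F z = (\<integral>\<^sup>+y. (indicator {0<..<1} y * ennreal (y powr (- a / 2))) * (indicator {0<..<1} y * ennreal (y powr (a / 2 - \<gamma>) * \<bar>?D z y\<bar>)) \<partial>lborel)"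
    proof (intro nn_integral_cong)
      fix y :: real
      have "y powr (- a / 2) * (y powr (a / 2 - \<gamma>) * \<bar>?D z y\<bar>) = y powr (- \<gamma>) * \<bar>?D z y\<bar>"
        by (simp add: mult.assoc[symmetric] powr_add[symmetric])
      then show "indicator {0<..<1} y * ennreal (y powr (- \<gamma>) * \<bar>?D z y\<bar>) = (indicator {0<..<1} y * ennreal (y powr (- a / 2))) * (indicator {0<..<1} y * ennreal (y powr (a / 2 - \<gamma>) * \<bar>?D z y\<bar>))"
        by (auto simp: indicator_def ennreal_mult[symmetric])
    qed
    have e2: "(\<integral>\<^sup>+y. (indicator {0<..<1} y * ennreal (y powr (- a / 2))) * (indicator {0<..<1} y * ennreal (y powr (a / 2 - \<gamma>) * \<bar>?D z y\<bar>)) \<partial>lborel)\<^sup>2 \<le> (\<integral>\<^sup>+y. (indicator {0<..<1} y * ennreal (y powr (- a / 2)))\<^sup>2 \<partial>lborel) * (\<integral>\<^sup>+y. (indicator {0<..<1} y * ennreal (y powr (a / 2 - \<gamma>) * \<bar>?D z y\<bar>))\<^sup>2 \<partial>lborel)"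
      by (rule Cauchy_Schwarz_nn_integral) measurable
    have e3: "(\<integral>\<^sup>+y. (indicator {0<..<1} y * ennreal (y powr (- a / 2)))\<^sup>2 \<partial>lborel) = ?A"
      by (intro nn_integral_cong) (auto simp: indicator_def power2_eq_square ennreal_mult[symmetric] powr_add[symmetric])
    have e4: "(\<integral>\<^sup>+y. (indicator {0<..<1} y * ennreal (y powr (a / 2 - \<gamma>) * \<bar>?D z y\<bar>))\<^sup>2 \<partial>lborel) = (\<integral>\<^sup>+y. indicator {0<..<1} y * ennreal (y powr (a - 2 * \<gamma>) * (?D z y)\<^sup>2) \<partial>lborel)"
    proof (intro nn_integral_cong)
      fix y :: real
      have "(y powr (a / 2 - \<gamma>) * \<bar>?D z y\<bar>)\<^sup>2 = y powr (a - 2 * \<gamma>) * (?D z y)\<^sup>2"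
        by (simp add: power_mult_distrib) (simp add: power2_eq_square powr_add[symmetric])
      then show "(indicator {0<..<1} y * ennreal (y powr (a / 2 - \<gamma>) * \<bar>?D z y\<bar>))\<^sup>2 = indicator {0<..<1} y * ennreal (y powr (a - 2 * \<gamma>) * (?D z y)\<^sup>2)"
        by (auto simp: indicator_def ennreal_power)
    qed
    show ?thesis using e2 unfolding e1[symmetric] e3 e4 .
  qed
  have mE: "(\<lambda>z. ennreal ((1 + \<bar>fst z\<bar>) * (?D z y)\<^sup>2)) \<in> borel_measurable ?m" for y using mD by measurable
  have E: "(\<integral>\<^sup>+z. ennreal ((1 + \<bar>fst z\<bar>) * (?D z y)\<^sup>2) \<partial>?m) \<le> ennreal (C * y powr (\<beta> - 1))" if "0 < y" "y < 1" for y
  proof -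
    from nn_integral_snd[OF mE] have "(\<integral>\<^sup>+z. ennreal ((1 + \<bar>fst z\<bar>) * (?D z y)\<^sup>2) \<partial>?m) = (\<integral>\<^sup>+\<omega>. \<integral>\<^sup>+x. ennreal ((1 + \<bar>x\<bar>) * (L t (x + s * y) \<omega> - L t (x + 0) \<omega>)\<^sup>2) \<partial>lborel \<partial>P)"
      by simp
    also have "\<dots> \<le> ennreal (C * \<bar>s * y - 0\<bar> powr (\<beta> - 1))" using s that by (intro C(2)) auto
    also have "\<bar>s * y - 0\<bar> = y" using s that by auto
    finally show ?thesis .
  qed
  show ?thesis
  proof (rule L_dominated_weighted_square[OF stable_levyD(1)[OF X] _ _ \<alpha>])
    show "?F \<in> borel_measurable ?m"
      by (rule lborel.borel_measurable_nn_integral) (simp add: split_beta')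
    have "(\<integral>\<^sup>+z. ennreal (1 + \<bar>fst z\<bar>) * (?F z)\<^sup>2 \<partial>?m) \<le>
      (\<integral>\<^sup>+z. ?A * (\<integral>\<^sup>+y. (indicator {0<..<1} y * ennreal (y powr (a - 2 * \<gamma>))) * ennreal ((1 + \<bar>fst z\<bar>) * (?D z y)\<^sup>2) \<partial>lborel) \<partial>?m)"
    proof (rule nn_integral_mono)
      fix z assume z: "z \<in> space ?m"
      have [measurable]: "(\<lambda>x. L t x (snd z)) \<in> borel_measurable borel"
        using z by (intro occupation_densityD(3)[OF L t]) (auto simp: space_pair_measure)
      have "ennreal (1 + \<bar>fst z\<bar>) * (?F z)\<^sup>2 \<le> ennreal (1 + \<bar>fst z\<bar>) * (?A * (\<integral>\<^sup>+y. indicator {0<..<1} y * ennreal (y powr (a - 2 * \<gamma>) * (?D z y)\<^sup>2) \<partial>lborel))"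
        by (intro mult_left_mono sq[OF z]) auto
      also have "\<dots> = ?A * (\<integral>\<^sup>+y. ennreal (1 + \<bar>fst z\<bar>) * (indicator {0<..<1} y * ennreal (y powr (a - 2 * \<gamma>) * (?D z y)\<^sup>2)) \<partial>lborel)"
        by (subst nn_integral_cmult) (auto simp: mult_ac)
      also have "\<dots> = ?A * (\<integral>\<^sup>+y. (indicator {0<..<1} y * ennreal (y powr (a - 2 * \<gamma>))) * ennreal ((1 + \<bar>fst z\<bar>) * (?D z y)\<^sup>2) \<partial>lborel)"
      proof (rule arg_cong2[where f="(*)", OF refl], rule nn_integral_cong)
        fix y :: real
        have 1: "ennreal (y powr (a - 2 * \<gamma>) * (?D z y)\<^sup>2) = ennreal (y powr (a - 2 * \<gamma>)) * ennreal ((?D z y)\<^sup>2)"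
          and 2: "ennreal ((1 + \<bar>fst z\<bar>) * (?D z y)\<^sup>2) = ennreal (1 + \<bar>fst z\<bar>) * ennreal ((?D z y)\<^sup>2)"
          by (rule ennreal_mult; simp)+
        show "ennreal (1 + \<bar>fst z\<bar>) * (indicator {0<..<1} y * ennreal (y powr (a - 2 * \<gamma>) * (?D z y)\<^sup>2)) =
          (indicator {0<..<1} y * ennreal (y powr (a - 2 * \<gamma>))) * ennreal ((1 + \<bar>fst z\<bar>) * (?D z y)\<^sup>2)"
          unfolding 1 2 by (simp only: mult_ac)
      qed
      finally show "ennreal (1 + \<bar>fst z\<bar>) * (?F z)\<^sup>2 \<le> ?A * (\<integral>\<^sup>+y. (indicator {0<..<1} y * ennreal (y powr (a - 2 * \<gamma>))) * ennreal ((1 + \<bar>fst z\<bar>) * (?D z y)\<^sup>2) \<partial>lborel)" .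
    qed
    also have "\<dots> = ?A * (\<integral>\<^sup>+z. \<integral>\<^sup>+y. (indicator {0<..<1} y * ennreal (y powr (a - 2 * \<gamma>))) * ennreal ((1 + \<bar>fst z\<bar>) * (?D z y)\<^sup>2) \<partial>lborel \<partial>?m)"
      by (rule nn_integral_cmult, rule lborel.borel_measurable_nn_integral) (simp add: split_beta')
    finally have I1: "(\<integral>\<^sup>+z. ennreal (1 + \<bar>fst z\<bar>) * (?F z)\<^sup>2 \<partial>?m) \<le> ?A * (\<integral>\<^sup>+z. \<integral>\<^sup>+y. (indicator {0<..<1} y * ennreal (y powr (a - 2 * \<gamma>))) * ennreal ((1 + \<bar>fst z\<bar>) * (?D z y)\<^sup>2) \<partial>lborel \<partial>?m)" .
    have "(\<integral>\<^sup>+z. \<integral>\<^sup>+y. (indicator {0<..<1} y * ennreal (y powr (a - 2 * \<gamma>))) * ennreal ((1 + \<bar>fst z\<bar>) * (?D z y)\<^sup>2) \<partial>lborel \<partial>?m) =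
      (\<integral>\<^sup>+y. \<integral>\<^sup>+z. (indicator {0<..<1} y * ennreal (y powr (a - 2 * \<gamma>))) * ennreal ((1 + \<bar>fst z\<bar>) * (?D z y)\<^sup>2) \<partial>?m \<partial>lborel)"
    proof -
      interpret q: pair_sigma_finite ?m "lborel :: real measure"
        ..
      show ?thesis by (rule q.Fubini'[symmetric]) (simp add: split_beta')
    qed
    also have "\<dots> = (\<integral>\<^sup>+y. (indicator {0<..<1} y * ennreal (y powr (a - 2 * \<gamma>))) * (\<integral>\<^sup>+z. ennreal ((1 + \<bar>fst z\<bar>) * (?D z y)\<^sup>2) \<partial>?m) \<partial>lborel)"
      by (intro nn_integral_cong nn_integral_cmult mE)
    also have "\<dots> \<le> (\<integral>\<^sup>+y. ennreal C * (indicator {0<..<1} y * ennreal (y powr (a - 2 * \<gamma> + \<beta> - 1))) \<partial>lborel)"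
    proof (rule nn_integral_mono)
      fix y :: real
      show "(indicator {0<..<1} y * ennreal (y powr (a - 2 * \<gamma>))) * (\<integral>\<^sup>+z. ennreal ((1 + \<bar>fst z\<bar>) * (?D z y)\<^sup>2) \<partial>?m) \<le> ennreal C * (indicator {0<..<1} y * ennreal (y powr (a - 2 * \<gamma> + \<beta> - 1)))"
      proof (cases "0 < y \<and> y < 1")
        case True
        have "ennreal (y powr (a - 2 * \<gamma>)) * (\<integral>\<^sup>+z. ennreal ((1 + \<bar>fst z\<bar>) * (?D z y)\<^sup>2) \<partial>?m) \<le> ennreal (y powr (a - 2 * \<gamma>)) * ennreal (C * y powr (\<beta> - 1))"
          using E True by (intro mult_left_mono) auto
        also have "\<dots> = ennreal (C * y powr (a - 2 * \<gamma> + \<beta> - 1))"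
          using C(1) by (simp add: ennreal_mult[symmetric] powr_add[symmetric] algebra_simps)
        finally show ?thesis using True C(1) by (simp add: ennreal_mult)
      qed simp
    qed
    also have "\<dots> = ennreal C * (\<integral>\<^sup>+y. indicator {0<..<1} y * ennreal (y powr (a - 2 * \<gamma> + \<beta> - 1)) \<partial>lborel)"
      by (rule nn_integral_cmult) measurable
    finally have "(\<integral>\<^sup>+z. ennreal (1 + \<bar>fst z\<bar>) * (?F z)\<^sup>2 \<partial>?m) \<le> ?A * (ennreal C * (\<integral>\<^sup>+y. indicator {0<..<1} y * ennreal (y powr (a - 2 * \<gamma> + \<beta> - 1)) \<partial>lborel))"
      by (intro order_trans[OF I1] mult_left_mono) auto
    also have "\<dots> < \<infinity>" using powr_fin[of "-a"] powr_fin[of "a - 2 * \<gamma> + \<beta> - 1"] a by (simp add: ennreal_mult_less_top)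
    finally show "(\<integral>\<^sup>+z. ennreal (1 + \<bar>fst z\<bar>) * (?F z)\<^sup>2 \<partial>?m) < \<infinity>" .
  qed
qed

end

lemma in_L_dominated:
  assumes R: "in_L m \<alpha> R" and h: "h \<in> borel_measurable m" and le: "AE z in m. \<bar>h z\<bar> \<le> R z" and \<alpha>: "0 \<le> \<alpha>"
  shows "in_L m \<alpha> h"
proof -
  have [measurable]: "h \<in> borel_measurable m" by fact
  have "integrable m (\<lambda>z. \<bar>R z\<bar> powr \<alpha>)" using R by (simp add: in_L_def)
  then have "integrable m (\<lambda>z. \<bar>h z\<bar> powr \<alpha>)"
  proof (rule Bochner_Integration.integrable_bound)
    show "AE z in m. norm (\<bar>h z\<bar> powr \<alpha>) \<le> norm (\<bar>R z\<bar> powr \<alpha>)"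
      using le by eventually_elim (use \<alpha> in \<open>auto intro!: powr_mono2\<close>)
  qed measurable
  then show ?thesis using h by (simp add: in_L_def)
qed

context
  fixes P :: "'a measure" and X L and \<sigma> \<beta> t :: real
  assumes X: "stable_levy P \<sigma> \<beta> X" and \<sigma>: "0 < \<sigma>" and \<beta>: "1 < \<beta>" "\<beta> < 2"
    and rc: "AE \<omega> in P. right_continuous_path (\<lambda>s. X s \<omega>)" and L: "occupation_density P X L" and t: "0 \<le> t"
begin

lemma AE_local_time_nonneg: "AE z in (lborel :: real measure) \<Otimes>\<^sub>M P. (\<forall>x. 0 \<le> L t x (snd z)) \<and> snd z \<in> space P"
proof -
  have "AE \<omega> in P. (\<forall>x. 0 \<le> L t x \<omega>) \<and> \<omega> \<in> space P"
    using occupation_densityD(4)[OF L t] AE_space by eventually_elim auto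
  from AE_pair_snd[OF stable_levyD(1)[OF X] this] show ?thesis .
qed

text \<open>For 0 < y < 1 one has y^(-\<gamma>) \<ge> 1, hence L(x) \<le> y^(-\<gamma>)|L(x + y) -
  L(x)| + L(x + y). Integration over such y bounds the local time itself by two functions that are
  already dominated.\<close>

lemma local_time_dominated:
  assumes \<alpha>: "1 < \<alpha>" "\<alpha> < 2"
  shows "L_dominated (lborel \<Otimes>\<^sub>M P) \<alpha> (\<lambda>z. ennreal (L t (fst z) (snd z)))"
proof -
  \<comment> \<open>An auxiliary admissible index, the midpoint between 1 and 1 + (\<beta> -
    1)/2.\<close>
  define \<gamma> where "\<gamma> = 1 + (\<beta> - 1) / 4"
  have \<gamma>: "1 < \<gamma>" "\<gamma> < 1 + (\<beta> - 1) / 2" using \<beta> by (auto simp: \<gamma>_def field_simps)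
  let ?near = "\<lambda>z y. indicator {0<..<1} y * ennreal (y powr (- \<gamma>) * \<bar>L t (fst z + 1 * y) (snd z) - L t (fst z) (snd z)\<bar>)"
  let ?avg = "\<lambda>z y. indicator {0<..<1::real} y * ennreal (L t (fst z + 1 * y) (snd z))"
  have "L_dominated (lborel \<Otimes>\<^sub>M P) \<alpha> (\<lambda>z. (\<integral>\<^sup>+y. ?near z y \<partial>lborel) + (\<integral>\<^sup>+y. ?avg z y \<partial>lborel))"
  proof (intro L_dominated_add near_local_time_dominated[OF X \<sigma> \<beta> rc L t \<gamma>] averaged_local_time_dominated[OF X \<sigma> \<beta> rc L t])
    show "(\<integral>\<^sup>+y. indicator {0<..<1::real} y \<partial>lborel) < \<infinity>" by simp
  qed (use \<alpha> in \<open>auto simp: indicator_def\<close>)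
  then show ?thesis
  proof (rule L_dominated_mono)
    show "AE z in lborel \<Otimes>\<^sub>M P. ennreal (L t (fst z) (snd z)) \<le> (\<integral>\<^sup>+y. ?near z y \<partial>lborel) + (\<integral>\<^sup>+y. ?avg z y \<partial>lborel)"
      using AE_local_time_nonneg
    proof eventually_elim
      case (elim z)
      have [measurable]: "(\<lambda>x. L t x (snd z)) \<in> borel_measurable borel" using elim by (intro occupation_densityD(3)[OF L t]) auto
      have "ennreal (L t (fst z) (snd z)) = (\<integral>\<^sup>+y. ennreal (L t (fst z) (snd z)) * indicator {0<..<1::real} y \<partial>lborel)"
        by (simp add: nn_integral_cmult_indicator)
      also have "\<dots> \<le> (\<integral>\<^sup>+y. ?near z y + ?avg z y \<partial>lborel)"
      proof (rule nn_integral_mono)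
        fix y :: real
        have "L t (fst z) (snd z) \<le> y powr (- \<gamma>) * \<bar>L t (fst z + 1 * y) (snd z) - L t (fst z) (snd z)\<bar> + L t (fst z + 1 * y) (snd z)"
          if y: "0 < y" "y < 1"
        proof -
          have "1 powr (- \<gamma>) \<le> y powr (- \<gamma>)" using y \<gamma> by (intro powr_mono2') auto
          then have b: "\<bar>L t (fst z + 1 * y) (snd z) - L t (fst z) (snd z)\<bar> \<le> y powr (- \<gamma>) * \<bar>L t (fst z + 1 * y) (snd z) - L t (fst z) (snd z)\<bar>"
            using mult_right_mono[of 1 "y powr (- \<gamma>)" "\<bar>L t (fst z + 1 * y) (snd z) - L t (fst z) (snd z)\<bar>"] by simp
          have "u \<le> \<bar>v - u\<bar> + v" for u v :: real by linarith
          from order_trans[OF this add_right_mono[OF b]] show ?thesis .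
        qed
        then show "ennreal (L t (fst z) (snd z)) * indicator {0<..<1::real} y \<le> ?near z y + ?avg z y"
          using elim by (auto simp: indicator_def ennreal_plus[symmetric] ennreal_leI simp del: ennreal_plus)
      qed
      also have "\<dots> = (\<integral>\<^sup>+y. ?near z y \<partial>lborel) + (\<integral>\<^sup>+y. ?avg z y \<partial>lborel)" by (rule nn_integral_add) measurable
      finally show ?case .
    qed
  qed
qed

text \<open>For y < 1 the bracket is a combination of increments from \<open>x\<close> to either
  side. For y \<ge> 1 its terms are estimated singly, the one at \<open>x\<close> contributing
  L_t(x) times 1/(\<gamma> - 1), the integral of y^(-\<gamma>) over y \<ge> 1.\<close>

lemma riesz_kernel_dominated:
  assumes \<gamma>: "1 < \<gamma>" "\<gamma> < 1 + (\<beta> - 1) / 2" and \<alpha>: "1 < \<alpha>" "\<alpha> < 2"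
  shows "L_dominated (lborel \<Otimes>\<^sub>M P) \<alpha> (\<lambda>z. \<integral>\<^sup>+y. ennreal (norm (indicator {0<..} y *\<^sub>R riesz_kernel L \<gamma> p q t z y)) \<partial>lborel)"
proof -
  let ?near = "\<lambda>s z y. indicator {0<..<1} y * ennreal (y powr (- \<gamma>) * \<bar>L t (fst z + s * y) (snd z) - L t (fst z) (snd z)\<bar>)"
  let ?K = "\<lambda>y::real. ennreal (y powr (- \<gamma>)) * indicator {1..} y"
  let ?far = "\<lambda>s z y. ?K y * ennreal (L t (fst z + s * y) (snd z))"
  let ?G = "\<lambda>z y. ennreal \<bar>p\<bar> * ?near 1 z y + ennreal \<bar>q\<bar> * ?near (-1) z y + (ennreal \<bar>p\<bar> * ?far 1 z y + ennreal \<bar>q\<bar> * ?far (-1) z y)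
      + ennreal \<bar>p + q\<bar> * (?K y * ennreal (L t (fst z) (snd z)))"
  have Kint: "(\<integral>\<^sup>+y. ?K y \<partial>lborel) = ennreal (1 / (\<gamma> - 1))"
    using nn_integral_powr_at_top[of "- \<gamma>"] \<gamma> by simp
  have K1: "?K y \<le> 1" for y
  proof (cases "1 \<le> y")
    case True
    then have "y powr (- \<gamma>) \<le> y powr 0" using \<gamma> by (intro powr_mono) auto
    then show ?thesis using True by simp
  qed simp
  have near: "L_dominated (lborel \<Otimes>\<^sub>M P) \<alpha> (\<lambda>z. \<integral>\<^sup>+y. ?near s z y \<partial>lborel)" if "s = 1 \<or> s = -1" for s
    by (rule near_local_time_dominated[OF X \<sigma> \<beta> rc L t \<gamma> that \<alpha>])
  have far: "L_dominated (lborel \<Otimes>\<^sub>M P) \<alpha> (\<lambda>z. \<integral>\<^sup>+y. ?far s z y \<partial>lborel)" if "s = 1 \<or> s = -1" for s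
    using \<alpha> that K1 by (intro averaged_local_time_dominated[OF X \<sigma> \<beta> rc L t]) (auto simp: Kint)
  have "L_dominated (lborel \<Otimes>\<^sub>M P) \<alpha> (\<lambda>z. ennreal \<bar>p\<bar> * (\<integral>\<^sup>+y. ?near 1 z y \<partial>lborel) + ennreal \<bar>q\<bar> * (\<integral>\<^sup>+y. ?near (-1) z y \<partial>lborel)
     + (ennreal \<bar>p\<bar> * (\<integral>\<^sup>+y. ?far 1 z y \<partial>lborel) + ennreal \<bar>q\<bar> * (\<integral>\<^sup>+y. ?far (-1) z y \<partial>lborel))
     + ennreal (\<bar>p + q\<bar> * (1 / (\<gamma> - 1))) * ennreal (L t (fst z) (snd z)))"
    using \<alpha> \<gamma> by (intro L_dominated_add L_dominated_cmult near far local_time_dominated) auto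
  then show ?thesis
  proof (rule L_dominated_mono)
    show "AE z in lborel \<Otimes>\<^sub>M P. (\<integral>\<^sup>+y. ennreal (norm (indicator {0<..} y *\<^sub>R riesz_kernel L \<gamma> p q t z y)) \<partial>lborel) \<le>
       ennreal \<bar>p\<bar> * (\<integral>\<^sup>+y. ?near 1 z y \<partial>lborel) + ennreal \<bar>q\<bar> * (\<integral>\<^sup>+y. ?near (-1) z y \<partial>lborel)
     + (ennreal \<bar>p\<bar> * (\<integral>\<^sup>+y. ?far 1 z y \<partial>lborel) + ennreal \<bar>q\<bar> * (\<integral>\<^sup>+y. ?far (-1) z y \<partial>lborel))
     + ennreal (\<bar>p + q\<bar> * (1 / (\<gamma> - 1))) * ennreal (L t (fst z) (snd z))"
      using AE_local_time_nonneg
    proof eventually_elim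
      case (elim z)
      have [measurable]: "(\<lambda>x. L t x (snd z)) \<in> borel_measurable borel" using elim by (intro occupation_densityD(3)[OF L t]) auto
      have "(\<integral>\<^sup>+y. ennreal (norm (indicator {0<..} y *\<^sub>R riesz_kernel L \<gamma> p q t z y)) \<partial>lborel) \<le> (\<integral>\<^sup>+y. ?G z y \<partial>lborel)"
      proof (rule nn_integral_mono)
        fix y :: real
        let ?x = "fst z" and ?w = "snd z"
        let ?l = "\<lambda>x. L t x (snd z)"
        have l0: "0 \<le> ?l x" for x using elim by auto
        consider "y \<le> 0" | "0 < y" "y < 1" | "1 \<le> y" by linarith
        then show "ennreal (norm (indicator {0<..} y *\<^sub>R riesz_kernel L \<gamma> p q t z y)) \<le> ?G z y"
        proof cases
          case 2
          have "\<bar>p * ?l (?x + y) + q * ?l (?x - y) - (p + q) * ?l ?x\<bar> = \<bar>p * (?l (?x + y) - ?l ?x) + q * (?l (?x - y) - ?l ?x)\<bar>"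
            by (simp add: algebra_simps)
          also have "\<dots> \<le> \<bar>p\<bar> * \<bar>?l (?x + y) - ?l ?x\<bar> + \<bar>q\<bar> * \<bar>?l (?x - y) - ?l ?x\<bar>"
            by (rule order_trans[OF abs_triangle_ineq]) (simp add: abs_mult)
          finally have "y powr (- \<gamma>) * \<bar>p * ?l (?x + y) + q * ?l (?x - y) - (p + q) * ?l ?x\<bar> \<le>
             y powr (- \<gamma>) * (\<bar>p\<bar> * \<bar>?l (?x + y) - ?l ?x\<bar> + \<bar>q\<bar> * \<bar>?l (?x - y) - ?l ?x\<bar>)"
            by (rule mult_left_mono) simp
          also have "\<dots> = \<bar>p\<bar> * (y powr (- \<gamma>) * \<bar>?l (?x + 1 * y) - ?l ?x\<bar>) + \<bar>q\<bar> * (y powr (- \<gamma>) * \<bar>?l (?x + (-1) * y) - ?l ?x\<bar>)"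
            by (simp add: algebra_simps)
          finally have "ennreal (y powr (- \<gamma>) * \<bar>p * ?l (?x + y) + q * ?l (?x - y) - (p + q) * ?l ?x\<bar>) \<le>
            ennreal \<bar>p\<bar> * ennreal (y powr (- \<gamma>) * \<bar>?l (?x + 1 * y) - ?l ?x\<bar>) + ennreal \<bar>q\<bar> * ennreal (y powr (- \<gamma>) * \<bar>?l (?x + (-1) * y) - ?l ?x\<bar>)"
            by (simp add: ennreal_mult[symmetric] ennreal_plus[symmetric] ennreal_leI del: ennreal_plus)
          then show ?thesis using 2 by (simp add: riesz_kernel_def abs_mult)
        next
          case 3
          have "\<bar>p * ?l (?x + y) + q * ?l (?x - y) - (p + q) * ?l ?x\<bar> \<le> \<bar>p * ?l (?x + y)\<bar> + \<bar>q * ?l (?x - y)\<bar> + \<bar>(p + q) * ?l ?x\<bar>"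
            by linarith
          also have "\<dots> = \<bar>p\<bar> * ?l (?x + y) + \<bar>q\<bar> * ?l (?x - y) + \<bar>p + q\<bar> * ?l ?x"
            using l0 by (simp add: abs_mult)
          finally have "y powr (- \<gamma>) * \<bar>p * ?l (?x + y) + q * ?l (?x - y) - (p + q) * ?l ?x\<bar> \<le>
             y powr (- \<gamma>) * (\<bar>p\<bar> * ?l (?x + y) + \<bar>q\<bar> * ?l (?x - y) + \<bar>p + q\<bar> * ?l ?x)"
            by (rule mult_left_mono) simp
          also have "\<dots> = \<bar>p\<bar> * (y powr (- \<gamma>) * ?l (?x + 1 * y)) + \<bar>q\<bar> * (y powr (- \<gamma>) * ?l (?x + (-1) * y)) + \<bar>p + q\<bar> * (y powr (- \<gamma>) * ?l ?x)"
            by (simp add: algebra_simps)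
          finally have "ennreal (y powr (- \<gamma>) * \<bar>p * ?l (?x + y) + q * ?l (?x - y) - (p + q) * ?l ?x\<bar>) \<le>
            ennreal \<bar>p\<bar> * (ennreal (y powr (- \<gamma>)) * ennreal (?l (?x + 1 * y))) + ennreal \<bar>q\<bar> * (ennreal (y powr (- \<gamma>)) * ennreal (?l (?x + (-1) * y))) + ennreal \<bar>p + q\<bar> * (ennreal (y powr (- \<gamma>)) * ennreal (?l ?x))"
            using l0 by (simp add: ennreal_mult[symmetric] ennreal_plus[symmetric] ennreal_leI del: ennreal_plus)
          then show ?thesis using 3 by (simp add: riesz_kernel_def abs_mult)
        qed simp
      qed
      also have "\<dots> = ennreal \<bar>p\<bar> * (\<integral>\<^sup>+y. ?near 1 z y \<partial>lborel) + ennreal \<bar>q\<bar> * (\<integral>\<^sup>+y. ?near (-1) z y \<partial>lborel)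
        + (ennreal \<bar>p\<bar> * (\<integral>\<^sup>+y. ?far 1 z y \<partial>lborel) + ennreal \<bar>q\<bar> * (\<integral>\<^sup>+y. ?far (-1) z y \<partial>lborel))
        + ennreal \<bar>p + q\<bar> * ((\<integral>\<^sup>+y. ?K y \<partial>lborel) * ennreal (L t (fst z) (snd z)))"
        by (simp add: nn_integral_add nn_integral_cmult nn_integral_multc)
      also have "ennreal \<bar>p + q\<bar> * ((\<integral>\<^sup>+y. ?K y \<partial>lborel) * ennreal (L t (fst z) (snd z))) = ennreal (\<bar>p + q\<bar> * (1 / (\<gamma> - 1))) * ennreal (L t (fst z) (snd z))"
      proof -
        have "ennreal (\<bar>p + q\<bar> * (1 / (\<gamma> - 1))) = ennreal \<bar>p + q\<bar> * ennreal (1 / (\<gamma> - 1))"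
          using \<gamma> by (intro ennreal_mult) auto
        then show ?thesis unfolding Kint by (simp only: mult.assoc)
      qed
      finally show ?case .
    qed
  qed
qed

lemma riesz_kernel_integrable:
  assumes \<gamma>: "1 < \<gamma>" "\<gamma> < 1 + (\<beta> - 1) / 2"
  shows "AE z in lborel \<Otimes>\<^sub>M P. set_integrable lborel {0<..} (riesz_kernel L \<gamma> p q t z)"
    and riesz_transform_in_L: "1 < \<alpha> \<Longrightarrow> \<alpha> < 2 \<Longrightarrow> in_L (lborel \<Otimes>\<^sub>M P) \<alpha> (riesz_transform L \<gamma> p q t)"
proof -
  have km: "(\<lambda>y. indicator {0<..} y *\<^sub>R riesz_kernel L \<gamma> p q t z y) \<in> borel_measurable lborel" if "snd z \<in> space P" for z
  proof -
    have [measurable]: "(\<lambda>x. L t x (snd z)) \<in> borel_measurable borel" by (rule occupation_densityD(3)[OF L t that])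
    show ?thesis unfolding riesz_kernel_def by measurable
  qed
  have 1: "(AE z in lborel \<Otimes>\<^sub>M P. set_integrable lborel {0<..} (riesz_kernel L \<gamma> p q t z)) \<and> in_L (lborel \<Otimes>\<^sub>M P) \<alpha> (riesz_transform L \<gamma> p q t)"
    if \<alpha>: "1 < \<alpha>" "\<alpha> < 2" for \<alpha>
  proof -
    obtain R where R: "\<And>z. 0 \<le> R z" "in_L (lborel \<Otimes>\<^sub>M P) \<alpha> R"
      and le: "AE z in lborel \<Otimes>\<^sub>M P. (\<integral>\<^sup>+y. ennreal (norm (indicator {0<..} y *\<^sub>R riesz_kernel L \<gamma> p q t z y)) \<partial>lborel) \<le> ennreal (R z)"
      using riesz_kernel_dominated[OF \<gamma> \<alpha>] unfolding L_dominated_def by blast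
    have "AE z in lborel \<Otimes>\<^sub>M P. integrable lborel (\<lambda>y. indicator {0<..} y *\<^sub>R riesz_kernel L \<gamma> p q t z y)"
      using le AE_local_time_nonneg
    proof eventually_elim
      case (elim z)
      show ?case
        by (rule integrableI_bounded[OF km]) (use elim in \<open>auto intro: le_less_trans\<close>)
    qed
    moreover from this le have "AE z in lborel \<Otimes>\<^sub>M P. \<bar>riesz_transform L \<gamma> p q t z\<bar> \<le> R z"
    proof eventually_elim
      case (elim z)
      have "ennreal (norm (riesz_transform L \<gamma> p q t z)) \<le> ennreal (R z)"
        unfolding riesz_transform_def set_lebesgue_integral_def
        by (rule order_trans[OF integral_norm_bound_ennreal[OF elim(1)] elim(2)])
      then show ?case using R(1)[of z] by (simp add: ennreal_le_iff)
    qed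
    ultimately show ?thesis
      using in_L_dominated[OF R(2) riesz_transform_measurable[OF L t]] \<alpha> by (auto simp: set_integrable_def)
  qed
  \<comment> \<open>Absolute convergence does not mention \<alpha>, so the estimate is used at one
    index between 1 and 2, here 3/2.\<close>
  show "AE z in lborel \<Otimes>\<^sub>M P. set_integrable lborel {0<..} (riesz_kernel L \<gamma> p q t z)"
    using 1[of "3/2"] by simp
  show "in_L (lborel \<Otimes>\<^sub>M P) \<alpha> (riesz_transform L \<gamma> p q t)" if "1 < \<alpha>" "\<alpha> < 2"
    using 1[OF that] by simp
qed

end

section \<open>Laws of linear functionals of the local time\<close>

text \<open>Point values are limits of integrals against mollifiers centred at \<open>x\<close>.
  They are carried along with the integrals because a truncated Riesz functional also contains a
  multiple of L_t(x).\<close>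

lemma occupation_density_point_law:
  assumes X: "stable_levy P \<sigma> \<beta> X" "AE \<omega> in P. right_continuous_path (\<lambda>s. X s \<omega>)" "occupation_density P X L"
    and X': "stable_levy P' \<sigma> \<beta> X'" "AE \<omega> in P'. right_continuous_path (\<lambda>s. X' s \<omega>)" "occupation_density P' X' L'"
    and J: "finite J" and t: "\<And>j. j \<in> J \<Longrightarrow> 0 \<le> t j"
    and f: "\<And>j. j \<in> J \<Longrightarrow> continuous_on UNIV (f j)" "\<And>j v. j \<in> J \<Longrightarrow> \<bar>f j v\<bar> \<le> B j"
  shows "(CLINT \<omega>|P. iexp (\<Sum>j\<in>J. (LINT v|lborel. f j v * L (t j) v \<omega>) + c j * L (t j) x \<omega>)) =
         (CLINT \<omega>|P'. iexp (\<Sum>j\<in>J. (LINT v|lborel. f j v * L' (t j) v \<omega>) + c j * L' (t j) x \<omega>))"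
proof -
  define g where "g = (\<lambda>n j v. f j v + c j * gauss_kernel n (v - x))"
  have gk: "continuous_on UNIV (\<lambda>v. gauss_kernel n (v - x))" for n
    by (rule continuous_on_compose2[OF gauss_kernel_continuous]) (auto intro!: continuous_intros)
  have g: "continuous_on UNIV (g n j)" "\<And>v. \<bar>g n j v\<bar> \<le> B j + \<bar>c j\<bar> * real (Suc n)" if "j \<in> J" for n j
  proof -
    show "continuous_on UNIV (g n j)" unfolding g_def by (intro continuous_intros f that gk)
    fix v
    have "\<bar>c j * gauss_kernel n (v - x)\<bar> \<le> \<bar>c j\<bar> * real (Suc n)"
      unfolding abs_mult using gauss_kernel_le[of n "v - x"] gauss_kernel_nonneg[of n "v - x"] by (intro mult_left_mono) auto
    then show "\<bar>g n j v\<bar> \<le> B j + \<bar>c j\<bar> * real (Suc n)" unfolding g_def using f(2)[OF that, of v] by linarith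
  qed
  have fm[measurable]: "f j \<in> borel_measurable borel" if "j \<in> J" for j using f(1)[OF that] by (rule borel_measurable_continuous_onI)
  have gm: "g n j \<in> borel_measurable borel" if "j \<in> J" for n j using g(1)[OF that] by (rule borel_measurable_continuous_onI)
  have *: "(\<lambda>\<omega>. \<Sum>j\<in>J. LINT v|lborel. g n j v * L (t j) v \<omega>) \<in> borel_measurable P"
    "(\<lambda>\<omega>. \<Sum>j\<in>J. (LINT v|lborel. f j v * L (t j) v \<omega>) + c j * L (t j) x \<omega>) \<in> borel_measurable P"
    "AE \<omega> in P. (\<lambda>n. \<Sum>j\<in>J. LINT v|lborel. g n j v * L (t j) v \<omega>) \<longlonglongrightarrow> (\<Sum>j\<in>J. (LINT v|lborel. f j v * L (t j) v \<omega>) + c j * L (t j) x \<omega>)"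
    if L: "occupation_density P X L" for P :: "'x measure" and X L and n
  proof -
    show "(\<lambda>\<omega>. \<Sum>j\<in>J. LINT v|lborel. g n j v * L (t j) v \<omega>) \<in> borel_measurable P"
      using t gm by (intro borel_measurable_sum occupation_density_integral_measurable[OF L])
    show "(\<lambda>\<omega>. \<Sum>j\<in>J. (LINT v|lborel. f j v * L (t j) v \<omega>) + c j * L (t j) x \<omega>) \<in> borel_measurable P"
      using t fm occupation_densityD(1)[OF L t] by (intro borel_measurable_sum borel_measurable_add borel_measurable_times occupation_density_integral_measurable[OF L]) auto
    have "AE \<omega> in P. \<forall>j\<in>J. integrable lborel (\<lambda>x. L (t j) x \<omega>)"
    proof (intro AE_finite_allI J)
      fix j assume "j \<in> J"
      from occupation_densityD(4)[OF L t[OF this]] show "AE \<omega> in P. integrable lborel (\<lambda>x. L (t j) x \<omega>)"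
        by eventually_elim auto
    qed
    then show "AE \<omega> in P. (\<lambda>n. \<Sum>j\<in>J. LINT v|lborel. g n j v * L (t j) v \<omega>) \<longlonglongrightarrow> (\<Sum>j\<in>J. (LINT v|lborel. f j v * L (t j) v \<omega>) + c j * L (t j) x \<omega>)"
      using AE_space
    proof eventually_elim
      case (elim \<omega>)
      show ?case
      proof (intro tendsto_sum)
        fix j assume j: "j \<in> J"
        let ?l = "\<lambda>v. L (t j) v \<omega>"
        have [measurable]: "?l \<in> borel_measurable borel" by (rule occupation_densityD(3)[OF L t[OF j] elim(2)])
        have i: "integrable lborel ?l" using elim(1) j by auto
        have i1: "integrable lborel (\<lambda>v. f j v * ?l v)"
          using f(2)[OF j] fm[OF j] by (intro integrable_bounded_mult[OF i]) auto
        have i2: "integrable lborel (\<lambda>v. gauss_kernel n (v - x) * ?l v)" for n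
          by (rule integrable_bounded_mult[OF i, where B="real (Suc n)"])
            (use gauss_kernel_le gauss_kernel_nonneg in \<open>auto simp del: of_nat_Suc\<close>)
        have "(LINT v|lborel. g n j v * ?l v) = (LINT v|lborel. f j v * ?l v) + c j * (LINT v|lborel. gauss_kernel n (v - x) * ?l v)" for n
        proof -
          have "(LINT v|lborel. g n j v * ?l v) = (LINT v|lborel. f j v * ?l v + c j * (gauss_kernel n (v - x) * ?l v))"
            by (intro Bochner_Integration.integral_cong) (auto simp: g_def algebra_simps)
          then show ?thesis using i1 i2[of n] by simp
        qed
        moreover have "(\<lambda>n. LINT v|lborel. gauss_kernel n (v - x) * ?l v) \<longlonglongrightarrow> ?l x"
          by (rule gauss_kernel_tendsto[OF occupation_densityD(2)[OF L t[OF j] elim(2)] i])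
        ultimately show "(\<lambda>n. LINT v|lborel. g n j v * ?l v) \<longlonglongrightarrow> (LINT v|lborel. f j v * ?l v) + c j * ?l x"
          by (simp only:) (intro tendsto_intros)
      qed
    qed
  qed
  show ?thesis
    by (rule integral_iexp_eq_LIMSEQ[OF stable_levyD(1)[OF X(1)] stable_levyD(1)[OF X'(1)] *(1)[OF X(3)] *(2)[OF X(3)] *(1)[OF X'(3)] *(2)[OF X'(3)] *(3)[OF X(3)] *(3)[OF X'(3)]])
      (rule occupation_density_integral_law[OF X X' J t g])
qed

section \<open>Truncated Riesz kernels and the law of the transform\<close>

text \<open>y^(-\<gamma>) made bounded and continuous: the ramp is 0 up to y = 1/(n + 1) and 1 from
  y = 2/(n + 1) on, and the maximum under the power keeps it away from the singularity for every
  real y.\<close>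

definition cut_kernel :: "real \<Rightarrow> nat \<Rightarrow> real \<Rightarrow> real" where
  "cut_kernel \<gamma> n y = max 0 (min 1 (real (Suc n) * y - 1)) * max y (1 / real (Suc n)) powr (- \<gamma>)"

lemma cut_kernel:
  assumes \<gamma>: "1 < \<gamma>"
  shows "continuous_on UNIV (cut_kernel \<gamma> n)" "\<bar>cut_kernel \<gamma> n y\<bar> \<le> real (Suc n) powr \<gamma>"
    "0 \<le> cut_kernel \<gamma> n y" "y \<le> 0 \<Longrightarrow> cut_kernel \<gamma> n y = 0" "0 < y \<Longrightarrow> cut_kernel \<gamma> n y \<le> y powr (- \<gamma>)"
    "0 < y \<Longrightarrow> (\<lambda>n. cut_kernel \<gamma> n y) \<longlonglongrightarrow> y powr (- \<gamma>)"
    "integrable lborel (cut_kernel \<gamma> n)" "cut_kernel \<gamma> n \<in> borel_measurable borel"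
proof -
  let ?N = "real (Suc n)"
  have pos: "0 < max y (1 / ?N)" for y by (simp add: less_max_iff_disj del: of_nat_Suc)
  show c: "continuous_on UNIV (cut_kernel \<gamma> n)"
    unfolding cut_kernel_def using pos by (intro continuous_intros) (auto simp: less_le simp del: of_nat_Suc)
  show m[measurable]: "cut_kernel \<gamma> n \<in> borel_measurable borel" using c by (rule borel_measurable_continuous_onI)
  show nn: "0 \<le> cut_kernel \<gamma> n y" for y by (simp add: cut_kernel_def)
  have b: "cut_kernel \<gamma> n y \<le> ?N powr \<gamma>" for y
  proof -
    have "max y (1 / ?N) powr (- \<gamma>) \<le> (1 / ?N) powr (- \<gamma>)" using \<gamma> by (intro powr_mono2') auto
    also have "(1 / ?N) powr (- \<gamma>) = ?N powr \<gamma>" by (simp add: powr_minus_divide powr_divide del: of_nat_Suc)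
    finally have "cut_kernel \<gamma> n y \<le> 1 * ?N powr \<gamma>" unfolding cut_kernel_def by (intro mult_mono) auto
    then show ?thesis by simp
  qed
  then show "\<bar>cut_kernel \<gamma> n y\<bar> \<le> ?N powr \<gamma>" using nn[of y] by simp
  have z: "cut_kernel \<gamma> n y = 0" if "y \<le> 1 / ?N" for y
  proof -
    have "?N * y \<le> 1" using that by (simp add: field_simps)
    then show ?thesis by (simp add: cut_kernel_def del: of_nat_Suc)
  qed
  then show "cut_kernel \<gamma> n y = 0" if "y \<le> 0" for y using order_trans[OF that, of "1 / ?N"] by simp
  show le: "cut_kernel \<gamma> n y \<le> y powr (- \<gamma>)" if "0 < y" for y
  proof -
    have "max y (1 / ?N) powr (- \<gamma>) \<le> y powr (- \<gamma>)" using \<gamma> that by (intro powr_mono2') auto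
    then have "cut_kernel \<gamma> n y \<le> 1 * y powr (- \<gamma>)" unfolding cut_kernel_def by (intro mult_mono) auto
    then show ?thesis by simp
  qed
  show "(\<lambda>n. cut_kernel \<gamma> n y) \<longlonglongrightarrow> y powr (- \<gamma>)" if y: "0 < y"
  proof (rule tendsto_eventually)
    \<comment> \<open>From this index on, \<open>y\<close> lies past the ramp and the truncated
      kernel agrees with y^(-\<gamma>).\<close>
    obtain K where K: "2 / y < real K" using reals_Archimedean2 by blast
    show "\<forall>\<^sub>F n in sequentially. cut_kernel \<gamma> n y = y powr (- \<gamma>)"
      using eventually_ge_at_top[of K]
    proof eventually_elim
      case (elim n)
      then have "2 / y < real (Suc n)" using K by linarith
      then have "2 < real (Suc n) * y" using y by (simp add: field_simps del: of_nat_Suc)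
      moreover from this have "1 / real (Suc n) \<le> y" by (simp add: field_simps del: of_nat_Suc)
      ultimately show ?case by (simp add: cut_kernel_def max_absorb1 min_absorb1 del: of_nat_Suc)
    qed
  qed
  show "integrable lborel (cut_kernel \<gamma> n)"
  proof (rule integrableI_bounded)
    have "(\<integral>\<^sup>+y. ennreal (cut_kernel \<gamma> n y) \<partial>lborel) < \<infinity>"
    proof (rule nn_integral_lborel_finite_powr[where C="?N powr \<gamma>" and a=0 and b="-\<gamma>"])
      fix y :: real assume y: "1 \<le> \<bar>y\<bar>"
      have 1: "1 \<le> ?N powr \<gamma>" using \<gamma> by (intro ge_one_powr_ge_zero) auto
      show "cut_kernel \<gamma> n y \<le> ?N powr \<gamma> * \<bar>y\<bar> powr (- \<gamma>)"
      proof (cases "y \<le> 0")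
        case True
        then have "cut_kernel \<gamma> n y = 0" using z order_trans[OF True, of "1 / ?N"] by simp
        then show ?thesis by simp
      next
        case False
        then have "cut_kernel \<gamma> n y \<le> 1 * \<bar>y\<bar> powr (- \<gamma>)" using le[of y] by simp
        also have "\<dots> \<le> ?N powr \<gamma> * \<bar>y\<bar> powr (- \<gamma>)" using 1 by (intro mult_right_mono) auto
        finally show ?thesis .
      qed
    qed (use b \<gamma> in \<open>auto simp del: of_nat_Suc\<close>)
    then show "(\<integral>\<^sup>+y. ennreal (norm (cut_kernel \<gamma> n y)) \<partial>lborel) < \<infinity>" using nn by simp
  qed measurable
qed

text \<open>Truncation makes the three terms of the bracket separately integrable. The substitutions
  v = x + y and v = x - y then show an integral of \<open>l\<close> against a bounded continuous
  function plus a multiple of \<open>l x\<close>, as \<open>occupation_density_point_law\<close>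
  demands.\<close>

lemma cut_kernel_integral_eq:
  assumes \<gamma>: "1 < \<gamma>" and [measurable]: "l \<in> borel_measurable borel" and l: "integrable lborel l"
  shows "(LINT v|lborel. (p * cut_kernel \<gamma> n (v - x) + q * cut_kernel \<gamma> n (x - v)) * l v) + (- (p + q) * (LINT y|lborel. cut_kernel \<gamma> n y)) * l x
    = (LINT y|lborel. cut_kernel \<gamma> n y * (p * l (x + y) + q * l (x - y) - (p + q) * l x))"
proof -
  note [measurable] = cut_kernel(8)[OF \<gamma>]
  have i: "integrable lborel (\<lambda>v. cut_kernel \<gamma> n (u v) * l v)" if [measurable]: "u \<in> borel_measurable borel" for u
    by (rule Bochner_Integration.integrable_bound[where f="\<lambda>v. real (Suc n) powr \<gamma> * l v"])
      (use l cut_kernel(2)[OF \<gamma>] in \<open>auto simp: abs_mult intro!: mult_right_mono simp del: of_nat_Suc\<close>)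
  have a1: "(LINT v|lborel. cut_kernel \<gamma> n (v - x) * l v) = (LINT y|lborel. cut_kernel \<gamma> n y * l (x + y))"
    using lborel_integral_real_affine[of 1 "\<lambda>v. cut_kernel \<gamma> n (v - x) * l v" x] by simp
  have a2: "(LINT v|lborel. cut_kernel \<gamma> n (x - v) * l v) = (LINT y|lborel. cut_kernel \<gamma> n y * l (x - y))"
    using lborel_integral_real_affine[of "-1" "\<lambda>v. cut_kernel \<gamma> n (x - v) * l v" x] by simp
  have j1: "integrable lborel (\<lambda>y. cut_kernel \<gamma> n y * l (x + y))"
    using lborel_integrable_real_affine[of "\<lambda>v. cut_kernel \<gamma> n (v - x) * l v" 1 x] i[of "\<lambda>v. v - x"] by simp
  have j2: "integrable lborel (\<lambda>y. cut_kernel \<gamma> n y * l (x - y))"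
    using lborel_integrable_real_affine[of "\<lambda>v. cut_kernel \<gamma> n (x - v) * l v" "-1" x] i[of "\<lambda>v. x - v"] by simp
  have "(LINT v|lborel. (p * cut_kernel \<gamma> n (v - x) + q * cut_kernel \<gamma> n (x - v)) * l v) =
     (LINT v|lborel. p * (cut_kernel \<gamma> n (v - x) * l v) + q * (cut_kernel \<gamma> n (x - v) * l v))"
    by (intro Bochner_Integration.integral_cong refl) (simp add: algebra_simps)
  also have "\<dots> = p * (LINT y|lborel. cut_kernel \<gamma> n y * l (x + y)) + q * (LINT y|lborel. cut_kernel \<gamma> n y * l (x - y))"
    using i[of "\<lambda>v. v - x"] i[of "\<lambda>v. x - v"] by (simp add: a1 a2)
  finally have 1: "(LINT v|lborel. (p * cut_kernel \<gamma> n (v - x) + q * cut_kernel \<gamma> n (x - v)) * l v) =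
     p * (LINT y|lborel. cut_kernel \<gamma> n y * l (x + y)) + q * (LINT y|lborel. cut_kernel \<gamma> n y * l (x - y))" .
  have "(LINT y|lborel. cut_kernel \<gamma> n y * (p * l (x + y) + q * l (x - y) - (p + q) * l x)) =
    (LINT y|lborel. (p * (cut_kernel \<gamma> n y * l (x + y)) + q * (cut_kernel \<gamma> n y * l (x - y))) - ((p + q) * l x) * cut_kernel \<gamma> n y)"
    by (intro Bochner_Integration.integral_cong refl) (simp add: algebra_simps)
  also have "\<dots> = p * (LINT y|lborel. cut_kernel \<gamma> n y * l (x + y)) + q * (LINT y|lborel. cut_kernel \<gamma> n y * l (x - y)) - ((p + q) * l x) * (LINT y|lborel. cut_kernel \<gamma> n y)"
    using j1 j2 cut_kernel(7)[OF \<gamma>, of n] by simp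
  finally show ?thesis unfolding 1 by (simp add: algebra_simps)
qed

text \<open>The full kernel y^(-\<gamma>) dominates all truncations on y > 0, so absolute
  convergence is enough for removing them.\<close>

lemma cut_kernel_tendsto:
  assumes \<gamma>: "1 < \<gamma>" and [measurable]: "l \<in> borel_measurable borel"
    and int: "set_integrable lborel {0<..} (\<lambda>y. \<bar>y\<bar> powr (- \<gamma>) * l y)"
  shows "(\<lambda>n. LINT y|lborel. cut_kernel \<gamma> n y * l y) \<longlonglongrightarrow> (LINT y:{0<..}|lborel. \<bar>y\<bar> powr (- \<gamma>) * l y)"
  unfolding set_lebesgue_integral_def
proof (rule integral_dominated_convergence[where w="\<lambda>y. norm (indicator {0<..} y *\<^sub>R (\<bar>y\<bar> powr (- \<gamma>) * l y))"])
  note [measurable] = cut_kernel(8)[OF \<gamma>]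
  show "integrable lborel (\<lambda>y. norm (indicator {0<..} y *\<^sub>R (\<bar>y\<bar> powr (- \<gamma>) * l y)))"
    using int unfolding set_integrable_def by (rule integrable_norm)
  show "AE y in lborel. norm (cut_kernel \<gamma> n y * l y) \<le> norm (indicator {0<..} y *\<^sub>R (\<bar>y\<bar> powr (- \<gamma>) * l y))" for n
  proof (rule AE_I2)
    fix y :: real
    show "norm (cut_kernel \<gamma> n y * l y) \<le> norm (indicator {0<..} y *\<^sub>R (\<bar>y\<bar> powr (- \<gamma>) * l y))"
      using cut_kernel(3)[OF \<gamma>, of n y] cut_kernel(4)[OF \<gamma>, of y n] cut_kernel(5)[OF \<gamma>, of y n]
      by (cases "0 < y") (auto simp: abs_mult intro!: mult_right_mono)
  qed
  show "AE y in lborel. (\<lambda>n. cut_kernel \<gamma> n y * l y) \<longlonglongrightarrow> indicator {0<..} y *\<^sub>R (\<bar>y\<bar> powr (- \<gamma>) * l y)"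
  proof (rule AE_I2)
    fix y :: real
    show "(\<lambda>n. cut_kernel \<gamma> n y * l y) \<longlonglongrightarrow> indicator {0<..} y *\<^sub>R (\<bar>y\<bar> powr (- \<gamma>) * l y)"
    proof (cases "0 < y")
      case True
      then show ?thesis using tendsto_mult[OF cut_kernel(6)[OF \<gamma> True] tendsto_const[of "l y"]] by simp
    qed (simp add: cut_kernel(4)[OF \<gamma>])
  qed
  show "(\<lambda>y. cut_kernel \<gamma> n y * l y) \<in> borel_measurable lborel" for n by measurable
  show "(\<lambda>y. indicator {0<..} y *\<^sub>R (\<bar>y\<bar> powr (- \<gamma>) * l y)) \<in> borel_measurable lborel" by measurable
qed

definition riesz_comb :: "(real \<Rightarrow> real \<Rightarrow> 'a \<Rightarrow> real) \<Rightarrow> real \<Rightarrow> real \<Rightarrow> real \<Rightarrow> 'i set \<Rightarrow> ('i \<Rightarrow> real) \<Rightarrow> ('i \<Rightarrow> real) \<Rightarrow> real \<times> 'a \<Rightarrow> real" where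
  "riesz_comb L \<gamma> p q J t \<theta> z = (\<Sum>j\<in>J. \<theta> j * riesz_transform L \<gamma> p q (t j) z)"

text \<open>The shape of functional compared by \<open>occupation_density_point_law\<close>, indexed
  by the truncation level \<open>n\<close>.\<close>

definition cut_comb :: "(real \<Rightarrow> real \<Rightarrow> 'a \<Rightarrow> real) \<Rightarrow> 'i set \<Rightarrow> ('i \<Rightarrow> real) \<Rightarrow> (nat \<Rightarrow> 'i \<Rightarrow> real \<Rightarrow> real) \<Rightarrow> (nat \<Rightarrow> 'i \<Rightarrow> real) \<Rightarrow> real \<Rightarrow> nat \<Rightarrow> 'a \<Rightarrow> real" where
  "cut_comb L J t f c x n \<omega> = (\<Sum>j\<in>J. (LINT v|lborel. f n j v * L (t j) v \<omega>) + c n j * L (t j) x \<omega>)"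

text \<open>At a fixed \<open>x\<close> the truncated functionals have equal characteristic
  functions on both spaces, and by absolute convergence they tend to the transforms almost
  surely.\<close>

lemma riesz_transform_point_law:
  assumes X: "stable_levy P \<sigma> \<beta> X" "AE \<omega> in P. right_continuous_path (\<lambda>s. X s \<omega>)" "occupation_density P X L"
    and X': "stable_levy P' \<sigma> \<beta> X'" "AE \<omega> in P'. right_continuous_path (\<lambda>s. X' s \<omega>)" "occupation_density P' X' L'"
    and J: "finite J" and t: "\<And>j. j \<in> J \<Longrightarrow> 0 \<le> t j" and \<gamma>: "1 < \<gamma>"
    and int: "AE \<omega> in P. \<forall>j\<in>J. set_integrable lborel {0<..} (riesz_kernel L \<gamma> p q (t j) (x, \<omega>))"
      "AE \<omega> in P'. \<forall>j\<in>J. set_integrable lborel {0<..} (riesz_kernel L' \<gamma> p q (t j) (x, \<omega>))"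
  shows "(CLINT \<omega>|P. iexp (\<Sum>j\<in>J. \<theta> j * riesz_transform L \<gamma> p q (t j) (x, \<omega>))) =
         (CLINT \<omega>|P'. iexp (\<Sum>j\<in>J. \<theta> j * riesz_transform L' \<gamma> p q (t j) (x, \<omega>)))"
proof -
  define f where "f = (\<lambda>n j v. \<theta> j * (p * cut_kernel \<gamma> n (v - x) + q * cut_kernel \<gamma> n (x - v)))"
  define c where "c = (\<lambda>n j. \<theta> j * (- (p + q) * (LINT y|lborel. cut_kernel \<gamma> n y)))"
  have fc: "continuous_on UNIV (f n j)" for n j
  proof -
    have "continuous_on UNIV (\<lambda>v. cut_kernel \<gamma> n (v - x))" "continuous_on UNIV (\<lambda>v. cut_kernel \<gamma> n (x - v))"
      by (rule continuous_on_compose2[OF cut_kernel(1)[OF \<gamma>]], auto intro!: continuous_intros)+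
    then show ?thesis unfolding f_def by (intro continuous_intros)
  qed
  have fb: "\<bar>f n j v\<bar> \<le> \<bar>\<theta> j\<bar> * (\<bar>p\<bar> * real (Suc n) powr \<gamma> + \<bar>q\<bar> * real (Suc n) powr \<gamma>)" for n j v
    unfolding f_def abs_mult[of "\<theta> j"]
    by (intro mult_left_mono order_trans[OF abs_triangle_ineq] add_mono) (auto simp: abs_mult intro!: mult_left_mono cut_kernel(2)[OF \<gamma>] simp del: of_nat_Suc)
  have fm[measurable]: "f n j \<in> borel_measurable borel" for n j using fc by (rule borel_measurable_continuous_onI)
  have *: "cut_comb L J t f c x n \<in> borel_measurable P" "(\<lambda>\<omega>. \<Sum>j\<in>J. \<theta> j * riesz_transform L \<gamma> p q (t j) (x, \<omega>)) \<in> borel_measurable P"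
    "AE \<omega> in P. (\<lambda>n. cut_comb L J t f c x n \<omega>) \<longlonglongrightarrow> (\<Sum>j\<in>J. \<theta> j * riesz_transform L \<gamma> p q (t j) (x, \<omega>))"
    if L: "occupation_density P X L" and int: "AE \<omega> in P. \<forall>j\<in>J. set_integrable lborel {0<..} (riesz_kernel L \<gamma> p q (t j) (x, \<omega>))"
    for P :: "'x measure" and X L and n
  proof -
    show "cut_comb L J t f c x n \<in> borel_measurable P" unfolding cut_comb_def
      using t occupation_densityD(1)[OF L t] by (intro borel_measurable_sum borel_measurable_add borel_measurable_times occupation_density_integral_measurable[OF L] fm) auto
    show "(\<lambda>\<omega>. \<Sum>j\<in>J. \<theta> j * riesz_transform L \<gamma> p q (t j) (x, \<omega>)) \<in> borel_measurable P"
    proof (intro borel_measurable_sum borel_measurable_times borel_measurable_const)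
      fix j assume "j \<in> J"
      have "(\<lambda>\<omega>. (x, \<omega>)) \<in> measurable P (lborel \<Otimes>\<^sub>M P)" by measurable
      from measurable_compose[OF this riesz_transform_measurable[OF L t[OF \<open>j \<in> J\<close>]]]
      show "(\<lambda>\<omega>. riesz_transform L \<gamma> p q (t j) (x, \<omega>)) \<in> borel_measurable P" .
    qed
    have "AE \<omega> in P. \<forall>j\<in>J. integrable lborel (\<lambda>x. L (t j) x \<omega>)"
    proof (intro AE_finite_allI J)
      fix j assume "j \<in> J"
      from occupation_densityD(4)[OF L t[OF this]] show "AE \<omega> in P. integrable lborel (\<lambda>x. L (t j) x \<omega>)"
        by eventually_elim auto
    qed
    then show "AE \<omega> in P. (\<lambda>n. cut_comb L J t f c x n \<omega>) \<longlonglongrightarrow> (\<Sum>j\<in>J. \<theta> j * riesz_transform L \<gamma> p q (t j) (x, \<omega>))"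
      using AE_space int
    proof eventually_elim
      case (elim \<omega>)
      show ?case unfolding cut_comb_def
      proof (intro tendsto_sum)
        fix j assume j: "j \<in> J"
        let ?l = "\<lambda>v. L (t j) v \<omega>"
        let ?D = "\<lambda>y. p * ?l (x + y) + q * ?l (x - y) - (p + q) * ?l x"
        have [measurable]: "?l \<in> borel_measurable borel" by (rule occupation_densityD(3)[OF L t[OF j] elim(2)])
        have i: "integrable lborel ?l" using elim(1) j by auto
        have "(LINT v|lborel. f n j v * ?l v) + c n j * ?l x = \<theta> j * (LINT y|lborel. cut_kernel \<gamma> n y * ?D y)" for n
        proof -
          have "(LINT v|lborel. f n j v * ?l v) = \<theta> j * (LINT v|lborel. (p * cut_kernel \<gamma> n (v - x) + q * cut_kernel \<gamma> n (x - v)) * ?l v)"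
            unfolding f_def by (subst integral_mult_right_zero[symmetric]) (simp only: mult.assoc)
          then show ?thesis unfolding cut_kernel_integral_eq[OF \<gamma> \<open>?l \<in> borel_measurable borel\<close> i, symmetric] c_def
            by (simp only: distrib_left mult.assoc)
        qed
        moreover have "(\<lambda>n. LINT y|lborel. cut_kernel \<gamma> n y * ?D y) \<longlonglongrightarrow> riesz_transform L \<gamma> p q (t j) (x, \<omega>)"
        proof -
          have "set_integrable lborel {0<..} (\<lambda>y. \<bar>y\<bar> powr (- \<gamma>) * ?D y)"
            using elim(3) j unfolding riesz_kernel_def by simp
          then show ?thesis
            using cut_kernel_tendsto[OF \<gamma>, of ?D] unfolding riesz_transform_def riesz_kernel_def by simp
        qed
        ultimately show "(\<lambda>n. (LINT v|lborel. f n j v * ?l v) + c n j * ?l x) \<longlonglongrightarrow> \<theta> j * riesz_transform L \<gamma> p q (t j) (x, \<omega>)"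
          by (simp only:) (intro tendsto_intros)
      qed
    qed
  qed
  show ?thesis
  proof (rule integral_iexp_eq_LIMSEQ[OF stable_levyD(1)[OF X(1)] stable_levyD(1)[OF X'(1)]
      *(1)[OF X(3) int(1)] *(2)[OF X(3) int(1)] *(1)[OF X'(3) int(2)] *(2)[OF X'(3) int(2)] *(3)[OF X(3) int(1)] *(3)[OF X'(3) int(2)]])
    show "(CLINT \<omega>|P. iexp (cut_comb L J t f c x n \<omega>)) = (CLINT \<omega>|P'. iexp (cut_comb L' J t f c x n \<omega>))" for n
      unfolding cut_comb_def by (rule occupation_density_point_law[OF X X' J t fc fb])
  qed
qed

text \<open>The kernels converge at almost every pair, hence for almost every \<open>x\<close> at
  almost every path; for such \<open>x\<close> the combination has the same law on both spaces. Its
  moment of order \<alpha> depends on this law alone, and Fubini integrates over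
  \<open>x\<close>.\<close>

lemma riesz_transform_norm_eq:
  assumes X: "stable_levy P \<sigma> \<beta> X" "AE \<omega> in P. right_continuous_path (\<lambda>s. X s \<omega>)" "occupation_density P X L"
    and X': "stable_levy P' \<sigma> \<beta> X'" "AE \<omega> in P'. right_continuous_path (\<lambda>s. X' s \<omega>)" "occupation_density P' X' L'"
    and \<sigma>: "0 < \<sigma>" and \<beta>: "1 < \<beta>" "\<beta> < 2" and \<gamma>: "1 < \<gamma>" "\<gamma> < 1 + (\<beta> - 1) / 2"
    and J: "finite J" and t: "\<And>j. j \<in> J \<Longrightarrow> 0 \<le> t j"
  shows "(\<integral>\<^sup>+z. ennreal (\<bar>riesz_comb L \<gamma> p q J t \<theta> z\<bar> powr \<alpha>) \<partial>(lborel \<Otimes>\<^sub>M P)) =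
         (\<integral>\<^sup>+z. ennreal (\<bar>riesz_comb L' \<gamma> p q J t \<theta> z\<bar> powr \<alpha>) \<partial>(lborel \<Otimes>\<^sub>M P'))"
proof -
  have *: "riesz_comb L \<gamma> p q J t \<theta> \<in> borel_measurable (lborel \<Otimes>\<^sub>M P)"
    "AE x in lborel. AE \<omega> in P. \<forall>j\<in>J. set_integrable lborel {0<..} (riesz_kernel L \<gamma> p q (t j) (x, \<omega>))"
    "(\<integral>\<^sup>+z. ennreal (\<bar>riesz_comb L \<gamma> p q J t \<theta> z\<bar> powr \<alpha>) \<partial>(lborel \<Otimes>\<^sub>M P)) = (\<integral>\<^sup>+x. \<integral>\<^sup>+\<omega>. ennreal (\<bar>riesz_comb L \<gamma> p q J t \<theta> (x, \<omega>)\<bar> powr \<alpha>) \<partial>P \<partial>lborel)"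
    if X: "stable_levy P \<sigma> \<beta> X" "AE \<omega> in P. right_continuous_path (\<lambda>s. X s \<omega>)" "occupation_density P X L"
    for P :: "'x measure" and X L
  proof -
    interpret P: prob_space P by (rule stable_levyD[OF X(1)])
    interpret pair_sigma_finite "lborel :: real measure" P ..
    show [measurable]: "riesz_comb L \<gamma> p q J t \<theta> \<in> borel_measurable (lborel \<Otimes>\<^sub>M P)"
      unfolding riesz_comb_def by (intro borel_measurable_sum borel_measurable_times borel_measurable_const riesz_transform_measurable[OF X(3) t])
    have "AE z in lborel \<Otimes>\<^sub>M P. \<forall>j\<in>J. set_integrable lborel {0<..} (riesz_kernel L \<gamma> p q (t j) z)"
      by (intro AE_finite_allI J riesz_kernel_integrable[OF X(1) \<sigma> \<beta> X(2,3) t \<gamma>])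
    then show "AE x in lborel. AE \<omega> in P. \<forall>j\<in>J. set_integrable lborel {0<..} (riesz_kernel L \<gamma> p q (t j) (x, \<omega>))"
      by (rule AE_pair)
    show "(\<integral>\<^sup>+z. ennreal (\<bar>riesz_comb L \<gamma> p q J t \<theta> z\<bar> powr \<alpha>) \<partial>(lborel \<Otimes>\<^sub>M P)) = (\<integral>\<^sup>+x. \<integral>\<^sup>+\<omega>. ennreal (\<bar>riesz_comb L \<gamma> p q J t \<theta> (x, \<omega>)\<bar> powr \<alpha>) \<partial>P \<partial>lborel)"
      by (rule sigma_finite_measure.nn_integral_fst[symmetric, OF prob_space_imp_sigma_finite[OF stable_levyD(1)[OF X(1)]]]) measurable
  qed
  have "(\<integral>\<^sup>+x. \<integral>\<^sup>+\<omega>. ennreal (\<bar>riesz_comb L \<gamma> p q J t \<theta> (x, \<omega>)\<bar> powr \<alpha>) \<partial>P \<partial>lborel) = (\<integral>\<^sup>+x. \<integral>\<^sup>+\<omega>. ennreal (\<bar>riesz_comb L' \<gamma> p q J t \<theta> (x, \<omega>)\<bar> powr \<alpha>) \<partial>P' \<partial>lborel)"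
  proof (rule nn_integral_cong_AE)
    show "AE x in lborel. (\<integral>\<^sup>+\<omega>. ennreal (\<bar>riesz_comb L \<gamma> p q J t \<theta> (x, \<omega>)\<bar> powr \<alpha>) \<partial>P) = (\<integral>\<^sup>+\<omega>. ennreal (\<bar>riesz_comb L' \<gamma> p q J t \<theta> (x, \<omega>)\<bar> powr \<alpha>) \<partial>P')"
      using *(2)[OF X] *(2)[OF X']
    proof eventually_elim
      case (elim x)
      interpret P: prob_space P by (rule stable_levyD[OF X(1)])
      interpret P': prob_space P' by (rule stable_levyD[OF X'(1)])
      have m: "(\<lambda>\<omega>. riesz_comb L \<gamma> p q J t \<theta> (x, \<omega>)) \<in> borel_measurable P" using measurable_Pair2[OF *(1)[OF X], of x] by simp
      have m': "(\<lambda>\<omega>. riesz_comb L' \<gamma> p q J t \<theta> (x, \<omega>)) \<in> borel_measurable P'" using measurable_Pair2[OF *(1)[OF X'], of x] by simp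
      have ch: "char (distr P borel (\<lambda>\<omega>. riesz_comb L \<gamma> p q J t \<theta> (x, \<omega>))) \<tau> = char (distr P' borel (\<lambda>\<omega>. riesz_comb L' \<gamma> p q J t \<theta> (x, \<omega>))) \<tau>" for \<tau>
      proof -
        have "(CLINT \<omega>|P. iexp (\<tau> * riesz_comb L \<gamma> p q J t \<theta> (x, \<omega>))) = (CLINT \<omega>|P'. iexp (\<tau> * riesz_comb L' \<gamma> p q J t \<theta> (x, \<omega>)))"
          using riesz_transform_point_law[OF X X' J t \<gamma>(1) elim, of "\<lambda>j. \<tau> * \<theta> j"]
          by (simp only: riesz_comb_def sum_distrib_left mult.assoc)
        then show ?thesis unfolding char_def by (simp add: integral_distr[OF m] integral_distr[OF m'])
      qed
      have eq: "distr P borel (\<lambda>\<omega>. riesz_comb L \<gamma> p q J t \<theta> (x, \<omega>)) = distr P' borel (\<lambda>\<omega>. riesz_comb L' \<gamma> p q J t \<theta> (x, \<omega>))"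
        by (intro Levy_uniqueness P.real_distribution_distr P'.real_distribution_distr m m' ext ch)
      have "(\<integral>\<^sup>+\<omega>. ennreal (\<bar>riesz_comb L \<gamma> p q J t \<theta> (x, \<omega>)\<bar> powr \<alpha>) \<partial>P) = (\<integral>\<^sup>+v. ennreal (\<bar>v\<bar> powr \<alpha>) \<partial>distr P borel (\<lambda>\<omega>. riesz_comb L \<gamma> p q J t \<theta> (x, \<omega>)))"
        by (rule nn_integral_distr[OF m, symmetric]) measurable
      also have "\<dots> = (\<integral>\<^sup>+\<omega>. ennreal (\<bar>riesz_comb L' \<gamma> p q J t \<theta> (x, \<omega>)\<bar> powr \<alpha>) \<partial>P')"
        unfolding eq by (rule nn_integral_distr[OF m']) measurable
      finally show ?case .
    qed
  qed
  then show ?thesis unfolding *(3)[OF X] *(3)[OF X'] .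
qed

section \<open>Stationarity and scaling\<close>

lemma stable_levy_shift:
  assumes X: "stable_levy P \<sigma> \<beta> X" and s: "0 \<le> s"
  shows "stable_levy P \<sigma> \<beta> (\<lambda>u \<omega>. X (s + u) \<omega> - X s \<omega>)"
  unfolding stable_levy_def
proof (intro conjI allI impI)
  show "prob_space P" by (rule stable_levyD[OF X])
  show "(\<lambda>\<omega>. X (s + t) \<omega> - X s \<omega>) \<in> borel_measurable P" if "0 \<le> t" for t
    using s that by (intro borel_measurable_diff stable_levyD(2)[OF X]) auto
  show "AE \<omega> in P. X (s + 0) \<omega> - X s \<omega> = 0" by simp
  show "prob_space.indep_vars P (\<lambda>_. borel) (\<lambda>i \<omega>. X (s + \<tau> (Suc i)) \<omega> - X s \<omega> - (X (s + \<tau> i) \<omega> - X s \<omega>)) {..<n}"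
    if "mono \<tau> \<and> 0 \<le> \<tau> 0" for n :: nat and \<tau>
    using stable_levyD(4)[OF X, of "\<lambda>i. s + \<tau> i" n] s that by (simp add: mono_def)
  show "distr P borel (\<lambda>\<omega>. X (s + (u + t)) \<omega> - X s \<omega> - (X (s + u) \<omega> - X s \<omega>)) = distr P borel (\<lambda>\<omega>. X (s + t) \<omega> - X s \<omega>)"
    if "0 \<le> u" "0 \<le> t" for u t
    using stable_levyD(5)[OF X, of "s + u" t] stable_levyD(5)[OF X s that(2)] s that by (simp add: add.assoc)
  show "char (distr P borel (\<lambda>\<omega>. X (s + t) \<omega> - X s \<omega>)) \<theta> = complex_of_real (exp (- \<sigma> * t * \<bar>\<theta>\<bar> powr \<beta>))" if "0 \<le> t" for t \<theta>
    using stable_levyD(5)[OF X s that] stable_levyD(6)[OF X that] by simp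
qed

lemma stable_levy_scale:
  assumes X: "stable_levy P \<sigma> \<beta> X" and c: "0 < c" and \<beta>: "\<beta> \<noteq> 0"
  shows "stable_levy P \<sigma> \<beta> (\<lambda>u \<omega>. X (c * u) \<omega> / c powr (1 / \<beta>))"
  unfolding stable_levy_def
proof (intro conjI allI impI)
  \<comment> \<open>a^\<beta> = c turns |\<theta>/a|^\<beta> into |\<theta>|^\<beta>/c, which
    cancels the lengthened time c t.\<close>
  define a where "a = c powr (1 / \<beta>)"
  have a: "a > 0" "a powr \<beta> = c" using c \<beta> by (auto simp: a_def powr_powr)
  interpret P: prob_space P by (rule stable_levyD[OF X])
  show "prob_space P" by (rule P.prob_space_axioms)
  show "(\<lambda>\<omega>. X (c * t) \<omega> / c powr (1 / \<beta>)) \<in> borel_measurable P" if "0 \<le> t" for t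
    using c that by (intro borel_measurable_divide borel_measurable_const stable_levyD(2)[OF X]) auto
  show "AE \<omega> in P. X (c * 0) \<omega> / c powr (1 / \<beta>) = 0" using stable_levyD(3)[OF X] by eventually_elim simp
  show "prob_space.indep_vars P (\<lambda>_. borel) (\<lambda>i \<omega>. X (c * \<tau> (Suc i)) \<omega> / c powr (1 / \<beta>) - X (c * \<tau> i) \<omega> / c powr (1 / \<beta>)) {..<n}"
    if "mono \<tau> \<and> 0 \<le> \<tau> 0" for n :: nat and \<tau>
  proof -
    have "P.indep_vars (\<lambda>_. borel) (\<lambda>i \<omega>. X (c * \<tau> (Suc i)) \<omega> - X (c * \<tau> i) \<omega>) {..<n}"
      using stable_levyD(4)[OF X, of "\<lambda>i. c * \<tau> i" n] c that by (simp add: mono_def)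
    then have "P.indep_vars (\<lambda>_. borel) (\<lambda>i \<omega>. (X (c * \<tau> (Suc i)) \<omega> - X (c * \<tau> i) \<omega>) / a) {..<n}"
      by (rule P.indep_vars_compose2[where Y="\<lambda>_ x. x / a"]) auto
    then show ?thesis by (simp add: a_def diff_divide_distrib)
  qed
  have div: "distr P borel (\<lambda>\<omega>. Y \<omega> / a) = distr (distr P borel Y) borel (\<lambda>x. x / a)" if "Y \<in> borel_measurable P" for Y
    using that by (subst distr_distr) (auto simp: o_def)
  show "distr P borel (\<lambda>\<omega>. X (c * (u + t)) \<omega> / c powr (1 / \<beta>) - X (c * u) \<omega> / c powr (1 / \<beta>)) = distr P borel (\<lambda>\<omega>. X (c * t) \<omega> / c powr (1 / \<beta>))"
    if ut: "0 \<le> u" "0 \<le> t" for u t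
  proof -
    have m: "X (c * u) \<in> borel_measurable P" "X (c * u + c * t) \<in> borel_measurable P" "X (c * t) \<in> borel_measurable P"
      using c ut by (auto intro!: stable_levyD(2)[OF X])
    have "distr P borel (\<lambda>\<omega>. (X (c * u + c * t) \<omega> - X (c * u) \<omega>) / a) = distr P borel (\<lambda>\<omega>. X (c * t) \<omega> / a)"
      using m stable_levyD(5)[OF X, of "c * u" "c * t"] c ut by (simp add: div)
    then show ?thesis by (simp add: a_def diff_divide_distrib distrib_left)
  qed
  show "char (distr P borel (\<lambda>\<omega>. X (c * t) \<omega> / c powr (1 / \<beta>))) \<theta> = complex_of_real (exp (- \<sigma> * t * \<bar>\<theta>\<bar> powr \<beta>))" if t: "0 \<le> t" for t \<theta>
  proof -
    have m[measurable]: "X (c * t) \<in> borel_measurable P" using c t by (intro stable_levyD(2)[OF X]) auto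
    have "char (distr P borel (\<lambda>\<omega>. X (c * t) \<omega> / a)) \<theta> = char (distr P borel (X (c * t))) (\<theta> / a)"
      by (simp add: char_def integral_distr)
    also have "\<dots> = complex_of_real (exp (- \<sigma> * (c * t) * \<bar>\<theta> / a\<bar> powr \<beta>))"
      using c t by (intro stable_levyD(6)[OF X]) auto
    also have "\<bar>\<theta> / a\<bar> powr \<beta> = \<bar>\<theta>\<bar> powr \<beta> / c" using a by (simp add: abs_divide powr_divide)
    finally show ?thesis using c by (simp add: a_def)
  qed
qed

lemma right_continuous_path_shift:
  assumes x: "right_continuous_path x" and s: "0 \<le> s"
  shows "right_continuous_path (\<lambda>u. x (s + u) - x s)"
  unfolding right_continuous_path_def
proof (intro allI impI tendsto_diff tendsto_const)
  fix t :: real assume t: "0 \<le> t"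
  have "filterlim (\<lambda>u. s + u) (at_right (s + t)) (at_right t)"
    unfolding filterlim_at by (auto intro!: tendsto_intros simp: eventually_at_filter)
  moreover have "(x \<longlongrightarrow> x (s + t)) (at_right (s + t))" using x s t by (simp add: right_continuous_path_def)
  ultimately show "((\<lambda>u. x (s + u)) \<longlongrightarrow> x (s + t)) (at_right t)" by (rule filterlim_compose[rotated])
qed

lemma right_continuous_path_scale:
  assumes x: "right_continuous_path x" and c: "0 < c"
  shows "right_continuous_path (\<lambda>u. x (c * u) / a)"
  unfolding right_continuous_path_def
proof (intro allI impI)
  fix t :: real assume t: "0 \<le> t"
  have "filterlim (\<lambda>u. c * u) (at_right (c * t)) (at_right t)"
    unfolding filterlim_at using c by (auto intro!: tendsto_intros simp: eventually_at_filter)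
  moreover have "(x \<longlongrightarrow> x (c * t)) (at_right (c * t))" using x c t by (simp add: right_continuous_path_def)
  ultimately have "((\<lambda>u. x (c * u)) \<longlongrightarrow> x (c * t)) (at_right t)" by (rule filterlim_compose[rotated])
  then show "((\<lambda>u. x (c * u) / a) \<longlongrightarrow> x (c * t) / a) (at_right t)"
    unfolding divide_inverse by (intro tendsto_intros)
qed

lemma right_continuous_path_set_integrable:
  assumes x: "right_continuous_path x" and B: "\<And>s. \<bar>x s\<bar> \<le> B"
  shows "set_integrable lborel {0..t} x"
  unfolding set_integrable_def
proof (rule Bochner_Integration.integrable_bound[where f="\<lambda>s. indicator {0..t} s * B"])
  have "emeasure lborel {0..t} < \<infinity>" by (cases "0 \<le> t") auto
  then show "integrable lborel (\<lambda>s. indicator {0..t} s * B)" by (intro integrable_mult_left integrable_real_indicator) auto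
  show "(\<lambda>s. indicator {0..t} s *\<^sub>R x s) \<in> borel_measurable lborel" using right_continuous_path_measurable[OF x, of t] by simp
  show "AE s in lborel. norm (indicator {0..t} s *\<^sub>R x s) \<le> norm (indicator {0..t} s * B)"
    using B by (auto simp: indicator_def intro: order_trans[OF _ abs_ge_self])
qed

lemma set_integral_Icc_shift:
  fixes x :: "real \<Rightarrow> real"
  assumes x: "\<And>t. set_integrable lborel {0..t} x" and s: "0 \<le> s" and t: "0 \<le> t"
  shows "(LINT u:{0..t}|lborel. x (s + u)) = (LINT u:{0..s + t}|lborel. x u) - (LINT u:{0..s}|lborel. x u)"
proof -
  have "(LINT u:{0..t}|lborel. x (s + u)) = (LINT u|lborel. indicator {s..s + t} (s + 1 * u) *\<^sub>R x (s + 1 * u))"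
    unfolding set_lebesgue_integral_def by (intro Bochner_Integration.integral_cong) (auto simp: indicator_def)
  also have "\<dots> = (LINT u|lborel. indicator {s..s + t} u *\<^sub>R x u)"
    using lborel_integral_real_affine[of 1 "\<lambda>u. indicator {s..s + t} u *\<^sub>R x u" s] by simp
  also have "\<dots> = (LINT u|lborel. indicator {0..s + t} u *\<^sub>R x u - indicator {0..s} u *\<^sub>R x u)"
    by (rule integral_discrete_difference[of "{s}"]) (use s t in \<open>auto simp: indicator_def\<close>)
  also have "\<dots> = (LINT u:{0..s + t}|lborel. x u) - (LINT u:{0..s}|lborel. x u)"
    unfolding set_lebesgue_integral_def using x unfolding set_integrable_def by (intro Bochner_Integration.integral_diff)
  finally show ?thesis .
qed

text \<open>Serves the difference of local times at s + t and s, a difference of nonnegative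
  functions. Mollified values of \<open>l\<close> are occupation integrals of a nonnegative
  function, and continuity of \<open>l\<close> lets the mollifier be removed at every point.\<close>

lemma occupation_density_nonneg:
  fixes l x :: "real \<Rightarrow> real"
  assumes l: "continuous_on UNIV l" "integrable lborel l"
    and eq: "\<And>f B. continuous_on UNIV f \<Longrightarrow> (\<And>v. \<bar>f v\<bar> \<le> B) \<Longrightarrow> (LINT u:{0..t}|lborel. f (x u)) = (LINT v|lborel. f v * l v)"
  shows "0 \<le> l z"
proof (rule LIMSEQ_le_const[OF gauss_kernel_tendsto[OF l]])
  have "0 \<le> (LINT v|lborel. gauss_kernel n (v - z) * l v)" for n
  proof -
    have "continuous_on UNIV (\<lambda>v. gauss_kernel n (v - z))"
      by (rule continuous_on_compose2[OF gauss_kernel_continuous]) (auto intro!: continuous_intros)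
    moreover have "\<bar>gauss_kernel n (v - z)\<bar> \<le> real (Suc n)" for v
      using gauss_kernel_le[of n "v - z"] gauss_kernel_nonneg[of n "v - z"] by simp
    ultimately have "(LINT v|lborel. gauss_kernel n (v - z) * l v) = (LINT u:{0..t}|lborel. gauss_kernel n (x u - z))"
      by (rule eq[symmetric])
    also have "0 \<le> \<dots>" unfolding set_lebesgue_integral_def
      by (intro integral_nonneg_AE) (auto simp: gauss_kernel_nonneg)
    finally show ?thesis .
  qed
  then show "\<exists>N. \<forall>n\<ge>N. 0 \<le> (LINT v|lborel. gauss_kernel n (v - z) * l v)" by blast
qed

text \<open>The increments after \<open>s\<close> are near \<open>x\<close> when the path is near x
  + X_s, whence the difference of local times at a random level. Joint measurability of the density
  makes this random level admissible.\<close>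

lemma occupation_density_shift:
  assumes rc: "AE \<omega> in P. right_continuous_path (\<lambda>s. X s \<omega>)" and L: "occupation_density P X L" and s: "0 \<le> s"
    and Xs: "X s \<in> borel_measurable P"
  shows "occupation_density P (\<lambda>u \<omega>. X (s + u) \<omega> - X s \<omega>) (\<lambda>t x \<omega>. L (s + t) (x + X s \<omega>) \<omega> - L s (x + X s \<omega>) \<omega>)"
  unfolding occupation_density_def
proof (intro conjI ballI allI impI)
  have m: "(\<lambda>\<omega>. L t (x + X s \<omega>) \<omega>) \<in> borel_measurable P" if "0 \<le> t" for t x
  proof -
    have "(\<lambda>\<omega>. (x + X s \<omega>, \<omega>)) \<in> measurable P (borel \<Otimes>\<^sub>M P)" using Xs by measurable
    from measurable_compose[OF this occupation_density_joint_measurable[OF L that]] show ?thesis by simp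
  qed
  show "(\<lambda>\<omega>. L (s + t) (x + X s \<omega>) \<omega> - L s (x + X s \<omega>) \<omega>) \<in> borel_measurable P" if "0 \<le> t" for t x
    using s that by (intro borel_measurable_diff m) auto
  show cont: "continuous_on UNIV (\<lambda>x. L (s + t) (x + X s \<omega>) \<omega> - L s (x + X s \<omega>) \<omega>)" if "\<omega> \<in> space P" "0 \<le> t" for \<omega> t
  proof -
    have "continuous_on UNIV (\<lambda>x. L u (x + X s \<omega>) \<omega>)" if "0 \<le> u" for u
      by (rule continuous_on_compose2[OF occupation_densityD(2)[OF L that \<open>\<omega> \<in> space P\<close>]]) (auto intro!: continuous_intros)
    then show ?thesis using s that by (intro continuous_on_diff) auto
  qed
  fix t :: real assume t: "0 \<le> t"
  have st: "0 \<le> s + t" using s t by simp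
  show "AE \<omega> in P. (\<forall>x. 0 \<le> L (s + t) (x + X s \<omega>) \<omega> - L s (x + X s \<omega>) \<omega>) \<and>
      integrable lborel (\<lambda>x. L (s + t) (x + X s \<omega>) \<omega> - L s (x + X s \<omega>) \<omega>) \<and>
      (\<forall>f B. continuous_on UNIV f \<longrightarrow> (\<forall>v. \<bar>f v\<bar> \<le> B) \<longrightarrow>
        (LINT u:{0..t}|lborel. f (X (s + u) \<omega> - X s \<omega>)) = (LINT v|lborel. f v * (L (s + t) (v + X s \<omega>) \<omega> - L s (v + X s \<omega>) \<omega>)))"
    using occupation_densityD(4)[OF L st] occupation_densityD(4)[OF L s] rc AE_space
  proof eventually_elim
    case (elim \<omega>)
    let ?y = "X s \<omega>"
    let ?l = "\<lambda>x. L (s + t) (x + ?y) \<omega> - L s (x + ?y) \<omega>"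
    have aff: "integrable lborel (\<lambda>v. g (v + ?y))" if "integrable lborel g" for g :: "real \<Rightarrow> real"
      using lborel_integrable_real_affine[OF that, of 1 ?y] by (simp add: add.commute)
    have li: "integrable lborel ?l" using elim by (intro Bochner_Integration.integrable_diff aff) auto
    have eq: "(LINT u:{0..t}|lborel. f (X (s + u) \<omega> - ?y)) = (LINT v|lborel. f v * ?l v)"
      if f: "continuous_on UNIV f" "\<And>v. \<bar>f v\<bar> \<le> B" for f B
    proof -
      let ?g = "\<lambda>v. f (v - ?y)"
      have g: "continuous_on UNIV ?g" by (rule continuous_on_compose2[OF f(1)]) (auto intro!: continuous_intros)
      have [measurable]: "f \<in> borel_measurable borel" using f(1) by (rule borel_measurable_continuous_onI)
      have "(LINT u:{0..t}|lborel. ?g (X (s + u) \<omega>)) = (LINT u:{0..s + t}|lborel. ?g (X u \<omega>)) - (LINT u:{0..s}|lborel. ?g (X u \<omega>))"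
        by (rule set_integral_Icc_shift[OF right_continuous_path_set_integrable[OF right_continuous_path_compose[OF elim(3) g] f(2)] s t])
      also have "(LINT u:{0..s + t}|lborel. ?g (X u \<omega>)) = (LINT v|lborel. ?g v * L (s + t) v \<omega>)"
        by (rule elim(1)[THEN conjunct2, THEN conjunct2, rule_format]) (rule g f(2))+
      also have "(LINT u:{0..s}|lborel. ?g (X u \<omega>)) = (LINT v|lborel. ?g v * L s v \<omega>)"
        by (rule elim(2)[THEN conjunct2, THEN conjunct2, rule_format]) (rule g f(2))+
      finally have d: "(LINT u:{0..t}|lborel. ?g (X (s + u) \<omega>)) = (LINT v|lborel. ?g v * L (s + t) v \<omega>) - (LINT v|lborel. ?g v * L s v \<omega>)" .
      have sh: "(LINT v|lborel. ?g v * h v) = (LINT v|lborel. f v * h (v + ?y))" for h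
        using lborel_integral_real_affine[of 1 "\<lambda>v. ?g v * h v" ?y] by (simp add: add.commute)
      have fi: "integrable lborel (\<lambda>v. f v * h v)" if "integrable lborel h" for h :: "real \<Rightarrow> real"
        by (rule integrable_bounded_mult[OF that _ f(2)]) simp
      note d
      also have "(LINT v|lborel. ?g v * L (s + t) v \<omega>) - (LINT v|lborel. ?g v * L s v \<omega>) = (LINT v|lborel. f v * L (s + t) (v + ?y) \<omega> - f v * L s (v + ?y) \<omega>)"
        unfolding sh using elim by (intro Bochner_Integration.integral_diff[symmetric] fi aff) auto
      also have "\<dots> = (LINT v|lborel. f v * ?l v)" by (simp add: right_diff_distrib)
      finally show ?thesis .
    qed
    show ?case
    proof (intro conjI allI impI)
      show "0 \<le> ?l x" for x
        by (rule occupation_density_nonneg[OF cont[OF elim(4) t] li, of t "\<lambda>u. X (s + u) \<omega> - ?y"]) (rule eq)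
      show "integrable lborel ?l" by (rule li)
      show "(LINT u:{0..t}|lborel. f (X (s + u) \<omega> - ?y)) = (LINT v|lborel. f v * ?l v)"
        if "continuous_on UNIV f" "\<forall>v. \<bar>f v\<bar> \<le> B" for f B using that by (intro eq) auto
    qed
  qed
qed

text \<open>The change of time contributes 1/c, the change of the space variable
  \<open>a\<close>.\<close>

lemma occupation_density_scale:
  assumes L: "occupation_density P X L" and c: "0 < c" and a: "0 < a"
  shows "occupation_density P (\<lambda>u \<omega>. X (c * u) \<omega> / a) (\<lambda>t x \<omega>. a / c * L (c * t) (a * x) \<omega>)"
  unfolding occupation_density_def
proof (intro conjI ballI allI impI)
  have ct: "0 \<le> c * t" if "0 \<le> t" for t using c that by simp
  show "(\<lambda>\<omega>. a / c * L (c * t) (a * x) \<omega>) \<in> borel_measurable P" if "0 \<le> t" for t x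
    by (intro borel_measurable_times borel_measurable_const occupation_densityD(1)[OF L ct[OF that]])
  show "continuous_on UNIV (\<lambda>x. a / c * L (c * t) (a * x) \<omega>)" if "\<omega> \<in> space P" "0 \<le> t" for \<omega> t
  proof -
    have "continuous_on UNIV (\<lambda>x. L (c * t) (a * x) \<omega>)"
      by (rule continuous_on_compose2[OF occupation_densityD(2)[OF L ct[OF that(2)] that(1)]]) (auto intro!: continuous_intros)
    then show ?thesis by (intro continuous_intros)
  qed
  fix t :: real assume t: "0 \<le> t"
  show "AE \<omega> in P. (\<forall>x. 0 \<le> a / c * L (c * t) (a * x) \<omega>) \<and> integrable lborel (\<lambda>x. a / c * L (c * t) (a * x) \<omega>) \<and>
      (\<forall>f B. continuous_on UNIV f \<longrightarrow> (\<forall>v. \<bar>f v\<bar> \<le> B) \<longrightarrow>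
        (LINT u:{0..t}|lborel. f (X (c * u) \<omega> / a)) = (LINT v|lborel. f v * (a / c * L (c * t) (a * v) \<omega>)))"
    using occupation_densityD(4)[OF L ct[OF t]]
  proof eventually_elim
    case (elim \<omega>)
    have "integrable lborel (\<lambda>x. L (c * t) (a * x) \<omega>)"
      using lborel_integrable_real_affine[of "\<lambda>x. L (c * t) x \<omega>" a 0] elim a by auto
    moreover have "(LINT u:{0..t}|lborel. f (X (c * u) \<omega> / a)) = (LINT v|lborel. f v * (a / c * L (c * t) (a * v) \<omega>))"
      if f: "continuous_on UNIV f" "\<forall>v. \<bar>f v\<bar> \<le> B" for f B
    proof -
      have g: "continuous_on UNIV (\<lambda>v. f (v / a))"
        by (rule continuous_on_compose2[OF f(1)]) (use a in \<open>auto intro!: continuous_intros\<close>)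
      have "c * (LINT u:{0..t}|lborel. f (X (c * u) \<omega> / a)) = (LINT u:{0..c * t}|lborel. f (X u \<omega> / a))"
      proof -
        have "indicator {0..c * t} (c * u) = (indicator {0..t} u :: real)" for u using c by (auto simp: indicator_def zero_le_mult_iff)
        then show ?thesis
          using lborel_integral_real_affine[of c "\<lambda>u. indicator {0..c * t} u *\<^sub>R f (X u \<omega> / a)" 0] c
          by (simp add: set_lebesgue_integral_def)
      qed
      also have "\<dots> = (LINT v|lborel. f (v / a) * L (c * t) v \<omega>)"
        using elim[THEN conjunct2, THEN conjunct2, rule_format, of "\<lambda>v. f (v / a)" B] g f(2) by simp
      also have "\<dots> = a * (LINT v|lborel. f v * L (c * t) (a * v) \<omega>)"
        using lborel_integral_real_affine[of a "\<lambda>v. f (v / a) * L (c * t) v \<omega>" 0] a by simp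
      finally have "(LINT u:{0..t}|lborel. f (X (c * u) \<omega> / a)) = a / c * (LINT v|lborel. f v * L (c * t) (a * v) \<omega>)"
        using c by (simp add: field_simps)
      also have "\<dots> = (LINT v|lborel. a / c * (f v * L (c * t) (a * v) \<omega>))" by (rule integral_mult_right_zero[symmetric])
      finally show ?thesis by (simp only: mult.left_commute)
    qed
    ultimately show ?case using elim a c by auto
  qed
qed

section \<open>Riesz transforms and their norms under scaling and shift\<close>

text \<open>Replacing y by a y gives a^(1 - \<gamma>), and undoing the factor a/c of the rescaled
  density gives c/a; the product is c a^(-\<gamma>).\<close>

lemma riesz_transform_scale:
  assumes c: "0 < c" and a: "0 < a"
  shows "riesz_transform L \<gamma> p q (c * t) (x, \<omega>) =
     c * a powr (- \<gamma>) * riesz_transform (\<lambda>t x \<omega>. a / c * L (c * t) (a * x) \<omega>) \<gamma> p q t (x / a, \<omega>)"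
proof -
  let ?L = "\<lambda>t x \<omega>. a / c * L (c * t) (a * x) \<omega>"
  have k: "indicator {0<..} (0 + a * y) *\<^sub>R riesz_kernel L \<gamma> p q (c * t) (x, \<omega>) (0 + a * y) =
     (c / a * a powr (- \<gamma>)) * (indicator {0<..} y *\<^sub>R riesz_kernel ?L \<gamma> p q t (x / a, \<omega>) y)" for y
  proof -
    have "indicator {0<..} (a * y) = (indicator {0<..} y :: real)" using a by (auto simp: indicator_def zero_less_mult_iff)
    moreover have "a * (x / a + y) = x + a * y" "a * (x / a - y) = x - a * y" "a * (x / a) = x"
      using a by (auto simp: distrib_left right_diff_distrib)
    moreover have "\<bar>a * y\<bar> powr (- \<gamma>) = a powr (- \<gamma>) * \<bar>y\<bar> powr (- \<gamma>)" using a by (simp add: abs_mult powr_mult)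
    moreover have "i * (u * v * (p * A + q * B - (p + q) * C)) = (c / a * u) * (i * (v * (p * (a / c * A) + q * (a / c * B) - (p + q) * (a / c * C))))"
      for i u v A B C :: real
      using a c by (simp add: field_simps)
    ultimately show ?thesis by (simp only: riesz_kernel_def fst_conv snd_conv real_scaleR_def add_0)
  qed
  have "riesz_transform L \<gamma> p q (c * t) (x, \<omega>) = \<bar>a\<bar> * (LINT y|lborel. indicator {0<..} (0 + a * y) *\<^sub>R riesz_kernel L \<gamma> p q (c * t) (x, \<omega>) (0 + a * y))"
    unfolding riesz_transform_def set_lebesgue_integral_def
    by (subst lborel_integral_real_affine[of a _ 0]) (use a in auto)
  also have "\<dots> = a * ((c / a * a powr (- \<gamma>)) * (LINT y|lborel. indicator {0<..} y *\<^sub>R riesz_kernel ?L \<gamma> p q t (x / a, \<omega>) y))"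
    unfolding k integral_mult_right_zero using a by simp
  also have "\<dots> = c * a powr (- \<gamma>) * riesz_transform ?L \<gamma> p q t (x / a, \<omega>)"
    unfolding riesz_transform_def set_lebesgue_integral_def using a by simp
  finally show ?thesis .
qed

text \<open>The increment of the transform is the transform of the local time accumulated after
  \<open>s\<close>, viewed from x - X_s: the random shift moves from the level of the density into
  the space variable.\<close>

lemma riesz_transform_shift:
  assumes "set_integrable lborel {0<..} (riesz_kernel L \<gamma> p q (s + t) (x, \<omega>))" "set_integrable lborel {0<..} (riesz_kernel L \<gamma> p q s (x, \<omega>))"
  shows "riesz_transform L \<gamma> p q (s + t) (x, \<omega>) - riesz_transform L \<gamma> p q s (x, \<omega>) =
    riesz_transform (\<lambda>t x \<omega>. L (s + t) (x + X s \<omega>) \<omega> - L s (x + X s \<omega>) \<omega>) \<gamma> p q t (x - X s \<omega>, \<omega>)"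
proof -
  have "riesz_kernel L \<gamma> p q (s + t) (x, \<omega>) y - riesz_kernel L \<gamma> p q s (x, \<omega>) y =
     riesz_kernel (\<lambda>t x \<omega>. L (s + t) (x + X s \<omega>) \<omega> - L s (x + X s \<omega>) \<omega>) \<gamma> p q t (x - X s \<omega>, \<omega>) y" for y
  proof -
    have "x - X s \<omega> + y + X s \<omega> = x + y" "x - X s \<omega> - y + X s \<omega> = x - y" "x - X s \<omega> + X s \<omega> = x" by auto
    then show ?thesis unfolding riesz_kernel_def fst_conv snd_conv by (simp only:) (simp add: algebra_simps)
  qed
  then show ?thesis
    using set_integral_diff(2)[OF assms] by (simp add: riesz_transform_def)
qed

text \<open>Homogeneity of the power gives k^\<alpha>, and substitution in the space variable gives
  \<open>a\<close>.\<close>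

lemma nn_integral_pair_scale:
  fixes F :: "real \<times> 'a \<Rightarrow> real"
  assumes P: "prob_space P" and F[measurable]: "F \<in> borel_measurable (lborel \<Otimes>\<^sub>M P)" and a: "0 < a" and k: "0 < k"
  shows "(\<integral>\<^sup>+z. ennreal (\<bar>k * F (fst z / a, snd z)\<bar> powr \<alpha>) \<partial>(lborel \<Otimes>\<^sub>M P)) =
    ennreal (k powr \<alpha> * a) * (\<integral>\<^sup>+z. ennreal (\<bar>F z\<bar> powr \<alpha>) \<partial>(lborel \<Otimes>\<^sub>M P))"
proof -
  interpret P: prob_space P by (rule P)
  interpret pair_sigma_finite "lborel :: real measure" P ..
  define K where "K = ennreal (k powr \<alpha> * a)"
  define G where "G = (\<lambda>z. ennreal (\<bar>F z\<bar> powr \<alpha>))"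
  have G[measurable]: "G \<in> borel_measurable (lborel \<Otimes>\<^sub>M P)" unfolding G_def by measurable
  have G': "(\<lambda>z. G (fst z / a, snd z)) \<in> borel_measurable (lborel \<Otimes>\<^sub>M P)"
  proof -
    have "(\<lambda>z. (fst z / a, snd z)) \<in> measurable (lborel \<Otimes>\<^sub>M P) (lborel \<Otimes>\<^sub>M P)" by measurable
    from measurable_compose[OF this G] show ?thesis .
  qed
  have "(\<integral>\<^sup>+x. G (x / a, \<omega>) \<partial>lborel) = ennreal a * (\<integral>\<^sup>+x. G (x, \<omega>) \<partial>lborel)" if \<omega>: "\<omega> \<in> space P" for \<omega>
  proof -
    have "(\<lambda>x. G (x, \<omega>)) \<in> borel_measurable lborel" using measurable_Pair1[OF G \<omega>] by simp
    then have [measurable]: "(\<lambda>x. G (x, \<omega>)) \<in> borel_measurable borel" by simp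
    have "(\<lambda>x. G (x / a, \<omega>)) \<in> borel_measurable borel" by measurable
    from nn_integral_real_affine[OF this, of a 0] show ?thesis using a by simp
  qed
  then have "(\<integral>\<^sup>+\<omega>. \<integral>\<^sup>+x. G (x / a, \<omega>) \<partial>lborel \<partial>P) = (\<integral>\<^sup>+\<omega>. ennreal a * (\<integral>\<^sup>+x. G (x, \<omega>) \<partial>lborel) \<partial>P)"
    by (rule nn_integral_cong)
  also have "\<dots> = ennreal a * (\<integral>\<^sup>+\<omega>. \<integral>\<^sup>+x. G (x, \<omega>) \<partial>lborel \<partial>P)"
    by (rule nn_integral_cmult) measurable
  finally have "(\<integral>\<^sup>+z. G (fst z / a, snd z) \<partial>(lborel \<Otimes>\<^sub>M P)) = ennreal a * (\<integral>\<^sup>+z. G z \<partial>(lborel \<Otimes>\<^sub>M P))"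
    using nn_integral_snd[OF G] nn_integral_snd[OF G'] by simp
  moreover have "ennreal (\<bar>k * F (fst z / a, snd z)\<bar> powr \<alpha>) = ennreal (k powr \<alpha>) * G (fst z / a, snd z)" for z
    using k by (simp add: G_def abs_mult powr_mult ennreal_mult)
  moreover have "(\<integral>\<^sup>+z. ennreal (k powr \<alpha>) * G (fst z / a, snd z) \<partial>(lborel \<Otimes>\<^sub>M P)) = ennreal (k powr \<alpha>) * (\<integral>\<^sup>+z. G (fst z / a, snd z) \<partial>(lborel \<Otimes>\<^sub>M P))"
    by (rule nn_integral_cmult[OF G'])
  moreover have "K = ennreal (k powr \<alpha>) * ennreal a" unfolding K_def using a by (intro ennreal_mult) auto
  ultimately show ?thesis by (simp add: K_def[symmetric] G_def[symmetric] mult.assoc)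
qed

context
  fixes P :: "'a measure" and X L and \<sigma> \<beta> \<gamma> :: real
  assumes X: "stable_levy P \<sigma> \<beta> X" and \<sigma>: "0 < \<sigma>" and \<beta>: "1 < \<beta>" "\<beta> < 2"
    and rc: "AE \<omega> in P. right_continuous_path (\<lambda>s. X s \<omega>)" and L: "occupation_density P X L"
    and \<gamma>: "1 < \<gamma>" "\<gamma> < 1 + (\<beta> - 1) / 2"
begin

lemma riesz_comb_measurable:
  assumes "occupation_density P X' L'" "\<And>j. j \<in> J \<Longrightarrow> 0 \<le> t j"
  shows "riesz_comb L' \<gamma> p q J t \<theta> \<in> borel_measurable (lborel \<Otimes>\<^sub>M P)"
  unfolding riesz_comb_def using assms
  by (intro borel_measurable_sum borel_measurable_times borel_measurable_const riesz_transform_measurable)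

text \<open>For a fixed path the shift x - X_s is a translation, which Lebesgue measure in
  \<open>x\<close> absorbs. What remains is a norm of the process of increments after
  \<open>s\<close>, which has the law of \<open>X\<close>.\<close>

lemma riesz_transform_increment_norm:
  assumes J: "finite J" and t: "\<And>j. j \<in> J \<Longrightarrow> 0 \<le> t j" and s: "0 \<le> s"
  shows "(\<integral>\<^sup>+z. ennreal (\<bar>\<Sum>j\<in>J. \<theta> j * (riesz_transform L \<gamma> p q (t j + s) z - riesz_transform L \<gamma> p q s z)\<bar> powr \<alpha>) \<partial>(lborel \<Otimes>\<^sub>M P)) =
         (\<integral>\<^sup>+z. ennreal (\<bar>\<Sum>j\<in>J. \<theta> j * riesz_transform L \<gamma> p q (t j) z\<bar> powr \<alpha>) \<partial>(lborel \<Otimes>\<^sub>M P))"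
proof -
  interpret P: prob_space P by (rule stable_levyD[OF X])
  interpret pair_sigma_finite "lborel :: real measure" P ..
  let ?X = "\<lambda>u \<omega>. X (s + u) \<omega> - X s \<omega>"
  let ?L = "\<lambda>t x \<omega>. L (s + t) (x + X s \<omega>) \<omega> - L s (x + X s \<omega>) \<omega>"
  have Xs[measurable]: "X s \<in> borel_measurable P" by (rule stable_levyD(2)[OF X s])
  have X': "stable_levy P \<sigma> \<beta> ?X" by (rule stable_levy_shift[OF X s])
  have rc': "AE \<omega> in P. right_continuous_path (\<lambda>u. ?X u \<omega>)"
    using rc by eventually_elim (rule right_continuous_path_shift[OF _ s])
  have L': "occupation_density P ?X ?L" by (rule occupation_density_shift[OF rc L s Xs])
  let ?F = "riesz_comb ?L \<gamma> p q J t \<theta>"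
  have mF[measurable]: "?F \<in> borel_measurable (lborel \<Otimes>\<^sub>M P)" by (rule riesz_comb_measurable[OF L' t])
  have mF': "(\<lambda>z. ennreal (\<bar>?F (fst z - X s (snd z), snd z)\<bar> powr \<alpha>)) \<in> borel_measurable (lborel \<Otimes>\<^sub>M P)"
  proof -
    have "(\<lambda>z. (fst z - X s (snd z), snd z)) \<in> measurable (lborel \<Otimes>\<^sub>M P) (lborel \<Otimes>\<^sub>M P)" by measurable
    from measurable_compose[OF this mF] show ?thesis by measurable
  qed
  have "AE z in lborel \<Otimes>\<^sub>M P. \<forall>j\<in>J. set_integrable lborel {0<..} (riesz_kernel L \<gamma> p q (s + t j) z)"
    using s t by (intro AE_finite_allI J riesz_kernel_integrable[OF X \<sigma> \<beta> rc L _ \<gamma>]) auto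
  moreover have "AE z in lborel \<Otimes>\<^sub>M P. set_integrable lborel {0<..} (riesz_kernel L \<gamma> p q s z)"
    by (rule riesz_kernel_integrable[OF X \<sigma> \<beta> rc L s \<gamma>])
  ultimately have "AE z in lborel \<Otimes>\<^sub>M P. (\<Sum>j\<in>J. \<theta> j * (riesz_transform L \<gamma> p q (t j + s) z - riesz_transform L \<gamma> p q s z)) = ?F (fst z - X s (snd z), snd z)"
  proof eventually_elim
    case (elim z)
    show ?case unfolding riesz_comb_def
    proof (intro sum.cong refl arg_cong2[where f="(*)"])
      fix j assume "j \<in> J"
      then show "riesz_transform L \<gamma> p q (t j + s) z - riesz_transform L \<gamma> p q s z = riesz_transform ?L \<gamma> p q (t j) (fst z - X s (snd z), snd z)"
        using riesz_transform_shift[of L \<gamma> p q s "t j" "fst z" "snd z" X] elim by (simp add: add.commute[of _ s])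
    qed
  qed
  then have "(\<integral>\<^sup>+z. ennreal (\<bar>\<Sum>j\<in>J. \<theta> j * (riesz_transform L \<gamma> p q (t j + s) z - riesz_transform L \<gamma> p q s z)\<bar> powr \<alpha>) \<partial>(lborel \<Otimes>\<^sub>M P)) =
     (\<integral>\<^sup>+z. ennreal (\<bar>?F (fst z - X s (snd z), snd z)\<bar> powr \<alpha>) \<partial>(lborel \<Otimes>\<^sub>M P))"
    by (intro nn_integral_cong_AE) auto
  also have "\<dots> = (\<integral>\<^sup>+\<omega>. \<integral>\<^sup>+x. ennreal (\<bar>?F (x - X s \<omega>, \<omega>)\<bar> powr \<alpha>) \<partial>lborel \<partial>P)"
    using nn_integral_snd[OF mF'] by simp
  also have "\<dots> = (\<integral>\<^sup>+\<omega>. \<integral>\<^sup>+x. ennreal (\<bar>?F (x, \<omega>)\<bar> powr \<alpha>) \<partial>lborel \<partial>P)"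
  proof (rule nn_integral_cong)
    fix \<omega> assume \<omega>: "\<omega> \<in> space P"
    have "(\<lambda>x. ?F (x, \<omega>)) \<in> borel_measurable lborel" using measurable_Pair1[OF mF \<omega>] by simp
    then have "(\<lambda>x. ennreal (\<bar>?F (x, \<omega>)\<bar> powr \<alpha>)) \<in> borel_measurable borel" by simp
    from nn_integral_real_affine[OF this, of 1 "- X s \<omega>"]
    show "(\<integral>\<^sup>+x. ennreal (\<bar>?F (x - X s \<omega>, \<omega>)\<bar> powr \<alpha>) \<partial>lborel) = (\<integral>\<^sup>+x. ennreal (\<bar>?F (x, \<omega>)\<bar> powr \<alpha>) \<partial>lborel)"
      by simp
  qed
  also have "\<dots> = (\<integral>\<^sup>+z. ennreal (\<bar>?F z\<bar> powr \<alpha>) \<partial>(lborel \<Otimes>\<^sub>M P))"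
  proof -
    have "(\<lambda>z. ennreal (\<bar>?F z\<bar> powr \<alpha>)) \<in> borel_measurable (lborel \<Otimes>\<^sub>M P)" by measurable
    from nn_integral_snd[OF this] show ?thesis .
  qed
  also have "\<dots> = (\<integral>\<^sup>+z. ennreal (\<bar>riesz_comb L \<gamma> p q J t \<theta> z\<bar> powr \<alpha>) \<partial>(lborel \<Otimes>\<^sub>M P))"
    by (rule riesz_transform_norm_eq[OF X' rc' L' X rc L \<sigma> \<beta> \<gamma> J t])
  finally show ?thesis unfolding riesz_comb_def .
qed

text \<open>Running time at speed c and dividing space by c^(1/\<beta>) yields a stable process with
  the same \<sigma>, hence the same norm; the constants produced on the way make up the power of
  c.\<close>

lemma riesz_transform_scale_norm:
  assumes J: "finite J" and t: "\<And>j. j \<in> J \<Longrightarrow> 0 \<le> t j" and c: "0 < c" and \<alpha>: "1 < \<alpha>"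
  shows "(\<integral>\<^sup>+z. ennreal (\<bar>\<Sum>j\<in>J. \<theta> j * riesz_transform L \<gamma> p q (c * t j) z\<bar> powr \<alpha>) \<partial>(lborel \<Otimes>\<^sub>M P)) =
         (\<integral>\<^sup>+z. ennreal (\<bar>\<Sum>j\<in>J. \<theta> j * (c powr (1 + 1 / (\<alpha> * \<beta>) - \<gamma> / \<beta>) * riesz_transform L \<gamma> p q (t j) z)\<bar> powr \<alpha>) \<partial>(lborel \<Otimes>\<^sub>M P))"
proof -
  interpret P: prob_space P by (rule stable_levyD[OF X])
  interpret pair_sigma_finite "lborel :: real measure" P ..
  define a where "a = c powr (1 / \<beta>)"
  have a: "0 < a" using c by (simp add: a_def)
  let ?H = "1 + 1 / (\<alpha> * \<beta>) - \<gamma> / \<beta>"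
  let ?X = "\<lambda>u \<omega>. X (c * u) \<omega> / a"
  let ?L = "\<lambda>t x \<omega>. a / c * L (c * t) (a * x) \<omega>"
  have X': "stable_levy P \<sigma> \<beta> ?X" unfolding a_def using \<beta> by (intro stable_levy_scale[OF X c]) auto
  have rc': "AE \<omega> in P. right_continuous_path (\<lambda>u. ?X u \<omega>)"
    using rc by eventually_elim (rule right_continuous_path_scale[OF _ c])
  have L': "occupation_density P ?X ?L" by (rule occupation_density_scale[OF L c a])
  let ?F = "riesz_comb ?L \<gamma> p q J t \<theta>"
  let ?k = "c * a powr (- \<gamma>)"
  have k0: "0 < ?k" using c a by simp
  have mF[measurable]: "?F \<in> borel_measurable (lborel \<Otimes>\<^sub>M P)" by (rule riesz_comb_measurable[OF L' t])
  have "(\<Sum>j\<in>J. \<theta> j * riesz_transform L \<gamma> p q (c * t j) z) = ?k * ?F (fst z / a, snd z)" for z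
    using riesz_transform_scale[OF c a, of L \<gamma> p q _ "fst z" "snd z"]
    unfolding riesz_comb_def sum_distrib_left by (intro sum.cong refl) simp
  then have "(\<integral>\<^sup>+z. ennreal (\<bar>\<Sum>j\<in>J. \<theta> j * riesz_transform L \<gamma> p q (c * t j) z\<bar> powr \<alpha>) \<partial>(lborel \<Otimes>\<^sub>M P)) =
     (\<integral>\<^sup>+z. ennreal (\<bar>?k * ?F (fst z / a, snd z)\<bar> powr \<alpha>) \<partial>(lborel \<Otimes>\<^sub>M P))"
    by (simp only:)
  also have "\<dots> = ennreal (?k powr \<alpha> * a) * (\<integral>\<^sup>+z. ennreal (\<bar>?F z\<bar> powr \<alpha>) \<partial>(lborel \<Otimes>\<^sub>M P))"
    by (rule nn_integral_pair_scale[OF stable_levyD(1)[OF X] mF a k0])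
  finally have lhs: "(\<integral>\<^sup>+z. ennreal (\<bar>\<Sum>j\<in>J. \<theta> j * riesz_transform L \<gamma> p q (c * t j) z\<bar> powr \<alpha>) \<partial>(lborel \<Otimes>\<^sub>M P)) =
    ennreal (?k powr \<alpha> * a) * (\<integral>\<^sup>+z. ennreal (\<bar>?F z\<bar> powr \<alpha>) \<partial>(lborel \<Otimes>\<^sub>M P))" .
  have norm: "(\<integral>\<^sup>+z. ennreal (\<bar>?F z\<bar> powr \<alpha>) \<partial>(lborel \<Otimes>\<^sub>M P)) = (\<integral>\<^sup>+z. ennreal (\<bar>riesz_comb L \<gamma> p q J t \<theta> z\<bar> powr \<alpha>) \<partial>(lborel \<Otimes>\<^sub>M P))"
    by (rule riesz_transform_norm_eq[OF X' rc' L' X rc L \<sigma> \<beta> \<gamma> J t])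
  \<comment> \<open>This is the origin of H: (1 - \<gamma>/\<beta>)\<alpha> + 1/\<beta> = \<alpha>H,
    the last summand on the left coming from dx.\<close>
  have const: "?k powr \<alpha> * a = (c powr ?H) powr \<alpha>"
  proof -
    have "?k = c powr (1 - \<gamma> / \<beta>)" unfolding a_def powr_powr using c by (simp add: powr_diff powr_minus_divide)
    moreover have "(1 - \<gamma> / \<beta>) * \<alpha> + 1 / \<beta> = ?H * \<alpha>" using \<alpha> \<beta> by (simp add: field_simps)
    then have "(c powr (1 - \<gamma> / \<beta>)) powr \<alpha> * c powr (1 / \<beta>) = (c powr ?H) powr \<alpha>"
      unfolding powr_powr powr_add[symmetric] by (simp only:)
    ultimately show ?thesis by (simp only: a_def)
  qed
  have m: "(\<lambda>z. ennreal (\<bar>riesz_comb L \<gamma> p q J t \<theta> z\<bar> powr \<alpha>)) \<in> borel_measurable (lborel \<Otimes>\<^sub>M P)"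
    using riesz_comb_measurable[OF L t] by measurable
  have "(\<Sum>j\<in>J. \<theta> j * (c powr ?H * riesz_transform L \<gamma> p q (t j) z)) = c powr ?H * riesz_comb L \<gamma> p q J t \<theta> z" for z
    unfolding riesz_comb_def sum_distrib_left by (intro sum.cong refl) (simp only: mult.left_commute)
  then have "ennreal (\<bar>\<Sum>j\<in>J. \<theta> j * (c powr ?H * riesz_transform L \<gamma> p q (t j) z)\<bar> powr \<alpha>) =
      ennreal ((c powr ?H) powr \<alpha>) * ennreal (\<bar>riesz_comb L \<gamma> p q J t \<theta> z\<bar> powr \<alpha>)" for z
    by (simp add: abs_mult powr_mult ennreal_mult del: powr_powr)
  then show ?thesis by (simp only: lhs norm const nn_integral_cmult[OF m])
qed

end

section \<open>Self-similarity and stationary increments of the stable integral\<close>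

text \<open>A combination of integrals is the integral of the combination, so its characteristic
  function at 1 is a function of an L^\<alpha> norm; letting the coefficients vary determines the
  joint law.\<close>

lemma (in stable_measure) same_fdd_stable_integrals:
  assumes V: "\<And>t. 0 \<le> t \<Longrightarrow> has_stable_integral Q m M \<alpha> (h t) (V t)"
    and W: "\<And>t. 0 \<le> t \<Longrightarrow> has_stable_integral Q m M \<alpha> (g t) (W t)"
    and eq: "\<And>J \<theta>. finite J \<Longrightarrow> J \<subseteq> {0..} \<Longrightarrow>
      (\<integral>\<^sup>+z. ennreal (\<bar>\<Sum>t\<in>J. \<theta> t * h t z\<bar> powr \<alpha>) \<partial>m) = (\<integral>\<^sup>+z. ennreal (\<bar>\<Sum>t\<in>J. \<theta> t * g t z\<bar> powr \<alpha>) \<partial>m)"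
  shows "same_fdd Q V W"
  unfolding same_fdd_def
proof (intro allI impI)
  fix J :: "real set" assume J: "finite J \<and> J \<subseteq> {0..}"
  have *: "(CLINT \<omega>|Q. iexp (\<Sum>t\<in>J. \<theta> t * V t \<omega>)) = complex_of_real (exp (- c * enn2real (\<integral>\<^sup>+z. ennreal (\<bar>\<Sum>t\<in>J. \<theta> t * h t z\<bar> powr \<alpha>) \<partial>m)))"
    if V: "\<And>t. 0 \<le> t \<Longrightarrow> has_stable_integral Q m M \<alpha> (h t) (V t)" for h V \<theta>
  proof -
    have S: "has_stable_integral Q m M \<alpha> (\<lambda>z. \<Sum>t\<in>J. \<theta> t * h t z) (\<lambda>\<omega>. \<Sum>t\<in>J. \<theta> t * V t \<omega>)"
      using J V by (intro has_stable_integral_sum) auto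
    then have [measurable]: "(\<lambda>\<omega>. \<Sum>t\<in>J. \<theta> t * V t \<omega>) \<in> borel_measurable Q" "(\<lambda>z. \<Sum>t\<in>J. \<theta> t * h t z) \<in> borel_measurable m"
      by (auto simp: has_stable_integral_def in_L_def)
    have "(CLINT \<omega>|Q. iexp (\<Sum>t\<in>J. \<theta> t * V t \<omega>)) = char (distr Q borel (\<lambda>\<omega>. \<Sum>t\<in>J. \<theta> t * V t \<omega>)) 1"
      by (simp add: char_def integral_distr)
    also have "\<dots> = complex_of_real (exp (- c * (LINT z|m. \<bar>\<Sum>t\<in>J. \<theta> t * h t z\<bar> powr \<alpha>)))"
      using char_stable_integral[OF S, of 1] by simp
    also have "(LINT z|m. \<bar>\<Sum>t\<in>J. \<theta> t * h t z\<bar> powr \<alpha>) = enn2real (\<integral>\<^sup>+z. ennreal (\<bar>\<Sum>t\<in>J. \<theta> t * h t z\<bar> powr \<alpha>) \<partial>m)"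
      by (intro integral_eq_nn_integral) auto
    finally show ?thesis .
  qed
  show "distr Q (Pi\<^sub>M J (\<lambda>t. borel)) (\<lambda>\<omega>. \<lambda>t\<in>J. V t \<omega>) = distr Q (Pi\<^sub>M J (\<lambda>t. borel)) (\<lambda>\<omega>. \<lambda>t\<in>J. W t \<omega>)"
  proof (rule distr_PiM_eqI_char[OF Q Q])
    show "(CLINT \<omega>|Q. iexp (\<Sum>t\<in>J. \<theta> t * V t \<omega>)) = (CLINT \<omega>|Q. iexp (\<Sum>t\<in>J. \<theta> t * W t \<omega>))" for \<theta>
      using eq[of J \<theta>] J by (simp only: *[OF V] *[OF W])
  qed (use J V W in \<open>auto simp: has_stable_integral_def\<close>)
qed

lemma stable_random_measureE:
  fixes Q :: "'b measure" and m :: "'a measure"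
  assumes M: "stable_random_measure Q m \<alpha> M" and \<alpha>: "1 < \<alpha>" "\<alpha> < 2"
  obtains c where "stable_measure Q m \<alpha> M c"
proof -
  note M' = M[unfolded stable_random_measure_def]
  obtain c where c: "c > 0" "\<forall>A\<in>sets m. emeasure m A < \<infinity> \<longrightarrow>
      (\<forall>\<theta>. char (distr Q borel (M A)) \<theta> = complex_of_real (exp (- c * measure m A * \<bar>\<theta>\<bar> powr \<alpha>)))"
    using M'[THEN conjunct2, THEN conjunct2, THEN conjunct1] by blast
  show ?thesis
  proof (rule that[of c], rule stable_measure.intro)
    show "prob_space Q" by (rule M'[THEN conjunct1])
    show "M A \<in> borel_measurable Q" if "A \<in> sets m" "emeasure m A < \<infinity>" for A
      using M'[THEN conjunct2, THEN conjunct1] that by simp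
    show "char (distr Q borel (M A)) \<theta> = complex_of_real (exp (- c * measure m A * \<bar>\<theta>\<bar> powr \<alpha>))"
      if "A \<in> sets m" "emeasure m A < \<infinity>" for A \<theta>
      using c(2) that by simp
    show "prob_space.indep_vars Q (\<lambda>_. borel) (\<lambda>i. M (A i)) {..<n}"
      if "disjoint_family_on A {..<n}" "\<And>i. i < n \<Longrightarrow> A i \<in> sets m \<and> emeasure m (A i) < \<infinity>" for n :: nat and A
      by (rule M'[THEN conjunct2, THEN conjunct2, THEN conjunct2, THEN conjunct1, rule_format]) (use that in simp)
    show "AE \<omega> in Q. (\<lambda>i. M (A i) \<omega>) sums M (\<Union>i. A i) \<omega>"
      if "disjoint_family A" "range A \<subseteq> sets m" "emeasure m (\<Union>i. A i) < \<infinity>" for A :: "nat \<Rightarrow> 'a set"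
      by (rule M'[THEN conjunct2, THEN conjunct2, THEN conjunct2, THEN conjunct2, rule_format]) (use that in simp)
  qed (use \<alpha> c(1) in auto)
qed

text \<open>Both properties reduce to equalities between L^\<alpha> norms of combinations of
  kernels. \<open>V\<close> stands for an arbitrary choice of versions, so only the defining
  property of the integral is used.\<close>

lemma riesz_transform_process_H_sssi:
  assumes X: "symmetric_stable_levy_process P \<beta> X" and L: "jointly_continuous_local_time P X L"
    and M: "stable_random_measure Q (lborel \<Otimes>\<^sub>M P) \<alpha> M"
    and \<alpha>: "1 < \<alpha>" "\<alpha> < 2" and \<beta>: "1 < \<beta>" "\<beta> < 2" and \<gamma>: "1 < \<gamma>" "\<gamma> < 1 + (\<beta> - 1) / 2"
  shows "stable_integral_process_H_sssi Q (lborel \<Otimes>\<^sub>M P) M \<alpha> (riesz_kernel L \<gamma> p q) (1 + 1 / (\<alpha> * \<beta>) - \<gamma> / \<beta>)"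
proof -
  obtain \<sigma> where \<sigma>: "0 < \<sigma>" and X: "stable_levy P \<sigma> \<beta> X" and rc: "AE \<omega> in P. right_continuous_path (\<lambda>s. X s \<omega>)"
    using X by (rule symmetric_stable_levy_processE)
  have L: "occupation_density P X L" by (rule occupation_density_of_local_time[OF rc L])
  obtain c where "stable_measure Q (lborel \<Otimes>\<^sub>M P) \<alpha> M c" using stable_random_measureE[OF M \<alpha>] .
  then interpret stable_measure Q "lborel \<Otimes>\<^sub>M P" \<alpha> M c .
  let ?h = "riesz_transform L \<gamma> p q"
  let ?H = "1 + 1 / (\<alpha> * \<beta>) - \<gamma> / \<beta>"
  have h: "(LINT y:{0<..}|lborel. riesz_kernel L \<gamma> p q t z y) = ?h t z" for t z by (simp add: riesz_transform_def)
  have "H_sssi Q ?H V" if V: "\<And>t. 0 \<le> t \<Longrightarrow> has_stable_integral Q (lborel \<Otimes>\<^sub>M P) M \<alpha> (?h t) (V t)" for V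
    unfolding H_sssi_def
  proof (intro conjI allI impI)
    show "V t \<in> borel_measurable Q" if "0 \<le> t" for t using V[OF that] by (simp add: has_stable_integral_def)
    show "self_similar Q ?H V"
      unfolding self_similar_def
    proof (intro allI impI)
      fix c :: real assume c: "0 < c"
      show "same_fdd Q (\<lambda>t. V (c * t)) (\<lambda>t \<omega>. c powr ?H * V t \<omega>)"
      proof (rule same_fdd_stable_integrals)
        show "has_stable_integral Q (lborel \<Otimes>\<^sub>M P) M \<alpha> (?h (c * t)) (V (c * t))" if "0 \<le> t" for t
          using c that by (intro V) auto
        show "has_stable_integral Q (lborel \<Otimes>\<^sub>M P) M \<alpha> (\<lambda>z. c powr ?H * ?h t z) (\<lambda>\<omega>. c powr ?H * V t \<omega>)" if "0 \<le> t" for t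
          using has_stable_integral_lincomb[OF V[OF that] V[OF that], of "c powr ?H" 0] by simp
        show "(\<integral>\<^sup>+z. ennreal (\<bar>\<Sum>t\<in>J. \<theta> t * ?h (c * t) z\<bar> powr \<alpha>) \<partial>(lborel \<Otimes>\<^sub>M P)) =
          (\<integral>\<^sup>+z. ennreal (\<bar>\<Sum>t\<in>J. \<theta> t * (c powr ?H * ?h t z)\<bar> powr \<alpha>) \<partial>(lborel \<Otimes>\<^sub>M P))" if "finite J" "J \<subseteq> {0..}" for J \<theta>
          using that by (intro riesz_transform_scale_norm[OF X \<sigma> \<beta> rc L \<gamma> _ _ c \<alpha>(1)]) auto
      qed
    qed
    show "stationary_increments Q V"
      unfolding stationary_increments_def
    proof (intro allI impI)
      fix s :: real assume s: "0 \<le> s"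
      show "same_fdd Q (\<lambda>t \<omega>. V (t + s) \<omega> - V s \<omega>) V"
      proof (rule same_fdd_stable_integrals[OF _ V])
        show "has_stable_integral Q (lborel \<Otimes>\<^sub>M P) M \<alpha> (\<lambda>z. ?h (t + s) z - ?h s z) (\<lambda>\<omega>. V (t + s) \<omega> - V s \<omega>)" if "0 \<le> t" for t
          using has_stable_integral_lincomb[OF V[of "t + s"] V[OF s], of 1 "-1"] s that by simp
        show "(\<integral>\<^sup>+z. ennreal (\<bar>\<Sum>t\<in>J. \<theta> t * (?h (t + s) z - ?h s z)\<bar> powr \<alpha>) \<partial>(lborel \<Otimes>\<^sub>M P)) =
          (\<integral>\<^sup>+z. ennreal (\<bar>\<Sum>t\<in>J. \<theta> t * ?h t z\<bar> powr \<alpha>) \<partial>(lborel \<Otimes>\<^sub>M P))" if "finite J" "J \<subseteq> {0..}" for J \<theta>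
          using that by (intro riesz_transform_increment_norm[OF X \<sigma> \<beta> rc L \<gamma> _ _ s]) auto
      qed
    qed
  qed
  moreover have "\<exists>Y. has_stable_integral Q (lborel \<Otimes>\<^sub>M P) M \<alpha> (?h t) Y" if "0 \<le> t" for t
    by (intro has_stable_integral_exists riesz_transform_in_L[OF X \<sigma> \<beta> rc L that \<gamma> \<alpha>])
  moreover have "AE z in lborel \<Otimes>\<^sub>M P. set_integrable lborel {0<..} (riesz_kernel L \<gamma> p q t z)" if "0 \<le> t" for t
    by (rule riesz_kernel_integrable[OF X \<sigma> \<beta> rc L that \<gamma>])
  ultimately show ?thesis
    unfolding stable_integral_process_H_sssi_def h by blast
qed

section \<open>Attained exponents and the theorem\<close>

text \<open>With \<beta> = 3/2 and \<alpha> = 1/H the formula for H is linear in \<gamma>, and 1 +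
  (1 - H)/2 is its solution. It is admissible, as (1 - H)/2 < 1/8 stays below (\<beta> - 1)/2 =
  1/4.\<close>

lemma Hurst_exponent_attained:
  fixes H :: real
  assumes "3 / 4 < H" "H < 1"
  defines "\<gamma> \<equiv> 1 + (1 - H) / 2"
  shows "1 < 1 / H" "1 / H < 2" "1 < \<gamma>" "\<gamma> < 1 + (3 / 2 - 1) / 2" "H = 1 + 1 / (1 / H * (3 / 2)) - \<gamma> / (3 / 2)"
  using assms by (auto simp: field_simps)

theorem proposition2p10:
  shows
    "(\<forall>(P :: 'w measure) (Q :: 'v measure) X L M (\<alpha>::real) (\<beta>::real).
        1 < \<alpha> \<and> \<alpha> < 2 \<and> 1 < \<beta> \<and> \<beta> < 2 \<and>
        symmetric_stable_levy_process P \<beta> X \<and>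
        jointly_continuous_local_time P X L \<and>
        stable_random_measure Q (lborel \<Otimes>\<^sub>M P) \<alpha> M \<longrightarrow>
        (\<forall>\<gamma>. 1 < \<gamma> \<and> \<gamma> < 1 + (\<beta> - 1) / 2 \<longrightarrow>
           stable_integral_process_H_sssi Q (lborel \<Otimes>\<^sub>M P) M \<alpha>
             (\<lambda>t (x, \<omega>) y. \<bar>y\<bar> powr (- \<gamma>) * (L t (x + y) \<omega> - L t (x - y) \<omega>))
             (1 + 1 / (\<alpha> * \<beta>) - \<gamma> / \<beta>)) \<and>
        (\<forall>\<gamma>1 \<gamma>2. 1 < \<gamma>1 \<and> \<gamma>1 < \<gamma>2 \<and> \<gamma>1 < 1 + (\<beta> - 1) / 2 \<longrightarrow>
           stable_integral_process_H_sssi Q (lborel \<Otimes>\<^sub>M P) M \<alpha>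
             (\<lambda>t (x, \<omega>) y. \<bar>y\<bar> powr (- \<gamma>1) * (L t (x + y) \<omega> - L t x \<omega>))
             (1 + 1 / (\<alpha> * \<beta>) - min \<gamma>1 \<gamma>2 / \<beta>))) \<and>
     (\<forall>H. 3 / 4 < H \<and> H < 1 \<longrightarrow>
        (\<exists>\<alpha> \<beta> \<gamma> :: real.
           1 < \<alpha> \<and> \<alpha> < 2 \<and> 1 < \<beta> \<and> \<beta> < 2 \<and> 1 < \<gamma> \<and> \<gamma> < 1 + (\<beta> - 1) / 2 \<and>
           H = 1 + 1 / (\<alpha> * \<beta>) - \<gamma> / \<beta>) \<and>
        (\<exists>\<alpha> \<beta> \<gamma>1 \<gamma>2 :: real.
           1 < \<alpha> \<and> \<alpha> < 2 \<and> 1 < \<beta> \<and> \<beta> < 2 \<and>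
           1 < \<gamma>1 \<and> \<gamma>1 < \<gamma>2 \<and> \<gamma>1 < 1 + (\<beta> - 1) / 2 \<and>
           H = 1 + 1 / (\<alpha> * \<beta>) - min \<gamma>1 \<gamma>2 / \<beta>))"
proof (intro conjI allI impI)
  fix P :: "'w measure" and Q :: "'v measure" and X L and M :: "(real \<times> 'w) set \<Rightarrow> 'v \<Rightarrow> real" and \<alpha> \<beta> \<gamma> :: real
  assume *: "1 < \<alpha> \<and> \<alpha> < 2 \<and> 1 < \<beta> \<and> \<beta> < 2 \<and> symmetric_stable_levy_process P \<beta> X \<and>
        jointly_continuous_local_time P X L \<and> stable_random_measure Q (lborel \<Otimes>\<^sub>M P) \<alpha> M"
    and \<gamma>: "1 < \<gamma> \<and> \<gamma> < 1 + (\<beta> - 1) / 2"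
  \<comment> \<open>The symmetric difference has p + q = 0, so the term at \<open>x\<close> drops
    out.\<close>
  have "riesz_kernel L \<gamma> 1 (-1) = (\<lambda>t (x, \<omega>) y. \<bar>y\<bar> powr (- \<gamma>) * (L t (x + y) \<omega> - L t (x - y) \<omega>))"
    by (auto simp: riesz_kernel_def fun_eq_iff)
  then show "stable_integral_process_H_sssi Q (lborel \<Otimes>\<^sub>M P) M \<alpha>
       (\<lambda>t (x, \<omega>) y. \<bar>y\<bar> powr (- \<gamma>) * (L t (x + y) \<omega> - L t (x - y) \<omega>)) (1 + 1 / (\<alpha> * \<beta>) - \<gamma> / \<beta>)"
    using riesz_transform_process_H_sssi[of P \<beta> X L Q \<alpha> M \<gamma> 1 "-1"] * \<gamma> by simp
next
  fix P :: "'w measure" and Q :: "'v measure" and X L and M :: "(real \<times> 'w) set \<Rightarrow> 'v \<Rightarrow> real" and \<alpha> \<beta> \<gamma>1 \<gamma>2 :: real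
  assume *: "1 < \<alpha> \<and> \<alpha> < 2 \<and> 1 < \<beta> \<and> \<beta> < 2 \<and> symmetric_stable_levy_process P \<beta> X \<and>
        jointly_continuous_local_time P X L \<and> stable_random_measure Q (lborel \<Otimes>\<^sub>M P) \<alpha> M"
    and \<gamma>: "1 < \<gamma>1 \<and> \<gamma>1 < \<gamma>2 \<and> \<gamma>1 < 1 + (\<beta> - 1) / 2"
  \<comment> \<open>The one-sided difference; the minimum in the exponent evaluates to
    \<gamma>1.\<close>
  have "riesz_kernel L \<gamma>1 1 0 = (\<lambda>t (x, \<omega>) y. \<bar>y\<bar> powr (- \<gamma>1) * (L t (x + y) \<omega> - L t x \<omega>))"
    by (auto simp: riesz_kernel_def fun_eq_iff)
  then show "stable_integral_process_H_sssi Q (lborel \<Otimes>\<^sub>M P) M \<alpha>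
       (\<lambda>t (x, \<omega>) y. \<bar>y\<bar> powr (- \<gamma>1) * (L t (x + y) \<omega> - L t x \<omega>)) (1 + 1 / (\<alpha> * \<beta>) - min \<gamma>1 \<gamma>2 / \<beta>)"
    using riesz_transform_process_H_sssi[of P \<beta> X L Q \<alpha> M \<gamma>1 1 0] * \<gamma> by simp
next
  fix H :: real assume H: "3 / 4 < H \<and> H < 1"
  let ?\<gamma> = "1 + (1 - H) / 2"
  note h = Hurst_exponent_attained[OF conjunct1[OF H] conjunct2[OF H]]
  show "\<exists>\<alpha> \<beta> \<gamma> :: real. 1 < \<alpha> \<and> \<alpha> < 2 \<and> 1 < \<beta> \<and> \<beta> < 2 \<and> 1 < \<gamma> \<and> \<gamma> < 1 + (\<beta> - 1) / 2 \<and> H = 1 + 1 / (\<alpha> * \<beta>) - \<gamma> / \<beta>"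
    using h by (intro exI[of _ "1 / H"] exI[of _ "3 / 2"] exI[of _ ?\<gamma>] conjI) auto
  \<comment> \<open>The witness 2 for \<gamma>2 lies above \<gamma>1 < 9/8, so that the minimum is
    the index solving the equation for H.\<close>
  show "\<exists>\<alpha> \<beta> \<gamma>1 \<gamma>2 :: real. 1 < \<alpha> \<and> \<alpha> < 2 \<and> 1 < \<beta> \<and> \<beta> < 2 \<and>
           1 < \<gamma>1 \<and> \<gamma>1 < \<gamma>2 \<and> \<gamma>1 < 1 + (\<beta> - 1) / 2 \<and> H = 1 + 1 / (\<alpha> * \<beta>) - min \<gamma>1 \<gamma>2 / \<beta>"
    using h by (intro exI[of _ "1 / H"] exI[of _ "3 / 2"] exI[of _ ?\<gamma>] exI[of _ 2] conjI) auto
qed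

end
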